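(* Let $T$ be a self-similar interval exchange map (self-induced on $[0,\alpha)$, $0<\alpha<1$) with matrix $M$, and let $\beta$ with $|\beta|>1$ be a non-real eigenvalue of $M$. Assume that either $\beta$ is Galois-conjugate with $\alpha^{-1}$, or that $\beta$ is Galois-conjugate with $\alpha$ and $T$ is periodic for the Rauzy-Veech renormalization algorithm on the interval $[0,\alpha)$. If $T$ has the unique representation property for $\beta$, then for almost every eigenvector $\gamma$ of $M$ associated with $\beta$ (with respect to Lebesgue measure on the eigenspace), $\exp(-\operatorname{Re}(\gamma))=(\exp(-\operatorname{Re}(\gamma_a)))_{a\in\mathcal A}$ can be realized as the slope vector of an affine interval exchange map which is semi-conjugate with $T$ and has wandering intervals.
   Context: Interval exchange maps. An interval exchange map (i.e.m.) is a bijection $T:[0,1)\to[0,1)$ with a finite partition $(I_a)_{a\in\mathcal A}$ of $[0,1)$ into intervals (closed on the left, open on the right) such that $T(t)=t+\delta_a$ for $t\in I_a$. $T$ is self-similar if for some $0<\alpha<1$ the first return map $T^{(1)}$ of $T$ to $[0,\alpha)$ equals $T$ up to rescaling: $T^{(1)}(\alpha t)=\alpha T(t)$ for $t\in[0,1)$. Put $I_a^{(1)}=\alpha I_a$. It is understood that the first return time $r_a$ to $[0,\alpha)$ is constant on $I_a^{(1)}$ and that for each $0\le m\le r_a-1$ the set $T^m(I_a^{(1)})$ is contained in a single interval $I_{w_m}$. The associated substitution $\sigma:\mathcal A\to\mathcal A^+$ is $\sigma(a)=w_0\cdots w_{r_a-1}$, extended to words by concatenation, and $M_{a,b}$ is the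 number of occurrences of $b$ in $\sigma(a)$ (so $M$ is the transpose of the renormalization matrix). Standing facts: $T$ is minimal and uniquely ergodic, $\sigma$ is primitive, and $\alpha^{-1}$ is the Perron-Frobenius eigenvalue of $M$. Rauzy-Veech periodicity. One step of the Rauzy-Veech algorithm replaces an i.e.m. on $[0,L)$ by its first return map to $[0,L-\min(\lambda_b,\lambda_c))$, where $b$ and $c$ are the labels of the rightmost interval before and after applying the map (assuming $\lambda_b\ne\lambda_c$), and rescales to $[0,1)$. $T$ is periodic for the Rauzy-Veech renormalization algorithm on $[0,\alpha)$ if some iterate of this algorithm applied to $T$ yields the first return map to $[0,\alpha)$ and returns to the original map $T$ after rescaling; $M^t$ is then the associated renormalization matrix. Two algebraic numbers are Galois-conjugate if they have the same minimal polynomial over $\mathbb Q$. Affine i.e.m. An affine i.e.m. is a bijective piecewise affine map $f:[0,1)\to[0,1)$ with positive slopes; if $(J_a)_{a\in\mathcal A}$ are its continuity intervals and $f$ has slope $\ell_a>0$ on $J_a$, then $(\ell_a)_{a\in\mathcal A}$ is its slope vector. $f$ is semi-conjugate with $T$ if there is a continuous, surjective, nondecreasing $h:[0,1)\to[0,1)$ with $h\circ f=T\circ h$. A wandering interval of $f$ is a nondegenerate interval $J$ whose iterates $f^n(J)$, $n\in\mathbb Z$, are pairwise disjoint. Fractals and unique representation property. Let $\gamma\in\mathbb C^{\mathcal A}$ be an eigenvector of $M$ for $\beta$. For a word $w=w_0\cdots w_{n-1}$ put $\gamma(w)=\gamma_{w_0}+\dots+\gamma_{w_{n-1}}$ ($\gamma(\varepsilon)=0$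 for the empty word). For $a\in\mathcal A$ let $\mathcal S_a$ be the set of sequences $x=(p_m^x,c_m^x,s_m^x)_{m\ge1}$ in $\mathcal A^*\times\mathcal A\times\mathcal A^*$ with $\sigma(a)=p_1^xc_1^xs_1^x$ and $\sigma(c_m^x)=p_{m+1}^xc_{m+1}^xs_{m+1}^x$ for all $m\ge1$. Put $\zeta_a(x)=\sum_{m\ge1}\beta^{-m}\gamma(p_m^x)$ and $\mathfrak F_a=\zeta_a(\mathcal S_a)\subset\mathbb C$; $x\in\mathcal S_a$ is a representation of $z\in\mathfrak F_a$ if $z=\zeta_a(x)$. For $\tau$ in the unit circle $\mathbb S^1\subset\mathbb C$, the extreme points of $\mathfrak F_a$ for the direction $\tau$ are the $z\in\mathfrak F_a$ with $\operatorname{Re}(\tau z)=\min_{z'\in\mathfrak F_a}\operatorname{Re}(\tau z')$. $T$ has the unique representation property for $\beta$ and $\gamma$ if for every $a\in\mathcal A$ and $\tau\in\mathbb S^1$ every extreme point of $\mathfrak F_a$ for the direction $\tau$ has exactly one representation in $\mathcal S_a$. This property is unchanged when $\gamma$ is multiplied by a nonzero complex number; in the present situation the eigenspace of $\beta$ is one-dimensional, so one says that $T$ has the unique representation property for $\beta$ if it has it for $\beta$ and one (equivalently any) eigenvector $\gamma$. *)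

theory Defs
  imports "HOL-Analysis.Analysis" "HOL-Computational_Algebra.Polynomial"
begin

section \<open>Interval exchange maps\<close>

definition interval_partition :: "('a::finite \<Rightarrow> real set) \<Rightarrow> bool" where
  "interval_partition I \<longleftrightarrow>
     (\<forall>a. \<exists>l r. l < r \<and> I a = {l..<r}) \<and> disjoint_family I \<and> (\<Union>a. I a) = {0..<1}"

text \<open>
  Maps of \<open>[0,1)\<close> are represented by functions on all reals; only their values on \<open>[0,1)\<close> matter.
\<close>

definition iem :: "('a::finite \<Rightarrow> real set) \<Rightarrow> (real \<Rightarrow> real) \<Rightarrow> bool" where
  "iem I T \<longleftrightarrow>
     interval_partition I \<and> bij_betw T {0..<1} {0..<1} \<and> (\<forall>a. \<exists>\<delta>. \<forall>t\<in>I a. T t = t + \<delta>)"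

definition first_return_time :: "(real \<Rightarrow> real) \<Rightarrow> real set \<Rightarrow> real \<Rightarrow> nat" where
  "first_return_time T J t = (LEAST n. n > 0 \<and> (T ^^ n) t \<in> J)"

definition first_return_map :: "(real \<Rightarrow> real) \<Rightarrow> real set \<Rightarrow> real \<Rightarrow> real" where
  "first_return_map T J t = (T ^^ first_return_time T J t) t"

definition self_similar :: "real \<Rightarrow> ('a::finite \<Rightarrow> real set) \<Rightarrow> (real \<Rightarrow> real) \<Rightarrow> bool" where
  "self_similar \<alpha> I T \<longleftrightarrow>
     iem I T \<and> 0 < \<alpha> \<and> \<alpha> < 1 \<and>
     (\<forall>t\<in>{0..<\<alpha>}. \<exists>n>0. (T ^^ n) t \<in> {0..<\<alpha>}) \<and>
     (\<forall>t\<in>{0..<1}. first_return_map T {0..<\<alpha>} (\<alpha> * t) = \<alpha> * T t)"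

text \<open>
  Here \<open>length (\<sigma> a)\<close> is the common return time of the points of \<open>\<alpha> I\<^sub>a\<close>. Since the sets \<open>I\<^sub>a\<close> are
  nonempty and pairwise disjoint, there is at most one such \<open>\<sigma>\<close>.
\<close>

definition associated_substitution ::
    "real \<Rightarrow> ('a::finite \<Rightarrow> real set) \<Rightarrow> (real \<Rightarrow> real) \<Rightarrow> ('a \<Rightarrow> 'a list) \<Rightarrow> bool" where
  "associated_substitution \<alpha> I T \<sigma> \<longleftrightarrow>
     (\<forall>a. (\<forall>t\<in>(*) \<alpha> ` I a. first_return_time T {0..<\<alpha>} t = length (\<sigma> a)) \<and>
          (\<forall>m<length (\<sigma> a). (T ^^ m) ` ((*) \<alpha> ` I a) \<subseteq> I (\<sigma> a ! m)))"

definition subst_matrix :: "('a::finite \<Rightarrow> 'a list) \<Rightarrow> complex^'a^'a" where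
  "subst_matrix \<sigma> = (\<chi> a b. of_nat (count_list (\<sigma> a) b))"


section \<open>Rauzy-Veech induction\<close>

text \<open>
  A state \<open>(L, I, T)\<close> is an interval exchange map \<open>T\<close> of \<open>[0,L)\<close> with intervals \<open>I\<^sub>a\<close>. The steps
  are not rescaled; rescaling commutes with inducing and is done once, in \<open>rauzy_veech_periodic\<close>.
  In both rules \<open>x\<close> and \<open>y\<close> are the lengths of the last interval \<open>I\<^sub>b\<close> before and of the
  last interval \<open>T(I\<^sub>c)\<close> after applying \<open>T\<close>.
  If \<open>y < x\<close> the induced map is \<open>T\<^sup>2\<close> on \<open>I\<^sub>c\<close> and \<open>T\<close> elsewhere; if \<open>x < y\<close> it is
  \<open>T\<^sup>2\<close> on the part of \<open>I\<^sub>c\<close> sent into \<open>I\<^sub>b\<close>, which takes over the label \<open>b\<close>, and \<open>T\<close> elsewhere.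
\<close>

inductive rauzy_veech_step ::
    "real \<times> ('a::finite \<Rightarrow> real set) \<times> (real \<Rightarrow> real) \<Rightarrow>
     real \<times> ('a \<Rightarrow> real set) \<times> (real \<Rightarrow> real) \<Rightarrow> bool" where
  top: "I b = {L - x..<L} \<Longrightarrow> T ` I c = {L - y..<L} \<Longrightarrow> 0 < y \<Longrightarrow> y < x \<Longrightarrow>
    rauzy_veech_step (L, I, T)
      (L - y, \<lambda>a. I a \<inter> {0..<L - y}, first_return_map T {0..<L - y})"
| bottom: "I b = {L - x..<L} \<Longrightarrow> T ` I c = {L - y..<L} \<Longrightarrow> 0 < x \<Longrightarrow> x < y \<Longrightarrow>
    rauzy_veech_step (L, I, T)
      (L - x, I(b := {t \<in> I c. T t \<in> I b}, c := {t \<in> I c. T t \<notin> I b}),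
       first_return_map T {0..<L - x})"

text \<open>
  The map returns to itself after rescaling if the induced map on \<open>[0,\<alpha>)\<close> and its exchanged
  intervals are the rescaled ones. The labels produced by the induction are bookkeeping:
  the interval \<open>\<alpha> I\<^sub>a\<close> always carries the label \<open>a\<close>, so that the renormalization matrix
  is the transpose of the matrix of the associated substitution.
\<close>

definition rauzy_veech_periodic ::
    "real \<Rightarrow> ('a::finite \<Rightarrow> real set) \<Rightarrow> (real \<Rightarrow> real) \<Rightarrow> bool" where
  "rauzy_veech_periodic \<alpha> I T \<longleftrightarrow>
     (\<exists>I' T'. rauzy_veech_step\<^sup>*\<^sup>* (1, I, T) (\<alpha>, I', T') \<and>
        range I' = range (\<lambda>a. (*) \<alpha> ` I a) \<and>
        (\<forall>t\<in>{0..<1}. T' (\<alpha> * t) = \<alpha> * T t))"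


section \<open>Eigenvectors and Galois conjugation\<close>

definition eigenspace :: "complex^'a^'a \<Rightarrow> complex \<Rightarrow> (complex^'a::finite) set" where
  "eigenspace M \<beta> = {\<gamma>. M *v \<gamma> = \<beta> *s \<gamma>}"

definition eigenvector :: "complex^'a^'a \<Rightarrow> complex \<Rightarrow> complex^'a::finite \<Rightarrow> bool" where
  "eigenvector M \<beta> \<gamma> \<longleftrightarrow> \<gamma> \<noteq> 0 \<and> \<gamma> \<in> eigenspace M \<beta>"

definition eigenvalue :: "complex^'a^'a::finite \<Rightarrow> complex \<Rightarrow> bool" where
  "eigenvalue M \<beta> \<longleftrightarrow> (\<exists>\<gamma>. eigenvector M \<beta> \<gamma>)"

text \<open>
  The Lebesgue null sets of a complex subspace \<open>E\<close> of \<open>\<complex>\<^sup>n\<close> are those of \<open>\<complex>\<^sup>B\<close>, transported by the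
  coordinate isomorphism of a basis \<open>B\<close> of \<open>E\<close>; they do not depend on the choice of \<open>B\<close>.
\<close>

definition almost_everywhere_on_subspace ::
    "(complex^'a::finite) set \<Rightarrow> (complex^'a \<Rightarrow> bool) \<Rightarrow> bool" where
  "almost_everywhere_on_subspace E P \<longleftrightarrow>
     (\<forall>B. vec.independent B \<and> vec.span B = E \<longrightarrow>
        (AE c in Pi\<^sub>M B (\<lambda>_. lborel :: complex measure). P (\<Sum>v\<in>B. c v *s v)))"

definition is_minimal_polynomial :: "rat poly \<Rightarrow> complex \<Rightarrow> bool" where
  "is_minimal_polynomial p z \<longleftrightarrow>
     lead_coeff p = 1 \<and> poly (map_poly of_rat p) z = 0 \<and>
     (\<forall>q. q \<noteq> 0 \<and> poly (map_poly of_rat q) z = 0 \<longrightarrow> degree p \<le> degree q)"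

definition galois_conjugate :: "complex \<Rightarrow> complex \<Rightarrow> bool" where
  "galois_conjugate z w \<longleftrightarrow> (\<exists>p. is_minimal_polynomial p z \<and> is_minimal_polynomial p w)"


section \<open>Fractals and the unique representation property\<close>

definition word_value :: "complex^'a \<Rightarrow> 'a::finite list \<Rightarrow> complex" where
  "word_value \<gamma> w = (\<Sum>a\<leftarrow>w. \<gamma> $ a)"

text \<open>Sequences are indexed from \<open>0\<close>: \<open>x n\<close> is the triple \<open>(p\<^sub>m, c\<^sub>m, s\<^sub>m)\<close> with \<open>m = n + 1\<close>.\<close>

type_synonym 'a expansion = "nat \<Rightarrow> 'a list \<times> 'a \<times> 'a list"

definition prefix_part :: "'a expansion \<Rightarrow> nat \<Rightarrow> 'a list" where
  "prefix_part x n = fst (x n)"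

definition letter_part :: "'a expansion \<Rightarrow> nat \<Rightarrow> 'a" where
  "letter_part x n = fst (snd (x n))"

definition suffix_part :: "'a expansion \<Rightarrow> nat \<Rightarrow> 'a list" where
  "suffix_part x n = snd (snd (x n))"

definition expansions :: "('a \<Rightarrow> 'a list) \<Rightarrow> 'a \<Rightarrow> 'a expansion set" where
  "expansions \<sigma> a =
     {x. \<sigma> a = prefix_part x 0 @ [letter_part x 0] @ suffix_part x 0 \<and>
         (\<forall>n. \<sigma> (letter_part x n) =
            prefix_part x (Suc n) @ [letter_part x (Suc n)] @ suffix_part x (Suc n))}"

definition expansion_value :: "complex \<Rightarrow> complex^'a \<Rightarrow> 'a::finite expansion \<Rightarrow> complex" where
  "expansion_value \<beta> \<gamma> x = (\<Sum>n. inverse \<beta> ^ Suc n * word_value \<gamma> (prefix_part x n))"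

definition fractal ::
    "('a::finite \<Rightarrow> 'a list) \<Rightarrow> complex \<Rightarrow> complex^'a \<Rightarrow> 'a \<Rightarrow> complex set" where
  "fractal \<sigma> \<beta> \<gamma> a = expansion_value \<beta> \<gamma> ` expansions \<sigma> a"

definition extreme_points :: "complex set \<Rightarrow> complex \<Rightarrow> complex set" where
  "extreme_points F \<tau> = {z \<in> F. \<forall>z'\<in>F. Re (\<tau> * z) \<le> Re (\<tau> * z')}"

definition unique_representation_for_vector ::
    "('a::finite \<Rightarrow> 'a list) \<Rightarrow> complex \<Rightarrow> complex^'a \<Rightarrow> bool" where
  "unique_representation_for_vector \<sigma> \<beta> \<gamma> \<longleftrightarrow>
     (\<forall>a \<tau>. norm \<tau> = 1 \<longrightarrow>
        (\<forall>z\<in>extreme_points (fractal \<sigma> \<beta> \<gamma> a) \<tau>.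
           \<exists>!x. x \<in> expansions \<sigma> a \<and> expansion_value \<beta> \<gamma> x = z))"

definition unique_representation_property ::
    "('a::finite \<Rightarrow> 'a list) \<Rightarrow> complex \<Rightarrow> bool" where
  "unique_representation_property \<sigma> \<beta> \<longleftrightarrow>
     (\<exists>\<gamma>. eigenvector (subst_matrix \<sigma>) \<beta> \<gamma> \<and> unique_representation_for_vector \<sigma> \<beta> \<gamma>)"


section \<open>Affine interval exchange maps\<close>

definition affine_iem ::
    "('a::finite \<Rightarrow> real set) \<Rightarrow> ('a \<Rightarrow> real) \<Rightarrow> (real \<Rightarrow> real) \<Rightarrow> bool" where
  "affine_iem J l f \<longleftrightarrow>
     interval_partition J \<and> bij_betw f {0..<1} {0..<1} \<and>
     (\<forall>a. l a > 0 \<and> (\<exists>d. \<forall>t\<in>J a. f t = l a * t + d))"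

definition semi_conjugacy ::
    "(real \<Rightarrow> real) \<Rightarrow> (real \<Rightarrow> real) \<Rightarrow> (real \<Rightarrow> real) \<Rightarrow> bool" where
  "semi_conjugacy h f T \<longleftrightarrow>
     continuous_on {0..<1} h \<and> h ` {0..<1} = {0..<1} \<and> mono_on {0..<1} h \<and>
     (\<forall>t\<in>{0..<1}. h (f t) = T (h t))"

definition iterated_image :: "(real \<Rightarrow> real) \<Rightarrow> int \<Rightarrow> real set \<Rightarrow> real set" where
  "iterated_image f n J =
     (if n \<ge> 0 then (f ^^ nat n) ` J else {t \<in> {0..<1}. (f ^^ nat (- n)) t \<in> J})"

definition wandering_interval :: "(real \<Rightarrow> real) \<Rightarrow> real set \<Rightarrow> bool" where
  "wandering_interval f J \<longleftrightarrow>
     J \<subseteq> {0..<1} \<and> is_interval J \<and> (\<exists>x\<in>J. \<exists>y\<in>J. x < y) \<and>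
     disjoint_family (\<lambda>n. iterated_image f n J)"

text \<open>
  The slope vector of \<open>f\<close> is indexed by the intervals of \<open>T\<close>: the interval \<open>J\<^sub>a\<close> on which \<open>f\<close> has slope
  \<open>l\<^sub>a\<close> is the one lying over \<open>I\<^sub>a\<close> under the semi-conjugacy.
\<close>

definition wandering_slope_vector ::
    "('a::finite \<Rightarrow> real set) \<Rightarrow> (real \<Rightarrow> real) \<Rightarrow> ('a \<Rightarrow> real) \<Rightarrow> bool" where
  "wandering_slope_vector I T l \<longleftrightarrow>
     (\<exists>f J h. affine_iem J l f \<and> semi_conjugacy h f T \<and>
        (\<forall>a. J a = {t \<in> {0..<1}. h t \<in> I a}) \<and>
        (\<exists>W. wandering_interval f W))"

end

theory Submission
  imports Defs "HOL-Library.Diagonal_Subsequence" "HOL-Real_Asymp.Real_Asymp"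
begin

text \<open>
  An orbit of \<open>T\<close> is blown up as in Denjoy's construction: its points become intervals whose lengths are the
  exponentials of minus the real parts of the Birkhoff sums of \<open>\<gamma>\<close>. This requires an orbit along which these
  exponentials are summable in both directions. It is found as a limit of the minimal positions in the words
  \<open>\<sigma>\<^sup>N(a)\<close>, which describe extreme points of the fractals in the directions \<open>\<beta>\<^sup>N\<close>. The unique representation
  property separates the minima, so that for almost every multiple of \<open>\<gamma>\<close> (by a Borel-Cantelli argument) they
  beat all competitors with a different first symbol by a margin growing exponentially in \<open>N\<close>, and the Birkhoff sums grow
  like a power of the time, unless the minimal positions have an eventually periodic address.
  The latter is excluded because no power of \<open>\<beta>\<close> is real. Indeed \<open>M\<^sup>k\<close> has a one-dimensional eigenspace for \<open>\<beta>\<^sup>k\<close>,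
  which by Galois conjugation can be checked for \<open>\<alpha>\<^sup>-\<^sup>k\<close> (Perron-Frobenius) or for \<open>\<alpha>\<^sup>k\<close>; in the latter case Rauzy-Veech
  periodicity rules out connections, and then the corresponding cocycle is the coboundary of a linear function.
\<close>

section \<open>Interval exchange maps and itineraries\<close>

text \<open>The weight at time \<open>n\<close> is \<open>exp (- Re (c * G n))\<close> with
  \<open>G\<close> the two-sided Birkhoff sum, so \<open>Re (c * G n)\<close> must tend to infinity
  in both directions of time. The prefix sums of \<open>\<sigma>^N(a)\<close> agree with
  \<open>\<beta>^N\<close> times the fractal up to a bounded error. A minimal position is therefore
  nearly extreme in the direction of \<open>c * \<beta>^N\<close>, which keeps turning with
  \<open>N\<close>, and separation must be uniform over all directions; it comes from compactness of
  the circle and of the space of expansions. Two distant pieces can still have almost equal minima,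
  and this is what a generic \<open>c\<close> repairs. The margin \<open>r^N\<close> with
  \<open>r = sqrt (norm \<beta>)\<close> is a compromise: relative to \<open>norm \<beta>^N\<close>
  it decays geometrically, so the measures of the exceptional sets are summable; in absolute terms
  it grows, and \<open>exp (- r^N / 2)\<close> beats the number of positions, which is of order
  \<open>\<alpha>^(-N)\<close>. Aperiodicity, the tower structure and primitivity are proved from
  the definition of self-similarity. The identity must be excluded for this, and an eigenvalue of
  modulus above 1 does so.\<close>

abbreviation unit_ico :: "real set" where "unit_ico \<equiv> {0..<1}"

text \<open>Pigeonhole over the cells of length \<open>d\<close>. It supplies the recurrence of
  rigidly moving intervals and forbids infinitely many disjoint intervals of one length.\<close>

lemma bounded_seq_close:
  fixes f :: "nat \<Rightarrow> real"
  assumes "range f \<subseteq> {0..1}" "d > 0"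
  obtains j k where "j < k" "\<bar>f j - f k\<bar> < d"
proof -
  define g where "g n = \<lfloor>f n / d\<rfloor>" for n
  have "g n \<in> {0..\<lfloor>1 / d\<rfloor>}" for n
  proof -
    have "f n \<in> {0..1}" using assms(1) by blast
    with assms(2) show ?thesis by (auto simp: g_def intro!: floor_mono divide_right_mono)
  qed
  then have "finite (range g)" by (metis finite_atLeastAtMost_int finite_subset image_subsetI)
  then have "\<not> inj g" using finite_imageD by (metis infinite_UNIV_nat)
  then obtain j k where jk: "j < k" "g j = g k" unfolding inj_def by (metis nat_neq_iff)
  have fl: "g n * d \<le> f n \<and> f n < g n * d + d" for n
    using assms(2) floor_divide_lower[of d "f n"] floor_divide_upper[of d "f n"]
    unfolding g_def by (simp add: algebra_simps)
  have "\<bar>f j - f k\<bar> < d" using fl[of j] fl[of k] jk(2) by auto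
  with jk(1) show ?thesis using that by blast
qed

locale interval_exchange =
  fixes I :: "'a::finite \<Rightarrow> real set" and T :: "real \<Rightarrow> real"
  assumes iem: "iem I T"
begin

definition lft :: "'a \<Rightarrow> real" where "lft a = Inf (I a)"
definition rgt :: "'a \<Rightarrow> real" where "rgt a = Sup (I a)"
definition dl :: "'a \<Rightarrow> real" where "dl a = T (lft a) - lft a"
definition ltr :: "real \<Rightarrow> 'a" where "ltr t = (THE a. t \<in> I a)"

definition itin :: "nat \<Rightarrow> real \<Rightarrow> 'a list" where
  "itin n t = map (\<lambda>i. ltr ((T ^^ i) t)) [0..<n]"

lemma lft_rgt: "lft a < rgt a" "I a = {lft a..<rgt a}"
proof -
  obtain l r where lr: "l < r" "I a = {l..<r}"
    using iem unfolding iem_def interval_partition_def by blast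
  then show "lft a < rgt a" "I a = {lft a..<rgt a}" unfolding lft_def rgt_def by auto
qed

lemma lft_in_I: "lft a \<in> I a" using lft_rgt[of a] by auto

lemma Un_I: "(\<Union>a. I a) = unit_ico"
  using iem unfolding iem_def interval_partition_def by blast

lemma I_sub: "I a \<subseteq> unit_ico" using Un_I by blast

lemma lft_U: "lft a \<in> unit_ico" using lft_in_I I_sub by blast

lemma rgt_le: "rgt a \<le> 1"
proof (rule ccontr)
  assume "\<not> rgt a \<le> 1"
  then have "max (lft a) 1 \<in> I a" using lft_rgt[of a] by auto
  then show False using I_sub[of a] by auto
qed

lemma I_disjoint: "t \<in> I a \<Longrightarrow> t \<in> I b \<Longrightarrow> a = b"
  using iem unfolding iem_def interval_partition_def disjoint_family_on_def by blast

lemma ltr_eq: "t \<in> I a \<Longrightarrow> ltr t = a"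
  unfolding ltr_def using I_disjoint by (intro the_equality) auto

lemma ltr_lft [simp]: "ltr (lft a) = a" using lft_in_I ltr_eq by blast

lemma ltr_I: "t \<in> unit_ico \<Longrightarrow> t \<in> I (ltr t)"
  using Un_I ltr_eq by (metis UN_E)

lemma ltr_bounds: "t \<in> unit_ico \<Longrightarrow> lft (ltr t) \<le> t" "t \<in> unit_ico \<Longrightarrow> t < rgt (ltr t)"
  using ltr_I[of t] lft_rgt[of "ltr t"] by auto

lemma T_translation: "t \<in> I a \<Longrightarrow> T t = t + dl a"
proof -
  assume t: "t \<in> I a"
  obtain \<delta> where "\<forall>t\<in>I a. T t = t + \<delta>" using iem unfolding iem_def by blast
  then show ?thesis using t lft_in_I[of a] unfolding dl_def by auto
qed

lemma T_ltr: "t \<in> unit_ico \<Longrightarrow> T t = t + dl (ltr t)"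
  using T_translation ltr_I by blast

lemma T_bij: "bij_betw T unit_ico unit_ico" using iem unfolding iem_def by blast

lemma T_U: "t \<in> unit_ico \<Longrightarrow> T t \<in> unit_ico" using T_bij bij_betwE by blast

lemma T_inj: "s \<in> unit_ico \<Longrightarrow> t \<in> unit_ico \<Longrightarrow> T s = T t \<Longrightarrow> s = t"
  using T_bij unfolding bij_betw_def inj_on_def by blast

lemma T_surj: "t \<in> unit_ico \<Longrightarrow> \<exists>s\<in>unit_ico. T s = t"
  using T_bij unfolding bij_betw_def by (metis imageE)

lemma Tn_U: "t \<in> unit_ico \<Longrightarrow> (T ^^ n) t \<in> unit_ico"
  by (induction n) (use T_U in auto)

lemma Tn_inj: "s \<in> unit_ico \<Longrightarrow> t \<in> unit_ico \<Longrightarrow> (T ^^ n) s = (T ^^ n) t \<Longrightarrow> s = t"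
proof (induction n)
  case (Suc n)
  then show ?case using T_inj[of "(T ^^ n) s" "(T ^^ n) t"] Tn_U by (metis comp_apply funpow.simps(2))
qed simp

lemma Tn_surj: "t \<in> unit_ico \<Longrightarrow> \<exists>s\<in>unit_ico. (T ^^ n) s = t"
proof (induction n)
  case (Suc n)
  then obtain s where s: "s \<in> unit_ico" "(T ^^ n) s = t" by blast
  then obtain s' where "s' \<in> unit_ico" "T s' = s" using T_surj by blast
  then have "(T ^^ Suc n) s' = t" using s by (metis comp_apply funpow_Suc_right)
  then show ?case using \<open>s' \<in> unit_ico\<close> by blast
qed simp

lemma length_itin [simp]: "length (itin n t) = n" unfolding itin_def by simp

lemma itin_0 [simp]: "itin 0 t = []" unfolding itin_def by simp

lemma itin_nth: "i < n \<Longrightarrow> itin n t ! i = ltr ((T ^^ i) t)" unfolding itin_def by simp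

lemma itin_Suc: "itin (Suc n) t = itin n t @ [ltr ((T ^^ n) t)]" unfolding itin_def by simp

lemma funpow_add_app: "(T ^^ (m + n)) t = (T ^^ n) ((T ^^ m) t)"
  by (metis add.commute comp_apply funpow_add)

lemma itin_add: "itin (m + n) t = itin m t @ itin n ((T ^^ m) t)"
  by (rule nth_equalityI)
     (auto simp: itin_nth nth_append funpow_add_app[symmetric])

lemma take_itin: "m \<le> n \<Longrightarrow> take m (itin n t) = itin m t"
  by (rule nth_equalityI) (auto simp: itin_nth)

lemma itin_eq_mono: "itin n s = itin n t \<Longrightarrow> m \<le> n \<Longrightarrow> itin m s = itin m t"
  by (metis take_itin)

lemma itin_eqI: "(\<And>i. i < n \<Longrightarrow> ltr ((T ^^ i) s) = ltr ((T ^^ i) t)) \<Longrightarrow> itin n s = itin n t"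
  unfolding itin_def by auto

lemma itin_eqD: "itin n s = itin n t \<Longrightarrow> i < n \<Longrightarrow> ltr ((T ^^ i) s) = ltr ((T ^^ i) t)"
  by (metis itin_nth)

text \<open>The displacement is the sum of the translation lengths \<open>dl\<close> read off the
  itinerary.\<close>

lemma same_itin:
  assumes "s \<in> unit_ico" "t \<in> unit_ico" "itin n s = itin n t"
  shows "(T ^^ n) s - s = (T ^^ n) t - t"
  using assms(3)
proof (induction n)
  case (Suc n)
  then have "itin n s = itin n t" using itin_eq_mono le_SucI by blast
  moreover have "ltr ((T ^^ n) s) = ltr ((T ^^ n) t)" using Suc.prems itin_eqD by blast
  ultimately show ?case using Suc.IH T_ltr Tn_U assms(1,2) by simp
qed simp

text \<open>Points with a common word move rigidly, so whatever lies between them stays between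
  them, inside the same \<open>I a\<close> at each step.\<close>

lemma itin_between:
  assumes "x \<in> unit_ico" "y \<in> unit_ico" "itin n x = itin n y" "x \<le> z" "z \<le> y"
  shows "itin n z = itin n x"
  using assms(3)
proof (induction n)
  case (Suc n)
  have zU: "z \<in> unit_ico" using assms by auto
  have xy: "itin n x = itin n y" using Suc.prems itin_eq_mono le_SucI by blast
  then have zx: "itin n z = itin n x" by (rule Suc.IH)
  have eq: "ltr ((T ^^ n) x) = ltr ((T ^^ n) y)" using Suc.prems itin_eqD by blast
  have "(T ^^ n) x \<le> (T ^^ n) z" "(T ^^ n) z \<le> (T ^^ n) y"
    using same_itin[OF zU assms(1) zx] same_itin[OF assms(1,2) xy] assms(4,5) by auto
  moreover have "(T ^^ n) x \<in> I (ltr ((T ^^ n) x))" "(T ^^ n) y \<in> I (ltr ((T ^^ n) x))"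
    using ltr_I[OF Tn_U] assms(1,2) eq by metis+
  ultimately have "(T ^^ n) z \<in> I (ltr ((T ^^ n) x))"
    using lft_rgt(2)[of "ltr ((T ^^ n) x)"] by auto
  then show ?case using zx ltr_eq by (simp add: itin_Suc)
qed simp

text \<open>The intervals are closed on the left, so every iterate keeps its letter under a small
  push to the right. A push to the left can fail at a left end, which is why left ends govern all
  later arguments.\<close>

lemma itin_right_germ:
  assumes "t \<in> unit_ico"
  shows "\<exists>\<epsilon>>0. t + \<epsilon> \<le> 1 \<and> (\<forall>s\<in>{t..<t + \<epsilon>}. itin n s = itin n t)"
proof (induction n)
  case 0
  then show ?case using assms by (intro exI[of _ "1 - t"]) auto
next
  case (Suc n)
  then obtain \<epsilon> where e: "\<epsilon> > 0" "t + \<epsilon> \<le> 1" "\<forall>s\<in>{t..<t + \<epsilon>}. itin n s = itin n t" by blast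
  define p where "p = (T ^^ n) t"
  have p: "p \<in> unit_ico" using Tn_U assms p_def by blast
  define \<epsilon>' where "\<epsilon>' = min \<epsilon> (rgt (ltr p) - p)"
  have "\<epsilon>' > 0" using e ltr_bounds[OF p] unfolding \<epsilon>'_def by auto
  moreover have "itin (Suc n) s = itin (Suc n) t" if s: "s \<in> {t..<t + \<epsilon>'}" for s
  proof -
    have "s \<in> {t..<t + \<epsilon>}" using s unfolding \<epsilon>'_def by auto
    then have i: "itin n s = itin n t" using e(3) by blast
    have "s \<in> unit_ico" using s e assms unfolding \<epsilon>'_def by auto
    then have "(T ^^ n) s = p + (s - t)" using same_itin[OF _ assms i] unfolding p_def by auto
    then have "(T ^^ n) s \<in> I (ltr p)"
      using s ltr_bounds[OF p] lft_rgt(2)[of "ltr p"] unfolding \<epsilon>'_def by auto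
    then show ?thesis using i ltr_eq unfolding itin_Suc p_def by auto
  qed
  moreover have "t + \<epsilon>' \<le> 1" using e(2) unfolding \<epsilon>'_def by simp
  ultimately show ?case by blast
qed

text \<open>Move \<open>x\<close> to the left until some iterate up to time \<open>n\<close> meets \<open>D\<close>.\<close>

lemma left_shift:
  assumes D: "finite D" "range lft \<subseteq> D" and x: "x \<in> unit_ico"
  obtains x' i where "x' \<in> unit_ico" "x' \<le> x" "itin (Suc n) x' = itin (Suc n) x" "i \<le> n" "(T ^^ i) x' \<in> D"
    "\<And>k d. k \<le> n \<Longrightarrow> d \<in> D \<Longrightarrow> d \<le> (T ^^ k) x \<Longrightarrow> d \<le> (T ^^ k) x'"
proof -
  define m where "m i = Max {d \<in> D. d \<le> (T ^^ i) x}" for i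
  have ne: "lft (ltr ((T ^^ i) x)) \<in> {d \<in> D. d \<le> (T ^^ i) x}" for i
    using D(2) ltr_bounds(1)[OF Tn_U[OF x]] by auto
  have mD: "m i \<in> D" "m i \<le> (T ^^ i) x" for i
    using Max_in[of "{d \<in> D. d \<le> (T ^^ i) x}"] ne[of i] D(1) unfolding m_def by fastforce+
  have mge: "d \<in> D \<Longrightarrow> d \<le> (T ^^ i) x \<Longrightarrow> d \<le> m i" for d i
    unfolding m_def using D(1) by (intro Max_ge) auto
  \<comment> \<open>The largest common shift for which no iterate passes the nearest point of
    \<open>D\<close> on its left; the iterate attaining the minimum lands in
    \<open>D\<close>.\<close>
  define \<delta> where "\<delta> = Min ((\<lambda>i. (T ^^ i) x - m i) ` {..n})"
  have dle: "\<delta> \<le> (T ^^ i) x - m i" if "i \<le> n" for i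
    unfolding \<delta>_def using that by (intro Min_le) auto
  have d0: "\<delta> \<ge> 0" unfolding \<delta>_def using mD(2) by (subst Min_ge_iff) auto
  have "\<delta> \<in> (\<lambda>i. (T ^^ i) x - m i) ` {..n}" unfolding \<delta>_def by (rule Min_in) auto
  then obtain i where i: "i \<le> n" "\<delta> = (T ^^ i) x - m i" by auto
  define x' where "x' = x - \<delta>"
  have x': "x' \<in> unit_ico"
  proof -
    have "lft (ltr x) \<le> m 0" using mge[of "lft (ltr x)" 0] ne[of 0] by auto
    then show ?thesis using lft_U[of "ltr x"] dle[of 0] x d0 unfolding x'_def by auto
  qed
  have key: "itin k x' = itin k x \<and> (T ^^ k) x' = (T ^^ k) x - \<delta>" if "k \<le> Suc n" for k
    using that
  proof (induction k)
    case (Suc k)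
    then have IH: "itin k x' = itin k x" "(T ^^ k) x' = (T ^^ k) x - \<delta>" and k: "k \<le> n" by auto
    have "lft (ltr ((T ^^ k) x)) \<le> (T ^^ k) x'"
      using dle[OF k] mge ne[of k] IH(2) by fastforce
    then have "(T ^^ k) x' \<in> I (ltr ((T ^^ k) x))"
      using lft_rgt(2)[of "ltr ((T ^^ k) x)"] ltr_bounds(2)[OF Tn_U[OF x, of k]] IH(2) d0 by auto
    then have "itin (Suc k) x' = itin (Suc k) x" using IH(1) ltr_eq by (simp add: itin_Suc)
    then show ?case using same_itin[OF x' x] unfolding x'_def by fastforce
  qed (simp add: x'_def)
  show ?thesis
  proof (rule that[OF x' _ _ i(1)])
    show "x' \<le> x" using d0 x'_def by simp
    show "itin (Suc n) x' = itin (Suc n) x" using key by blast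
    show "(T ^^ i) x' \<in> D" using key[of i] i mD(1) by auto
    fix k d assume "k \<le> n" "d \<in> D" "d \<le> (T ^^ k) x"
    then show "d \<le> (T ^^ k) x'" using key[of k] mge[of d k] dle[of k] by auto
  qed
qed

text \<open>A periodic orbit can be slid to the left with its itinerary until it meets a left end.
  It then has a period of one of the finitely many periodic left ends.\<close>

lemma periods_bounded:
  "\<exists>P. \<forall>t\<in>unit_ico. \<forall>n>0. (T ^^ n) t = t \<longrightarrow> (\<exists>k>0. k \<le> P \<and> (T ^^ k) t = t)"
proof -
  define q where "q b = (LEAST k. k > 0 \<and> (T ^^ k) (lft b) = lft b)" for b
  have "\<exists>k>0. k \<le> Max (range q) \<and> (T ^^ k) t = t"
    if t: "t \<in> unit_ico" and n: "n > 0" "(T ^^ n) t = t" for t n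
  proof -
    obtain x' i where x': "x' \<in> unit_ico" "itin (Suc n) x' = itin (Suc n) t" "i \<le> n"
      "(T ^^ i) x' \<in> range lft"
      using left_shift[of "range lft" t n] t finite_class.finite_UNIV by (metis finite_imageI order_refl)
    obtain b where b: "(T ^^ i) x' = lft b" using x'(4) by auto
    have "(T ^^ n) x' = x'"
      using same_itin[OF x'(1) t itin_eq_mono[OF x'(2)], of n] n by auto
    then have "(T ^^ n) (lft b) = lft b"
      using funpow_add_app[of i n x'] funpow_add_app[of n i x'] b by (simp add: add.commute)
    then have q: "q b > 0 \<and> (T ^^ q b) (lft b) = lft b" "q b \<le> n"
      unfolding q_def using LeastI[of "\<lambda>k. k > 0 \<and> (T ^^ k) (lft b) = lft b" n]
        Least_le[of "\<lambda>k. k > 0 \<and> (T ^^ k) (lft b) = lft b" n] n(1) by blast+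
    have "(T ^^ i) ((T ^^ q b) x') = (T ^^ i) x'"
      using q b funpow_add_app[of i "q b" x'] funpow_add_app[of "q b" i x'] by (simp add: add.commute)
    then have "(T ^^ q b) x' = x'" using Tn_inj Tn_U x'(1) by blast
    then have "(T ^^ q b) t = t"
      using same_itin[OF x'(1) t itin_eq_mono[OF x'(2)], of "q b"] q by auto
    then show ?thesis using q by (intro exI[of _ "q b"]) auto
  qed
  then show ?thesis by blast
qed

lemma forward_image_I: "T ` I b = {T (lft b)..<T (lft b) + (rgt b - lft b)}"
proof -
  have "T ` I b = (\<lambda>t. t + dl b) ` {lft b..<rgt b}" using T_translation lft_rgt(2) by auto
  also have "\<dots> = {lft b + dl b..<rgt b + dl b}" by (rule image_add_atLeastLessThan')
  finally show ?thesis unfolding dl_def by (simp add: algebra_simps)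
qed

lemma image_end_is_image_left:
  assumes "e = T (lft b) + (rgt b - lft b)" "e < 1"
  obtains c where "e = T (lft c)"
proof -
  have e: "e \<in> unit_ico" using assms lft_rgt(1)[of b] T_U[OF lft_U, of b] by auto
  obtain s where s: "s \<in> unit_ico" "T s = e" using T_surj[OF e] by blast
  define c where "c = ltr s"
  have eT: "e \<in> T ` I c" using ltr_I[OF s(1)] s(2) unfolding c_def by blast
  have cb: "c \<noteq> b" using eT forward_image_I[of b] assms(1) by auto
  have "\<not> T (lft c) < e"
  proof
    assume "T (lft c) < e"
    then have "max (T (lft c)) (T (lft b)) \<in> T ` I c \<inter> T ` I b"
      using eT assms(1) lft_rgt(1)[of b] unfolding forward_image_I by auto
    then obtain x y where "x \<in> I c" "y \<in> I b" "T x = T y" by (auto 0 3)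
    then show False using T_inj I_sub cb I_disjoint by (metis subset_iff)
  qed
  then show ?thesis using eT that[of c] unfolding forward_image_I by auto
qed

section \<open>Hitting times of an interval\<close>

definition hits :: "real set \<Rightarrow> real \<Rightarrow> bool" where "hits J t \<longleftrightarrow> (\<exists>n. (T ^^ n) t \<in> J)"
text \<open>Unlike a return time this counts time 0, so points of \<open>J\<close> have hitting time
  0. For points that never hit \<open>J\<close> the value is unspecified.\<close>

definition hit_time :: "real set \<Rightarrow> real \<Rightarrow> nat" where "hit_time J t = (LEAST n. (T ^^ n) t \<in> J)"

lemma hit_timeI:
  assumes "(T ^^ n) t \<in> J" "\<And>i. i < n \<Longrightarrow> (T ^^ i) t \<notin> J"
  shows "hits J t" "hit_time J t = n"
  using assms unfolding hits_def hit_time_def by (auto intro!: Least_equality) (meson not_less)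

lemma hit_time: "hits J t \<Longrightarrow> (T ^^ hit_time J t) t \<in> J" "i < hit_time J t \<Longrightarrow> (T ^^ i) t \<notin> J"
  unfolding hits_def hit_time_def using LeastI_ex not_less_Least by metis+

lemma hit_time_funpow:
  assumes "hits J t" "i \<le> hit_time J t"
  shows "hits J ((T ^^ i) t)" "hit_time J ((T ^^ i) t) = hit_time J t - i"
proof -
  have 1: "(T ^^ (hit_time J t - i)) ((T ^^ i) t) \<in> J"
    using hit_time(1)[OF assms(1)] assms(2) funpow_add_app[of i "hit_time J t - i" t] by simp
  have 2: "(T ^^ k) ((T ^^ i) t) \<notin> J" if "k < hit_time J t - i" for k
    using hit_time(2)[of "i + k" J t] that funpow_add_app[of i k t] by auto
  show "hits J ((T ^^ i) t)" "hit_time J ((T ^^ i) t) = hit_time J t - i"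
    using hit_timeI[OF 1 2] by auto
qed

text \<open>Up to time \<open>n\<close> the iterates move rigidly under a small push to the right,
  and none of them crosses \<open>u\<close> or \<open>v\<close> if the push is below all distances
  collected in \<open>B\<close>.\<close>

lemma hit_time_right_germ:
  assumes "u < v" "J = {u..<v}" and t: "t \<in> unit_ico" "hits J t"
  shows "\<exists>\<epsilon>>0. t + \<epsilon> \<le> 1 \<and> (\<forall>s\<in>{t..<t + \<epsilon>}. hits J s \<and> hit_time J s = hit_time J t)"
proof -
  define n where "n = hit_time J t"
  obtain \<epsilon>1 where e1: "\<epsilon>1 > 0" "t + \<epsilon>1 \<le> 1" "\<forall>s\<in>{t..<t + \<epsilon>1}. itin (Suc n) s = itin (Suc n) t"
    using itin_right_germ[OF t(1)] by blast
  define B where "B = insert \<epsilon>1 ((\<lambda>(i, d). d - (T ^^ i) t) ` {(i, d). i \<le> n \<and> d \<in> {u, v} \<and> d > (T ^^ i) t})"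
  have "finite {(i, d). i \<le> n \<and> d \<in> {u, v} \<and> d > (T ^^ i) t}"
    by (rule finite_subset[of _ "{..n} \<times> {u, v}"]) auto
  then have fB: "finite B" unfolding B_def by auto
  define \<epsilon> where "\<epsilon> = Min B"
  have ne: "B \<noteq> {}" unfolding B_def by auto
  have "\<epsilon> > 0" unfolding \<epsilon>_def using fB ne e1(1) by (subst Min_gr_iff) (auto simp: B_def)
  moreover have le1: "\<epsilon> \<le> \<epsilon>1" unfolding \<epsilon>_def using fB by (intro Min_le) (auto simp: B_def)
  moreover have "hits J s \<and> hit_time J s = n" if s: "s \<in> {t..<t + \<epsilon>}" for s
  proof -
    have sU: "s \<in> unit_ico" using s le1 e1(2) t(1) by auto
    have "s \<in> {t..<t + \<epsilon>1}" using s le1 by auto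
    then have it: "itin (Suc n) s = itin (Suc n) t" using e1(3) by blast
    have J: "(T ^^ i) s \<in> J \<longleftrightarrow> (T ^^ i) t \<in> J" if "i \<le> n" for i
    proof -
      have sh: "(T ^^ i) s = (T ^^ i) t + (s - t)"
        using same_itin[OF sU t(1) itin_eq_mono[OF it], of i] that by simp
      have "\<epsilon> \<le> d - (T ^^ i) t" if "d \<in> {u, v}" "d > (T ^^ i) t" for d
        unfolding \<epsilon>_def using fB that \<open>i \<le> n\<close> by (intro Min_le) (auto simp: B_def)
      then have "d > (T ^^ i) s \<longleftrightarrow> d > (T ^^ i) t" if "d \<in> {u, v}" for d
        using sh s that by (smt (verit) atLeastLessThan_iff)
      from this[of u] this[of v] show ?thesis unfolding assms(2) atLeastLessThan_iff by auto
    qed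
    have "(T ^^ n) s \<in> J" using J[of n] hit_time(1)[OF t(2)] unfolding n_def by simp
    moreover have "(T ^^ i) s \<notin> J" if "i < n" for i
      using J[of i] hit_time(2)[of i J t] that unfolding n_def by simp
    ultimately show ?thesis using hit_timeI[of n s J] by blast
  qed
  moreover have "t + \<epsilon> \<le> 1" using le1 e1(2) by simp
  ultimately have "\<exists>\<epsilon>>0. t + \<epsilon> \<le> 1 \<and> (\<forall>s\<in>{t..<t + \<epsilon>}. hits J s \<and> hit_time J s = n)" by blast
  then show ?thesis unfolding n_def .
qed

end

section \<open>Aperiodic interval exchange maps\<close>

text \<open>Collects what depends on aperiodicity alone; self-similar exchanges join it by a
  sublocale declaration as soon as their periodic points are excluded.\<close>

locale aperiodic_exchange = interval_exchange +
  assumes aperiodic: "\<And>t n. t \<in> unit_ico \<Longrightarrow> n > 0 \<Longrightarrow> (T ^^ n) t \<noteq> t"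
begin

lemma Tn_ne: "t \<in> unit_ico \<Longrightarrow> m \<noteq> n \<Longrightarrow> (T ^^ m) t \<noteq> (T ^^ n) t"
proof (induction m n rule: linorder_wlog)
  case (le m n)
  then have "(T ^^ n) t = (T ^^ (n - m)) ((T ^^ m) t)" using funpow_add_app[of m "n - m" t] by simp
  then show ?case using aperiodic[OF Tn_U[OF le(2)], of "n - m" m] le by simp
qed (metis (no_types))

text \<open>
  If \<open>z\<close> and \<open>T\<^sup>p z\<close> had the same forward itinerary, then \<open>T\<^bsup>np\<^esup> z\<close> would be an arithmetic progression in \<open>[0,1)\<close>.
\<close>

lemma itin_funpow_ne:
  assumes z: "z \<in> unit_ico" and p: "p > 0"
  shows "\<exists>n. itin n ((T ^^ p) z) \<noteq> itin n z"
proof (rule ccontr)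
  assume "\<not> ?thesis"
  then have same: "itin n ((T ^^ p) z) = itin n z" for n by blast
  define d where "d = (T ^^ p) z - z"
  have ltr_p: "ltr ((T ^^ (p + i)) z) = ltr ((T ^^ i) z)" for i
    using itin_eqD[OF same[of "Suc i"], of i] funpow_add_app[of p i z] by simp
  have "ltr ((T ^^ (n * p + i)) z) = ltr ((T ^^ i) z)" for n i
    by (induction n arbitrary: i) (use ltr_p in \<open>auto simp: add.assoc\<close>)
  then have itn: "itin k ((T ^^ (n * p)) z) = itin k z" for n k
    by (intro itin_eqI) (simp add: funpow_add_app[symmetric])
  have "(T ^^ (n * p)) z = z + real n * d" for n
  proof (induction n)
    case (Suc n)
    have "(T ^^ p) ((T ^^ (n * p)) z) - (T ^^ (n * p)) z = d"
      using same_itin[OF Tn_U[OF z] z itn, of p] unfolding d_def .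
    moreover have "(T ^^ (Suc n * p)) z = (T ^^ p) ((T ^^ (n * p)) z)"
      using funpow_add_app[of "n * p" p z] by (simp add: add.commute)
    ultimately show ?case using Suc by (simp add: algebra_simps)
  qed simp
  moreover have "(T ^^ (n * p)) z \<in> unit_ico" for n using Tn_U z by blast
  ultimately have "z + real n * d \<in> unit_ico" for n by metis
  then have "\<bar>real n * d\<bar> \<le> 1" for n
  proof -
    have "z + real n * d \<in> unit_ico" using \<open>\<And>n. z + real n * d \<in> unit_ico\<close> .
    then show ?thesis using z unfolding atLeastLessThan_iff abs_le_iff by linarith
  qed
  then have bd: "real n * \<bar>d\<bar> \<le> 1" for n by (simp add: abs_mult)
  have "d = 0"
  proof (rule ccontr)
    assume "d \<noteq> 0"
    then obtain n where "real n * \<bar>d\<bar> > 1" using reals_Archimedean3[of "\<bar>d\<bar>"] by auto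
    then show False using bd[of n] by simp
  qed
  then show False using aperiodic[OF z p] unfolding d_def by simp
qed

text \<open>Two points that are never separated span an interval that moves rigidly forever. By
  pigeonhole two of its translates have left ends closer than its length, so two points of one orbit
  share their itinerary, which \<open>itin_funpow_ne\<close> forbids.\<close>

lemma itin_separates:
  assumes x: "x \<in> unit_ico" and y: "y \<in> unit_ico" and xy: "x < y"
  shows "\<exists>n. itin n x \<noteq> itin n y"
proof (rule ccontr)
  assume "\<not> ?thesis"
  then have same: "itin n x = itin n y" for n by blast
  have Ty: "(T ^^ k) y = (T ^^ k) x + (y - x)" for k using same_itin[OF x y same] by (smt (verit))
  have same_k: "itin n ((T ^^ k) x) = itin n ((T ^^ k) y)" for n k
    using same[of "k + n"] unfolding itin_add by (simp add: append_eq_append_conv)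
  have Tx01: "range (\<lambda>k. (T ^^ k) x) \<subseteq> {0..1}" using Tn_U[OF x] by (force simp: less_imp_le)
  obtain j k where jk: "j < k" "\<bar>(T ^^ j) x - (T ^^ k) x\<bar> < y - x"
    using bounded_seq_close[OF Tx01, of "y - x"] xy by auto
  have "itin n ((T ^^ k) x) = itin n ((T ^^ j) x)" for n
  proof (cases "(T ^^ j) x \<le> (T ^^ k) x")
    case True
    then show ?thesis
      using itin_between[OF Tn_U[OF x] Tn_U[OF y] same_k, of j "(T ^^ k) x"] jk(2) Ty[of j] by auto
  next
    case False
    then show ?thesis
      using itin_between[OF Tn_U[OF x] Tn_U[OF y] same_k, of k "(T ^^ j) x"] jk(2) Ty[of k] by auto
  qed
  moreover have "(T ^^ k) x = (T ^^ (k - j)) ((T ^^ j) x)" using funpow_add_app[of j "k - j" x] jk(1) by simp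
  ultimately show False using itin_funpow_ne[OF Tn_U[OF x], of "k - j" j] jk(1) by auto
qed

text \<open>Up to the first time at which \<open>x\<close> and \<open>y\<close> are separated, the
  interval between them is only translated. The cut that separates them is a left end, and forward
  invariance keeps it in \<open>Q\<close>.\<close>

lemma left_endpoint_in_forward_invariant:
  assumes Q: "\<And>t. t \<in> Q \<Longrightarrow> T t \<in> Q" "{x..y} \<subseteq> Q" "Q \<subseteq> unit_ico" and xy: "x < y"
  shows "\<exists>b. lft b \<in> Q"
proof -
  have xU: "x \<in> unit_ico" and yU: "y \<in> unit_ico" using Q(2,3) xy by (meson atLeastAtMost_iff less_imp_le order_refl subsetD)+
  define n where "n = (LEAST n. itin n x \<noteq> itin n y)"
  have n: "itin n x \<noteq> itin n y"
    unfolding n_def using LeastI_ex[OF itin_separates[OF xU yU xy]] .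
  have "n \<noteq> 0" using n by (metis itin_0)
  then obtain m where m: "n = Suc m" using not0_implies_Suc by blast
  have same: "itin m x = itin m y" using not_less_Least[of m "\<lambda>n. itin n x \<noteq> itin n y"] m n_def by auto
  define b where "b = ltr ((T ^^ m) y)"
  have neq: "ltr ((T ^^ m) x) \<noteq> b" using n same m unfolding b_def by (simp add: itin_Suc)
  have yx: "(T ^^ m) y = (T ^^ m) x + (y - x)" using same_itin[OF xU yU same] by auto
  have lb: "lft b \<le> (T ^^ m) y" "(T ^^ m) y < rgt b" using ltr_bounds[OF Tn_U[OF yU]] unfolding b_def by auto
  have "(T ^^ m) x < lft b"
  proof (rule ccontr)
    assume "\<not> ?thesis"
    then have "(T ^^ m) x \<in> I b" using lb yx xy lft_rgt(2)[of b] by auto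
    then show False using neq ltr_eq by blast
  qed
  \<comment> \<open>The point of the interval that is carried exactly onto the cut after
    \<open>m\<close> steps.\<close>
  define z where "z = x + (lft b - (T ^^ m) x)"
  have z: "x \<le> z" "z \<le> y" using \<open>(T ^^ m) x < lft b\<close> lb yx unfolding z_def by auto
  have zU: "z \<in> unit_ico" using z xU yU by auto
  have "itin m z = itin m x" using itin_between[OF xU yU same z] .
  then have "(T ^^ m) z = lft b" using same_itin[OF zU xU] unfolding z_def by fastforce
  moreover have "(T ^^ k) z \<in> Q" for k
    by (induction k) (use Q z in auto)
  ultimately show ?thesis by metis
qed

end

context interval_exchange
begin

text \<open>
  Points with large hitting time \<open>n\<close> shift left to a backward iterate of some \<open>d \<in> D\<close>. Once \<open>n\<close> exceeds the
  hitting times of the finitely many points where \<open>T\<^sup>-\<^sup>1\<close> can cut, a whole interval to the right of such an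
  iterate is translated backwards forever, which produces infinitely many disjoint intervals of the same length.
\<close>

lemma hit_time_bounded:
  assumes uv: "0 \<le> u" "u < v" "v \<le> 1" and J: "J = {u..<v}"
  shows "\<exists>m. \<forall>x\<in>unit_ico. hits J x \<longrightarrow> hit_time J x \<le> m"
proof (rule ccontr)
  assume "\<not> ?thesis"
  then have unb: "\<exists>x\<in>unit_ico. hits J x \<and> hit_time J x > m" for m by (meson not_less)
  \<comment> \<open>The end \<open>v\<close> is tracked only when it is a point of
    \<open>[0,1)\<close>; for \<open>v = 1\<close> lying below \<open>v\<close> is
    automatic.\<close>
  define D where "D = range lft \<union> ({u, v} \<inter> unit_ico)"
  have D: "finite D" "range lft \<subseteq> D" "D \<subseteq> unit_ico" using lft_U unfolding D_def by auto
  have uD: "u \<in> D" unfolding D_def using uv by auto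
  have shift: "\<exists>d\<in>D. hits J d \<and> (\<exists>x'\<in>unit_ico. \<exists>i. hits J x' \<and> hit_time J x' = hit_time J x \<and> i \<le> hit_time J x' \<and> (T ^^ i) x' = d)"
    if x: "x \<in> unit_ico" "hits J x" for x
  proof -
    define n where "n = hit_time J x"
    obtain x' i where x': "x' \<in> unit_ico" "x' \<le> x" "itin (Suc n) x' = itin (Suc n) x" "i \<le> n" "(T ^^ i) x' \<in> D"
      "\<And>k d. k \<le> n \<Longrightarrow> d \<in> D \<Longrightarrow> d \<le> (T ^^ k) x \<Longrightarrow> d \<le> (T ^^ k) x'"
      using left_shift[OF D(1,2) x(1), of n] by blast
    have sh: "(T ^^ k) x' \<le> (T ^^ k) x" if "k \<le> n" for k
      using same_itin[OF x'(1) x(1) itin_eq_mono[OF x'(3)], of k] that x'(2) by simp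
    have mem: "(T ^^ k) x' \<in> J \<longleftrightarrow> (T ^^ k) x \<in> J" if k: "k \<le> n" for k
    proof -
      have "u \<le> (T ^^ k) x' \<longleftrightarrow> u \<le> (T ^^ k) x" using x'(6)[OF k uD] sh[OF k] by linarith
      moreover have "v \<le> (T ^^ k) x' \<longleftrightarrow> v \<le> (T ^^ k) x"
      proof (cases "v < 1")
        case True
        then have "v \<in> D" unfolding D_def using uv by auto
        then show ?thesis using x'(6)[OF k] sh[OF k] by force
      next
        case False
        then show ?thesis using Tn_U[OF x(1), of k] Tn_U[OF x'(1), of k] by auto
      qed
      ultimately show ?thesis unfolding J by auto
    qed
    have "(T ^^ n) x' \<in> J" using mem[of n] hit_time(1)[OF x(2)] unfolding n_def by simp
    moreover have "(T ^^ k) x' \<notin> J" if "k < n" for k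
      using mem[of k] hit_time(2)[of k J x] that unfolding n_def by simp
    ultimately have h: "hits J x'" "hit_time J x' = n" using hit_timeI[of n x' J] by blast+
    have "hits J ((T ^^ i) x')" using hit_time_funpow(1)[OF h(1), of i] h(2) x'(4) by simp
    moreover have "hit_time J x' = hit_time J x" "i \<le> hit_time J x'" using h(2) x'(4) unfolding n_def by auto
    ultimately show ?thesis using h(1) x'(1,5) by blast
  qed
  define E where "E = D \<union> T ` D"
  \<comment> \<open>\<open>E\<close> contains all points at which a backward translation can be cut.
    Unspecified values at points that never hit \<open>J\<close> can only enlarge the bound.\<close>
  define m0 where "m0 = Max (insert 0 (hit_time J ` E))"
  have m0: "hit_time J e \<le> m0" if "e \<in> E" for e
    unfolding m0_def using that D(1) by (intro Max_ge) (auto simp: E_def)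
  \<comment> \<open>If each \<open>d\<close> in the finite set \<open>D\<close> failed at some depth
    \<open>K d\<close>, a point with hitting time above \<open>M + m0\<close> would slide to a
    preimage of some \<open>d\<close> of depth at least \<open>K d\<close>, because \<open>d\<close>
    itself is at most \<open>m0\<close> steps away from \<open>J\<close>.\<close>
  have "\<exists>d\<in>D. \<forall>k. \<exists>y\<in>unit_ico. hits J y \<and> (T ^^ k) y = d \<and> hit_time J y = k + hit_time J d"
  proof (rule ccontr)
    assume "\<not> ?thesis"
    then have "\<forall>d\<in>D. \<exists>k. \<not> (\<exists>y\<in>unit_ico. hits J y \<and> (T ^^ k) y = d \<and> hit_time J y = k + hit_time J d)" by meson
    then obtain K where K: "\<forall>d\<in>D. \<not> (\<exists>y\<in>unit_ico. hits J y \<and> (T ^^ K d) y = d \<and> hit_time J y = K d + hit_time J d)"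
      by metis
    define M where "M = Max (K ` D)"
    have M: "K d \<le> M" if "d \<in> D" for d unfolding M_def using that D(1) by auto
    obtain x where x: "x \<in> unit_ico" "hits J x" "hit_time J x > M + m0" using unb by blast
    obtain d x' i where d: "d \<in> D" "hits J d" "x' \<in> unit_ico" "hits J x'" "hit_time J x' = hit_time J x"
      "i \<le> hit_time J x'" "(T ^^ i) x' = d" using shift[OF x(1,2)] by blast
    have hd: "hit_time J d = hit_time J x - i" using hit_time_funpow(2)[OF d(4,6)] d by simp
    have "hit_time J d \<le> m0" using m0 d(1) unfolding E_def by blast
    then have iM: "K d \<le> i" using M[OF d(1)] x(3) hd by linarith
    define y where "y = (T ^^ (i - K d)) x'"
    have "y \<in> unit_ico" using Tn_U d(3) unfolding y_def by blast
    moreover have "(T ^^ K d) y = d" using funpow_add_app[of "i - K d" "K d" x'] iM d(7) unfolding y_def by simp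
    moreover have "hits J y" "hit_time J y = K d + hit_time J d"
      using hit_time_funpow[OF d(4), of "i - K d"] d iM hd unfolding y_def by auto
    ultimately show False using K d(1) by blast
  qed
  then obtain d where d: "d \<in> D"
    "\<And>k. \<exists>y\<in>unit_ico. hits J y \<and> (T ^^ k) y = d \<and> hit_time J y = k + hit_time J d" by blast
  obtain y where y: "y \<in> unit_ico" "hits J y" "(T ^^ Suc m0) y = d" "hit_time J y = Suc m0 + hit_time J d"
    using d(2) by blast
  define n where "n = hit_time J y"
  have n: "n > m0" using y(4) unfolding n_def by simp
  obtain \<epsilon> where e: "\<epsilon> > 0" "y + \<epsilon> \<le> 1" "\<forall>s\<in>{y..<y + \<epsilon>}. hits J s \<and> hit_time J s = n"
    using hit_time_right_germ[OF uv(2) J y(1,2)] unfolding n_def by blast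
  have backward: "\<exists>z. 0 \<le> z \<and> z + \<epsilon> \<le> 1 \<and> (T ^^ k) z = y \<and> (\<forall>s\<in>{z..<z + \<epsilon>}. hits J s \<and> hit_time J s = n + k)" for k
  proof (induction k)
    case 0
    then show ?case using e y(1) by (intro exI[of _ y]) auto
  next
    case (Suc k)
    then obtain z where z: "0 \<le> z" "z + \<epsilon> \<le> 1" "(T ^^ k) z = y"
      "\<forall>s\<in>{z..<z + \<epsilon>}. hits J s \<and> hit_time J s = n + k" by blast
    have zU: "z \<in> unit_ico" using z e(1) by auto
    obtain z' where z': "z' \<in> unit_ico" "T z' = z" using T_surj[OF zU] by blast
    define b where "b = ltr z'"
    have z'b: "lft b \<le> z'" "z' < rgt b" using ltr_bounds z'(1) unfolding b_def by auto
    have Tlb: "T (lft b) = lft b + dl b" unfolding dl_def by simp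
    have zz': "z = z' + dl b" using T_ltr[OF z'(1)] z'(2) unfolding b_def by simp
    have noE: "e \<notin> E" if "e \<in> {z..<z + \<epsilon>}" for e using m0[of e] z(4) that n by force
    have fits: "z' + \<epsilon> \<le> rgt b"
    proof (rule ccontr)
      assume nf: "\<not> ?thesis"
      define f where "f = T (lft b) + (rgt b - lft b)"
      have f: "f \<in> {z..<z + \<epsilon>}" using nf z'b zz' Tlb unfolding f_def by auto
      then obtain c where "f = T (lft c)" using image_end_is_image_left[of f b] z(2) unfolding f_def by auto
      then have "f \<in> E" unfolding E_def using D(2) by auto
      then show False using noE f by blast
    qed
    have Ts: "T s = s + dl b" if "s \<in> {z'..<z' + \<epsilon>}" for s
      by (rule T_translation) (use that z'b fits lft_rgt(2)[of b] in auto)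
    obtain w where w: "w \<in> unit_ico" "hits J w" "(T ^^ (Suc k + Suc m0)) w = d"
      "hit_time J w = Suc k + Suc m0 + hit_time J d" using d(2) by blast
    have "(T ^^ (Suc k + Suc m0)) z' = d"
      using z'(2) z(3) y(3) funpow_add_app[of "Suc k" "Suc m0" z'] by (simp add: funpow_Suc_right del: funpow.simps)
    then have "z' = w" using Tn_inj[OF z'(1) w(1)] w(3) by metis
    then have z'J: "z' \<notin> J" using hit_time(2)[of 0 J w] w(4) by simp
    \<comment> \<open>Since \<open>z'\<close> lies outside \<open>J\<close>, meeting
      \<open>J\<close> further right would mean that its left end \<open>u\<close> is in the
      interval; then \<open>T u\<close> is a point of \<open>E\<close> with hitting time above
      \<open>m0\<close>.\<close>
    have notJ: "s \<notin> J" if s: "s \<in> {z'..<z' + \<epsilon>}" for s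
    proof
      assume "s \<in> J"
      then have "u \<in> {z'..<z' + \<epsilon>}" using s z'J unfolding J by auto
      then have "T u \<in> {z..<z + \<epsilon>}" using Ts zz' by auto
      then show False using noE uD unfolding E_def by blast
    qed
    have "hits J s \<and> hit_time J s = n + Suc k" if s: "s \<in> {z'..<z' + \<epsilon>}" for s
    proof -
      have "T s \<in> {z..<z + \<epsilon>}" using Ts[OF s] zz' s by auto
      then have h: "hits J (T s)" "hit_time J (T s) = n + k" using z(4) by blast+
      have 1: "(T ^^ (n + Suc k)) s \<in> J"
        using hit_time(1)[OF h(1)] h(2) by (simp add: funpow_Suc_right del: funpow.simps)
      have 2: "(T ^^ i) s \<notin> J" if "i < n + Suc k" for i
      proof (cases i)
        case 0
        then show ?thesis using notJ[OF s] by simp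
      next
        case (Suc j)
        then show ?thesis using hit_time(2)[of j J "T s"] h(2) that
          by (simp add: funpow_Suc_right del: funpow.simps)
      qed
      show ?thesis using hit_timeI[OF 1 2] by blast
    qed
    moreover have "(T ^^ Suc k) z' = y" using z'(2) z(3) by (simp add: funpow_Suc_right del: funpow.simps)
    moreover have "0 \<le> z'" "z' + \<epsilon> \<le> 1" using z'(1) fits rgt_le[of b] by auto
    ultimately show ?case by blast
  qed
  then obtain f where f: "\<And>k. 0 \<le> f k \<and> f k + \<epsilon> \<le> 1 \<and> (\<forall>s\<in>{f k..<f k + \<epsilon>}. hits J s \<and> hit_time J s = n + k)"
    by metis
  have "range f \<subseteq> {0..1}" using f e(1) by (smt (verit) atLeastAtMost_iff image_subsetI)
  then obtain j k where jk: "j < k" "\<bar>f j - f k\<bar> < \<epsilon>" using bounded_seq_close[OF _ e(1)] by blast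
  then have "max (f j) (f k) \<in> {f j..<f j + \<epsilon>} \<inter> {f k..<f k + \<epsilon>}" using e(1) by auto
  then have "n + j = n + k" using f[of j] f[of k] by (metis IntE)
  then show False using jk(1) by simp
qed

end

section \<open>Self-similar interval exchange maps\<close>

text \<open>Telescoping along a finite tiling whose blocks come in no order and whose
  \<open>g\<close> is arbitrary: the induction removes the block containing \<open>l\<close>, which
  must start there.\<close>

lemma sum_increments_partition:
  fixes g :: "real \<Rightarrow> 'b::ab_group_add"
  assumes "finite F" "\<And>i. i \<in> F \<Longrightarrow> p i < q i" "disjoint_family_on (\<lambda>i. {p i..<q i}) F"
    "(\<Union>i\<in>F. {p i..<q i}) = {l..<r}" "l \<le> r"
  shows "(\<Sum>i\<in>F. g (q i) - g (p i)) = g r - g l"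
  using assms
proof (induction "card F" arbitrary: F l)
  case 0
  then have "l = r" by (metis UN_empty atLeastLessThan_empty_iff card_eq_0_iff order.order_iff_strict)
  with 0 show ?case by simp
next
  case (Suc n)
  have ne: "F \<noteq> {}" using Suc.hyps(2) by auto
  then obtain i0 where "i0 \<in> F" by blast
  then have "p i0 \<in> {l..<r}" using Suc.prems(2)[of i0] Suc.prems(4) by (metis UN_I atLeastLessThan_iff order_refl)
  then have "l < r" by simp
  then have "l \<in> (\<Union>i\<in>F. {p i..<q i})" using Suc.prems(4) by auto
  then obtain i where i: "i \<in> F" "l \<in> {p i..<q i}" by blast
  have sub: "{p i..<q i} \<subseteq> {l..<r}" using Suc.prems(4) i(1) by blast
  then have pi: "p i = l" "q i \<le> r" using i Suc.prems(2)[OF i(1)] by auto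
  define F' where "F' = F - {i}"
  have card: "n = card F'" using Suc.hyps(2) i(1) Suc.prems(1) unfolding F'_def by simp
  have "(\<Union>j\<in>F'. {p j..<q j}) = {l..<r} - {p i..<q i}"
  proof -
    have "{p j..<q j} \<inter> {p i..<q i} = {}" if "j \<in> F'" for j
      using Suc.prems(3) that i(1) unfolding disjoint_family_on_def F'_def by blast
    then show ?thesis using Suc.prems(4) i(1) unfolding F'_def by blast
  qed
  also have "\<dots> = {q i..<r}" using pi i by auto
  finally have un: "(\<Union>j\<in>F'. {p j..<q j}) = {q i..<r}" .
  have "(\<Sum>j\<in>F'. g (q j) - g (p j)) = g r - g (q i)"
    using Suc.hyps(1)[OF card _ _ _ un pi(2)] Suc.prems(1,2,3) disjoint_family_on_mono[of F' F]
    unfolding F'_def by auto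
  then show ?case using sum.remove[OF Suc.prems(1) i(1), of "\<lambda>i. g (q i) - g (p i)"] pi(1)
    unfolding F'_def by simp
qed

text \<open>The hypotheses in working form, in terms of itineraries and words. The last assumption
  excludes the identity, all of whose points are fixed.\<close>

locale self_similar_exchange = interval_exchange I T
  for I :: "'a::finite \<Rightarrow> real set" and T :: "real \<Rightarrow> real" +
  fixes \<alpha> :: real and \<sigma> :: "'a \<Rightarrow> 'a list"
  assumes alpha: "0 < \<alpha>" "\<alpha> < 1"
    and sigma_nonempty: "\<sigma> a \<noteq> []"
    and itin_sigma: "t \<in> I a \<Longrightarrow> itin (length (\<sigma> a)) (\<alpha> * t) = \<sigma> a"
    and return: "t \<in> I a \<Longrightarrow> (T ^^ length (\<sigma> a)) (\<alpha> * t) = \<alpha> * T t"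
    and no_return: "t \<in> I a \<Longrightarrow> 0 < m \<Longrightarrow> m < length (\<sigma> a) \<Longrightarrow> (T ^^ m) (\<alpha> * t) \<notin> {0..<\<alpha>}"
    and nontrivial: "\<exists>t\<in>unit_ico. T t \<noteq> t"
begin

text \<open>\<open>W N a\<close> is the \<open>N\<close>-th iterate of the substitution. It is the
  itinerary of the points of \<open>\<alpha>^N I a\<close> until they return to
  \<open>[0, \<alpha>^N)\<close>, so its length is the height of the tower over \<open>a\<close> at
  level \<open>N\<close>.\<close>

primrec W :: "nat \<Rightarrow> 'a \<Rightarrow> 'a list" where
  "W 0 a = [a]"
| "W (Suc N) a = concat (map (W N) (\<sigma> a))"

abbreviation WW :: "nat \<Rightarrow> 'a list \<Rightarrow> 'a list" where "WW N w \<equiv> concat (map (W N) w)"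

lemma WW_0 [simp]: "WW 0 w = w" by (induction w) auto

lemma W_1 [simp]: "W (Suc 0) a = \<sigma> a" by simp

lemma W_add: "W (M + N) a = WW N (W M a)"
proof (induction M arbitrary: a)
  case (Suc M)
  have "WW N (concat (map (W M) ws)) = concat (map (\<lambda>b. WW N (W M b)) ws)" for ws
    by (induction ws) auto
  then show ?case using Suc by (simp cong: map_cong)
qed simp

lemma WW_add: "WW (M + N) w = WW N (WW M w)"
  by (induction w) (auto simp: W_add)

lemma W_nonempty [simp]: "W N a \<noteq> []"
proof (induction N arbitrary: a)
  case (Suc N)
  then show ?case using sigma_nonempty by (cases "\<sigma> a") auto
qed simp

lemma W_length_pos [simp]: "0 < length (W N a)" by simp

lemma length_WW_ge: "length w \<le> length (WW N w)"
proof (induction w)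
  case (Cons a w)
  have "1 \<le> length (W N a)" using W_nonempty[of N a] by (cases "W N a") auto
  with Cons show ?case by simp
qed simp

section \<open>Renormalization at the scale \<open>\<alpha>^N\<close>\<close>

lemma alpha_pow: "0 < \<alpha> ^ N" "\<alpha> ^ N \<le> 1"
  using alpha by (auto intro: power_le_one)

lemma scale_U: "t \<in> unit_ico \<Longrightarrow> \<alpha> ^ N * t \<in> {0..<\<alpha> ^ N}"
  using alpha by auto

lemma scale_U': "t \<in> unit_ico \<Longrightarrow> \<alpha> ^ N * t \<in> unit_ico"
  using scale_U[of t N] alpha_pow[of N] unfolding atLeastLessThan_iff by linarith

lemma scale_U1: "t \<in> unit_ico \<Longrightarrow> \<alpha> * t \<in> unit_ico"
  using scale_U'[of t 1] by simp

text \<open>The orbit of \<open>\<alpha>^N * t\<close> shadows that of \<open>t\<close>, with every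
  letter replaced by its word of level \<open>N\<close>. The inner induction follows
  \<open>t\<close>; the outer hypothesis is used for \<open>\<alpha> * t\<close> and the word
  \<open>\<sigma> a\<close>, which make up one step one level higher.\<close>

lemma level:
  assumes "t \<in> unit_ico"
  shows "(T ^^ length (WW N (itin m t))) (\<alpha> ^ N * t) = \<alpha> ^ N * (T ^^ m) t \<and>
    itin (length (WW N (itin m t))) (\<alpha> ^ N * t) = WW N (itin m t)"
  using assms
proof (induction N arbitrary: m t)
  case (Suc N)
  note outer = Suc.IH
  show ?case using Suc.prems
  proof (induction m arbitrary: t)
    case (Suc m)
    define a where "a = ltr t"
    have ta: "t \<in> I a" using ltr_I Suc.prems a_def by blast
    define n where "n = length (WW (Suc N) [a])"
    have W: "WW N (itin (length (\<sigma> a)) (\<alpha> * t)) = WW (Suc N) [a]" using itin_sigma[OF ta] by simp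
    have one: "(T ^^ n) (\<alpha> ^ Suc N * t) = \<alpha> ^ Suc N * T t" "itin n (\<alpha> ^ Suc N * t) = WW (Suc N) [a]"
      using outer[OF scale_U1[OF Suc.prems], of "length (\<sigma> a)"] W return[OF ta]
      unfolding n_def by (auto simp: algebra_simps)
    have it: "itin (Suc m) t = [a] @ itin m (T t)" using itin_add[of 1 m t] by (simp add: itin_Suc a_def)
    define L where "L = length (WW (Suc N) (itin m (T t)))"
    have len: "length (WW (Suc N) (itin (Suc m) t)) = n + L" unfolding n_def L_def it by simp
    have IH: "(T ^^ L) (\<alpha> ^ Suc N * T t) = \<alpha> ^ Suc N * (T ^^ m) (T t)"
      "itin L (\<alpha> ^ Suc N * T t) = WW (Suc N) (itin m (T t))"
      unfolding L_def using Suc.IH[OF T_U[OF Suc.prems]] by blast+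
    have "(T ^^ (n + L)) (\<alpha> ^ Suc N * t) = \<alpha> ^ Suc N * (T ^^ m) (T t)"
      by (simp only: funpow_add_app one(1) IH(1))
    moreover have "itin (n + L) (\<alpha> ^ Suc N * t) = WW (Suc N) (itin (Suc m) t)"
      by (simp only: itin_add one IH(2) it map_append concat_append)
    moreover have "(T ^^ Suc m) t = (T ^^ m) (T t)" by (simp add: funpow_swap1)
    ultimately show ?case unfolding len by (simp only:)
  qed simp
qed simp

lemma level_letter:
  assumes "t \<in> I a"
  shows "(T ^^ length (W N a)) (\<alpha> ^ N * t) = \<alpha> ^ N * T t" "itin (length (W N a)) (\<alpha> ^ N * t) = W N a"
proof -
  have "itin 1 t = [a]" using ltr_eq[OF assms] by (simp add: itin_Suc)
  then show "(T ^^ length (W N a)) (\<alpha> ^ N * t) = \<alpha> ^ N * T t" "itin (length (W N a)) (\<alpha> ^ N * t) = W N a"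
    using level[of t N 1] assms I_sub[of a] by auto
qed

lemma return_1:
  assumes "t \<in> unit_ico" "(T ^^ j) (\<alpha> * t) \<in> {0..<\<alpha>}"
  shows "\<exists>m. j = length (WW 1 (itin m t))"
  using assms
proof (induction j arbitrary: t rule: less_induct)
  case (less j)
  define a where "a = ltr t"
  have ta: "t \<in> I a" using ltr_I less.prems a_def by blast
  consider "j = 0" | "j > 0" "j \<ge> length (\<sigma> a)" using no_return[OF ta, of j] less.prems by fastforce
  then show ?case
  proof cases
    case 1
    then show ?thesis by (intro exI[of _ 0]) simp
  next
    case 2
    define k where "k = j - length (\<sigma> a)"
    have j: "j = length (\<sigma> a) + k" using 2 k_def by simp
    then have "(T ^^ k) (\<alpha> * T t) \<in> {0..<\<alpha>}" using less.prems funpow_add_app return[OF ta] by metis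
    moreover have "k < j" using j sigma_nonempty[of a] by simp
    ultimately obtain m where "k = length (WW 1 (itin m (T t)))" using less.IH T_U less.prems(1) by blast
    moreover have "itin (Suc m) t = [a] @ itin m (T t)" using itin_add[of 1 m t] by (simp add: itin_Suc a_def)
    ultimately have "j = length (WW 1 (itin (Suc m) t))" using j by simp
    then show ?thesis by blast
  qed
qed

text \<open>Converse of \<open>level\<close>: returns occur only at the ends of substituted words. A
  return to the base of level \<open>Suc N\<close> is a return of \<open>\<alpha> * t\<close> to the
  larger base of level \<open>N\<close>, and after rescaling \<open>return_1\<close> picks those
  that land in \<open>[0, \<alpha>)\<close>.\<close>

lemma return_level:
  assumes "t \<in> unit_ico" "(T ^^ j) (\<alpha> ^ N * t) \<in> {0..<\<alpha> ^ N}"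
  shows "\<exists>m. j = length (WW N (itin m t))"
  using assms
proof (induction N arbitrary: t)
  case 0
  then show ?case by (intro exI[of _ j]) simp
next
  case (Suc N)
  have "\<alpha> ^ Suc N \<le> \<alpha> ^ N" using alpha alpha_pow[of N] by (simp add: mult_le_cancel_right1)
  then have "(T ^^ j) (\<alpha> ^ N * (\<alpha> * t)) \<in> {0..<\<alpha> ^ N}" using Suc.prems(2) by (auto simp: algebra_simps)
  then obtain m' where m': "j = length (WW N (itin m' (\<alpha> * t)))" using Suc.IH scale_U1 Suc.prems(1) by blast
  then have "(T ^^ j) (\<alpha> ^ N * (\<alpha> * t)) = \<alpha> ^ N * (T ^^ m') (\<alpha> * t)" using level[OF scale_U1[OF Suc.prems(1)]] by metis
  then have "\<alpha> ^ N * (T ^^ m') (\<alpha> * t) \<in> {0..<\<alpha> ^ N * \<alpha>}" using Suc.prems(2) by (simp add: algebra_simps)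
  then have "(T ^^ m') (\<alpha> * t) \<in> {0..<\<alpha>}" using alpha_pow[of N] by (auto simp: zero_le_mult_iff)
  then obtain m where m: "m' = length (WW 1 (itin m t))" using return_1 Suc.prems(1) by blast
  then have "itin m' (\<alpha> * t) = WW 1 (itin m t)" using level[OF Suc.prems(1), of 1 m] by simp
  then show ?case using m' WW_add[of 1 N] by (metis plus_1_eq_Suc)
qed

text \<open>Division with remainder: \<open>m\<close> towers have been climbed completely, and
  \<open>j'\<close> is the height reached in the current one.\<close>

lemma level_decompose:
  assumes "t \<in> unit_ico"
  shows "\<exists>m j'. j = length (WW N (itin m t)) + j' \<and> j' < length (W N (ltr ((T ^^ m) t)))"
proof (induction j)
  case 0
  then show ?case by (intro exI[of _ 0]) simp
next
  case (Suc j)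
  then obtain m j' where mj: "j = length (WW N (itin m t)) + j'" "j' < length (W N (ltr ((T ^^ m) t)))" by blast
  show ?case
  proof (cases "Suc j' < length (W N (ltr ((T ^^ m) t)))")
    case True
    then show ?thesis using mj by (intro exI[of _ m] exI[of _ "Suc j'"]) simp
  next
    case False
    then have "Suc j' = length (W N (ltr ((T ^^ m) t)))" using mj by simp
    then show ?thesis using mj by (intro exI[of _ "Suc m"] exI[of _ 0]) (simp add: itin_Suc)
  qed
qed

text \<open>If the heights differed, undoing \<open>j\<close> steps would produce a return to the
  base after \<open>j' - j\<close> steps, a positive time below the full height of the tower over
  \<open>a'\<close>.\<close>

lemma tower_unique:
  assumes "u \<in> I a" "u' \<in> I a'" "j < length (W N a)" "j' < length (W N a')"
    "(T ^^ j) (\<alpha> ^ N * u) = (T ^^ j') (\<alpha> ^ N * u')"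
  shows "a = a' \<and> j = j' \<and> u = u'"
  using assms
proof (induction j j' arbitrary: a a' u u' rule: linorder_wlog)
  case (le j j')
  have U: "u \<in> unit_ico" "u' \<in> unit_ico" using le I_sub by blast+
  have "(T ^^ j) ((T ^^ (j' - j)) (\<alpha> ^ N * u')) = (T ^^ j) (\<alpha> ^ N * u)"
    using le(1,6) funpow_add_app[of "j' - j" j "\<alpha> ^ N * u'"] by simp
  then have eq: "(T ^^ (j' - j)) (\<alpha> ^ N * u') = \<alpha> ^ N * u"
    using Tn_inj Tn_U scale_U' U by blast
  then obtain m where m: "j' - j = length (WW N (itin m u'))"
    using return_level[OF U(2), of "j' - j" N] scale_U[OF U(1), of N] by auto
  have "m = 0"
  proof (rule ccontr)
    assume "m \<noteq> 0"
    then obtain k where k: "m = 1 + k" by (metis Suc_pred' bot_nat_0.not_eq_extremum plus_1_eq_Suc)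
    have "itin m u' = [a'] @ itin k (T u')"
      unfolding k itin_add using ltr_eq[OF le(3)] by (simp add: itin_Suc)
    then show False using m le(5) by simp
  qed
  then have "j = j'" using m le(1) by simp
  then have "u = u'" using eq alpha by simp
  then show ?case using \<open>j = j'\<close> le I_disjoint by blast
next
  case (sym j j')
  show ?case using sym.IH[OF sym.prems(2,1,4,3) sym.prems(5)[symmetric]] by auto
qed

subsection \<open>Aperiodicity\<close>

text \<open>
  The least period of \<open>\<alpha> t\<close> is at least that of \<open>t\<close>. Hence, for a point \<open>t\<close> whose least period is maximal, the
  orbit of \<open>\<alpha>\<^sup>K t\<close> is \<open>\<alpha>\<^sup>K\<close> times the orbit of \<open>t\<close>; for large \<open>K\<close> it stays in the first interval, so the
  translation there is trivial, and then \<open>T\<close> is the identity.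
\<close>

lemma no_periodic_point:
  assumes "t \<in> unit_ico" "n > 0"
  shows "(T ^^ n) t \<noteq> t"
proof
  assume per0: "(T ^^ n) t = t"
  define per where "per s \<longleftrightarrow> s \<in> unit_ico \<and> (\<exists>n>0. (T ^^ n) s = s)" for s
  define q where "q s = (LEAST n. n > 0 \<and> (T ^^ n) s = s)" for s
  have q: "q s > 0" "(T ^^ q s) s = s" if "per s" for s
    using that LeastI_ex[of "\<lambda>n. n > 0 \<and> (T ^^ n) s = s"] unfolding per_def q_def by auto
  have q_le: "q s \<le> k" if "k > 0" "(T ^^ k) s = s" for s k
    unfolding q_def using that by (intro Least_le) auto
  obtain P where P: "\<forall>t\<in>unit_ico. \<forall>n>0. (T ^^ n) t = t \<longrightarrow> (\<exists>k>0. k \<le> P \<and> (T ^^ k) t = t)"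
    using periods_bounded by blast
  have "\<forall>s. per s \<longrightarrow> q s < Suc P"
    using P q_le unfolding per_def by (meson le_imp_less_Suc order_trans)
  then obtain t1 where t1: "per t1" "\<And>s. per s \<Longrightarrow> q s \<le> q t1"
    using ex_has_greatest_nat[of per t q "Suc P"] per0 assms unfolding per_def by blast
  define Q where "Q = q t1"
  have Q0: "Q > 0" using q(1)[OF t1(1)] Q_def by simp
  have step: "per (\<alpha> * s) \<and> q (\<alpha> * s) = Q \<and> (\<forall>i\<le>Q. (T ^^ i) (\<alpha> * s) = \<alpha> * (T ^^ i) s)"
    if s: "per s" "q s = Q" for s
  proof -
    have sU: "s \<in> unit_ico" using s(1) per_def by blast
    define L where "L i = length (WW 1 (itin i s))" for i
    have L: "(T ^^ L i) (\<alpha> * s) = \<alpha> * (T ^^ i) s" for i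
      using level[OF sU, of 1 i] unfolding L_def by simp
    have Lge: "i \<le> L i" for i using length_WW_ge[of "itin i s" 1] unfolding L_def by simp
    have "(T ^^ L Q) (\<alpha> * s) = \<alpha> * s" using L[of Q] q(2)[OF s(1)] s(2) by simp
    then have per: "per (\<alpha> * s)" using Lge[of Q] Q0 scale_U1[OF sU] unfolding per_def
      by (intro conjI exI[of _ "L Q"]) auto
    define p where "p = q (\<alpha> * s)"
    have p: "p > 0" "(T ^^ p) (\<alpha> * s) = \<alpha> * s" "p \<le> Q"
      using q[OF per] t1(2)[OF per] unfolding p_def Q_def by auto
    have "\<alpha> * s \<in> {0..<\<alpha>}" using scale_U[OF sU, of 1] by simp
    then obtain n where n: "p = L n" using return_1[OF sU, of p] p(2) unfolding L_def by auto
    then have "\<alpha> * (T ^^ n) s = \<alpha> * s" using L[of n] p(2) by simp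
    then have "(T ^^ n) s = s" using alpha by simp
    moreover have "n > 0" using n p(1) unfolding L_def by (cases n) auto
    ultimately have "Q \<le> n" using q_le s(2) by blast
    moreover have "n \<le> Q" using n p(3) Lge[of n] by simp
    ultimately have "n = Q" by simp
    then have nQ: "L Q = Q" "p = Q" using n p(3) Lge[of Q] by simp_all
    \<comment> \<open>Substitution never shortens a word, and the word of the full period keeps its
      length \<open>Q\<close>; hence no initial segment is lengthened.\<close>
    have "L i = i" if "i \<le> Q" for i
    proof -
      have "itin Q s = itin i s @ itin (Q - i) ((T ^^ i) s)" using itin_add[of i "Q - i" s] that by simp
      then have "L Q = L i + length (WW 1 (itin (Q - i) ((T ^^ i) s)))" unfolding L_def by simp
      then show ?thesis
        using length_WW_ge[of "itin (Q - i) ((T ^^ i) s)" 1] nQ(1) Lge[of i] that by simp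
    qed
    then show ?thesis using per L nQ(2) p_def by metis
  qed
  have iter: "per (\<alpha> ^ K * t1) \<and> q (\<alpha> ^ K * t1) = Q \<and> (\<forall>i\<le>Q. (T ^^ i) (\<alpha> ^ K * t1) = \<alpha> ^ K * (T ^^ i) t1)" for K
  proof (induction K)
    case 0
    then show ?case using t1(1) Q_def by simp
  next
    case (Suc K)
    then show ?case using step[of "\<alpha> ^ K * t1"] by (simp add: mult.assoc)
  qed
  define a where "a = ltr 0"
  have a0: "lft a = 0" "0 < rgt a" using ltr_bounds[of 0] lft_U[of a] unfolding a_def by auto
  obtain K where K: "\<alpha> ^ K < rgt a" using real_arch_pow_inv[OF a0(2) alpha(2)] by blast
  have inI: "\<alpha> ^ K * s \<in> I a" if "s \<in> unit_ico" for s
    using scale_U[OF that, of K] K a0 lft_rgt(2)[of a] by auto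
  have t1U: "t1 \<in> unit_ico" using t1(1) per_def by blast
  have "(T ^^ i) (\<alpha> ^ K * t1) = \<alpha> ^ K * t1 + real i * dl a" if "i \<le> Q" for i
    using that
  proof (induction i)
    case (Suc i)
    have "(T ^^ i) (\<alpha> ^ K * t1) \<in> I a" using iter[of K] Suc.prems inI Tn_U[OF t1U] by simp
    then show ?case using T_translation Suc by (simp add: algebra_simps)
  qed simp
  from this[of Q] have "dl a = 0" using iter[of K] q(2)[OF t1(1)] Q0 unfolding Q_def by simp
  have "T u = u" if u: "u \<in> unit_ico" for u
  proof -
    have fixed: "(T ^^ j) (\<alpha> ^ K * u) = \<alpha> ^ K * u" for j
      by (induction j) (use T_translation[OF inI[OF u]] \<open>dl a = 0\<close> in auto)
    have "\<alpha> ^ K * T u = \<alpha> ^ K * u" using level_letter(1)[OF ltr_I[OF u], of K] fixed by metis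
    then show ?thesis using alpha by auto
  qed
  then show False using nontrivial by blast
qed

end

sublocale self_similar_exchange \<subseteq> aperiodic_exchange
  by unfold_locales (rule no_periodic_point)

subsection \<open>Towers, minimality and primitivity\<close>

context self_similar_exchange
begin

lemma floor_translation:
  assumes "u \<in> I a" "j \<le> length (W N a)"
  shows "(T ^^ j) (\<alpha> ^ N * u) = (T ^^ j) (\<alpha> ^ N * lft a) + \<alpha> ^ N * (u - lft a)"
proof -
  have "itin (length (W N a)) (\<alpha> ^ N * u) = itin (length (W N a)) (\<alpha> ^ N * lft a)"
    using level_letter(2)[OF assms(1)] level_letter(2)[OF lft_in_I] by metis
  then have "itin j (\<alpha> ^ N * u) = itin j (\<alpha> ^ N * lft a)" using itin_eq_mono assms(2) by blast
  moreover have "u \<in> unit_ico" using assms(1) I_sub by blast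
  ultimately have "(T ^^ j) (\<alpha> ^ N * u) - \<alpha> ^ N * u = (T ^^ j) (\<alpha> ^ N * lft a) - \<alpha> ^ N * lft a"
    using same_itin[OF scale_U' scale_U'] lft_U by blast
  then show ?thesis by (simp add: algebra_simps)
qed

lemma itin_tower:
  assumes "u \<in> I a" "j < length (W N a)"
  shows "ltr ((T ^^ j) (\<alpha> ^ N * u)) = W N a ! j"
  using level_letter(2)[OF assms(1), of N] itin_nth[OF assms(2)] by metis

lemma itin_tower_take:
  assumes "u \<in> I a" "j \<le> length (W N a)"
  shows "itin j (\<alpha> ^ N * u) = take j (W N a)"
  using level_letter(2)[OF assms(1), of N] take_itin[OF assms(2)] by metis

text \<open>Given by its ends, so that it is an interval by definition. It is the floor
  \<open>T^j(\<alpha>^N I a)\<close> as long as \<open>j\<close> does not exceed the height of the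
  tower; this is \<open>in_flr_iff\<close>.\<close>

definition flr :: "nat \<Rightarrow> 'a \<Rightarrow> nat \<Rightarrow> real set" where
  "flr N a j = {(T ^^ j) (\<alpha> ^ N * lft a)..<(T ^^ j) (\<alpha> ^ N * lft a) + \<alpha> ^ N * (rgt a - lft a)}"

lemma in_flr_iff:
  assumes "j \<le> length (W N a)"
  shows "t \<in> flr N a j \<longleftrightarrow> (\<exists>u\<in>I a. t = (T ^^ j) (\<alpha> ^ N * u))"
proof
  assume t: "t \<in> flr N a j"
  define u where "u = lft a + (t - (T ^^ j) (\<alpha> ^ N * lft a)) / \<alpha> ^ N"
  have "0 \<le> (t - (T ^^ j) (\<alpha> ^ N * lft a)) / \<alpha> ^ N" "(t - (T ^^ j) (\<alpha> ^ N * lft a)) / \<alpha> ^ N < rgt a - lft a"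
    using t alpha_pow(1)[of N] unfolding flr_def by (auto simp: pos_divide_less_eq mult.commute)
  then have "u \<in> I a" unfolding u_def lft_rgt(2)[of a] by auto
  moreover have "t = (T ^^ j) (\<alpha> ^ N * u)"
    using floor_translation[OF \<open>u \<in> I a\<close> assms] alpha unfolding u_def by simp
  ultimately show "\<exists>u\<in>I a. t = (T ^^ j) (\<alpha> ^ N * u)" by blast
next
  assume "\<exists>u\<in>I a. t = (T ^^ j) (\<alpha> ^ N * u)"
  then obtain u where u: "u \<in> I a" "t = (T ^^ j) (\<alpha> ^ N * lft a) + \<alpha> ^ N * (u - lft a)"
    using floor_translation[OF _ assms] by metis
  then have "lft a \<le> u" "u < rgt a" using lft_rgt(2)[of a] by auto
  then show "t \<in> flr N a j" unfolding flr_def u(2) using alpha_pow(1)[of N] by simp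
qed

definition tower :: "nat \<Rightarrow> real set" where
  "tower N = {(T ^^ j) (\<alpha> ^ N * u) | a j u. u \<in> I a \<and> j < length (W N a)}"

lemma towerI: "u \<in> I a \<Longrightarrow> j < length (W N a) \<Longrightarrow> (T ^^ j) (\<alpha> ^ N * u) \<in> tower N"
  unfolding tower_def by blast

lemma tower_base: "t \<in> unit_ico \<Longrightarrow> \<alpha> ^ N * t \<in> tower N"
  using towerI[OF ltr_I, of t 0 N] by simp

lemma tower_funpow: "t \<in> unit_ico \<Longrightarrow> (T ^^ j) (\<alpha> ^ N * t) \<in> tower N"
proof -
  assume t: "t \<in> unit_ico"
  obtain m j' where mj: "j = length (WW N (itin m t)) + j'" "j' < length (W N (ltr ((T ^^ m) t)))"
    using level_decompose[OF t] by blast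
  then have "(T ^^ j) (\<alpha> ^ N * t) = (T ^^ j') (\<alpha> ^ N * (T ^^ m) t)"
    using funpow_add_app level[OF t] by metis
  then show ?thesis using towerI[OF ltr_I[OF Tn_U[OF t]] mj(2)] by simp
qed

lemma tower_U: "tower N \<subseteq> unit_ico"
  unfolding tower_def using Tn_U scale_U' I_sub by blast

lemma tower_antimono: "tower (Suc N) \<subseteq> tower N"
proof -
  have "(T ^^ j) (\<alpha> ^ Suc N * u) \<in> tower N" if "u \<in> I a" for j u a
  proof -
    have "u \<in> unit_ico" using that I_sub by blast
    then have "(T ^^ j) (\<alpha> ^ N * (\<alpha> * u)) \<in> tower N" by (intro tower_funpow scale_U1)
    then show ?thesis by (simp add: mult.assoc mult.commute mult.left_commute)
  qed
  then show ?thesis unfolding tower_def[of "Suc N"] by blast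
qed

lemma T_tower: "t \<in> tower N \<Longrightarrow> T t \<in> tower N"
proof -
  assume "t \<in> tower N"
  then obtain a j u where u: "t = (T ^^ j) (\<alpha> ^ N * u)" "u \<in> I a" unfolding tower_def by blast
  then show ?thesis using tower_funpow[of u "Suc j" N] I_sub[of a] by auto
qed

text \<open>Above the base the preimage is one floor down. A base point
  \<open>\<alpha>^N * u\<close> is reached from the top of the tower over the letter of the preimage
  of \<open>u\<close>.\<close>

lemma T_tower_rev: 
  assumes "T t \<in> tower N" "t \<in> unit_ico"
  shows "t \<in> tower N"
proof -
  obtain a j u where u: "T t = (T ^^ j) (\<alpha> ^ N * u)" "u \<in> I a" "j < length (W N a)"
    using assms(1) unfolding tower_def by blast
  have uU: "u \<in> unit_ico" using u(2) I_sub by blast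
  show ?thesis
  proof (cases j)
    case 0
    obtain s where s: "s \<in> unit_ico" "T s = u" using T_surj[OF uU] by blast
    define L where "L = length (W N (ltr s))"
    have "(T ^^ L) (\<alpha> ^ N * s) = \<alpha> ^ N * u"
      using level_letter(1)[OF ltr_I[OF s(1)], of N] s(2) unfolding L_def by simp
    moreover have "L = Suc (L - 1)" using W_length_pos[of N "ltr s"] unfolding L_def by simp
    ultimately have "T ((T ^^ (L - 1)) (\<alpha> ^ N * s)) = T t"
      using u(1) 0 by (metis comp_apply funpow.simps(2) funpow_0)
    then have "t = (T ^^ (L - 1)) (\<alpha> ^ N * s)" using T_inj assms(2) Tn_U scale_U' s(1) by metis
    then show ?thesis using tower_funpow s(1) by simp
  next
    case (Suc i)
    then have "T t = T ((T ^^ i) (\<alpha> ^ N * u))" using u(1) by simp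
    then have "t = (T ^^ i) (\<alpha> ^ N * u)" using T_inj[OF assms(2) Tn_U[OF scale_U'[OF uU]]] by blast
    then show ?thesis using tower_funpow uU by simp
  qed
qed

lemma tower_1: "tower 1 = (\<Union>(a, j)\<in>{(a, j). j < length (\<sigma> a)}. flr 1 a j)"
proof (rule set_eqI)
  fix t
  have "t \<in> tower 1 \<longleftrightarrow> (\<exists>a j. j < length (\<sigma> a) \<and> (\<exists>u\<in>I a. t = (T ^^ j) (\<alpha> ^ 1 * u)))"
    unfolding tower_def mem_Collect_eq by (simp only: One_nat_def W_1) blast
  also have "\<dots> \<longleftrightarrow> (\<exists>a j. j < length (\<sigma> a) \<and> t \<in> flr 1 a j)"
    using in_flr_iff[of _ 1] by (metis One_nat_def W_1 less_imp_le)
  finally show "t \<in> tower 1 \<longleftrightarrow> t \<in> (\<Union>(a, j)\<in>{(a, j). j < length (\<sigma> a)}. flr 1 a j)" by auto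
qed

lemma finite_positions: "finite {(a, j). j < length (W N a)}"
proof -
  have "{(a, j). j < length (W N a)} = (SIGMA a:UNIV. {..<length (W N a)})" by auto
  then show ?thesis by simp
qed

text \<open>
  If the towers of level 1 missed a point, they would miss an interval, and the invariant sets \<open>tower N - tower (N + 1)\<close>
  would contain intervals for all \<open>N\<close>; but each of them contains one of the finitely many left endpoints.
\<close>

lemma tower_cover_1: "tower 1 = unit_ico"
proof (rule ccontr)
  assume "tower 1 \<noteq> unit_ico"
  then obtain t where t: "t \<in> unit_ico" "t \<notin> tower 1" using tower_U by blast
  \<comment> \<open>Distances from \<open>t\<close> to 1 and to the floors further right. Floors are
    finite in number and closed on the left, so a missed point is the start of a missed
    interval.\<close>
  define E where "E = insert (1 - t) ((\<lambda>(a, j). (T ^^ j) (\<alpha> * lft a) - t) ` 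
    {(a, j). j < length (\<sigma> a) \<and> t < (T ^^ j) (\<alpha> * lft a)})"
  have "finite {(a, j). j < length (\<sigma> a) \<and> t < (T ^^ j) (\<alpha> * lft a)}"
    by (rule finite_subset[OF _ finite_positions[of 1]]) auto
  then have fE: "finite E" unfolding E_def by simp
  define \<epsilon> where "\<epsilon> = Min E"
  have e0: "\<epsilon> > 0" unfolding \<epsilon>_def using fE t(1) by (subst Min_gr_iff) (auto simp: E_def)
  have e1: "\<epsilon> \<le> 1 - t" unfolding \<epsilon>_def using fE by (intro Min_le) (auto simp: E_def)
  have miss: "s \<notin> tower 1" if s: "s \<in> {t..<t + \<epsilon>}" for s
  proof
    assume "s \<in> tower 1"
    then obtain a j where aj: "j < length (\<sigma> a)" "s \<in> flr 1 a j" unfolding tower_1 by auto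
    have "t \<notin> flr 1 a j" using t(2) aj(1) unfolding tower_1 by blast
    then have less: "t < (T ^^ j) (\<alpha> * lft a)" using aj(2) s unfolding flr_def by auto
    have "\<epsilon> \<le> (T ^^ j) (\<alpha> * lft a) - t"
      unfolding \<epsilon>_def using fE aj(1) less by (intro Min_le) (auto simp: E_def)
    then show False using aj(2) s unfolding flr_def by auto
  qed
  have ex: "\<exists>b. lft b \<in> tower N - tower (Suc N)" for N
  proof (rule left_endpoint_in_forward_invariant)
    show "T t \<in> tower N - tower (Suc N)" if "t \<in> tower N - tower (Suc N)" for t
      using that T_tower T_tower_rev tower_U by blast
    show "tower N - tower (Suc N) \<subseteq> unit_ico" using tower_U by blast
    show "\<alpha> ^ N * t < \<alpha> ^ N * (t + \<epsilon> / 2)" using e0 alpha_pow(1)[of N] by simp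
    show "{\<alpha> ^ N * t..\<alpha> ^ N * (t + \<epsilon> / 2)} \<subseteq> tower N - tower (Suc N)"
    proof
      fix x assume x: "x \<in> {\<alpha> ^ N * t..\<alpha> ^ N * (t + \<epsilon> / 2)}"
      define s where "s = x / \<alpha> ^ N"
      have xs: "x = \<alpha> ^ N * s" using alpha unfolding s_def by simp
      have "t \<le> s" "s \<le> t + \<epsilon> / 2" using x alpha_pow(1)[of N] unfolding xs by simp_all
      then have s: "s \<in> {t..<t + \<epsilon>}" "s \<in> unit_ico" using e0 e1 t(1) by auto
      \<comment> \<open>A point of \<open>tower (Suc N)\<close> in the base
        \<open>[0, \<alpha>^N)\<close> is a return to that base, so its rescaled copy lies in
        \<open>tower 1\<close>.\<close>
      have "x \<notin> tower (Suc N)"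
      proof
        assume "x \<in> tower (Suc N)"
        then obtain a j u where u: "x = (T ^^ j) (\<alpha> ^ N * (\<alpha> * u))" "u \<in> I a"
          unfolding tower_def by (auto simp: mult.assoc mult.commute mult.left_commute)
        have uU: "u \<in> unit_ico" using u(2) I_sub by blast
        obtain m where m: "j = length (WW N (itin m (\<alpha> * u)))"
          using return_level[OF scale_U1[OF uU], of j N] scale_U[OF s(2), of N] u(1) xs by auto
        then have "\<alpha> ^ N * s = \<alpha> ^ N * (T ^^ m) (\<alpha> * u)" using level[OF scale_U1[OF uU], of N m] u(1) xs by simp
        then have "s = (T ^^ m) (\<alpha> ^ 1 * u)" using alpha by simp
        then show False using miss[OF s(1)] tower_funpow[OF uU, of m 1] by simp
      qed
      then show "x \<in> tower N - tower (Suc N)" using tower_base[OF s(2)] xs by blast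
    qed
  qed
  then obtain f where f: "\<And>N. lft (f N) \<in> tower N - tower (Suc N)" by metis
  have mono: "tower N \<subseteq> tower M" if "M \<le> N" for M N
    using that lift_Suc_antimono_le[of tower] tower_antimono by blast
  \<comment> \<open>The layers \<open>tower N - tower (Suc N)\<close> are disjoint, so infinitely
    many of them would require infinitely many left ends.\<close>
  have "inj f"
  proof (rule linorder_injI)
    fix M N :: nat assume "M < N"
    then show "f M \<noteq> f N" using f[of M] f[of N] mono[of "Suc M" N] by (metis DiffD1 DiffD2 Suc_leI subsetD)
  qed
  then show False using finite_imageD[of f UNIV] by (meson finite infinite_UNIV_nat finite_subset subset_UNIV)
qed

lemma tower_cover: "tower N = unit_ico"
proof (induction N)
  case 0
  have "t \<in> tower 0" if "t \<in> unit_ico" for t using tower_base[OF that, of 0] by simp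
  then show ?case using tower_U by blast
next
  case (Suc N)
  have "t \<in> tower (Suc N)" if t: "t \<in> unit_ico" for t
  proof -
    obtain a j u where u: "t = (T ^^ j) (\<alpha> ^ N * u)" "u \<in> I a" using t Suc unfolding tower_def by blast
    then have "u \<in> tower 1" using tower_cover_1 I_sub by blast
    then obtain b k v where v: "u = (T ^^ k) (\<alpha> * v)" "v \<in> I b" unfolding tower_def by auto
    have vU: "v \<in> unit_ico" using v(2) I_sub by blast
    define L where "L = length (WW N (itin k (\<alpha> * v)))"
    have "(T ^^ (L + j)) (\<alpha> ^ N * (\<alpha> * v)) = t"
      using level[OF scale_U1[OF vU], of N k] u(1) v(1) funpow_add_app[of L j] unfolding L_def by simp
    then show ?thesis using tower_funpow[OF vU, of "L + j" "Suc N"] by (simp add: mult.assoc mult.commute mult.left_commute)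
  qed
  then show ?case using tower_U by blast
qed

lemma towerE:
  assumes "t \<in> unit_ico"
  obtains a j u where "u \<in> I a" "j < length (W N a)" "t = (T ^^ j) (\<alpha> ^ N * u)"
  using assms tower_cover[of N] unfolding tower_def by blast

lemma T_0_nonzero: "T 0 \<noteq> 0"
  using aperiodic[of 0 1] by simp

lemma exists_small_pow: "e > 0 \<Longrightarrow> \<exists>N. \<alpha> ^ N < e"
  using real_arch_pow_inv alpha(2) by blast

lemma alpha_pow_mono: "M \<le> N \<Longrightarrow> \<alpha> ^ N \<le> \<alpha> ^ M"
  using alpha by (intro power_decreasing) auto

text \<open>Since the towers cover, \<open>lft b\<close> is reached from a point as close to 0 as
  desired. The bound on hitting times makes the time needed uniform, and up to that time points
  close to 0 have the itinerary of 0.\<close>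

lemma orbit_of_0_hits: "\<exists>i. ltr ((T ^^ i) 0) = b"
proof -
  have U0: "0 \<in> unit_ico" by simp
  obtain m where m: "\<forall>x\<in>unit_ico. hits (I b) x \<longrightarrow> hit_time (I b) x \<le> m"
    using hit_time_bounded[of "lft b" "rgt b" "I b"] lft_U[of b] lft_rgt[of b] rgt_le[of b] by auto
  obtain \<epsilon> where e: "\<epsilon> > 0" "\<forall>s\<in>{0..<0 + \<epsilon>}. itin (Suc m) s = itin (Suc m) 0"
    using itin_right_germ[OF U0] by blast
  obtain N where N: "\<alpha> ^ N < \<epsilon>" using exists_small_pow[OF e(1)] by blast
  obtain a j u where u: "u \<in> I a" "j < length (W N a)" "lft b = (T ^^ j) (\<alpha> ^ N * u)" using towerE[OF lft_U] by metis
  define x where "x = \<alpha> ^ N * u"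
  have uU: "u \<in> unit_ico" using u(1) I_sub by blast
  have "hits (I b) x" using u(3) lft_in_I[of b] unfolding hits_def x_def by metis
  moreover have "x \<in> unit_ico" using scale_U' uU x_def by blast
  ultimately have i: "hit_time (I b) x \<le> m" "(T ^^ hit_time (I b) x) x \<in> I b"
    using m hit_time(1) by blast+
  have "x \<in> {0..<0 + \<epsilon>}" using scale_U[OF uU, of N] N unfolding x_def by auto
  then have "itin (Suc m) x = itin (Suc m) 0" using e(2) by blast
  then have "ltr ((T ^^ hit_time (I b) x) x) = ltr ((T ^^ hit_time (I b) x) 0)"
    using itin_eqD[of "Suc m" x 0 "hit_time (I b) x"] i(1) by simp
  then show ?thesis using ltr_eq[OF i(2)] by metis
qed

text \<open>The base \<open>[0, \<alpha>^N)\<close> shrinks into the interval that contains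
  0.\<close>

lemma first_letter: "\<exists>K. \<forall>N\<ge>K. \<forall>a. W N a ! 0 = ltr 0"
proof -
  define a0 where "a0 = ltr 0"
  have a0: "lft a0 = 0" "0 < rgt a0" using ltr_bounds[of 0] lft_U[of a0] unfolding a0_def by auto
  obtain K where K: "\<alpha> ^ K < rgt a0" using exists_small_pow[OF a0(2)] by blast
  have "W N a ! 0 = a0" if "N \<ge> K" for N a
  proof -
    have "\<alpha> ^ N * lft a \<in> {0..<\<alpha> ^ N}" using scale_U[OF lft_U] .
    then have "\<alpha> ^ N * lft a \<in> I a0" using alpha_pow_mono[OF that] K a0 lft_rgt(2)[of a0] by auto
    then show ?thesis using itin_tower[OF lft_in_I, of 0 N a] ltr_eq by simp
  qed
  then show ?thesis unfolding a0_def by blast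
qed

text \<open>For the letter \<open>a0\<close> of 0 the words \<open>W N a0\<close> are prefixes of
  the itinerary of 0. Their lengths are distinct, as they mark the times at which 0 is at
  \<open>\<alpha>^N * T 0\<close>, so these prefixes become arbitrarily long and see every letter.
  Every word of high level starts with \<open>a0\<close>.\<close>

lemma primitive: "\<exists>K. \<forall>N\<ge>K. \<forall>a b. b \<in> set (W N a)"
proof -
  define a0 where "a0 = ltr 0"
  have a0: "0 \<in> I a0" unfolding a0_def using ltr_I by simp
  have T0: "(T ^^ length (W N a0)) 0 = \<alpha> ^ N * T 0" for N using level_letter(1)[OF a0, of N] by simp
  have "inj (\<lambda>N. length (W N a0))"
  proof (rule linorder_injI)
    fix M N :: nat assume "M < N"
    then have "\<alpha> ^ N < \<alpha> ^ M" using alpha by (simp add: power_strict_decreasing)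
    then show "length (W M a0) \<noteq> length (W N a0)" using T0[of M] T0[of N] T_0_nonzero by auto
  qed
  then have inf: "infinite (range (\<lambda>N. length (W N a0)))" using finite_imageD infinite_UNIV_nat by blast
  have "\<exists>N. b \<in> set (W N a0)" for b
  proof -
    obtain i where i: "ltr ((T ^^ i) 0) = b" using orbit_of_0_hits by blast
    obtain n where n: "i < n" "n \<in> range (\<lambda>N. length (W N a0))" using inf unfolding infinite_nat_iff_unbounded by blast
    then obtain N where N: "i < length (W N a0)" by blast
    then have "W N a0 ! i = b" using itin_tower[OF a0 N] i by simp
    then show ?thesis using N nth_mem by blast
  qed
  then obtain f where f: "\<And>b. b \<in> set (W (f b) a0)" by metis
  obtain K where K: "\<forall>N\<ge>K. \<forall>a. W N a ! 0 = a0" using first_letter a0_def by blast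
  have "b \<in> set (W N a)" if N: "N \<ge> K + Max (range f)" for N a b
  proof -
    have "f b \<le> Max (range f)" by simp
    then have "N - f b \<ge> K" "N = (N - f b) + f b" using N by linarith+
    then have "a0 \<in> set (W (N - f b) a)" using K W_length_pos nth_mem by metis
    moreover have "W N a = WW (f b) (W (N - f b) a)" using W_add \<open>N = (N - f b) + f b\<close> by metis
    ultimately show ?thesis using f[of b] by auto
  qed
  then show ?thesis by blast
qed

text \<open>With a single letter \<open>T\<close> would be one nonzero translation, and the orbit of
  0 would leave \<open>[0,1)\<close>.\<close>

lemma two_letters: "\<exists>a b :: 'a. a \<noteq> b"
proof (rule ccontr)
  assume "\<not> ?thesis"
  then have all: "ltr t = ltr s" for s t by blast
  have "(T ^^ n) 0 = real n * dl (ltr 0)" for n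
  proof (induction n)
    case (Suc n)
    have "ltr ((T ^^ n) 0) = ltr 0" by (rule all)
    then have "T ((T ^^ n) 0) = (T ^^ n) 0 + dl (ltr 0)" using T_ltr[OF Tn_U[of 0 n]] by simp
    then show ?case using Suc by (simp add: algebra_simps)
  qed simp
  moreover have "(T ^^ n) 0 \<in> unit_ico" for n by (intro Tn_U) simp
  ultimately have b: "real n * dl (ltr 0) \<in> unit_ico" for n by metis
  have "dl (ltr 0) > 0" using b[of 1] T_0_nonzero T_ltr[of 0] by auto
  then obtain n where "real n * dl (ltr 0) > 1" using reals_Archimedean3 by blast
  then show False using b[of n] by simp
qed

lemma long_words: "\<exists>K. \<forall>N\<ge>K. \<forall>a. length (W N a) \<ge> 2"
proof -
  obtain K where K: "\<forall>N\<ge>K. \<forall>a b. b \<in> set (W N a)" using primitive by blast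
  obtain x y :: 'a where xy: "x \<noteq> y" using two_letters by blast
  have "length (W N a) \<ge> 2" if "N \<ge> K" for N a
  proof -
    have "{x, y} \<subseteq> set (W N a)" using K that by blast
    then have "card {x, y} \<le> length (W N a)" by (meson card_length card_mono finite_set le_trans)
    then show ?thesis using xy by simp
  qed
  then show ?thesis by blast
qed

section \<open>First level floors inside one interval\<close>

definition floor_left :: "'a \<times> nat \<Rightarrow> real" where "floor_left = (\<lambda>(a, m). (T ^^ m) (\<alpha> * lft a))"
definition floor_right :: "'a \<times> nat \<Rightarrow> real" where
  "floor_right = (\<lambda>(a, m). (T ^^ m) (\<alpha> * lft a) + \<alpha> * (rgt a - lft a))"
definition floors_in :: "'a \<Rightarrow> ('a \<times> nat) set" where
  "floors_in b = {(a, m). m < length (\<sigma> a) \<and> \<sigma> a ! m = b}"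

lemma floor_less: "floor_left i < floor_right i"
  unfolding floor_left_def floor_right_def using lft_rgt(1) alpha by (cases i) simp

text \<open>Disjointness is \<open>tower_unique\<close> and covering is \<open>towerE\<close>.
  Through this tiling, additive quantities on intervals become left eigenvectors of the
  matrix.\<close>

lemma letter_partition:
  "finite (floors_in b)"
  "disjoint_family_on (\<lambda>i. {floor_left i..<floor_right i}) (floors_in b)"
  "(\<Union>i\<in>floors_in b. {floor_left i..<floor_right i}) = {lft b..<rgt b}"
proof -
  have flr: "{floor_left i..<floor_right i} = flr 1 (fst i) (snd i)" for i
    unfolding floor_left_def floor_right_def flr_def by (cases i) simp
  have mem: "t \<in> flr 1 a m \<longleftrightarrow> (\<exists>u\<in>I a. t = (T ^^ m) (\<alpha> * u))" if "m < length (\<sigma> a)" for a m t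
    using in_flr_iff[of m 1 a t] that by simp
  show "finite (floors_in b)"
    unfolding floors_in_def by (rule finite_subset[OF _ finite_positions[of 1]]) auto
  show "disjoint_family_on (\<lambda>i. {floor_left i..<floor_right i}) (floors_in b)"
    unfolding disjoint_family_on_def flr floors_in_def
  proof (clarify, rule ccontr)
    fix a m a' m' assume *: "m < length (\<sigma> a)" "m' < length (\<sigma> a')" "\<not> (a = a' \<and> m = m')"
      "flr 1 (fst (a, m)) (snd (a, m)) \<inter> flr 1 (fst (a', m')) (snd (a', m')) \<noteq> {}"
    then obtain t where "t \<in> flr 1 a m" "t \<in> flr 1 a' m'" by auto
    then obtain u u' where "u \<in> I a" "u' \<in> I a'" "(T ^^ m) (\<alpha> * u) = (T ^^ m') (\<alpha> * u')"
      using mem[OF *(1)] mem[OF *(2)] by auto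
    then show False using tower_unique[of u a u' a' m 1 m'] * by simp
  qed
  have "t \<in> (\<Union>i\<in>floors_in b. flr 1 (fst i) (snd i)) \<longleftrightarrow> t \<in> I b" for t
  proof
    assume "t \<in> (\<Union>i\<in>floors_in b. flr 1 (fst i) (snd i))"
    then obtain a m where am: "m < length (\<sigma> a)" "\<sigma> a ! m = b" "t \<in> flr 1 a m" unfolding floors_in_def by auto
    then obtain u where u: "u \<in> I a" "t = (T ^^ m) (\<alpha> * u)" using mem by blast
    then have "ltr t = b" using itin_tower[of u a m 1] am by simp
    moreover have "t \<in> unit_ico" using u I_sub Tn_U scale_U1 by blast
    ultimately show "t \<in> I b" using ltr_I by blast
  next
    assume tb: "t \<in> I b"
    then have "t \<in> unit_ico" using I_sub by blast
    then obtain a j u where u: "u \<in> I a" "j < length (W 1 a)" "t = (T ^^ j) (\<alpha> ^ 1 * u)" by (rule towerE)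
    then have "\<sigma> a ! j = b" using itin_tower[OF u(1,2)] ltr_eq[OF tb] by simp
    moreover have "t \<in> flr 1 a j" using mem[of j a t] u by auto
    ultimately show "t \<in> (\<Union>i\<in>floors_in b. flr 1 (fst i) (snd i))" using u(2) unfolding floors_in_def by force
  qed
  then show "(\<Union>i\<in>floors_in b. {floor_left i..<floor_right i}) = {lft b..<rgt b}"
    unfolding flr lft_rgt(2)[symmetric] by blast
qed

lemma sum_increments_letter:
  fixes g :: "real \<Rightarrow> 'b::ab_group_add"
  shows "(\<Sum>i\<in>floors_in b. g (floor_right i) - g (floor_left i)) = g (rgt b) - g (lft b)"
  by (rule sum_increments_partition[OF letter_partition(1) floor_less letter_partition(2,3)])
     (use lft_rgt(1)[of b] in simp)

lemma sum_positions:
  fixes y :: "'a \<Rightarrow> 'b::comm_semiring_1"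
  shows "(\<Sum>i\<in>floors_in b. y (fst i)) = (\<Sum>a\<in>UNIV. of_nat (count_list (\<sigma> a) b) * y a)"
proof -
  have "floors_in b = (SIGMA a:UNIV. {m. m < length (\<sigma> a) \<and> \<sigma> a ! m = b})" unfolding floors_in_def by auto
  moreover have "(\<Sum>i\<in>floors_in b. y (fst i)) = (\<Sum>(a, m)\<in>floors_in b. y a)" by (simp add: case_prod_unfold)
  ultimately have "(\<Sum>i\<in>floors_in b. y (fst i))
      = (\<Sum>a\<in>UNIV. \<Sum>m\<in>{m. m < length (\<sigma> a) \<and> \<sigma> a ! m = b}. y a)"
    by (simp only:) (rule sum.Sigma[symmetric], auto)
  also have "\<dots> = (\<Sum>a\<in>UNIV. of_nat (card {m. m < length (\<sigma> a) \<and> \<sigma> a ! m = b}) * y a)" by simp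
  also have "\<dots> = (\<Sum>a\<in>UNIV. of_nat (count_list (\<sigma> a) b) * y a)"
    by (simp add: count_list_eq_length_filter length_filter_conv_card eq_commute)
  finally show ?thesis .
qed

abbreviation wid :: "'a \<Rightarrow> real" where "wid a \<equiv> rgt a - lft a"

lemma wid_pos: "wid a > 0" using lft_rgt(1)[of a] by simp

text \<open>The lengths form a positive left eigenvector of the matrix for
  \<open>inverse \<alpha>\<close>, the Perron vector of the arguments below.\<close>

lemma wid_eigen: "(\<Sum>a\<in>UNIV. real (count_list (\<sigma> a) b) * (\<alpha> * wid a)) = wid b"
  using sum_increments_letter[of "\<lambda>x. x" b] sum_positions[where b = b and y = "\<lambda>a. \<alpha> * wid a"]
  unfolding floor_left_def floor_right_def by (simp add: case_prod_unfold)

end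

section \<open>Eigenvectors of the substitution matrix\<close>

lemma word_value_simps [simp]:
  "word_value x [] = 0" "word_value x (a # w) = x $ a + word_value x w"
  "word_value x (v @ w) = word_value x v + word_value x w"
  unfolding word_value_def by auto

lemma word_value_scale: "word_value (c *s x) w = c * word_value x w"
  by (induction w) (auto simp: algebra_simps)

lemma word_value_count: "word_value x w = (\<Sum>a\<in>UNIV. of_nat (count_list w a) * x $ a)"
proof (induction w)
  case (Cons b w)
  have "(\<Sum>a\<in>UNIV. of_nat (count_list (b # w) a) * x $ a)
      = (\<Sum>a\<in>UNIV. (if a = b then x $ a else 0) + of_nat (count_list w a) * x $ a)"
    by (rule sum.cong) (auto simp: algebra_simps)
  then show ?case using Cons by (simp add: sum.distrib)
qed simp

lemma subst_matrix_mult: "(subst_matrix \<sigma> *v x) $ a = word_value x (\<sigma> a)"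
  unfolding word_value_count subst_matrix_def matrix_vector_mult_def by simp

lemma eigenspace_iff: "x \<in> eigenspace (subst_matrix \<sigma>) z \<longleftrightarrow> (\<forall>a. word_value x (\<sigma> a) = z * x $ a)"
  unfolding eigenspace_def by (simp add: vec_eq_iff subst_matrix_mult)

context self_similar_exchange
begin

lemma eigen_W:
  assumes "\<And>a. word_value x (\<sigma> a) = z * x $ a"
  shows "word_value x (W N a) = z ^ N * x $ a"
proof (induction N arbitrary: a)
  case (Suc N)
  have "word_value x (WW N w) = z ^ N * word_value x w" for w
    by (induction w) (auto simp: Suc algebra_simps)
  then show ?case using assms by (simp add: algebra_simps)
qed simp

lemma eigen_WW:
  assumes "\<And>a. word_value x (\<sigma> a) = z * x $ a"
  shows "word_value x (WW N w) = z ^ N * word_value x w"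
  by (induction w) (auto simp: eigen_W[OF assms] algebra_simps)

text \<open>Makes every result on \<open>\<sigma>\<close> available for its iterates, which is how
  powers of the matrix are handled.\<close>

lemma power_self_similar:
  assumes "k > 0"
  shows "self_similar_exchange I T (\<alpha> ^ k) (W k)"
proof
  show "0 < \<alpha> ^ k" "\<alpha> ^ k < 1" using alpha assms by (auto intro: power_Suc_less_one simp: power_less_one_iff)
  show "W k a \<noteq> []" for a by simp
  show "itin (length (W k a)) (\<alpha> ^ k * t) = W k a" "(T ^^ length (W k a)) (\<alpha> ^ k * t) = \<alpha> ^ k * T t"
    if "t \<in> I a" for t a using level_letter that by auto
  show "(T ^^ m) (\<alpha> ^ k * t) \<notin> {0..<\<alpha> ^ k}" if "t \<in> I a" "0 < m" "m < length (W k a)" for t a m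
  proof
    assume *: "(T ^^ m) (\<alpha> ^ k * t) \<in> {0..<\<alpha> ^ k}"
    have U: "t \<in> unit_ico" using that(1) I_sub by blast
    then have "\<alpha> ^ k * ((T ^^ m) (\<alpha> ^ k * t) / \<alpha> ^ k) = (T ^^ m) (\<alpha> ^ k * t)" using alpha by simp
    moreover have sU: "(T ^^ m) (\<alpha> ^ k * t) / \<alpha> ^ k \<in> unit_ico" using * alpha_pow[of k] by simp
    ultimately have "(T ^^ m) (\<alpha> ^ k * t) = (T ^^ 0) (\<alpha> ^ k * ((T ^^ m) (\<alpha> ^ k * t) / \<alpha> ^ k))" by simp
    then show False using tower_unique[OF that(1) ltr_I[OF sU] that(3), of 0] that(2) by simp
  qed
  show "\<exists>t\<in>unit_ico. T t \<noteq> t" by (rule nontrivial)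
qed

text \<open>The moduli satisfy \<open>n a \<le> \<alpha> * (\<Sum>b\<in>UNIV. c a b * n b)\<close>.
  Pairing with the positive left eigenvector \<open>wid\<close> forces equality, so they form a
  nonnegative eigenvector, and a word containing all letters spreads one zero entry to all
  entries.\<close>

lemma perron_right:
  assumes eig: "\<And>a. word_value x (\<sigma> a) = of_real (inverse \<alpha>) * x $ a" and b: "x $ b = 0"
  shows "x = 0"
proof -
  define n where "n a = norm (x $ a)" for a
  define c where "c a b = real (count_list (\<sigma> a) b)" for a b
  have le: "n a \<le> \<alpha> * (\<Sum>b\<in>UNIV. c a b * n b)" for a
  proof -
    have "inverse \<alpha> * n a = norm (word_value x (\<sigma> a))"
      unfolding eig norm_mult n_def using alpha by (simp add: norm_inverse)
    also have "\<dots> \<le> (\<Sum>b\<in>UNIV. norm (of_nat (count_list (\<sigma> a) b) * x $ b))"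
      unfolding word_value_count by (rule norm_sum)
    also have "\<dots> = (\<Sum>b\<in>UNIV. c a b * n b)" by (simp add: norm_mult c_def n_def)
    finally show ?thesis using alpha by (simp add: field_simps)
  qed
  have "(\<Sum>a\<in>UNIV. wid a * (\<alpha> * (\<Sum>b\<in>UNIV. c a b * n b))) = (\<Sum>a\<in>UNIV. \<Sum>b\<in>UNIV. (c a b * (\<alpha> * wid a)) * n b)"
    by (simp add: sum_distrib_left mult_ac)
  also have "\<dots> = (\<Sum>b\<in>UNIV. wid b * n b)"
    by (subst sum.swap) (simp add: sum_distrib_right[symmetric] wid_eigen c_def)
  finally have "(\<Sum>a\<in>UNIV. wid a * (\<alpha> * (\<Sum>b\<in>UNIV. c a b * n b) - n a)) = 0"
    by (simp add: right_diff_distrib sum_subtractf)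
  then have z: "wid a * (\<alpha> * (\<Sum>b\<in>UNIV. c a b * n b) - n a) = 0" for a
    using wid_pos le by (subst (asm) sum_nonneg_eq_0_iff) (auto simp: less_imp_le)
  then have eq: "n a = \<alpha> * (\<Sum>b\<in>UNIV. c a b * n b)" for a using wid_pos[of a] z[of a] by simp
  define y where "y = (\<chi> a. complex_of_real (n a))"
  have "word_value y (\<sigma> a) = of_real (inverse \<alpha>) * y $ a" for a
  proof -
    have "word_value y (\<sigma> a) = of_real (\<Sum>b\<in>UNIV. c a b * n b)"
      unfolding word_value_count y_def c_def by simp
    also have "(\<Sum>b\<in>UNIV. c a b * n b) = inverse \<alpha> * n a" using eq[of a] alpha by (simp add: field_simps)
    finally show ?thesis unfolding y_def by simp
  qed
  then have W: "word_value y (W N a) = of_real (inverse \<alpha>) ^ N * y $ a" for N a by (rule eigen_W)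
  obtain K where K: "\<forall>N\<ge>K. \<forall>a b. b \<in> set (W N a)" using primitive by blast
  have "word_value y w = of_real (sum_list (map n w))" for w
    by (induction w) (auto simp: y_def)
  moreover have "word_value y (W K b) = 0" using W b unfolding y_def n_def by simp
  ultimately have "sum_list (map n (W K b)) = 0" by simp
  then have "\<forall>r\<in>set (map n (W K b)). r = 0" by (subst (asm) sum_list_nonneg_eq_0_iff) (auto simp: n_def)
  then have "n a = 0" for a using K by simp
  then show ?thesis unfolding n_def by (simp add: vec_eq_iff)
qed

lemma count_list_WW: "count_list (WW N w) b = (\<Sum>c\<in>UNIV. count_list w c * count_list (W N c) b)"
proof (induction w)
  case (Cons d w)
  have "(\<Sum>c\<in>UNIV. count_list (d # w) c * count_list (W N c) b)
      = (\<Sum>c\<in>UNIV. (if c = d then count_list (W N c) b else 0) + count_list w c * count_list (W N c) b)"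
    by (rule sum.cong) (auto simp: algebra_simps)
  then show ?case using Cons by (simp add: sum.distrib)
qed simp

lemma left_eigen_W:
  fixes y :: "'a \<Rightarrow> real"
  assumes "\<And>b. (\<Sum>a\<in>UNIV. real (count_list (\<sigma> a) b) * (\<alpha> * y a)) = y b"
  shows "(\<Sum>a\<in>UNIV. real (count_list (W N a) b) * (\<alpha> ^ N * y a)) = y b"
proof (induction N arbitrary: b)
  case 0
  have "(\<Sum>a\<in>UNIV. real (count_list (W 0 a) b) * (\<alpha> ^ 0 * y a)) = (\<Sum>a\<in>UNIV. if a = b then y a else 0)"
    by (rule sum.cong) auto
  then show ?case by simp
next
  case (Suc N)
  have "(\<Sum>a\<in>UNIV. real (count_list (W (Suc N) a) b) * (\<alpha> ^ Suc N * y a))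
      = (\<Sum>a\<in>UNIV. \<Sum>c\<in>UNIV. real (count_list (\<sigma> a) c) * real (count_list (W N c) b) * (\<alpha> ^ Suc N * y a))"
    by (simp add: count_list_WW sum_distrib_right)
  also have "\<dots> = (\<Sum>c\<in>UNIV. real (count_list (W N c) b) * (\<alpha> ^ N * (\<Sum>a\<in>UNIV. real (count_list (\<sigma> a) c) * (\<alpha> * y a))))"
    by (subst sum.swap) (simp add: sum_distrib_left mult_ac)
  finally show ?case using assms Suc by simp
qed

text \<open>Subtract the largest multiple of \<open>wid\<close> that leaves a nonnegative vector
  \<open>z\<close>. One entry of \<open>z\<close> vanishes, and positivity of a power of the matrix
  then makes all of them vanish.\<close>

lemma perron_left:
  fixes y :: "'a \<Rightarrow> real"
  assumes eig: "\<And>b. (\<Sum>a\<in>UNIV. real (count_list (\<sigma> a) b) * (\<alpha> * y a)) = y b"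
  shows "\<exists>c. \<forall>a. y a = c * wid a"
proof -
  define c where "c = Min (range (\<lambda>a. y a / wid a))"
  have "c \<in> range (\<lambda>a. y a / wid a)" unfolding c_def by (rule Min_in) auto
  then obtain b where b: "c = y b / wid b" by auto
  define z where "z a = y a - c * wid a" for a
  have z0: "z a \<ge> 0" for a
  proof -
    have "c \<le> y a / wid a" unfolding c_def by (rule Min_le) auto
    then show ?thesis using wid_pos[of a] unfolding z_def by (simp add: pos_le_divide_eq)
  qed
  have zb: "z b = 0" using b wid_pos[of b] unfolding z_def by simp
  have "(\<Sum>a\<in>UNIV. real (count_list (\<sigma> a) d) * (\<alpha> * z a)) = z d" for d
  proof -
    have "(\<Sum>a\<in>UNIV. real (count_list (\<sigma> a) d) * (\<alpha> * z a)) =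
      (\<Sum>a\<in>UNIV. real (count_list (\<sigma> a) d) * (\<alpha> * y a)) - c * (\<Sum>a\<in>UNIV. real (count_list (\<sigma> a) d) * (\<alpha> * wid a))"
      unfolding z_def by (simp add: sum_distrib_left sum_subtractf[symmetric] algebra_simps)
    then show ?thesis using eig wid_eigen unfolding z_def by simp
  qed
  then have zW: "(\<Sum>a\<in>UNIV. real (count_list (W N a) d) * (\<alpha> ^ N * z a)) = z d" for N d by (rule left_eigen_W)
  obtain K where K: "\<forall>N\<ge>K. \<forall>a b. b \<in> set (W N a)" using primitive by blast
  have "(\<Sum>a\<in>UNIV. real (count_list (W K a) b) * (\<alpha> ^ K * z a)) = 0" using zW zb by simp
  then have "real (count_list (W K a) b) * (\<alpha> ^ K * z a) = 0" for a
    using z0 alpha by (subst (asm) sum_nonneg_eq_0_iff) auto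
  moreover have "count_list (W K a) b \<noteq> 0" for a using K by (simp add: count_list_0_iff)
  ultimately have "z a = 0" for a using alpha by (metis mult_eq_0_iff of_nat_eq_0_iff power_not_zero less_irrefl)
  then show ?thesis unfolding z_def by auto
qed

lemma perron_left_complex:
  fixes y :: "'a \<Rightarrow> complex"
  assumes eig: "\<And>b. (\<Sum>a\<in>UNIV. of_nat (count_list (\<sigma> a) b) * (of_real \<alpha> * y a)) = y b"
  shows "\<exists>c. \<forall>a. y a = c * of_real (wid a)"
proof -
  have Re: "(\<Sum>a\<in>UNIV. real (count_list (\<sigma> a) b) * (\<alpha> * Re (y a))) = Re (y b)" for b
    using arg_cong[OF eig[of b], of Re] by simp
  have Im: "(\<Sum>a\<in>UNIV. real (count_list (\<sigma> a) b) * (\<alpha> * Im (y a))) = Im (y b)" for b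
    using arg_cong[OF eig[of b], of Im] by simp
  obtain c d where "\<forall>a. Re (y a) = c * wid a" "\<forall>a. Im (y a) = d * wid a"
    using perron_left[OF Re] perron_left[OF Im] by blast
  then have "\<forall>a. y a = Complex c d * of_real (wid a)" by (simp add: complex_eq_iff)
  then show ?thesis by blast
qed

text \<open>The tower over \<open>a\<close> has height \<open>length (W N a)\<close> and width
  \<open>\<alpha>^N * wid a\<close> and must fit into \<open>[0,1)\<close>. Formally, letters are
  counted against the left eigenvector \<open>wid\<close>, whose entries sum to 1.\<close>

lemma length_W_bound: "real (length (W N a)) * (\<alpha> ^ N * wid a) \<le> 1"
proof -
  have "(\<Sum>b\<in>UNIV. real (count_list (W N a) b) * (\<alpha> ^ N * wid a)) \<le> (\<Sum>b\<in>UNIV. wid b)"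
  proof (rule sum_mono)
    fix b
    have "real (count_list (W N a) b) * (\<alpha> ^ N * wid a) \<le> (\<Sum>a\<in>UNIV. real (count_list (W N a) b) * (\<alpha> ^ N * wid a))"
      using wid_pos alpha by (intro member_le_sum) (auto simp: less_imp_le)
    then show "real (count_list (W N a) b) * (\<alpha> ^ N * wid a) \<le> wid b"
      using left_eigen_W[of wid N b] wid_eigen by simp
  qed
  also have "(\<Sum>b\<in>UNIV. wid b) = 1 - 0"
  proof (rule sum_increments_partition)
    show "disjoint_family_on (\<lambda>i. {lft i..<rgt i}) UNIV"
      unfolding lft_rgt(2)[symmetric] disjoint_family_on_def using I_disjoint by blast
    show "(\<Union>i. {lft i..<rgt i}) = {0..<1}" unfolding lft_rgt(2)[symmetric] by (rule Un_I)
  qed (auto simp: lft_rgt(1))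
  finally have "(\<Sum>b\<in>UNIV. real (count_list (W N a) b) * (\<alpha> ^ N * wid a)) \<le> 1" by simp
  then have "(\<Sum>b\<in>UNIV. real (count_list (W N a) b)) * (\<alpha> ^ N * wid a) \<le> 1"
    by (simp only: sum_distrib_right)
  moreover have "(\<Sum>b\<in>UNIV. count_list (W N a) b) = length (W N a)" by (rule sum_count_set) auto
  ultimately show ?thesis by (metis of_nat_sum)
qed

end

subsection \<open>Galois conjugation\<close>

definition rat_eval :: "rat poly \<Rightarrow> complex \<Rightarrow> complex" where
  "rat_eval q z = poly (map_poly of_rat q) z"

lemma rat_eval_pCons: "rat_eval (pCons a p) z = of_rat a + z * rat_eval p z"
  unfolding rat_eval_def by (simp add: map_poly_pCons)

lemma rat_eval_0: "rat_eval 0 z = 0" unfolding rat_eval_def by simp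

lemma rat_eval_add: "rat_eval (p + q) z = rat_eval p z + rat_eval q z"
  by (induction p q rule: poly_induct2) (auto simp: rat_eval_pCons rat_eval_0 of_rat_add algebra_simps)

lemma rat_eval_smult: "rat_eval (smult c p) z = of_rat c * rat_eval p z"
  by (induction p) (auto simp: rat_eval_pCons rat_eval_0 of_rat_mult algebra_simps)

lemma rat_eval_mult: "rat_eval (p * q) z = rat_eval p z * rat_eval q z"
  by (induction p) (auto simp: rat_eval_pCons rat_eval_0 rat_eval_add rat_eval_smult algebra_simps)

lemma minimal_polynomial_dvd:
  assumes "is_minimal_polynomial p z" "rat_eval q z = 0"
  shows "p dvd q"
proof (rule ccontr)
  assume "\<not> p dvd q"
  then have r: "q mod p \<noteq> 0" by (simp add: dvd_eq_mod_eq_0)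
  have "rat_eval q z = rat_eval (q div p) z * rat_eval p z + rat_eval (q mod p) z"
    using rat_eval_add rat_eval_mult by (metis div_mult_mod_eq)
  then have "rat_eval (q mod p) z = 0" using assms unfolding is_minimal_polynomial_def rat_eval_def by simp
  then have "degree p \<le> degree (q mod p)" using assms(1) r unfolding is_minimal_polynomial_def rat_eval_def by blast
  moreover have "p \<noteq> 0" using assms(1) unfolding is_minimal_polynomial_def by auto
  ultimately show False using degree_mod_less[of p q] r by simp
qed

lemma galois_conjugate_root:
  assumes "galois_conjugate z w" "rat_eval q z = 0"
  shows "rat_eval q w = 0"
proof -
  obtain p where p: "is_minimal_polynomial p z" "is_minimal_polynomial p w"
    using assms(1) unfolding galois_conjugate_def by blast
  obtain s where "q = p * s" using minimal_polynomial_dvd[OF p(1) assms(2)] by (elim dvdE)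
  then show ?thesis using p(2) rat_eval_mult unfolding is_minimal_polynomial_def rat_eval_def by simp
qed

text \<open>Despite the name these are polynomial functions with rational coefficients, phrased as
  functions so that determinants can be assembled by closure rules.\<close>

definition rational_function :: "(complex \<Rightarrow> complex) \<Rightarrow> bool" where
  "rational_function f \<longleftrightarrow> (\<exists>q. \<forall>z. f z = rat_eval q z)"

lemma rational_function_const: "rational_function (\<lambda>z. of_int n)"
proof -
  have "rat_eval [:of_int n:] z = of_int n" for z by (simp add: rat_eval_pCons rat_eval_0)
  then show ?thesis unfolding rational_function_def by metis
qed

lemma rational_function_id: "rational_function (\<lambda>z. z)"
proof -
  have "rat_eval [:0, 1:] z = z" for z by (simp add: rat_eval_pCons rat_eval_0)
  then show ?thesis unfolding rational_function_def by metis
qed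

lemma rational_function_add: "rational_function f \<Longrightarrow> rational_function g \<Longrightarrow> rational_function (\<lambda>z. f z + g z)"
  unfolding rational_function_def using rat_eval_add by metis

lemma rational_function_mult: "rational_function f \<Longrightarrow> rational_function g \<Longrightarrow> rational_function (\<lambda>z. f z * g z)"
  unfolding rational_function_def using rat_eval_mult by metis

lemma rational_function_sum: "(\<And>i. i \<in> A \<Longrightarrow> rational_function (f i)) \<Longrightarrow> rational_function (\<lambda>z. \<Sum>i\<in>A. f i z)"
  by (induction A rule: infinite_finite_induct)
     (use rational_function_const[of 0] in \<open>auto intro: rational_function_add\<close>)

lemma rational_function_prod: "(\<And>i. i \<in> A \<Longrightarrow> rational_function (f i)) \<Longrightarrow> rational_function (\<lambda>z. \<Prod>i\<in>A. f i z)"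
  by (induction A rule: infinite_finite_induct)
     (use rational_function_const[of 1] in \<open>auto intro: rational_function_mult\<close>)

lemma rational_function_det:
  fixes A :: "complex \<Rightarrow> complex^'n^'n"
  assumes "\<And>i j. rational_function (\<lambda>z. A z $ i $ j)"
  shows "rational_function (\<lambda>z. det (A z))"
  unfolding det_def
  by (intro rational_function_sum rational_function_mult rational_function_prod assms rational_function_const)

text \<open>
  A singular matrix whose kernel contains no nonzero vector with \<open>b\<close>-th entry 0 becomes invertible when a suitable
  row is replaced by the \<open>b\<close>-th unit vector, and invertibility transfers to conjugate numbers.
\<close>

lemma galois_kernel:
  fixes \<tau> :: "'a::finite \<Rightarrow> 'a list"
  assumes gal: "galois_conjugate z w"
    and w: "\<And>x. (\<And>a. word_value x (\<tau> a) = w ^ k * x $ a) \<Longrightarrow> x $ b = 0 \<Longrightarrow> x = 0"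
    and x: "\<And>a. word_value x (\<tau> a) = z ^ k * x $ a" "x $ b = 0"
  shows "x = 0"
proof -
  define A :: "complex \<Rightarrow> complex^'a^'a" where
    "A s = (\<chi> a c. of_int (int (count_list (\<tau> a) c)) + of_int (if a = c then -1 else 0) * s ^ k)" for s
  have A: "(A s *v v) $ a = word_value v (\<tau> a) - s ^ k * v $ a" for s v a
  proof -
    have "(A s *v v) $ a = (\<Sum>c\<in>UNIV. of_nat (count_list (\<tau> a) c) * v $ c + (if c = a then - (s ^ k * v $ c) else 0))"
      unfolding A_def matrix_vector_mult_def by (auto simp: algebra_simps intro!: sum.cong)
    then show ?thesis by (simp add: sum.distrib word_value_count)
  qed
  have ratA: "rational_function (\<lambda>s. A s $ i $ j)" for i j
  proof -
    have "rational_function (\<lambda>s. s ^ k)"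
      by (induction k) (use rational_function_const[of 1] in \<open>auto intro: rational_function_mult rational_function_id\<close>)
    then show ?thesis unfolding A_def
      by (auto intro!: rational_function_add rational_function_mult rational_function_const simp del: of_int_of_nat_eq of_int_minus)
  qed
  have transfer: "det (B z) \<noteq> 0" if B: "\<And>i j. rational_function (\<lambda>s. B s $ i $ j)" "det (B w) \<noteq> 0"
    for B :: "complex \<Rightarrow> complex^'a^'a"
  proof -
    obtain q where "\<And>s. det (B s) = rat_eval q s"
      using rational_function_det[OF B(1)] unfolding rational_function_def by blast
    then show ?thesis using galois_conjugate_root[OF gal] B(2) by metis
  qed
  have ker: "v = 0" if "det B \<noteq> 0" "B *v v = 0" for B :: "complex^'a^'a" and v
    using that matrix_left_invertible_ker[of B] invertible_det_nz[of B] invertible_left_inverse[of B] by blast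
  have Ax: "A z *v x = 0" using x(1) by (simp add: vec_eq_iff A)
  show ?thesis
  proof (cases "det (A w) = 0")
    case False
    then show ?thesis using ker[OF transfer[OF ratA] Ax] by blast
  next
    case True
    then have "det (transpose (A w)) = 0" by (simp add: det_transpose)
    then obtain y where y: "y \<noteq> 0" "transpose (A w) *v y = 0"
      using matrix_left_invertible_ker[of "transpose (A w)"] invertible_det_nz[of "transpose (A w)"]
        invertible_left_inverse[of "transpose (A w)"] by blast
    \<comment> \<open>A left kernel vector with nonzero \<open>r\<close>-th entry writes row
      \<open>r\<close> of \<open>A w\<close> as a combination of the other rows. Hence that row can
      give way to the condition that the \<open>b\<close>-th entry vanishes.\<close>
    then obtain r where r: "y $ r \<noteq> 0" by (auto simp: vec_eq_iff)
    define B :: "complex \<Rightarrow> complex^'a^'a" where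
      "B s = (\<chi> a c. if a = r then of_int (if c = b then 1 else 0) else A s $ a $ c)" for s
    have B: "(B s *v v) $ a = (if a = r then v $ b else (A s *v v) $ a)" for s v a
    proof -
      have "(\<Sum>c\<in>UNIV. of_int (if c = b then 1 else 0) * v $ c) = (\<Sum>c\<in>UNIV. if c = b then v $ c else 0)"
        by (rule sum.cong) auto
      then show ?thesis unfolding B_def matrix_vector_mult_def by simp
    qed
    have ratB: "rational_function (\<lambda>s. B s $ i $ j)" for i j
      unfolding B_def using ratA[of i j] rational_function_const by (cases "i = r") auto
    have "det (B w) \<noteq> 0"
    proof -
      have "v = 0" if v: "B w *v v = 0" for v
      proof (rule w)
        have vb: "v $ b = 0" using v B[of w v r] by simp
        then show "v $ b = 0" .
        have nr: "(A w *v v) $ a = 0" if "a \<noteq> r" for a using B[of w v a] v that by simp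
        have "(\<Sum>a\<in>UNIV. y $ a * (A w *v v) $ a) = (\<Sum>a\<in>UNIV. \<Sum>c\<in>UNIV. y $ a * (A w $ a $ c * v $ c))"
          by (simp add: matrix_vector_mult_def sum_distrib_left)
        also have "\<dots> = (\<Sum>c\<in>UNIV. (transpose (A w) *v y) $ c * v $ c)"
          by (subst sum.swap) (simp add: matrix_vector_mult_def transpose_def sum_distrib_left mult_ac)
        also have "\<dots> = 0" using y(2) by simp
        finally have "(\<Sum>a\<in>UNIV. y $ a * (A w *v v) $ a) = 0" .
        moreover have "(\<Sum>a\<in>UNIV. y $ a * (A w *v v) $ a) = y $ r * (A w *v v) $ r"
        proof -
          have "(\<Sum>a\<in>UNIV. y $ a * (A w *v v) $ a) = (\<Sum>a\<in>UNIV. if a = r then y $ r * (A w *v v) $ r else 0)"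
            by (rule sum.cong) (auto simp: nr)
          then show ?thesis by simp
        qed
        ultimately have "(A w *v v) $ r = 0" using r by simp
        then have "(A w *v v) $ a = 0" for a using nr by (cases "a = r") auto
        then show "word_value v (\<tau> a) = w ^ k * v $ a" for a using A[of w v a] by simp
      qed
      then show ?thesis
        using matrix_left_invertible_ker[of "B w"] invertible_det_nz[of "B w"] invertible_left_inverse[of "B w"] by blast
    qed
    then have "det (B z) \<noteq> 0" using transfer[OF ratB] by blast
    moreover have "B z *v x = 0" using Ax x(2) by (simp add: vec_eq_iff B)
    ultimately show ?thesis using ker by blast
  qed
qed

section \<open>Rauzy-Veech induction and connections\<close>

definition exchange_state :: "real \<Rightarrow> ('a::finite \<Rightarrow> real set) \<Rightarrow> (real \<Rightarrow> real) \<Rightarrow> bool" where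
  "exchange_state L I T \<longleftrightarrow>
     (\<forall>a. \<exists>l r. l < r \<and> I a = {l..<r}) \<and> (\<forall>a b. a \<noteq> b \<longrightarrow> I a \<inter> I b = {}) \<and> (\<Union>a. I a) = {0..<L} \<and>
     bij_betw T {0..<L} {0..<L} \<and> (\<forall>a. \<exists>\<delta>. \<forall>t\<in>I a. T t = t + \<delta>)"

definition left_end :: "('a \<Rightarrow> real set) \<Rightarrow> real \<Rightarrow> bool" where
  "left_end I x \<longleftrightarrow> (\<exists>a. x \<in> I a \<and> (\<forall>y\<in>I a. x \<le> y))"

text \<open>
  The points that are reached from the left ends of the intervals \<open>T(I\<^sub>a)\<close> without going below \<open>\<epsilon>\<close>. A connection
  leads from there to a left end of an interval \<open>I\<^sub>a\<close>.
\<close>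

inductive reached :: "real \<Rightarrow> ('a \<Rightarrow> real set) \<Rightarrow> (real \<Rightarrow> real) \<Rightarrow> real \<Rightarrow> bool"
  for \<epsilon> :: real and I :: "'a \<Rightarrow> real set" and T :: "real \<Rightarrow> real" where
  start: "left_end I x \<Longrightarrow> \<epsilon> \<le> T x \<Longrightarrow> reached \<epsilon> I T (T x)"
| step: "reached \<epsilon> I T x \<Longrightarrow> \<epsilon> \<le> T x \<Longrightarrow> reached \<epsilon> I T (T x)"

definition has_connection :: "real \<Rightarrow> ('a \<Rightarrow> real set) \<Rightarrow> (real \<Rightarrow> real) \<Rightarrow> bool" where
  "has_connection \<epsilon> I T \<longleftrightarrow> (\<exists>x. reached \<epsilon> I T x \<and> left_end I x)"

lemma reached_ge: "reached \<epsilon> I T x \<Longrightarrow> \<epsilon> \<le> x"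
  by (induction rule: reached.induct) auto

lemma first_return_cases:
  assumes "T t \<in> S \<or> T (T t) \<in> S"
  shows "first_return_map T S t = (if T t \<in> S then T t else T (T t))"
proof (cases "T t \<in> S")
  case True
  then have "first_return_time T S t = 1"
    unfolding first_return_time_def by (intro Least_equality) auto
  then show ?thesis using True unfolding first_return_map_def by simp
next
  case False
  have "first_return_time T S t = 2"
    unfolding first_return_time_def
  proof (rule Least_equality)
    show "0 < (2::nat) \<and> (T ^^ 2) t \<in> S" using assms False by (simp add: numeral_2_eq_2)
    fix n assume n: "0 < n \<and> (T ^^ n) t \<in> S"
    then have "n \<noteq> 1" using False by auto
    then show "2 \<le> n" using n by simp
  qed
  then show ?thesis using False unfolding first_return_map_def by (simp add: numeral_2_eq_2)
qed

lemma induced_bij: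
  assumes T: "bij_betw T X X" "S \<subseteq> X" and ret: "\<And>t. t \<in> S \<Longrightarrow> T t \<in> S \<or> T (T t) \<in> S"
    and from_S: "\<And>t. t \<in> X \<Longrightarrow> T t \<in> X - S \<Longrightarrow> t \<in> S"
  shows "bij_betw (first_return_map T S) S S"
proof -
  have eq: "first_return_map T S t = (if T t \<in> S then T t else T (T t))" if "t \<in> S" for t
    using first_return_cases ret[OF that] by metis
  have inj: "s = t" if "s \<in> X" "t \<in> X" "T s = T t" for s t
    using T(1) that unfolding bij_betw_def inj_on_def by blast
  have X: "T t \<in> X" if "t \<in> X" for t using T(1) that bij_betwE by blast
  have "inj_on (first_return_map T S) S"
  proof (rule inj_onI)
    fix s t assume s: "s \<in> S" and t: "t \<in> S" and e: "first_return_map T S s = first_return_map T S t"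
    have sX: "s \<in> X" "t \<in> X" "T s \<in> X" "T t \<in> X" using s t T(2) X by auto
    show "s = t"
      using e inj[OF sX(1,2)] inj[OF sX(1,4)] inj[OF sX(3,2)] inj[OF sX(3,4)] s t
      unfolding eq[OF s] eq[OF t] by (auto split: if_splits)
  qed
  moreover have "first_return_map T S ` S = S"
  proof
    show "first_return_map T S ` S \<subseteq> S" using eq ret by auto
    show "S \<subseteq> first_return_map T S ` S"
    proof
      fix y assume y: "y \<in> S"
      have onto: "\<exists>x\<in>X. T x = z" if "z \<in> X" for z using T(1) that unfolding bij_betw_def by (metis imageE)
      obtain x where x: "x \<in> X" "T x = y" using onto y T(2) by blast
      show "y \<in> first_return_map T S ` S"
      proof (cases "x \<in> S")
        case True
        then show ?thesis using eq[OF True] x y by force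
      next
        case False
        obtain w where w: "w \<in> X" "T w = x" using onto x(1) by blast
        then have wS: "w \<in> S" using from_S False x(1) by blast
        then show ?thesis using eq[OF wS] w x False by force
      qed
    qed
  qed
  ultimately show ?thesis unfolding bij_betw_def by blast
qed

text \<open>A connection survives each step: the induced map follows its orbit and skips only points
  in the part cut off, all of which come from \<open>I c\<close>. Points keep their positions, so
  the threshold \<open>\<epsilon>\<close> is preserved. What needs care is a connection that starts
  or ends at a left end that is cut off.\<close>

lemma rauzy_veech_step_state:
  assumes "rauzy_veech_step s s'" "s = (L, I, T)" "s' = (L', I', T')" and st: "exchange_state L I T" and eps: "\<epsilon> > 0"
  shows "exchange_state L' I' T' \<and> (has_connection \<epsilon> I T \<longrightarrow> has_connection \<epsilon> I' T')"
proof -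
  have ivl: "\<exists>l r. l < r \<and> I a = {l..<r}" for a using st unfolding exchange_state_def by simp
  have dis: "a = a'" if "t \<in> I a" "t \<in> I a'" for t a a' using st that unfolding exchange_state_def by blast
  have un: "(\<Union>a. I a) = {0..<L}" and bij: "bij_betw T {0..<L} {0..<L}" using st unfolding exchange_state_def by auto
  have sub: "I a \<subseteq> {0..<L}" for a using un by blast
  obtain \<delta> where \<delta>: "\<And>a t. t \<in> I a \<Longrightarrow> T t = t + \<delta> a" using st unfolding exchange_state_def by metis
  have inj: "s = t" if "s \<in> {0..<L}" "t \<in> {0..<L}" "T s = T t" for s t
    using bij that unfolding bij_betw_def inj_on_def by blast
  have TX: "T t \<in> {0..<L}" if "t \<in> {0..<L}" for t using bij that bij_betwE by blast
  from assms(1-3) show ?thesis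
  proof (cases rule: rauzy_veech_step.cases)
  case (top I1 b L1 x T1 c y)
  then have eqs: "I1 = I" "L1 = L" "T1 = T" "L' = L - y" "I' = (\<lambda>a. I a \<inter> {0..<L - y})"
    "T' = first_return_map T {0..<L - y}" using assms(2,3) by auto
  have Ib: "I b = {L - x..<L}" and TIc: "T ` I c = {L - y..<L}" and xy: "0 < y" "y < x" using top eqs by auto
  have bc: "b \<noteq> c"
  proof
    assume "b = c"
    have "T ` I c = (\<lambda>t. t + \<delta> c) ` I c" by (intro image_cong) (auto simp: \<delta>)
    then have "{L - y..<L} = {L - x + \<delta> c..<L + \<delta> c}" using TIc Ib \<open>b = c\<close> by simp
    then show False using xy by (auto simp: atLeastLessThan_eq_iff)
  qed
  define S where "S = {0..<L - y}"
  have cS: "I c \<subseteq> S"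
  proof
    fix t assume t: "t \<in> I c"
    then have "t \<notin> {L - x..<L}" "t \<in> {0..<L}" using dis[of t b c] bc sub[of c] Ib by blast+
    then show "t \<in> S" using xy unfolding S_def by auto
  qed
  have big: "t \<in> I c" if "t \<in> {0..<L}" "T t \<notin> S" for t
  proof -
    have "T t \<in> T ` I c" using TX[OF that(1)] that(2) unfolding TIc S_def by auto
    then show ?thesis using inj that(1) sub by (metis imageE subsetD)
  qed
  have big': "T t \<notin> S" if "t \<in> I c" for t
  proof -
    have "T t \<in> {L - y..<L}" using that TIc by blast
    then show ?thesis unfolding S_def by auto
  qed
  have Tb: "T t \<in> S" if "t \<in> {0..<L}" "t \<notin> S" for t using big[OF that(1)] that(2) cS by blast
  have ret: "T t \<in> S \<or> T (T t) \<in> S" if "t \<in> S" for t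
    using Tb[OF TX, of t] that unfolding S_def using xy by auto
  have T': "T' t = (if T t \<in> S then T t else T (T t))" if "t \<in> S" for t
    unfolding eqs(6) S_def[symmetric] by (rule first_return_cases[OF ret[OF that]])
  \<comment> \<open>Only \<open>I b\<close> is shortened, and by \<open>y < x\<close> it keeps its
    left end; no left end is cut off in this case.\<close>
  have le: "left_end I u \<Longrightarrow> u < L - y" for u
  proof -
    assume "left_end I u"
    then obtain a where a: "u \<in> I a" "\<forall>v\<in>I a. u \<le> v" unfolding left_end_def by blast
    show "u < L - y"
    proof (cases "a = b")
      case True
      have "L - x \<in> I b" using Ib xy by auto
      then have "u \<le> L - x" using a(2) True by blast
      then show ?thesis using xy by simp
    next
      case False
      then have "u \<notin> I b" using dis a(1) by blast
      then show ?thesis using a(1) sub Ib xy by fastforce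
    qed
  qed
  have left: "left_end I' u" if "left_end I u" for u
  proof -
    from that obtain a where a: "u \<in> I a" "\<forall>v\<in>I a. u \<le> v" unfolding left_end_def by blast
    then have "u \<in> I' a" "\<forall>v\<in>I' a. u \<le> v" using le[OF that] sub unfolding eqs(5) by fastforce+
    then show ?thesis unfolding left_end_def by blast
  qed
  have "exchange_state L' I' T'"
    unfolding exchange_state_def
  proof (intro conjI allI impI)
    fix a
    obtain l r where lr: "l < r" "I a = {l..<r}" using ivl by blast
    have "left_end I l" unfolding left_end_def using lr by (intro exI[of _ a]) auto
    then have "l < L - y" by (rule le)
    moreover have "0 \<le> l" using sub[of a] lr by auto
    ultimately show "\<exists>l r. l < r \<and> I' a = {l..<r}" using lr unfolding eqs(5)
      by (intro exI[of _ l] exI[of _ "min r (L - y)"]) auto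
    show "\<exists>\<delta>. \<forall>t\<in>I' a. T' t = t + \<delta>"
    proof (cases "a = c")
      case True
      have "T' t = t + (\<delta> c + \<delta> b)" if t: "t \<in> I c" for t
      proof -
        have "T t \<in> {L - y..<L}" using t TIc by blast
        then have "T t \<in> I b" using Ib xy by auto
        then show ?thesis using T'[of t] cS t big'[OF t] \<delta> by auto
      qed
      then show ?thesis unfolding eqs(5) using True by blast
    next
      case False
      have "T' t = t + \<delta> a" if t: "t \<in> I a" "t \<in> S" for t
      proof -
        have "T t \<in> S" using big[of t] t sub False dis by blast
        then show ?thesis using T'[OF t(2)] \<delta>[OF t(1)] by simp
      qed
      then show ?thesis unfolding eqs(5) S_def by blast
    qed
  next
    fix a a' :: 'a assume "a \<noteq> a'"
    then show "I' a \<inter> I' a' = {}" unfolding eqs(5) using dis by blast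
  next
    show "(\<Union>a. I' a) = {0..<L'}" unfolding eqs(4,5) using un xy by auto
    have "bij_betw (first_return_map T S) S S"
    proof (rule induced_bij[OF bij _ ret])
      show "S \<subseteq> {0..<L}" using xy unfolding S_def by auto
      show "t \<in> S" if "t \<in> {0..<L}" "T t \<in> {0..<L} - S" for t using big that cS by blast
    qed
    then show "bij_betw T' {0..<L'} {0..<L'}" unfolding eqs S_def .
  qed
  moreover have "has_connection \<epsilon> I' T'" if "has_connection \<epsilon> I T"
  proof -
    \<comment> \<open>A reached point in the part cut off is represented by its preimage
      \<open>q\<close>, from which the induced map continues beyond it.\<close>
    have inv: "p \<in> {0..<L} \<and> (p \<in> S \<longrightarrow> reached \<epsilon> I' T' p) \<and>
       (p \<notin> S \<longrightarrow> (\<exists>q\<in>I c. T q = p \<and> (left_end I q \<or> reached \<epsilon> I' T' q)))" if "reached \<epsilon> I T p" for p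
      using that
    proof (induction rule: reached.induct)
      case (start u)
      have uL: "u \<in> {0..<L}" using start(1) sub unfolding left_end_def by blast
      then have u: "u \<in> S" using le[OF start(1)] unfolding S_def by auto
      have "u \<in> {0..<L}" by (rule uL)
      moreover have "reached \<epsilon> I' T' (T u)" if "T u \<in> S"
        using reached.start[OF left[OF start(1)], of \<epsilon> T'] T'[OF u] that start(2) by auto
      moreover have "\<exists>q\<in>I c. T q = T u \<and> (left_end I q \<or> reached \<epsilon> I' T' q)" if "T u \<notin> S"
        using big[OF _ that] \<open>u \<in> {0..<L}\<close> start(1) by blast
      ultimately show ?case using TX by blast
    next
      case (step p)
      then have p: "p \<in> {0..<L}" by blast
      show ?case
      proof (cases "p \<in> S")
        case True
        then have r: "reached \<epsilon> I' T' p" using step by blast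
        have "reached \<epsilon> I' T' (T p)" if "T p \<in> S"
          using reached.step[OF r] T'[OF True] that step(2) by auto
        then show ?thesis using big[OF p] TX[OF p] r by blast
      next
        case False
        then obtain q where q: "q \<in> I c" "T q = p" "left_end I q \<or> reached \<epsilon> I' T' q" using step by blast
        have Tp: "T p \<in> S" using Tb[OF p False] .
        have "T' q = T p" using T'[of q] q cS False by auto
        then have "reached \<epsilon> I' T' (T p)"
          using q(3) reached.start[OF left, of q \<epsilon> T'] reached.step[of \<epsilon> I' T' q] step(2) by auto
        then show ?thesis using Tp TX[OF p] by blast
      qed
    qed
    from that obtain p where p: "reached \<epsilon> I T p" "left_end I p" unfolding has_connection_def by blast
    have "p \<in> S" using le[OF p(2)] inv[OF p(1)] unfolding S_def by auto
    then show ?thesis using inv[OF p(1)] left[OF p(2)] unfolding has_connection_def by blast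
  qed
  ultimately show ?thesis by blast
next
  case (bottom I1 b L1 x T1 c y)
  then have eqs: "I1 = I" "L1 = L" "T1 = T" "L' = L - x"
    "I' = I(b := {t \<in> I c. T t \<in> I b}, c := {t \<in> I c. T t \<notin> I b})"
    "T' = first_return_map T {0..<L - x}" using assms(2,3) by auto
  have Ib: "I b = {L - x..<L}" and TIc: "T ` I c = {L - y..<L}" and xy: "0 < x" "x < y" using bottom eqs by auto
  have bc: "b \<noteq> c"
  proof
    assume "b = c"
    have "T ` I c = (\<lambda>t. t + \<delta> c) ` I c" by (intro image_cong) (auto simp: \<delta>)
    then have "{L - y..<L} = {L - x + \<delta> c..<L + \<delta> c}" using TIc Ib \<open>b = c\<close> by simp
    then show False using xy by (auto simp: atLeastLessThan_eq_iff)
  qed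
  define S where "S = {0..<L - x}"
  have S_iff: "t \<in> S \<longleftrightarrow> t \<notin> I b" if "t \<in> {0..<L}" for t using that xy unfolding S_def Ib by auto
  have cS: "I c \<subseteq> S" using S_iff sub dis bc by blast
  obtain lc rc where lrc: "lc < rc" "I c = {lc..<rc}" using ivl by blast
  have Tc: "T lc = L - y" "rc = lc + y"
  proof -
    have "T ` I c = (\<lambda>t. t + \<delta> c) ` I c" by (intro image_cong) (auto simp: \<delta>)
    then have "{L - y..<L} = {lc + \<delta> c..<rc + \<delta> c}" using TIc lrc(2) by simp
    then have "L - y = lc + \<delta> c" "L = rc + \<delta> c" using lrc(1) xy by (auto simp: atLeastLessThan_eq_iff)
    then show "T lc = L - y" "rc = lc + y" using \<delta>[of lc c] lrc by auto
  qed
  \<comment> \<open>The point of \<open>I c\<close> that \<open>T\<close> sends to the left end of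
    \<open>I b\<close>. It becomes the left end of the interval that takes over the label
    \<open>b\<close>, and replaces the left end that is cut off.\<close>
  define m where "m = rc - x"
  have m: "m \<in> I c" "T m = L - x" "lc < m" using Tc lrc xy \<delta>[of lc c] \<delta>[of m c] unfolding m_def by auto
  have Tt: "T t = t + (L - y - lc)" if "t \<in> I c" for t using \<delta>[OF that] \<delta>[of lc c] lrc Tc(1) by auto
  have I'b: "I' b = {m..<rc}" and I'c: "I' c = {lc..<m}" and I'a: "\<And>a. a \<noteq> b \<Longrightarrow> a \<noteq> c \<Longrightarrow> I' a = I a"
  proof -
    have "T t \<in> I b \<longleftrightarrow> m \<le> t" if "t \<in> I c" for t
      using Tt[OF that] that lrc Tc unfolding Ib m_def by auto
    then show "I' b = {m..<rc}" "I' c = {lc..<m}"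
      unfolding eqs(5) using bc lrc m by auto
  qed (simp add: eqs(5))
  have big: "t \<in> I c" if "t \<in> {0..<L}" "T t \<notin> S" for t
  proof -
    have "T t \<in> T ` I c" using TX[OF that(1)] that(2) xy unfolding TIc S_def by auto
    then show ?thesis using inj that(1) sub by (metis imageE subsetD)
  qed
  have Tb: "T t \<in> S" if "t \<in> {0..<L}" "t \<notin> S" for t using big[OF that(1)] that(2) cS by blast
  have ret: "T t \<in> S \<or> T (T t) \<in> S" if "t \<in> S" for t
    using Tb[OF TX, of t] that unfolding S_def using xy by auto
  have T': "T' t = (if T t \<in> S then T t else T (T t))" if "t \<in> S" for t
    unfolding eqs(6) S_def[symmetric] by (rule first_return_cases[OF ret[OF that]])
  have leftb: "left_end I' m" unfolding left_end_def using I'b m(3) m_def xy by (intro exI[of _ b]) auto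
  have left: "left_end I' u" if u: "left_end I u" "u \<in> S" for u
  proof -
    obtain a where a: "u \<in> I a" "\<forall>v\<in>I a. u \<le> v" using u unfolding left_end_def by blast
    have ab: "a \<noteq> b" using a(1) u(2) S_iff sub by blast
    show ?thesis
    proof (cases "a = c")
      case True
      then have "u = lc" using a lrc by force
      then show ?thesis unfolding left_end_def using I'c m(3) by (intro exI[of _ c]) auto
    next
      case False
      then show ?thesis unfolding left_end_def using a I'a[OF ab False] by blast
    qed
  qed
  have "exchange_state L' I' T'"
    unfolding exchange_state_def
  proof (intro conjI allI impI)
    fix a
    consider "a = b" | "a = c" | "a \<noteq> b" "a \<noteq> c" by blast
    then show "\<exists>l r. l < r \<and> I' a = {l..<r}"
    proof cases
      case 1
      then show ?thesis using I'b xy m_def by (intro exI[of _ m] exI[of _ rc]) auto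
    next
      case 2
      then show ?thesis using I'c m(3) by blast
    next
      case 3
      then show ?thesis using I'a ivl by metis
    qed
    consider "a = b" | "a \<noteq> b" by blast
    then show "\<exists>\<delta>. \<forall>t\<in>I' a. T' t = t + \<delta>"
    proof cases
      case 1
      have "T' t = t + (\<delta> c + \<delta> b)" if "t \<in> I' b" for t
      proof -
        have t: "t \<in> I c" "T t \<in> I b" using that bc unfolding eqs(5) by auto
        then have "T t \<notin> S" using S_iff[of "T t"] sub by blast
        then show ?thesis using T'[of t] cS t \<delta> by auto
      qed
      then show ?thesis using 1 by blast
    next
      case 2
      have "T' t = t + \<delta> a" if "t \<in> I' a" for t
      proof -
        have t: "t \<in> I a" "a = c \<longrightarrow> T t \<notin> I b" using that 2 unfolding eqs(5) by (auto split: if_splits)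
        have tS: "t \<in> S" using t(1) 2 S_iff sub dis by blast
        have "T t \<in> S"
        proof (rule ccontr)
          assume n: "T t \<notin> S"
          then have "t \<in> I c" using big t(1) sub by blast
          then have "a = c" using dis t(1) by blast
          then show False using t(2) n S_iff[of "T t"] TX[of t] sub[of a] t(1) by blast
        qed
        then show ?thesis using T'[OF tS] \<delta>[OF t(1)] by simp
      qed
      then show ?thesis by blast
    qed
  next
    fix a a' :: 'a assume ne: "a \<noteq> a'"
    have sub': "I' b \<subseteq> I c" "I' c \<subseteq> I c" unfolding eqs(5) by auto
    show "I' a \<inter> I' a' = {}"
    proof (rule ccontr)
      assume "I' a \<inter> I' a' \<noteq> {}"
      then obtain t where t: "t \<in> I' a" "t \<in> I' a'" by blast
      have old: "t \<in> I (if d = b then c else d)" if "t \<in> I' d" for d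
        using that sub' I'a[of d] by (cases "d = b"; cases "d = c") auto
      have "(if a = b then c else a) = (if a' = b then c else a')" using dis old t by blast
      then have "{a, a'} = {b, c}" using ne by (auto split: if_splits)
      then have "t \<in> I' b" "t \<in> I' c" using t ne by (auto simp: doubleton_eq_iff)
      then show False using I'b I'c by auto
    qed
  next
    show "(\<Union>a. I' a) = {0..<L'}"
    proof -
      have "t \<in> (\<Union>a. I' a) \<longleftrightarrow> t \<in> S" for t
      proof
        assume "t \<in> (\<Union>a. I' a)"
        then obtain a where a: "t \<in> I' a" by blast
        show "t \<in> S"
        proof (cases "a = b \<or> a = c")
          case True
          then show ?thesis using a cS unfolding eqs(5) by (auto split: if_splits)
        next
          case False
          then show ?thesis using a I'a[of a] S_iff[of t] sub[of a] dis[of t a b] by blast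
        qed
      next
        assume t: "t \<in> S"
        then have "t \<in> {0..<L}" using xy unfolding S_def by auto
        then obtain a where a: "t \<in> I a" "a \<noteq> b" using un S_iff t by blast
        then show "t \<in> (\<Union>a. I' a)"
          using I'a[of a] I'b I'c lrc(2) by (cases "a = c"; cases "t < m") force+
      qed
      then show ?thesis unfolding eqs(4) S_def by blast
    qed
    have "bij_betw (first_return_map T S) S S"
    proof (rule induced_bij[OF bij _ ret])
      show "S \<subseteq> {0..<L}" using xy unfolding S_def by auto
      show "t \<in> S" if "t \<in> {0..<L}" "T t \<in> {0..<L} - S" for t using big that cS by blast
    qed
    then show "bij_betw T' {0..<L'} {0..<L'}" unfolding eqs S_def .
  qed
  moreover have "has_connection \<epsilon> I' T'" if "has_connection \<epsilon> I T"
  proof -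
    have inv: "p \<in> {0..<L} \<and> (p \<in> S \<longrightarrow> reached \<epsilon> I' T' p) \<and>
       (p \<notin> S \<longrightarrow> (\<exists>q\<in>I c. T q = p \<and> reached \<epsilon> I' T' q))" if "reached \<epsilon> I T p" for p
      using that
    proof (induction rule: reached.induct)
      case (start u)
      obtain a where a: "u \<in> I a" "\<forall>v\<in>I a. u \<le> v" using start(1) unfolding left_end_def by blast
      have uL: "u \<in> {0..<L}" using a(1) sub by blast
      show ?case
      proof (cases "u \<in> S")
        case False
        then have "a = b" using a(1) S_iff[OF uL] dis by blast
        then have u: "u = L - x" using a Ib xy by force
        have "T u \<in> S" using Tb[OF uL False] .
        moreover have "T' m = T u" using T'[of m] cS m u False by auto
        ultimately show ?thesis using reached.start[OF leftb, of \<epsilon> T'] start(2) TX[OF uL] by auto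
      next
        case True
        have "T u \<in> S"
        proof (rule ccontr)
          assume n: "T u \<notin> S"
          then have "a = c" using big[OF uL] a(1) dis by blast
          then have "u = lc" using a lrc by force
          then show False using n Tc xy TX[OF uL] unfolding S_def by auto
        qed
        then show ?thesis using reached.start[OF left[OF start(1) True], of \<epsilon> T'] T'[OF True] start(2) TX[OF uL] by auto
      qed
    next
      case (step p)
      then have p: "p \<in> {0..<L}" by blast
      show ?case
      proof (cases "p \<in> S")
        case True
        then have r: "reached \<epsilon> I' T' p" using step by blast
        have "reached \<epsilon> I' T' (T p)" if "T p \<in> S"
          using reached.step[OF r] T'[OF True] that step(2) by auto
        then show ?thesis using big[OF p] TX[OF p] r by blast
      next
        case False
        then obtain q where q: "q \<in> I c" "T q = p" "reached \<epsilon> I' T' q" using step by blast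
        have "T' q = T p" using T'[of q] q cS False by auto
        then have "reached \<epsilon> I' T' (T p)" using reached.step[OF q(3)] step(2) by auto
        then show ?thesis using Tb[OF p False] TX[OF p] by blast
      qed
    qed
    from that obtain p where p: "reached \<epsilon> I T p" "left_end I p" unfolding has_connection_def by blast
    show ?thesis
    proof (cases "p \<in> S")
      case True
      then show ?thesis using inv[OF p(1)] left[OF p(2)] unfolding has_connection_def by blast
    next
      case False
      \<comment> \<open>The connection ended at the left end of \<open>I b\<close>; its induced
        version ends one step earlier, at \<open>m\<close>.\<close>
      then obtain q where q: "q \<in> I c" "T q = p" "reached \<epsilon> I' T' q" using inv[OF p(1)] by blast
      obtain a where a: "p \<in> I a" "\<forall>v\<in>I a. p \<le> v" using p(2) unfolding left_end_def by blast
      have "a = b" using a(1) S_iff[of p] inv[OF p(1)] dis False by blast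
      then have "p = L - x" using a Ib xy by force
      then have "T q = T m" using q(2) m(2) by simp
      then have "q = m" using inj[of q m] q(1) m(1) sub[of c] by blast
      then show ?thesis using q(3) leftb unfolding has_connection_def by blast
    qed
  qed
  ultimately show ?thesis by blast
qed
qed

lemma rauzy_veech_steps_connection:
  assumes "rauzy_veech_step\<^sup>*\<^sup>* (L, I, T) s'" "exchange_state L I T" "\<epsilon> > 0"
  shows "case s' of (L', I', T') \<Rightarrow> exchange_state L' I' T' \<and> (has_connection \<epsilon> I T \<longrightarrow> has_connection \<epsilon> I' T')"
  using assms(1)
proof (induction rule: rtranclp_induct)
  case (step s s')
  then show ?case using rauzy_veech_step_state[OF step(2) _ _ _ assms(3)] by (cases s; cases s') fastforce
qed (use assms(2) in simp)

context self_similar_exchange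
begin

lemma left_end_iff: "left_end I x \<longleftrightarrow> (\<exists>a. x = lft a)"
proof
  assume "left_end I x"
  then obtain a where "x \<in> I a" "\<forall>y\<in>I a. x \<le> y" unfolding left_end_def by blast
  then have "x = lft a" using lft_in_I[of a] lft_rgt(2)[of a] by force
  then show "\<exists>a. x = lft a" by blast
next
  assume "\<exists>a. x = lft a"
  then show "left_end I x" unfolding left_end_def using lft_in_I lft_rgt(2) by fastforce
qed

lemma reached_U: "reached \<epsilon> I T x \<Longrightarrow> x \<in> unit_ico"
  by (induction rule: reached.induct) (use left_end_iff lft_U T_U in auto)

text \<open>Induction down to \<open>[0, \<alpha>)\<close> keeps a connection above
  \<open>\<epsilon>\<close>, and rescaling turns it into one of \<open>T\<close> above
  \<open>\<epsilon> / \<alpha>\<close>. Repetition pushes the threshold beyond 1, where there are no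
  points.\<close>

lemma no_connection:
  assumes rv: "rauzy_veech_periodic \<alpha> I T" and eps: "\<epsilon> > 0"
  shows "\<not> has_connection \<epsilon> I T"
proof
  assume con: "has_connection \<epsilon> I T"
  have st: "exchange_state 1 I T"
    unfolding exchange_state_def
  proof (intro conjI allI impI)
    show "\<exists>l r. l < r \<and> I a = {l..<r}" for a using lft_rgt by blast
    show "I a \<inter> I b = {}" if "a \<noteq> b" for a b using I_disjoint that by blast
    show "\<exists>\<delta>. \<forall>t\<in>I a. T t = t + \<delta>" for a using T_translation by blast
  qed (use Un_I T_bij in auto)
  obtain I' T' where rv': "rauzy_veech_step\<^sup>*\<^sup>* (1, I, T) (\<alpha>, I', T')" "range I' = range (\<lambda>a. (*) \<alpha> ` I a)"
    "\<forall>t\<in>unit_ico. T' (\<alpha> * t) = \<alpha> * T t" using rv unfolding rauzy_veech_periodic_def by (elim exE conjE) (rule that)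
  have left': "\<exists>y. x = \<alpha> * y \<and> left_end I y" if "left_end I' x" for x
  proof -
    from that obtain a where a: "x \<in> I' a" "\<forall>v\<in>I' a. x \<le> v" unfolding left_end_def by blast
    have "I' a \<in> range (\<lambda>a. (*) \<alpha> ` I a)" using rv'(2) by blast
    then obtain b where b: "I' a = (*) \<alpha> ` I b" by blast
    then obtain y where y: "y \<in> I b" "x = \<alpha> * y" using a(1) by blast
    have "y \<le> v" if "v \<in> I b" for v
    proof -
      have "x \<le> \<alpha> * v" using a(2) b that by blast
      then show ?thesis using y(2) alpha by simp
    qed
    then show ?thesis using y unfolding left_end_def by blast
  qed
  have reach': "\<exists>q. p = \<alpha> * q \<and> reached (e / \<alpha>) I T q" if "reached e I' T' p" for p e
    using that
  proof (induction rule: reached.induct)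
    case (start x)
    obtain y where y: "x = \<alpha> * y" "left_end I y" using left'[OF start(1)] by blast
    obtain a where "y = lft a" using y(2) left_end_iff by blast
    then have "y \<in> unit_ico" using lft_U by blast
    then have "T' x = \<alpha> * T y" using rv'(3) y(1) by blast
    then show ?case using reached.start[OF y(2), of "e / \<alpha>" T] start(2) alpha by (intro exI[of _ "T y"]) (auto simp: field_simps)
  next
    case (step p)
    then obtain q where q: "p = \<alpha> * q" "reached (e / \<alpha>) I T q" by blast
    have "q \<in> unit_ico" using reached_U[OF q(2)] .
    then have "T' p = \<alpha> * T q" using rv'(3) q(1) by blast
    then show ?case using reached.step[OF q(2)] step(2) alpha by (intro exI[of _ "T q"]) (auto simp: field_simps)
  qed
  have next_con: "has_connection (e / \<alpha>) I T" if e: "has_connection e I T" "e > 0" for e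
  proof -
    have "has_connection e I' T'" using rauzy_veech_steps_connection[OF rv'(1) st e(2)] e(1) by simp
    then obtain p where p: "reached e I' T' p" "left_end I' p" unfolding has_connection_def by blast
    obtain q where q: "p = \<alpha> * q" "reached (e / \<alpha>) I T q" using reach'[OF p(1)] by blast
    obtain y where "p = \<alpha> * y" "left_end I y" using left'[OF p(2)] by blast
    then have "left_end I q" using q(1) alpha by simp
    then show ?thesis using q(2) unfolding has_connection_def by blast
  qed
  have all: "has_connection (\<epsilon> / \<alpha> ^ n) I T" for n
  proof (induction n)
    case (Suc n)
    then show ?case using next_con[OF Suc] eps alpha by (simp add: mult.commute)
  qed (simp add: con)
  obtain n where n: "\<alpha> ^ n < \<epsilon>" using exists_small_pow[OF eps] by blast
  obtain p where p: "reached (\<epsilon> / \<alpha> ^ n) I T p" using all unfolding has_connection_def by blast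
  have "\<epsilon> / \<alpha> ^ n > 1" using n alpha by simp
  then show False using reached_ge[OF p] reached_U[OF p] by auto
qed

end

section \<open>Eigenvectors for the contracting eigenvalue\<close>

lemma geometric_limit:
  fixes f :: "nat \<Rightarrow> 'b::banach"
  assumes r: "0 < r" "r < 1" and f: "\<And>n. norm (f (Suc n) - f n) \<le> C * r ^ n"
  shows "f \<longlonglongrightarrow> lim f" "norm (lim f - f n) \<le> C / (1 - r) * r ^ n"
proof -
  have C: "0 \<le> C" using order_trans[OF norm_ge_zero f[of 0]] by simp
  have diff: "norm (f (n + k) - f n) \<le> C / (1 - r) * r ^ n" for n k
  proof -
    have "norm (f (n + k) - f n) \<le> C * r ^ n * (\<Sum>i<k. r ^ i)"
    proof (induction k)
      case (Suc k)
      have "norm (f (n + Suc k) - f n) \<le> norm (f (Suc (n + k)) - f (n + k)) + norm (f (n + k) - f n)"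
        using norm_triangle_ineq[of "f (Suc (n + k)) - f (n + k)" "f (n + k) - f n"] by simp
      also have "\<dots> \<le> C * r ^ (n + k) + C * r ^ n * (\<Sum>i<k. r ^ i)" using f Suc by (intro add_mono)
      finally show ?case by (simp add: power_add algebra_simps)
    qed simp
    also have "(\<Sum>i<k. r ^ i) \<le> 1 / (1 - r)"
      using r by (simp add: sum_gp_strict divide_right_mono)
    then have "C * r ^ n * (\<Sum>i<k. r ^ i) \<le> C * r ^ n * (1 / (1 - r))" using C r by (intro mult_left_mono) auto
    finally show ?thesis by (simp add: mult_ac)
  qed
  have "Cauchy f"
  proof (rule metric_CauchyI)
    fix e :: real assume e: "e > 0"
    have "(\<lambda>n. C / (1 - r) * r ^ n) \<longlonglongrightarrow> C / (1 - r) * 0"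
      using r by (intro tendsto_mult tendsto_const LIMSEQ_power_zero) auto
    then have lim0: "(\<lambda>n. C / (1 - r) * r ^ n) \<longlonglongrightarrow> 0" by (simp only: mult_zero_right)
    have "eventually (\<lambda>n. C / (1 - r) * r ^ n < e / 2) sequentially"
      by (rule order_tendstoD(2)[OF lim0]) (use e in simp)
    then obtain N where N: "C / (1 - r) * r ^ N < e / 2" using eventually_sequentially by auto
    have d: "dist (f m) (f N) < e / 2" if "m \<ge> N" for m
    proof -
      have "norm (f m - f N) \<le> C / (1 - r) * r ^ N" using diff[of N "m - N"] that by simp
      then show ?thesis using N unfolding dist_norm by linarith
    qed
    have "dist (f m) (f n) < e" if "m \<ge> N" "n \<ge> N" for m n
      using d[OF that(1)] d[OF that(2)] by (rule dist_triangle_half_l)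
    then show "\<exists>M. \<forall>m\<ge>M. \<forall>n\<ge>M. dist (f m) (f n) < e" by blast
  qed
  then show lim: "f \<longlonglongrightarrow> lim f" using Cauchy_convergent convergent_LIMSEQ_iff by blast
  have "(\<lambda>k. norm (f (k + n) - f n)) \<longlonglongrightarrow> norm (lim f - f n)"
    using LIMSEQ_ignore_initial_segment[OF lim, of n] by (intro tendsto_norm tendsto_diff) auto
  then show "norm (lim f - f n) \<le> C / (1 - r) * r ^ n"
    by (rule LIMSEQ_le_const2) (use diff[of n] in \<open>metis add.commute\<close>)
qed

text \<open>The blocks to the left of \<open>p i\<close> tile \<open>{l..<p i}\<close>, and the
  increments of \<open>g\<close> over them vanish.\<close>

lemma constant_along_partition:
  fixes g :: "real \<Rightarrow> 'b::ab_group_add"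
  assumes F: "finite F" "\<And>i. i \<in> F \<Longrightarrow> p i < q i" "disjoint_family_on (\<lambda>i. {p i..<q i}) F"
    "(\<Union>i\<in>F. {p i..<q i}) = {l..<r}" and g: "\<And>i. i \<in> F \<Longrightarrow> g (q i) = g (p i)" and i: "i \<in> F"
  shows "g (p i) = g l"
proof -
  define G where "G = {k \<in> F. p k < p i}"
  have "p i \<in> {p i..<q i}" using F(2)[OF i] by simp
  then have "p i \<in> {l..<r}" using F(4) i by blast
  then have li: "l \<le> p i" "p i < r" by auto
  have "(\<Sum>k\<in>G. g (q k) - g (p k)) = g (p i) - g l"
  proof (rule sum_increments_partition)
    show "(\<Union>k\<in>G. {p k..<q k}) = {l..<p i}"
    proof (intro equalityI subsetI)
      fix t assume "t \<in> (\<Union>k\<in>G. {p k..<q k})"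
      then obtain k where k: "k \<in> F" "p k < p i" "t \<in> {p k..<q k}" unfolding G_def by blast
      have "\<not> p i \<le> t"
      proof
        assume "p i \<le> t"
        then have "p i \<in> {p k..<q k} \<inter> {p i..<q i}" using k F(2)[OF i] by auto
        moreover have "k \<noteq> i" using k(2) by auto
        then have "{p k..<q k} \<inter> {p i..<q i} = {}" using F(3) i k(1) unfolding disjoint_family_on_def by blast
        ultimately show False by blast
      qed
      moreover have "t \<in> {l..<r}" using F(4) k by blast
      ultimately show "t \<in> {l..<p i}" by simp
    next
      fix t assume t: "t \<in> {l..<p i}"
      then have "t \<in> (\<Union>i\<in>F. {p i..<q i})" unfolding F(4) using li by auto
      then obtain k where "k \<in> F" "t \<in> {p k..<q k}" by blast
      then show "t \<in> (\<Union>k\<in>G. {p k..<q k})" using t unfolding G_def by (intro UN_I[of k]) auto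
    qed
    show "disjoint_family_on (\<lambda>i. {p i..<q i}) G"
      by (rule disjoint_family_on_mono[OF _ F(3)]) (auto simp: G_def)
  qed (use F li in \<open>auto simp: G_def\<close>)
  moreover have "(\<Sum>k\<in>G. g (q k) - g (p k)) = 0" by (rule sum.neutral) (auto simp: G_def g)
  ultimately show ?thesis by simp
qed

lemma norm_word_value_le: "norm (word_value x w) \<le> real (length w) * (\<Sum>a\<in>UNIV. norm (x $ a))"
proof (induction w)
  case (Cons b w)
  have "norm (x $ b) \<le> (\<Sum>a\<in>UNIV. norm (x $ a))" by (rule member_le_sum) auto
  then show ?case using Cons norm_triangle_ineq[of "x $ b" "word_value x w"] by (simp add: algebra_simps)
qed simp

text \<open>
  An eigenvector \<open>x\<close> for \<open>\<alpha>\<close> is a coboundary \<open>x\<^sub>a = \<psi>(T t) - \<psi>(t)\<close>, where \<open>\<psi>\<close> is the limit of the Birkhoff sums from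
  the base of the towers. Finitely many points carry a jump of \<open>\<psi>\<close> of given size, and jumps propagate along orbits
  up to the discontinuities of \<open>T\<close> and \<open>T\<^sup>-\<^sup>1\<close>; so without connections \<open>\<psi>\<close> is continuous. Its increments over the
  intervals \<open>I\<^sub>a\<close> form a left eigenvector for \<open>\<alpha>\<^sup>-\<^sup>1\<close>, hence are proportional to the lengths, and \<open>\<psi>\<close> is linear.
\<close>

context self_similar_exchange
begin

context
  fixes x :: "complex^'a"
  assumes eig: "\<And>a. word_value x (\<sigma> a) = of_real \<alpha> * x $ a"
    and nocon: "\<And>\<epsilon>. \<epsilon> > 0 \<Longrightarrow> \<not> has_connection \<epsilon> I T"
begin

section \<open>Birkhoff sums from the base of the towers\<close>

definition coord :: "nat \<Rightarrow> real \<Rightarrow> 'a \<times> nat" where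
  "coord N t = (SOME (a, j). j < length (W N a) \<and> (\<exists>u\<in>I a. t = (T ^^ j) (\<alpha> ^ N * u)))"

text \<open>The Birkhoff sum of \<open>x\<close> along the climb from the base of the level
  \<open>N\<close> tower up to \<open>t\<close>. The choice in \<open>coord\<close> is determined by
  \<open>tower_unique\<close>.\<close>

definition partial_sum :: "nat \<Rightarrow> real \<Rightarrow> complex" where
  "partial_sum N t = word_value x (take (snd (coord N t)) (W N (fst (coord N t))))"

definition psi :: "real \<Rightarrow> complex" where "psi t = lim (\<lambda>N. partial_sum N t)"

lemma partial_sum_eq:
  assumes "u \<in> I a" "j < length (W N a)"
  shows "partial_sum N ((T ^^ j) (\<alpha> ^ N * u)) = word_value x (itin j (\<alpha> ^ N * u))"
proof -
  have "coord N ((T ^^ j) (\<alpha> ^ N * u)) = (a, j)"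
    unfolding coord_def
  proof (rule some_equality)
    fix p assume p: "case p of (a', j') \<Rightarrow> j' < length (W N a') \<and> (\<exists>v\<in>I a'. (T ^^ j) (\<alpha> ^ N * u) = (T ^^ j') (\<alpha> ^ N * v))"
    obtain a' j' where p': "p = (a', j')" by (cases p)
    then obtain v where "v \<in> I a'" "j' < length (W N a')" "(T ^^ j) (\<alpha> ^ N * u) = (T ^^ j') (\<alpha> ^ N * v)" using p by auto
    then show "p = (a, j)" using tower_unique[of u a v a' j N j'] assms p' by simp
  qed (use assms in auto)
  then show ?thesis unfolding partial_sum_def using itin_tower_take[OF assms(1), of j N] assms(2) by simp
qed

definition xsum :: real where "xsum = (\<Sum>a\<in>UNIV. norm (x $ a))"
definition Cx :: real where "Cx = real (Max (range (\<lambda>a. length (\<sigma> a)))) * xsum"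

lemma xsum_nonneg: "xsum \<ge> 0" unfolding xsum_def by (rule sum_nonneg) simp

text \<open>At level \<open>Suc N\<close> the climb starts earlier. The additional part spells words
  of level \<open>N\<close> for at most \<open>length (\<sigma> a)\<close> letters, and each of
  these has sum \<open>\<alpha>^N\<close> times an entry of \<open>x\<close>.\<close>

lemma partial_sum_step:
  assumes t: "t \<in> unit_ico"
  shows "norm (partial_sum (Suc N) t - partial_sum N t) \<le> Cx * \<alpha> ^ N"
proof -
  obtain a j u where u: "u \<in> I a" "j < length (W (Suc N) a)" "t = (T ^^ j) (\<alpha> ^ Suc N * u)" using towerE[OF t] by metis
  have uU: "u \<in> unit_ico" "\<alpha> * u \<in> unit_ico" using u(1) I_sub scale_U1 by blast+
  have s: "\<alpha> ^ Suc N * u = \<alpha> ^ N * (\<alpha> * u)" by simp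
  obtain m j' where m: "j = length (WW N (itin m (\<alpha> * u))) + j'" "j' < length (W N (ltr ((T ^^ m) (\<alpha> * u))))"
    using level_decompose[OF uU(2)] by blast
  define v where "v = (T ^^ m) (\<alpha> * u)"
  have v: "v \<in> I (ltr v)" unfolding v_def by (intro ltr_I Tn_U uU)
  note lev = level[OF uU(2), of N m, folded v_def]
  have tv: "t = (T ^^ j') (\<alpha> ^ N * v)" using u(3) m(1) lev funpow_add_app s by metis
  have A: "partial_sum N t = word_value x (itin j' (\<alpha> ^ N * v))"
    unfolding tv using m(2) partial_sum_eq[OF v] v_def by simp
  have "itin j (\<alpha> ^ Suc N * u) = WW N (itin m (\<alpha> * u)) @ itin j' (\<alpha> ^ N * v)"
    unfolding s m(1) itin_add using lev by simp
  then have "partial_sum (Suc N) t = of_real \<alpha> ^ N * word_value x (itin m (\<alpha> * u)) + partial_sum N t"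
    using partial_sum_eq[OF u(1,2)] A eigen_WW[OF eig, of N "itin m (\<alpha> * u)"] unfolding u(3)[symmetric]
    by (simp only: word_value_simps)
  then have "norm (partial_sum (Suc N) t - partial_sum N t) = \<alpha> ^ N * norm (word_value x (itin m (\<alpha> * u)))"
    using alpha by (simp add: norm_mult norm_power)
  also have "\<dots> \<le> \<alpha> ^ N * (real m * xsum)"
    using norm_word_value_le[of x "itin m (\<alpha> * u)"] alpha_pow[of N] unfolding xsum_def by (intro mult_left_mono) auto
  also have "\<dots> \<le> \<alpha> ^ N * Cx"
  proof -
    have "m \<le> length (\<sigma> a)"
    proof (rule ccontr)
      assume "\<not> ?thesis"
      then have mm: "m = length (\<sigma> a) + (m - length (\<sigma> a))" by simp
      have "itin m (\<alpha> * u) = \<sigma> a @ itin (m - length (\<sigma> a)) ((T ^^ length (\<sigma> a)) (\<alpha> * u))"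
        using itin_add[of "length (\<sigma> a)" "m - length (\<sigma> a)" "\<alpha> * u"] mm itin_sigma[OF u(1)] by simp
      then show False using m(1) u(2) by simp
    qed
    also have "length (\<sigma> a) \<le> Max (range (\<lambda>a. length (\<sigma> a)))" by (rule Max_ge) auto
    finally have "real m \<le> real (Max (range (\<lambda>a. length (\<sigma> a))))" by simp
    then have "real m * xsum \<le> Cx" unfolding Cx_def using xsum_nonneg by (rule mult_right_mono)
    then show ?thesis using alpha_pow[of N] by simp
  qed
  finally show ?thesis by (simp add: mult.commute)
qed

definition K0 :: real where "K0 = Cx / (1 - \<alpha>)"

lemma psi_limit:
  assumes "t \<in> unit_ico"
  shows "(\<lambda>N. partial_sum N t) \<longlonglongrightarrow> psi t" "norm (psi t - partial_sum N t) \<le> K0 * \<alpha> ^ N"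
  using geometric_limit[OF alpha, of "\<lambda>N. partial_sum N t" Cx] partial_sum_step[OF assms]
  unfolding psi_def K0_def by auto

lemma psi_close:
  assumes "t \<in> flr N a j" "t' \<in> flr N a j" "j < length (W N a)"
  shows "norm (psi t - psi t') \<le> 2 * K0 * \<alpha> ^ N"
proof -
  obtain u u' where u: "u \<in> I a" "t = (T ^^ j) (\<alpha> ^ N * u)" "u' \<in> I a" "t' = (T ^^ j) (\<alpha> ^ N * u')"
    using assms in_flr_iff[of j N a] by (metis less_imp_le)
  have U: "t \<in> unit_ico" "t' \<in> unit_ico" using u I_sub Tn_U scale_U' by blast+
  have "partial_sum N t = partial_sum N t'"
    using partial_sum_eq[OF u(1) assms(3)] partial_sum_eq[OF u(3) assms(3)] u
      itin_tower_take[OF u(1), of j N] itin_tower_take[OF u(3), of j N] assms(3) by simp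
  then show ?thesis
    using psi_limit(2)[OF U(1), of N] psi_limit(2)[OF U(2), of N]
      norm_triangle_ineq4[of "psi t - partial_sum N t" "psi t' - partial_sum N t'"] by simp
qed

lemma pow_tendsto: "(\<lambda>N. C * \<alpha> ^ N) \<longlonglongrightarrow> 0"
  using tendsto_mult[OF tendsto_const LIMSEQ_power_zero[of \<alpha>], of C] alpha by simp

text \<open>Below the top floor the identity is exact at level \<open>N\<close>. At the top floor it
  is off by the sum over the whole word, \<open>\<alpha>^N * x $ a\<close>, which vanishes in the
  limit.\<close>

lemma psi_T:
  assumes t: "t \<in> unit_ico"
  shows "psi (T t) = psi t + x $ ltr t"
proof -
  have close: "norm (partial_sum N t + x $ ltr t - partial_sum N (T t)) \<le> xsum * \<alpha> ^ N" for N
  proof -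
    obtain a j u where u: "u \<in> I a" "j < length (W N a)" "t = (T ^^ j) (\<alpha> ^ N * u)" using towerE[OF t] by metis
    have "itin (Suc j) (\<alpha> ^ N * u) = itin j (\<alpha> ^ N * u) @ [ltr t]" using u(3) by (simp add: itin_Suc)
    then have A: "partial_sum N t + x $ ltr t = word_value x (itin (Suc j) (\<alpha> ^ N * u))"
      unfolding u(3) partial_sum_eq[OF u(1,2)] by simp
    show ?thesis
    proof (cases "Suc j < length (W N a)")
      case True
      have "T t = (T ^^ Suc j) (\<alpha> ^ N * u)" using u(3) by simp
      then show ?thesis using A partial_sum_eq[OF u(1) True] xsum_nonneg alpha by simp
    next
      case False
      then have len: "Suc j = length (W N a)" using u(2) by simp
      have "T t = (T ^^ 0) (\<alpha> ^ N * T u)" using u(3) level_letter(1)[OF u(1), of N] len[symmetric] by simp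
      then have "partial_sum N (T t) = 0"
        using partial_sum_eq[OF ltr_I[OF T_U[OF subsetD[OF I_sub u(1)]]], of 0 N] by simp
      moreover have "partial_sum N t + x $ ltr t = of_real \<alpha> ^ N * x $ a"
        unfolding A len level_letter(2)[OF u(1)] eigen_W[OF eig] ..
      moreover have "norm (x $ a) \<le> xsum" unfolding xsum_def by (rule member_le_sum) auto
      ultimately show ?thesis using alpha by (simp add: norm_mult norm_power mult.commute mult_right_mono)
    qed
  qed
  have "(\<lambda>N. partial_sum N t + x $ ltr t - partial_sum N (T t)) \<longlonglongrightarrow> psi t + x $ ltr t - psi (T t)"
    by (intro tendsto_intros psi_limit t T_U)
  moreover have "(\<lambda>N. partial_sum N t + x $ ltr t - partial_sum N (T t)) \<longlonglongrightarrow> 0"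
    by (rule Lim_null_comparison[OF _ pow_tendsto[of xsum]]) (use close in auto)
  ultimately have "psi t + x $ ltr t - psi (T t) = 0" using LIMSEQ_unique by blast
  then show ?thesis by (simp add: algebra_simps)
qed

lemma psi_Tn: "t \<in> unit_ico \<Longrightarrow> psi ((T ^^ n) t) = psi t + word_value x (itin n t)"
  by (induction n) (simp_all add: psi_T[OF Tn_U] itin_Suc)

text \<open>The climb to \<open>\<alpha> * t\<close> at level \<open>Suc N\<close> spells the
  substituted word of the climb to \<open>t\<close> at level \<open>N\<close>, and substitution
  multiplies sums by \<open>\<alpha>\<close>.\<close>

lemma psi_alpha:
  assumes t: "t \<in> unit_ico"
  shows "psi (\<alpha> * t) = of_real \<alpha> * psi t"
proof -
  have eq: "partial_sum (Suc N) (\<alpha> * t) = of_real \<alpha> * partial_sum N t" for N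
  proof -
    obtain a j u where u: "u \<in> I a" "j < length (W N a)" "t = (T ^^ j) (\<alpha> ^ N * u)" using towerE[OF t] by metis
    have uU: "\<alpha> ^ N * u \<in> unit_ico" using u(1) I_sub scale_U' by blast
    define J where "J = length (WW 1 (itin j (\<alpha> ^ N * u)))"
    note lev = level[OF uU, of 1 j, folded J_def]
    have "W (Suc N) a = WW 1 (W N a)" using W_add[of N 1 a] by simp
    also have "W N a = take j (W N a) @ drop j (W N a)" by simp
    finally have "length (W (Suc N) a) = J + length (WW 1 (drop j (W N a)))"
      unfolding J_def itin_tower_take[OF u(1) less_imp_le[OF u(2)]] by (metis concat_append length_append map_append)
    moreover have "length (WW 1 (drop j (W N a))) > 0"
      using length_WW_ge[of "drop j (W N a)" 1] u(2) by (metis length_drop less_le_trans zero_less_diff)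
    ultimately have J: "J < length (W (Suc N) a)" by simp
    have at: "\<alpha> * t = (T ^^ J) (\<alpha> ^ Suc N * u)" using lev u(3) by (simp add: mult.assoc)
    have "partial_sum (Suc N) (\<alpha> * t) = word_value x (WW 1 (itin j (\<alpha> ^ N * u)))"
      unfolding at partial_sum_eq[OF u(1) J] using lev by (simp add: mult.assoc)
    then show ?thesis unfolding u(3) partial_sum_eq[OF u(1,2)] eigen_WW[OF eig] by simp
  qed
  have "(\<lambda>N. partial_sum (Suc N) (\<alpha> * t)) \<longlonglongrightarrow> psi (\<alpha> * t)"
    using LIMSEQ_Suc[OF psi_limit(1)[OF scale_U1[OF t]]] .
  moreover have "(\<lambda>N. partial_sum (Suc N) (\<alpha> * t)) \<longlonglongrightarrow> of_real \<alpha> * psi t"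
    unfolding eq by (intro tendsto_intros psi_limit t)
  ultimately show ?thesis using LIMSEQ_unique by blast
qed

lemma psi_0: "psi 0 = 0"
proof -
  have "psi 0 = of_real \<alpha> * psi 0" using psi_alpha[of 0] by simp
  then have "(1 - of_real \<alpha>) * psi 0 = 0" by (simp add: algebra_simps)
  moreover have "1 - complex_of_real \<alpha> \<noteq> 0" using alpha by (simp add: complex_eq_iff)
  ultimately show ?thesis by simp
qed

section \<open>Discontinuities of \<open>psi\<close> from the left\<close>

definition jump :: "real \<Rightarrow> real \<Rightarrow> bool" where
  "jump e p \<longleftrightarrow> (\<forall>d>0. \<exists>s. p - d < s \<and> s < p \<and> 0 \<le> s \<and> e \<le> norm (psi p - psi s))"

lemma small_level: "e > 0 \<Longrightarrow> \<exists>N. 2 * K0 * \<alpha> ^ N < e"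
proof -
  assume "e > 0"
  then have "eventually (\<lambda>N. 2 * K0 * \<alpha> ^ N < e) sequentially" using order_tendstoD(2)[OF pow_tendsto] by blast
  then show ?thesis using eventually_sequentially by auto
qed

text \<open>A floor of level \<open>N\<close> with \<open>2 * K0 * \<alpha>^N < e\<close> can have a
  jump of size \<open>e\<close> only at its left end.\<close>

lemma finite_jumps:
  assumes "e > 0"
  shows "finite {p. 0 < p \<and> p < 1 \<and> jump e p}"
proof -
  obtain N where N: "2 * K0 * \<alpha> ^ N < e" using small_level[OF assms] by blast
  have "p \<in> (\<lambda>(a, j). (T ^^ j) (\<alpha> ^ N * lft a)) ` {(a, j). j < length (W N a)}"
    if p: "0 < p" "p < 1" "jump e p" for p
  proof -
    obtain a j u where u: "u \<in> I a" "j < length (W N a)" "p = (T ^^ j) (\<alpha> ^ N * u)" using towerE[of p N] p by (metis atLeastLessThan_iff less_imp_le)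
    then have pf: "p \<in> flr N a j" using in_flr_iff[of j N a p] by auto
    define P where "P = (T ^^ j) (\<alpha> ^ N * lft a)"
    have "P = p"
    proof (rule ccontr)
      assume "P \<noteq> p"
      then have "P < p" using pf unfolding flr_def P_def by auto
      then obtain s where s: "p - (p - P) < s" "s < p" "e \<le> norm (psi p - psi s)"
        using p(3) unfolding jump_def by (meson diff_gt_0_iff_gt)
      then have "s \<in> flr N a j" using pf unfolding flr_def P_def by auto
      then show False using psi_close[OF pf _ u(2)] s(3) N by force
    qed
    then show ?thesis using u(2) unfolding P_def by (intro image_eqI[of _ _ "(a, j)"]) auto
  qed
  then show ?thesis by (intro finite_subset[OF _ finite_imageI[OF finite_positions]]) auto
qed

lemma finite_invariant_empty:
  assumes "finite F" "F \<subseteq> unit_ico" "T ` F \<subseteq> F"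
  shows "F = {}"
proof (rule ccontr)
  assume "F \<noteq> {}"
  then obtain q where q: "q \<in> F" by blast
  have "(T ^^ n) q \<in> F" for n by (induction n) (use q assms(3) in auto)
  then have "finite (range (\<lambda>n. (T ^^ n) q))" using assms(1) by (meson finite_subset image_subsetI)
  then have "\<not> inj (\<lambda>n. (T ^^ n) q)" using finite_imageD infinite_UNIV_nat by blast
  then show False using Tn_ne q assms(2) unfolding inj_def by blast
qed

text \<open>Away from left ends \<open>T\<close> translates \<open>p\<close> together with the
  points just to its left, and \<open>psi\<close> changes on all of them by the same entry of
  \<open>x\<close>.\<close>

lemma jump_T:
  assumes p: "0 < p" "p < 1" "jump e p" "\<not> left_end I p"
  shows "0 < T p" "jump e (T p)"
proof -
  define a where "a = ltr p"
  have pU: "p \<in> unit_ico" using p by auto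
  have la: "lft a < p" "p < rgt a" using p(4) ltr_bounds[OF pU] left_end_iff[of p] unfolding a_def by (metis order.strict_iff_order)+
  have Tp: "T s = s + dl a" if "lft a \<le> s" "s \<le> p" for s
    using T_translation[of s a] lft_rgt(2)[of a] that la by auto
  have "T (lft a) \<ge> 0" using T_U[OF lft_U] by auto
  then show "0 < T p" using Tp[of p] Tp[of "lft a"] la by auto
  show "jump e (T p)"
    unfolding jump_def
  proof (intro allI impI)
    fix d :: real assume "d > 0"
    then have "min d (p - lft a) > 0" using la by simp
    then obtain s where s: "p - min d (p - lft a) < s" "s < p" "0 \<le> s" "e \<le> norm (psi p - psi s)"
      using p(3) unfolding jump_def by blast
    have sU: "s \<in> unit_ico" "s \<in> I a" using s p lft_rgt(2)[of a] la by auto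
    have "psi (T p) - psi (T s) = psi p - psi s" using psi_T[OF pU] psi_T[OF sU(1)] ltr_eq[OF sU(2)] a_def by simp
    moreover have "T s = s + dl a" "T p = p + dl a" using Tp s la by auto
    moreover have "0 \<le> T s" using T_U[OF sU(1)] by simp
    ultimately show "\<exists>s'. T p - d < s' \<and> s' < T p \<and> 0 \<le> s' \<and> e \<le> norm (psi (T p) - psi s')"
      using s by (intro exI[of _ "T s"]) auto
  qed
qed

lemma jump_T_rev:
  assumes p: "0 < T p" "p \<in> unit_ico" "jump e (T p)" "\<And>d. T p \<noteq> T (lft d)"
  shows "0 < p" "jump e p"
proof -
  define a where "a = ltr p"
  have la: "lft a < p" "p < rgt a" using p(4)[of a] ltr_bounds[OF p(2)] unfolding a_def
    by (auto simp: order.strict_iff_order)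
  then show "0 < p" using lft_U[of a] by auto
  have Tp: "T s = s + dl a" if "lft a \<le> s" "s \<le> p" for s
    using T_translation[of s a] lft_rgt(2)[of a] that la by auto
  show "jump e p"
    unfolding jump_def
  proof (intro allI impI)
    fix d :: real assume "d > 0"
    then have "min d (p - lft a) > 0" using la by simp
    then obtain s' where s': "T p - min d (p - lft a) < s'" "s' < T p" "0 \<le> s'" "e \<le> norm (psi (T p) - psi s')"
      using p(3) unfolding jump_def by blast
    define s where "s = s' - dl a"
    have s: "p - min d (p - lft a) < s" "s < p" using s' Tp[of p] la unfolding s_def by auto
    then have sI: "s \<in> I a" using la lft_rgt(2)[of a] by auto
    then have sU: "s \<in> unit_ico" using I_sub by blast
    have Ts: "T s = s'" using Tp[of s] s la unfolding s_def by auto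
    have "psi (T p) - psi s' = psi p - psi s" using psi_T[OF p(2)] psi_T[OF sU] ltr_eq[OF sI] a_def Ts by simp
    then show "\<exists>s. p - d < s \<and> s < p \<and> 0 \<le> s \<and> e \<le> norm (psi p - psi s)"
      using s s' sU by (intro exI[of _ s]) auto
  qed
qed

text \<open>Jumps propagate backwards except at points \<open>T (lft d)\<close>. If \<open>B\<close>
  contained no such point, it would be a finite set mapped onto itself. Starting from such a point,
  jumps propagate forwards until a left end is met, which would be a connection; so the reached
  points of \<open>B\<close> form a finite invariant set. Aperiodicity excludes both.\<close>

lemma no_jump:
  assumes e: "e > 0" and p0: "0 < p0" "p0 < 1"
  shows "\<not> jump e p0"
proof
  assume j0: "jump e p0"
  define B where "B = {p. 0 < p \<and> p < 1 \<and> jump e p}"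
  have fB: "finite B" unfolding B_def using finite_jumps[OF e] .
  have BU: "B \<subseteq> unit_ico" unfolding B_def by auto
  have p0B: "p0 \<in> B" using j0 p0 unfolding B_def by simp
  have "\<exists>q\<in>B. \<exists>d. q = T (lft d)"
  proof (rule ccontr)
    assume no: "\<not> ?thesis"
    have "B \<subseteq> T ` B"
    proof
      fix q assume q: "q \<in> B"
      then obtain p where p: "p \<in> unit_ico" "T p = q" using T_surj BU by blast
      then have "0 < p" "jump e p" using jump_T_rev[of p e] q no unfolding B_def by auto
      then show "q \<in> T ` B" using p unfolding B_def by auto
    qed
    moreover have "card (T ` B) \<le> card B" using fB by (rule card_image_le)
    ultimately have "T ` B = B" using card_seteq[of "T ` B" B] fB by simp
    then show False using finite_invariant_empty[OF fB BU] p0B by auto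
  qed
  then obtain q d where q: "q \<in> B" "q = T (lft d)" by blast
  \<comment> \<open>All jumps of size \<open>e\<close> lie at or above this positive threshold, so
    following them stays within \<open>reached\<close>.\<close>
  define \<epsilon> where "\<epsilon> = Min B"
  have eps: "\<epsilon> > 0" unfolding \<epsilon>_def using fB p0B by (subst Min_gr_iff) (auto simp: B_def)
  have ge: "\<epsilon> \<le> p" if "p \<in> B" for p unfolding \<epsilon>_def using fB that by simp
  define F where "F = {p \<in> B. reached \<epsilon> I T p}"
  have "reached \<epsilon> I T q"
    unfolding q(2) using ge[OF q(1)] q(2) left_end_iff by (intro reached.start) auto
  then have qF: "q \<in> F" using q(1) unfolding F_def by simp
  have "T ` F \<subseteq> F"
  proof
    fix y assume "y \<in> T ` F"
    then obtain p where p: "p \<in> F" "y = T p" by blast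
    then have "\<not> left_end I p" using nocon[OF eps] unfolding F_def has_connection_def by blast
    then have "T p \<in> B" using jump_T[of p e] p(1) T_U[of p] unfolding F_def B_def by auto
    then show "y \<in> F" using p reached.step[of \<epsilon> I T p] ge unfolding F_def by auto
  qed
  then have "F = {}" using finite_invariant_empty[of F] fB BU unfolding F_def by auto
  then show False using qF by blast
qed

text \<open>At every level a single floor extends up to 1, the one with the largest left end. This
  yields a left limit of \<open>psi\<close> at 1.\<close>

lemma last_floor: "\<exists>P. 0 \<le> P \<and> P < 1 \<and> (\<forall>s t. P \<le> s \<and> s < 1 \<and> P \<le> t \<and> t < 1 \<longrightarrow> norm (psi s - psi t) \<le> 2 * K0 * \<alpha> ^ N)"
proof -
  define E where "E = (\<lambda>(a, j). (T ^^ j) (\<alpha> ^ N * lft a)) ` {(a, j). j < length (W N a)}"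
  have fE: "finite E" unfolding E_def using finite_positions by blast
  have EU: "E \<subseteq> unit_ico" unfolding E_def using Tn_U scale_U' lft_U by auto
  have "(undefined, 0) \<in> {(a, j). j < length (W N a)}" by simp
  then have ne: "E \<noteq> {}" unfolding E_def by blast
  define P where "P = Max E"
  have PE: "P \<in> E" unfolding P_def using fE ne by (rule Max_in)
  then obtain a j where aj: "j < length (W N a)" "P = (T ^^ j) (\<alpha> ^ N * lft a)" unfolding E_def by auto
  have "t \<in> flr N a j" if t: "P \<le> t" "t < 1" for t
  proof -
    have "t \<in> unit_ico" using t PE EU by auto
    then obtain b k u where u: "u \<in> I b" "k < length (W N b)" "t = (T ^^ k) (\<alpha> ^ N * u)" by (rule towerE)
    then have tf: "t \<in> flr N b k" using in_flr_iff[of k N b t] by auto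
    have "(T ^^ k) (\<alpha> ^ N * lft b) \<in> E" unfolding E_def using u(2) by (intro image_eqI[of _ _ "(b, k)"]) auto
    then have "(T ^^ k) (\<alpha> ^ N * lft b) \<le> P" unfolding P_def using fE by simp
    then have "P \<in> flr N b k" using tf t(1) unfolding flr_def by auto
    then obtain v where "v \<in> I b" "P = (T ^^ k) (\<alpha> ^ N * v)" using in_flr_iff[of k N b P] u(2) by auto
    then show ?thesis using tf tower_unique[of "lft a" a v b j N k] aj u(2) lft_in_I by simp
  qed
  then have "\<forall>s t. P \<le> s \<and> s < 1 \<and> P \<le> t \<and> t < 1 \<longrightarrow> norm (psi s - psi t) \<le> 2 * K0 * \<alpha> ^ N"
    using psi_close aj(1) by blast
  then show ?thesis using PE EU by (intro exI[of _ P]) auto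
qed

lemma limit_at_1: "\<exists>G. ((psi \<longlongrightarrow> G) (at_left 1))"
proof -
  define f where "f n = 1 - 1 / real (n + 1)" for n
  have f01: "0 \<le> f n" "f n < 1" for n unfolding f_def by auto
  have f: "f \<longlonglongrightarrow> 1"
    unfolding f_def by real_asymp
  have "Cauchy (\<lambda>n. psi (f n))"
  proof (rule metric_CauchyI)
    fix e :: real assume e: "e > 0"
    obtain N where N: "2 * K0 * \<alpha> ^ N < e" using small_level[OF e] by blast
    obtain P where P: "P < 1" "\<forall>s t. P \<le> s \<and> s < 1 \<and> P \<le> t \<and> t < 1 \<longrightarrow> norm (psi s - psi t) \<le> 2 * K0 * \<alpha> ^ N"
      using last_floor by blast
    obtain M where M: "\<forall>n\<ge>M. P < f n" using order_tendstoD(1)[OF f P(1)] eventually_sequentially by auto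
    then show "\<exists>M. \<forall>m\<ge>M. \<forall>n\<ge>M. dist (psi (f m)) (psi (f n)) < e"
    proof (intro exI[of _ M] allI impI)
      fix m n assume "m \<ge> M" "n \<ge> M"
      then have "norm (psi (f m) - psi (f n)) \<le> 2 * K0 * \<alpha> ^ N" using P(2) f01 M by (meson less_imp_le)
      then show "dist (psi (f m)) (psi (f n)) < e" using N by (simp add: dist_norm)
    qed
  qed
  then obtain G where G: "(\<lambda>n. psi (f n)) \<longlonglongrightarrow> G" using Cauchy_convergent convergent_def by blast
  have "(psi \<longlongrightarrow> G) (at_left 1)"
  proof (rule tendstoI)
    fix e :: real assume e: "e > 0"
    obtain N where N: "2 * K0 * \<alpha> ^ N < e / 2" using small_level[of "e / 2"] e by auto
    obtain P where P: "P < 1" "\<forall>s t. P \<le> s \<and> s < 1 \<and> P \<le> t \<and> t < 1 \<longrightarrow> norm (psi s - psi t) \<le> 2 * K0 * \<alpha> ^ N"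
      using last_floor by blast
    have "eventually (\<lambda>n. P < f n) sequentially" using order_tendstoD(1)[OF f P(1)] .
    moreover have "eventually (\<lambda>n. dist (psi (f n)) G < e / 2) sequentially" using tendstoD[OF G, of "e / 2"] e by simp
    ultimately have "eventually (\<lambda>n. P < f n \<and> dist (psi (f n)) G < e / 2) sequentially" by (rule eventually_conj)
    then obtain n where n: "P < f n" "dist (psi (f n)) G < e / 2" using eventually_sequentially by auto
    have "dist (psi t) G < e" if "P < t" "t < 1" for t
    proof -
      have "dist (psi t) (psi (f n)) < e / 2" using P(2)[rule_format, of t "f n"] that n(1) f01[of n] N by (simp add: dist_norm)
      then show ?thesis using n(2) dist_triangle_half_r dist_commute by (metis dist_triangle_half_l)
    qed
    then show "eventually (\<lambda>t. dist (psi t) G < e) (at_left 1)"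
      using P(1) by (auto simp: eventually_at_left[of P] intro!: exI[of _ P])
  qed
  then show ?thesis by blast
qed

text \<open>\<open>psi\<close> lives on \<open>[0,1)\<close>, but right ends of intervals and floors
  may equal 1; the left limit supplies the value there.\<close>

definition gee :: "real \<Rightarrow> complex" where
  "gee t = (if t < 1 then psi t else (SOME G. (psi \<longlongrightarrow> G) (at_left 1)))"

lemma gee_psi: "t \<in> unit_ico \<Longrightarrow> gee t = psi t" unfolding gee_def by simp

lemma gee_left_continuous:
  assumes p: "0 < p" "p \<le> 1"
  shows "(gee \<longlongrightarrow> gee p) (at_left p)"
proof (cases "p < 1")
  case True
  show ?thesis
  proof (rule tendstoI)
    fix e :: real assume e: "e > 0"
    then obtain d where d: "d > 0" "\<And>s. p - d < s \<Longrightarrow> s < p \<Longrightarrow> 0 \<le> s \<Longrightarrow> norm (psi p - psi s) < e"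
      using no_jump[OF e p(1) True] unfolding jump_def by (meson not_le)
    have "dist (gee s) (gee p) < e" if "max 0 (p - d) < s" "s < p" for s
      using d(2)[of s] that True gee_psi[of s] gee_psi[of p] p by (auto simp: dist_norm norm_minus_commute)
    then show "eventually (\<lambda>s. dist (gee s) (gee p) < e) (at_left p)"
      using d(1) p(1) eventually_at_left[of "max 0 (p - d)" p] by (auto intro!: exI[of _ "max 0 (p - d)"])
  qed
next
  case False
  then have p1: "p = 1" using p by simp
  have "(psi \<longlongrightarrow> gee 1) (at_left 1)" unfolding gee_def using someI_ex[OF limit_at_1] by simp
  moreover have "eventually (\<lambda>t. psi t = gee t) (at_left 1)"
    unfolding eventually_at_left[OF zero_less_one] gee_def by (intro exI[of _ 0]) auto
  ultimately show ?thesis unfolding p1 by (rule Lim_transform_eventually)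
qed

definition inc :: "'a \<Rightarrow> complex" where "inc a = gee (rgt a) - gee (lft a)"

text \<open>Below its right end a floor carries a translated copy of \<open>psi\<close> on
  \<open>I a\<close>, scaled by \<open>\<alpha>\<close>. Left continuity extends the identity to the
  right ends, which belong to neither interval.\<close>

lemma floor_increment:
  assumes m: "m < length (\<sigma> a)"
  shows "gee (floor_right (a, m)) - gee (floor_left (a, m)) = of_real \<alpha> * inc a"
proof -
  define P where "P = (T ^^ m) (\<alpha> * lft a)"
  have fl: "(T ^^ m) (\<alpha> * u) = P + \<alpha> * (u - lft a)" if "u \<in> I a" for u
    using floor_translation[OF that, of m 1] m unfolding P_def by simp
  have PU: "P \<in> unit_ico" unfolding P_def by (intro Tn_U scale_U1 lft_U)
  define Q where "Q = P + \<alpha> * (rgt a - lft a)"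
  have Q0: "0 < Q" using PU alpha lft_rgt(1)[of a] unfolding Q_def by (auto intro: add_nonneg_pos)
  have Q1: "Q \<le> 1"
  proof -
    have "{P..<Q} \<subseteq> {0..<1}"
    proof
      fix t assume "t \<in> {P..<Q}"
      then have "t \<in> flr 1 a m" unfolding flr_def P_def Q_def by simp
      then obtain u where "u \<in> I a" "t = (T ^^ m) (\<alpha> ^ 1 * u)" using in_flr_iff[of m 1 a t] m by auto
      then show "t \<in> {0..<1}" using Tn_U scale_U' I_sub by blast
    qed
    moreover have "P < Q" using alpha lft_rgt(1)[of a] unfolding Q_def by simp
    ultimately show ?thesis by (meson atLeastLessThan_subset_iff not_le)
  qed
  have inc_u: "gee (P + \<alpha> * (u - lft a)) - gee P = of_real \<alpha> * (gee u - gee (lft a))" if u: "u \<in> I a" for u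
  proof -
    have uU: "u \<in> unit_ico" using u I_sub by blast
    have "itin m (\<alpha> * u) = itin m (\<alpha> * lft a)"
      using itin_tower_take[OF u, of m 1] itin_tower_take[OF lft_in_I, of m 1 a] m by simp
    then have "psi ((T ^^ m) (\<alpha> * u)) - psi P = psi (\<alpha> * u) - psi (\<alpha> * lft a)"
      unfolding P_def using psi_Tn[OF scale_U1] uU lft_U by simp
    also have "\<dots> = of_real \<alpha> * (psi u - psi (lft a))"
      using psi_alpha[OF uU] psi_alpha[OF lft_U] by (simp add: algebra_simps)
    finally show ?thesis using fl[OF u] gee_psi[OF uU] gee_psi[OF lft_U] gee_psi[OF PU]
      gee_psi[OF Tn_U[OF scale_U1[OF uU]], of m] by simp
  qed
  have ev: "eventually (\<lambda>u. lft a < u \<and> u < rgt a) (at_left (rgt a))"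
    using lft_rgt(1)[of a] eventually_at_left[of "lft a" "rgt a"] by blast
  have fl: "filterlim (\<lambda>u. P + \<alpha> * (u - lft a)) (at_left Q) (at_left (rgt a))"
    unfolding filterlim_at
  proof
    show "((\<lambda>u. P + \<alpha> * (u - lft a)) \<longlongrightarrow> Q) (at_left (rgt a))" unfolding Q_def by (intro tendsto_intros)
    show "eventually (\<lambda>u. P + \<alpha> * (u - lft a) \<in> {..<Q} \<and> P + \<alpha> * (u - lft a) \<noteq> Q) (at_left (rgt a))"
      using ev by eventually_elim (use alpha in \<open>auto simp: Q_def\<close>)
  qed
  have lim1: "((\<lambda>u. gee (P + \<alpha> * (u - lft a)) - gee P) \<longlongrightarrow> gee Q - gee P) (at_left (rgt a))"
    by (intro tendsto_intros filterlim_compose[OF gee_left_continuous[OF Q0 Q1] fl])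
  have lim2: "((\<lambda>u. of_real \<alpha> * (gee u - gee (lft a))) \<longlongrightarrow> of_real \<alpha> * inc a) (at_left (rgt a))"
    unfolding inc_def using gee_left_continuous[of "rgt a"] lft_rgt(1)[of a] lft_U[of a] rgt_le[of a]
    by (intro tendsto_intros) auto
  have "eventually (\<lambda>u. of_real \<alpha> * (gee u - gee (lft a)) = gee (P + \<alpha> * (u - lft a)) - gee P) (at_left (rgt a))"
    using ev by eventually_elim (use inc_u lft_rgt(2)[of a] in auto)
  then have "gee Q - gee P = of_real \<alpha> * inc a"
    using tendsto_unique[OF trivial_limit_at_left_real lim1 Lim_transform_eventually[OF lim2]] by blast
  then show ?thesis unfolding floor_left_def floor_right_def Q_def P_def by simp
qed

lemma inc_proportional: "\<exists>c. \<forall>a. inc a = c * of_real (wid a)"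
proof (rule perron_left_complex)
  fix b
  have "(\<Sum>i\<in>floors_in b. gee (floor_right i) - gee (floor_left i)) = (\<Sum>i\<in>floors_in b. of_real \<alpha> * inc (fst i))"
    by (rule sum.cong) (use floor_increment in \<open>auto simp: floors_in_def\<close>)
  then show "(\<Sum>a\<in>UNIV. of_nat (count_list (\<sigma> a) b) * (of_real \<alpha> * inc a)) = inc b"
    using sum_increments_letter[of gee b] sum_positions[where b = b and y = "\<lambda>a. of_real \<alpha> * inc a"]
    unfolding inc_def[of b] by simp
qed

text \<open>Subtracting \<open>c * t\<close> leaves a function \<open>\<phi>\<close> that vanishes
  at the left ends of all intervals and floors. Every value of \<open>\<phi>\<close> is then
  \<open>\<alpha>\<close> times another one, and a bounded function with this property is 0.\<close>

lemma eigenvector_alpha_aux: "\<exists>c. \<forall>a. x $ a = c * of_real (dl a)"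
proof -
  obtain c where c: "\<And>a. inc a = c * of_real (wid a)" using inc_proportional by blast
  define \<phi> where "\<phi> t = gee t - c * of_real t" for t
  have phi_I: "\<phi> (rgt a) = \<phi> (lft a)" for a
    using c[of a] unfolding inc_def \<phi>_def by (simp add: algebra_simps)
  have phi_0: "\<phi> 0 = 0" unfolding \<phi>_def using gee_psi[of 0] psi_0 by simp
  have phi_lft: "\<phi> (lft a) = 0" for a
  proof -
    have "\<phi> (lft a) = \<phi> 0"
    proof (rule constant_along_partition[where F = UNIV and p = lft and q = rgt])
      show "disjoint_family_on (\<lambda>i. {lft i..<rgt i}) UNIV"
        unfolding lft_rgt(2)[symmetric] disjoint_family_on_def using I_disjoint by blast
      show "(\<Union>i. {lft i..<rgt i}) = {0..<1}" unfolding lft_rgt(2)[symmetric] by (rule Un_I)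
    qed (use lft_rgt(1) phi_I in auto)
    then show ?thesis using phi_0 by simp
  qed
  have phi_floor: "\<phi> (floor_left (a, m)) = 0" if m: "m < length (\<sigma> a)" for a m
  proof -
    have "\<phi> (floor_left (a, m)) = \<phi> (lft (\<sigma> a ! m))"
    proof (rule constant_along_partition[OF letter_partition(1) floor_less letter_partition(2,3)])
      fix i assume "i \<in> floors_in (\<sigma> a ! m)"
      then obtain b k where i: "i = (b, k)" "k < length (\<sigma> b)" unfolding floors_in_def by auto
      have "gee (floor_right i) - gee (floor_left i) = c * of_real (\<alpha> * wid b)"
        using floor_increment[OF i(2)] c[of b] i(1) by simp
      moreover have "of_real (floor_right i) = (of_real (floor_left i) + of_real (\<alpha> * wid b) :: complex)"
        unfolding i(1) floor_left_def floor_right_def by simp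
      ultimately show "\<phi> (floor_right i) = \<phi> (floor_left i)" unfolding \<phi>_def by (simp only: algebra_simps)
    qed (use m in \<open>simp add: floors_in_def\<close>)
    then show ?thesis using phi_lft by simp
  qed
  have contract: "\<exists>u\<in>unit_ico. \<phi> t = of_real \<alpha> * \<phi> u" if t: "t \<in> unit_ico" for t
  proof -
    obtain a m u where u: "u \<in> I a" "m < length (W 1 a)" "t = (T ^^ m) (\<alpha> ^ 1 * u)" using towerE[OF t] by metis
    have m: "m < length (\<sigma> a)" using u(2) by simp
    have uU: "u \<in> unit_ico" using u(1) I_sub by blast
    define P where "P = floor_left (a, m)"
    have P: "P = (T ^^ m) (\<alpha> * lft a)" unfolding P_def floor_left_def by simp
    have PU: "P \<in> unit_ico" unfolding P by (intro Tn_U scale_U1 lft_U)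
    have "itin m (\<alpha> * u) = itin m (\<alpha> * lft a)"
      using itin_tower_take[OF u(1), of m 1] itin_tower_take[OF lft_in_I, of m 1 a] m by simp
    then have "psi t - psi P = psi (\<alpha> * u) - psi (\<alpha> * lft a)"
      unfolding P u(3) using psi_Tn[OF scale_U1] uU lft_U by simp
    also have "\<dots> = of_real \<alpha> * (psi u - psi (lft a))"
      using psi_alpha[OF uU] psi_alpha[OF lft_U] by (simp add: algebra_simps)
    finally have g: "gee t - gee P = of_real \<alpha> * (gee u - gee (lft a))"
      using gee_psi t PU uU lft_U by simp
    have "t = P + \<alpha> * (u - lft a)" using floor_translation[OF u(1), of m 1] m u(3) P by simp
    then have r: "of_real t - of_real P = (of_real \<alpha> * (of_real u - of_real (lft a)) :: complex)" by simp
    have "\<phi> t - \<phi> P = (gee t - gee P) - c * (of_real t - of_real P)" unfolding \<phi>_def by (simp add: algebra_simps)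
    also have "\<dots> = of_real \<alpha> * (\<phi> u - \<phi> (lft a))" unfolding g r \<phi>_def by (simp add: algebra_simps)
    finally have "\<phi> t - \<phi> P = of_real \<alpha> * (\<phi> u - \<phi> (lft a))" .
    then show ?thesis using phi_floor[OF m] phi_lft uU P_def by auto
  qed
  have bound: "\<exists>B. \<forall>t\<in>unit_ico. norm (\<phi> t) \<le> B"
  proof -
    have "norm (\<phi> t) \<le> K0 + norm c" if t: "t \<in> unit_ico" for t
    proof -
      have "t = (T ^^ 0) (\<alpha> ^ 0 * t)" by simp
      then have "partial_sum 0 t = 0" using partial_sum_eq[OF ltr_I[OF t], of 0 0] by simp
      then have "norm (gee t) \<le> K0" using psi_limit(2)[OF t, of 0] gee_psi[OF t] by simp
      moreover have "norm (c * of_real t) \<le> norm c" using t by (simp add: norm_mult mult_left_le)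
      ultimately show ?thesis unfolding \<phi>_def using norm_triangle_ineq4[of "gee t" "c * of_real t"] by simp
    qed
    then show ?thesis by blast
  qed
  then obtain B where B: "\<And>t. t \<in> unit_ico \<Longrightarrow> norm (\<phi> t) \<le> B" by blast
  have "norm (\<phi> t) \<le> B * \<alpha> ^ n" if "t \<in> unit_ico" for t n
    using that
  proof (induction n arbitrary: t)
    case (Suc n)
    then obtain u where u: "u \<in> unit_ico" "\<phi> t = of_real \<alpha> * \<phi> u" using contract by blast
    then show ?case using Suc.IH[OF u(1)] alpha by (simp add: norm_mult mult.left_commute)
  qed (use B in simp)
  then have "\<phi> t = 0" if "t \<in> unit_ico" for t
    using LIMSEQ_le_const[OF pow_tendsto[of B], of "norm (\<phi> t)"] that by auto
  then have lin: "psi t = c * of_real t" if "t \<in> unit_ico" for t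
    using that gee_psi[OF that] unfolding \<phi>_def by auto
  have "x $ a = c * of_real (dl a)" for a
  proof -
    have "x $ a = psi (T (lft a)) - psi (lft a)" using psi_T[OF lft_U] by simp
    also have "\<dots> = c * of_real (dl a)" using lin[OF T_U[OF lft_U]] lin[OF lft_U] unfolding dl_def by (simp add: algebra_simps)
    finally show ?thesis .
  qed
  then show ?thesis by blast
qed

end

text \<open>Eigenvectors for \<open>\<alpha>\<close> are multiples of the translation vector
  \<open>dl\<close>, hence are determined by an entry at which \<open>dl\<close> is nonzero.\<close>

lemma eigenvector_alpha:
  assumes "\<And>\<epsilon>. \<epsilon> > 0 \<Longrightarrow> \<not> has_connection \<epsilon> I T"
  obtains b where "\<And>x. (\<And>a. word_value x (\<sigma> a) = of_real \<alpha> * x $ a) \<Longrightarrow> x $ b = 0 \<Longrightarrow> x = 0"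
proof -
  obtain t where t: "t \<in> unit_ico" "T t \<noteq> t" using nontrivial by blast
  define b where "b = ltr t"
  have "dl b \<noteq> 0" using T_ltr[OF t(1)] t(2) b_def by auto
  then have "x = 0" if x: "\<And>a. word_value x (\<sigma> a) = of_real \<alpha> * x $ a" "x $ b = 0" for x
    using eigenvector_alpha_aux[OF x(1) assms] x(2) by (auto simp: vec_eq_iff)
  then show ?thesis using that by blast
qed

end

section \<open>Fractals and unique representation\<close>

text \<open>Sequential compactness of a product of finite sets, by a diagonal argument.\<close>

lemma finite_valued_subsequence:
  fixes X :: "nat \<Rightarrow> nat \<Rightarrow> 'b"
  assumes "\<And>n. finite (S n)" "\<And>k n. X k n \<in> S n"
  obtains r x where "strict_mono r" "\<And>n. eventually (\<lambda>k. X (r k) n = x n) sequentially"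
proof -
  define P where "P n s \<longleftrightarrow> (\<exists>c. \<forall>k. X (s k) n = c)" for n and s :: "nat \<Rightarrow> nat"
  interpret subseqs P
  proof
    fix n :: nat and s :: "nat \<Rightarrow> nat" assume "strict_mono s"
    have "range (\<lambda>k. X (s k) n) \<subseteq> S n" using assms(2) by blast
    then have "finite (range (\<lambda>k. X (s k) n))" using assms(1) by (rule finite_subset)
    from pigeonhole_infinite[OF infinite_UNIV_nat this]
    obtain k0 where inf: "infinite {k \<in> UNIV. X (s k) n = X (s k0) n}" by blast
    define E where "E = enumerate {k \<in> UNIV. X (s k) n = X (s k0) n}"
    have "X ((s \<circ> E) k) n = X (s k0) n" for k using enumerate_in_set[OF inf, of k] unfolding E_def by simp
    moreover have "strict_mono E" unfolding E_def using strict_mono_enumerate[OF inf] .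
    ultimately show "\<exists>r'. strict_mono r' \<and> P n (s \<circ> r')" unfolding P_def by (intro exI[of _ E]) simp
  qed
  have "P n (diagseq \<circ> ((+) (Suc n)))" for n
    by (rule diagseq_holds) (auto simp: P_def)
  then have "\<exists>c. \<forall>k. X (diagseq (Suc n + k)) n = c" for n unfolding P_def by simp
  then obtain x where x: "\<And>n k. X (diagseq (Suc n + k)) n = x n" by metis
  have "eventually (\<lambda>k. X (diagseq k) n = x n) sequentially" for n
    unfolding eventually_sequentially by (rule exI[of _ "Suc n"]) (metis x le_add_diff_inverse)
  then show ?thesis using that subseq_diagseq by blast
qed

lemma concat_map_split:
  assumes "i < length (concat (map f w))"
  obtains p c s j where "w = p @ [c] @ s" "i = length (concat (map f p)) + j" "j < length (f c)"
  using assms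
proof (induction w arbitrary: i thesis)
  case (Cons b w)
  show ?case
  proof (cases "i < length (f b)")
    case True
    then show ?thesis using Cons.prems(1)[of "[]" b w i] by simp
  next
    case False
    then have "i - length (f b) < length (concat (map f w))" using Cons.prems(2) by simp
    then obtain p c s j where "w = p @ [c] @ s" "i - length (f b) = length (concat (map f p)) + j" "j < length (f c)"
      using Cons.IH by blast
    then show ?thesis using Cons.prems(1)[of "b # p" c s j] False by simp
  qed
qed simp

locale complex_eigen = self_similar_exchange I T \<alpha> \<sigma>
  for I :: "'a::finite \<Rightarrow> real set" and T \<alpha> and \<sigma> :: "'a \<Rightarrow> 'a list" +
  fixes \<beta> :: complex and v :: "complex^'a"
  assumes beta: "norm \<beta> > 1"
    and v_eigen: "\<And>a. word_value v (\<sigma> a) = \<beta> * v $ a"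
    and urp: "unique_representation_for_vector \<sigma> \<beta> v"
    and nonreal: "\<And>k. k > 0 \<Longrightarrow> Im (\<beta> ^ k) \<noteq> 0"
begin

abbreviation S :: "'a \<Rightarrow> 'a expansion set" where "S \<equiv> expansions \<sigma>"
abbreviation zeta :: "'a expansion \<Rightarrow> complex" where "zeta \<equiv> expansion_value \<beta> v"
abbreviation wv :: "'a list \<Rightarrow> complex" where "wv \<equiv> word_value v"

lemma beta_nz: "\<beta> \<noteq> 0" using beta by auto

definition symbols :: "('a list \<times> 'a \<times> 'a list) set" where
  "symbols = {(p, c, s). \<exists>a. \<sigma> a = p @ [c] @ s}"

lemma finite_symbols: "finite symbols"
proof -
  have "symbols \<subseteq> (\<Union>a. (\<lambda>i. (take i (\<sigma> a), \<sigma> a ! i, drop (Suc i) (\<sigma> a))) ` {..<length (\<sigma> a)})"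
  proof
    fix y assume "y \<in> symbols"
    then obtain p c s a where y: "y = (p, c, s)" "\<sigma> a = p @ [c] @ s" unfolding symbols_def by auto
    then have "y = (take (length p) (\<sigma> a), \<sigma> a ! length p, drop (Suc (length p)) (\<sigma> a))" "length p < length (\<sigma> a)" by auto
    then show "y \<in> (\<Union>a. (\<lambda>i. (take i (\<sigma> a), \<sigma> a ! i, drop (Suc i) (\<sigma> a))) ` {..<length (\<sigma> a)})" by blast
  qed
  then show ?thesis by (rule finite_subset) auto
qed

definition shift :: "'a expansion \<Rightarrow> 'a expansion" where "shift x n = x (Suc n)"

lemma expansions_shift:
  "x \<in> S a \<longleftrightarrow> (\<exists>p c s. x 0 = (p, c, s) \<and> \<sigma> a = p @ [c] @ s \<and> shift x \<in> S c)"
proof -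
  define Q where "Q n \<longleftrightarrow> \<sigma> (letter_part x n) = prefix_part x (Suc n) @ [letter_part x (Suc n)] @ suffix_part x (Suc n)" for n
  have "(\<forall>n. Q n) \<longleftrightarrow> Q 0 \<and> (\<forall>n. Q (Suc n))" by (metis not0_implies_Suc)
  then have "x \<in> S a \<longleftrightarrow> \<sigma> a = prefix_part x 0 @ [letter_part x 0] @ suffix_part x 0 \<and> shift x \<in> S (letter_part x 0)"
    unfolding expansions_def shift_def Q_def prefix_part_def letter_part_def suffix_part_def by simp
  then show ?thesis unfolding prefix_part_def letter_part_def suffix_part_def by (cases "x 0") auto
qed

lemma expansions_symbols: "x \<in> S a \<Longrightarrow> x n \<in> symbols"
proof (induction n arbitrary: x a)
  case 0
  then show ?case using expansions_shift[of x a] unfolding symbols_def by auto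
next
  case (Suc n)
  then obtain c where "shift x \<in> S c" using expansions_shift[of x a] by blast
  then show ?case using Suc.IH unfolding shift_def by blast
qed

definition C0 :: real where "C0 = Max ((\<lambda>(p, c, s). norm (wv p)) ` symbols)"

lemma prefix_bound: "x \<in> S a \<Longrightarrow> norm (wv (prefix_part x n)) \<le> C0"
  unfolding C0_def prefix_part_def using finite_symbols expansions_symbols[of x a n]
  by (intro Max_ge) (auto simp: case_prod_unfold)

definition q :: real where "q = inverse (norm \<beta>)"

lemma q: "0 < q" "q < 1" unfolding q_def using beta by (auto simp: inverse_less_1_iff)

lemma C0_nonneg: "0 \<le> C0"
proof -
  have "\<sigma> a = [] @ [hd (\<sigma> a)] @ tl (\<sigma> a)" for a using sigma_nonempty[of a] by simp
  then have "([], hd (\<sigma> undefined), tl (\<sigma> undefined)) \<in> symbols" unfolding symbols_def by blast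
  then have "(\<lambda>(p, c, s). norm (wv p)) ([], hd (\<sigma> undefined), tl (\<sigma> undefined)) \<le> C0"
    unfolding C0_def using finite_symbols by (intro Max_ge imageI finite_imageI)
  then show ?thesis by simp
qed

lemma zeta_terms: "x \<in> S a \<Longrightarrow> norm (inverse \<beta> ^ Suc n * wv (prefix_part x n)) \<le> C0 * q ^ Suc n"
proof -
  assume x: "x \<in> S a"
  have "norm (inverse \<beta> ^ Suc n * wv (prefix_part x n)) = q ^ Suc n * norm (wv (prefix_part x n))"
    unfolding norm_mult norm_power norm_inverse q_def ..
  also have "\<dots> \<le> q ^ Suc n * C0" using prefix_bound[OF x, of n] q(1) by (intro mult_left_mono) auto
  finally show ?thesis by (simp only: mult.commute)
qed

lemma zeta_summable: "x \<in> S a \<Longrightarrow> summable (\<lambda>n. inverse \<beta> ^ Suc n * wv (prefix_part x n))"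
proof (rule summable_comparison_test'[of "\<lambda>n. C0 * q ^ Suc n" 0])
  show "summable (\<lambda>n. C0 * q ^ Suc n)" using q summable_geometric[of q] by (simp add: summable_mult)
qed (use zeta_terms in auto)

lemma zeta_shift:
  assumes "x \<in> S a" "x 0 = (p, c, s)"
  shows "\<beta> * zeta x = wv p + zeta (shift x)"
proof -
  obtain c' where c': "shift x \<in> S c'" using expansions_shift assms(1) by blast
  have "zeta x = (\<Sum>n. inverse \<beta> ^ Suc (Suc n) * wv (prefix_part x (Suc n))) + inverse \<beta> ^ Suc 0 * wv (prefix_part x 0)"
    unfolding expansion_value_def using suminf_split_head[OF zeta_summable[OF assms(1)]] by simp
  also have "(\<Sum>n. inverse \<beta> ^ Suc (Suc n) * wv (prefix_part x (Suc n))) = inverse \<beta> * zeta (shift x)"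
    unfolding expansion_value_def using suminf_mult[OF zeta_summable[OF c'], of "inverse \<beta>"]
    by (simp add: prefix_part_def shift_def mult.assoc)
  finally show ?thesis using assms(2) beta_nz by (simp add: prefix_part_def field_simps)
qed

text \<open>The sum of the geometric majorant, a common bound for the modulus of all points of all
  fractals.\<close>

definition CF :: real where "CF = C0 * q / (1 - q)"

lemma CF_nonneg: "0 \<le> CF" unfolding CF_def using C0_nonneg q by simp

lemma zeta_bound: "x \<in> S a \<Longrightarrow> norm (zeta x) \<le> CF"
proof -
  assume x: "x \<in> S a"
  have s: "(\<lambda>n. C0 * q ^ Suc n) sums CF"
  proof -
    have "(\<lambda>n. q ^ n) sums (1 / (1 - q))" using q by (intro geometric_sums) auto
    then have "(\<lambda>n. (C0 * q) * q ^ n) sums ((C0 * q) * (1 / (1 - q)))" by (rule sums_mult)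
    then show ?thesis unfolding CF_def by (simp add: mult.assoc)
  qed
  have "norm (zeta x) \<le> (\<Sum>n. C0 * q ^ Suc n)"
    unfolding expansion_value_def by (rule norm_suminf_le[OF zeta_terms[OF x] sums_summable[OF s]])
  then show ?thesis using s by (simp add: sums_iff)
qed

lemma zeta_close:
  assumes "x \<in> S a" "y \<in> S a" "\<And>i. i < n \<Longrightarrow> x i = y i"
  shows "norm (zeta x - zeta y) \<le> 2 * CF * q ^ n"
  using assms
proof (induction n arbitrary: x y a)
  case 0
  then show ?case using zeta_bound[OF 0(1)] zeta_bound[OF 0(2)] norm_triangle_ineq4[of "zeta x" "zeta y"] by simp
next
  case (Suc n)
  obtain p c s where x0: "x 0 = (p, c, s)" "shift x \<in> S c" using expansions_shift Suc.prems(1) by blast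
  then have y0: "y 0 = (p, c, s)" "shift y \<in> S c" using expansions_shift[of y a] Suc.prems(2) Suc.prems(3)[of 0] by auto
  have "\<beta> * (zeta x - zeta y) = zeta (shift x) - zeta (shift y)"
    using zeta_shift[OF Suc.prems(1) x0(1)] zeta_shift[OF Suc.prems(2) y0(1)] by (simp add: algebra_simps)
  then have "norm \<beta> * norm (zeta x - zeta y) = norm (zeta (shift x) - zeta (shift y))" by (metis norm_mult)
  also have "\<dots> \<le> 2 * CF * q ^ n"
  proof (rule Suc.IH[OF x0(2) y0(2)])
    show "shift x i = shift y i" if "i < n" for i using Suc.prems(3)[of "Suc i"] that by (simp add: shift_def)
  qed
  finally have "q * (norm \<beta> * norm (zeta x - zeta y)) \<le> q * (2 * CF * q ^ n)" using q(1) by (intro mult_left_mono) auto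
  then show ?case unfolding q_def using beta_nz by (simp add: field_simps)
qed

lemma expansions_limit:
  assumes "\<And>k. X k \<in> S a" "\<And>n. eventually (\<lambda>k. X k n = x n) sequentially"
  shows "x \<in> S a" "(\<lambda>k. zeta (X k)) \<longlonglongrightarrow> zeta x"
proof -
  show xS: "x \<in> S a"
  proof -
    have "\<sigma> a = prefix_part x 0 @ [letter_part x 0] @ suffix_part x 0"
    proof -
      obtain k where "X k 0 = x 0" using assms(2)[of 0] eventually_sequentially by auto
      then show ?thesis using assms(1)[of k] unfolding expansions_def prefix_part_def letter_part_def suffix_part_def by simp
    qed
    moreover have "\<sigma> (letter_part x n) = prefix_part x (Suc n) @ [letter_part x (Suc n)] @ suffix_part x (Suc n)" for n
    proof -
      have "eventually (\<lambda>k. X k n = x n \<and> X k (Suc n) = x (Suc n)) sequentially"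
        using assms(2) by (intro eventually_conj) auto
      then obtain k where "X k n = x n" "X k (Suc n) = x (Suc n)" using eventually_sequentially by auto
      then show ?thesis using assms(1)[of k] unfolding expansions_def prefix_part_def letter_part_def suffix_part_def by auto metis
    qed
    ultimately show ?thesis unfolding expansions_def by blast
  qed
  show "(\<lambda>k. zeta (X k)) \<longlonglongrightarrow> zeta x"
  proof (rule tendstoI)
    fix e :: real assume "e > 0"
    have "(\<lambda>n. 2 * CF * q ^ n) \<longlonglongrightarrow> 0" using tendsto_mult[OF tendsto_const LIMSEQ_power_zero[of q], of "2 * CF"] q by simp
    then have "eventually (\<lambda>n. 2 * CF * q ^ n < e) sequentially" using \<open>e > 0\<close> order_tendstoD(2) by blast
    then obtain n where n: "2 * CF * q ^ n < e" using eventually_sequentially by auto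
    have "eventually (\<lambda>k. \<forall>i\<in>{..<n}. X k i = x i) sequentially"
      using assms(2) by (subst eventually_ball_finite_distrib) auto
    then show "eventually (\<lambda>k. dist (zeta (X k)) (zeta x) < e) sequentially"
    proof eventually_elim
      case (elim k)
      then show ?case using zeta_close[OF assms(1) xS, of n k] n by (simp add: dist_norm)
    qed
  qed
qed

lemma urp_unique:
  assumes "norm \<tau> = 1" "x \<in> S a" "y \<in> S a" "zeta x = zeta y" "\<And>z. z \<in> S a \<Longrightarrow> Re (\<tau> * zeta x) \<le> Re (\<tau> * zeta z)"
  shows "x = y"
proof -
  have "zeta x \<in> extreme_points (fractal \<sigma> \<beta> v a) \<tau>"
    using assms unfolding extreme_points_def fractal_def by auto
  then have "\<exists>!y. y \<in> S a \<and> zeta y = zeta x" using urp assms(1) unfolding unique_representation_for_vector_def by blast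
  then show ?thesis using assms(2-4) by metis
qed

text \<open>Compactness: counterexamples for \<open>1 / (k + 1)\<close> accumulate at a direction
  and two expansions with different first symbols that represent the same extreme point, against
  unique representation.\<close>

lemma near_extreme_separated:
  "\<exists>\<kappa>>0. \<forall>a \<tau> x y. norm \<tau> = 1 \<longrightarrow> x \<in> S a \<longrightarrow> y \<in> S a \<longrightarrow> x 0 \<noteq> y 0 \<longrightarrow>
     (\<forall>z\<in>S a. Re (\<tau> * zeta x) \<le> Re (\<tau> * zeta z) + \<kappa>) \<longrightarrow> (\<forall>z\<in>S a. Re (\<tau> * zeta y) \<le> Re (\<tau> * zeta z) + \<kappa>) \<longrightarrow>
     \<kappa> \<le> norm (zeta x - zeta y)"
proof (rule ccontr)
  assume "\<not> ?thesis"
  then have "\<forall>k::nat. \<exists>a \<tau> x y. norm \<tau> = 1 \<and> x \<in> S a \<and> y \<in> S a \<and> x 0 \<noteq> y 0 \<and>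
     (\<forall>z\<in>S a. Re (\<tau> * zeta x) \<le> Re (\<tau> * zeta z) + 1 / real (k + 1)) \<and> norm (zeta x - zeta y) < 1 / real (k + 1)"
    by (metis (no_types, lifting) not_le of_nat_0_less_iff zero_less_divide_1_iff add_gr_0 zero_less_one)
  then obtain A \<tau> X Y where *: "\<And>k. norm (\<tau> k) = 1" "\<And>k. X k \<in> S (A k)" "\<And>k. Y k \<in> S (A k)" "\<And>k. X k 0 \<noteq> Y k 0"
    "\<And>k z. z \<in> S (A k) \<Longrightarrow> Re (\<tau> k * zeta (X k)) \<le> Re (\<tau> k * zeta z) + 1 / real (k + 1)"
    "\<And>k. norm (zeta (X k) - zeta (Y k)) < 1 / real (k + 1)" by metis
  have "\<forall>k. \<tau> k \<in> sphere 0 1" using *(1) by simp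
  then obtain \<tau>0 r1 where r1: "\<tau>0 \<in> sphere 0 1" "strict_mono r1" "(\<tau> \<circ> r1) \<longlonglongrightarrow> \<tau>0"
    using compact_sphere[of "0::complex" 1] unfolding compact_def by blast
  \<comment> \<open>Letter and expansions are bundled so that one diagonal subsequence fixes them
    all; the letter is repeated at each index.\<close>
  define Z where "Z k n = (A (r1 k), X (r1 k) n, Y (r1 k) n)" for k n
  obtain r2 z where r2: "strict_mono r2" "\<And>n. eventually (\<lambda>k. Z (r2 k) n = z n) sequentially"
  proof (rule finite_valued_subsequence[of "\<lambda>_. (UNIV :: 'a set) \<times> symbols \<times> symbols" Z])
    show "finite ((UNIV :: 'a set) \<times> symbols \<times> symbols)" using finite_symbols by simp
    show "Z k n \<in> UNIV \<times> symbols \<times> symbols" for k n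
      unfolding Z_def using expansions_symbols *(2,3) by blast
  qed blast
  obtain k0 where k0: "\<And>k. k \<ge> k0 \<Longrightarrow> Z (r2 k) 0 = z 0" using r2(2)[of 0] eventually_sequentially by auto
  define a where "a = fst (z 0)"
  define r where "r k = r1 (r2 (k + k0))" for k
  have r: "strict_mono r" unfolding r_def using r1(2) r2(1) by (simp add: strict_mono_def)
  have Aa: "A (r k) = a" for k using k0[of "k + k0"] unfolding Z_def a_def r_def by (metis fst_conv le_add2)
  define x y where "x n = fst (snd (z n))" and "y n = snd (snd (z n))" for n
  have ev: "eventually (\<lambda>k. Z (r2 (k + k0)) n = z n) sequentially" for n
    using r2(2)[of n] by (subst eventually_sequentially_seg)
  have evx: "eventually (\<lambda>k. X (r k) n = x n) sequentially" for n
    using ev[of n] unfolding Z_def r_def x_def by eventually_elim (metis fst_conv snd_conv)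
  have evy: "eventually (\<lambda>k. Y (r k) n = y n) sequentially" for n
    using ev[of n] unfolding Z_def r_def y_def by eventually_elim (metis snd_conv)
  have x: "x \<in> S a" "(\<lambda>k. zeta (X (r k))) \<longlonglongrightarrow> zeta x"
    using expansions_limit[of "\<lambda>k. X (r k)" a x] *(2) Aa evx by metis+
  have y: "y \<in> S a" "(\<lambda>k. zeta (Y (r k))) \<longlonglongrightarrow> zeta y"
    using expansions_limit[of "\<lambda>k. Y (r k)" a y] *(3) Aa evy by metis+
  have inv0: "(\<lambda>k. 1 / real (r k + 1)) \<longlonglongrightarrow> 0"
    using LIMSEQ_subseq_LIMSEQ[OF LIMSEQ_Suc[OF lim_1_over_n] r] by (simp add: o_def)
  have tau: "(\<lambda>k. \<tau> (r k)) \<longlonglongrightarrow> \<tau>0"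
  proof -
    have "strict_mono (\<lambda>k. r2 (k + k0))" using r2(1) by (simp add: strict_mono_def)
    then show ?thesis using LIMSEQ_subseq_LIMSEQ[OF r1(3)] unfolding r_def o_def by blast
  qed
  have "(\<lambda>k. norm (zeta (X (r k)) - zeta (Y (r k)))) \<longlonglongrightarrow> norm (zeta x - zeta y)"
    by (intro tendsto_intros x y)
  then have "norm (zeta x - zeta y) \<le> 0"
    by (rule LIMSEQ_le[OF _ inv0]) (use *(6) in \<open>auto intro: less_imp_le\<close>)
  then have eq: "zeta x = zeta y" by simp
  have "Re (\<tau>0 * zeta x) \<le> Re (\<tau>0 * zeta w)" if w: "w \<in> S a" for w
  proof -
    have "(\<lambda>k. Re (\<tau> (r k) * zeta (X (r k)))) \<longlonglongrightarrow> Re (\<tau>0 * zeta x)" by (intro tendsto_intros x tau)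
    moreover have "(\<lambda>k. Re (\<tau> (r k) * zeta w) + 1 / real (r k + 1)) \<longlonglongrightarrow> Re (\<tau>0 * zeta w) + 0"
      by (intro tendsto_add tendsto_intros inv0 tau)
    ultimately have "Re (\<tau>0 * zeta x) \<le> Re (\<tau>0 * zeta w) + 0"
      by (rule LIMSEQ_le) (use *(5) w Aa in auto)
    then show ?thesis by simp
  qed
  then have "x = y" using urp_unique[of \<tau>0 x a y] r1(1) x(1) y(1) eq by simp
  moreover have "x 0 \<noteq> y 0"
  proof -
    have "eventually (\<lambda>k. X (r k) 0 = x 0 \<and> Y (r k) 0 = y 0) sequentially" using evx evy by (rule eventually_conj)
    then obtain k where "X (r k) 0 = x 0" "Y (r k) 0 = y 0" using eventually_sequentially by auto
    then show ?thesis using *(4)[of "r k"] by simp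
  qed
  ultimately show False by simp
qed

subsection \<open>Prefixes of the words \<open>W N a\<close>\<close>

lemma empty_prefix_expansion: "\<exists>x\<in>S a. zeta x = 0"
proof -
  define d where "d n = ((\<lambda>c. hd (\<sigma> c)) ^^ n) a" for n
  define x where "x n = ([] :: 'a list, d (Suc n), tl (\<sigma> (d n)))" for n
  have hd_tl: "\<sigma> c = hd (\<sigma> c) # tl (\<sigma> c)" for c using sigma_nonempty[of c] by simp
  have "x \<in> S a"
    unfolding expansions_def x_def prefix_part_def letter_part_def suffix_part_def
    using hd_tl by (simp add: d_def)
  moreover have "zeta x = 0" unfolding expansion_value_def prefix_part_def x_def by simp
  ultimately show ?thesis by blast
qed

lemma expansion_Cons:
  assumes "\<sigma> a = p @ [c] @ s" "x \<in> S c"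
  shows "case_nat (p, c, s) x \<in> S a" "\<beta> * zeta (case_nat (p, c, s) x) = wv p + zeta x"
proof -
  have sh: "shift (case_nat (p, c, s) x) = x" unfolding shift_def by auto
  show 1: "case_nat (p, c, s) x \<in> S a" unfolding expansions_shift[of _ a] sh using assms by auto
  show "\<beta> * zeta (case_nat (p, c, s) x) = wv p + zeta x"
    using zeta_shift[OF 1, of p c s] sh by simp
qed

lemma beta_power_Suc: "\<beta> * z = x + y \<Longrightarrow> \<beta> ^ Suc N * z = \<beta> ^ N * x + \<beta> ^ N * y"
  by (metis distrib_left mult.assoc power_Suc2)

lemma W_split:
  assumes "\<sigma> a = p @ [c] @ s" "j < length (W N c)"
  shows "length (WW N p) + j < length (W (Suc N) a)"
    "take (length (WW N p) + j) (W (Suc N) a) = WW N p @ take j (W N c)"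
  using assms by auto

text \<open>The address lists the \<open>N\<close> choices of a letter that locate position
  \<open>j\<close> and continues with empty prefixes, which contribute nothing; so the identity is
  exact.\<close>

lemma position_expansion:
  assumes "j < length (W N a)"
  shows "\<exists>x\<in>S a. \<beta> ^ N * zeta x = wv (take j (W N a))"
  using assms
proof (induction N arbitrary: a j)
  case 0
  then show ?case using empty_prefix_expansion by simp
next
  case (Suc N)
  then have "j < length (WW N (\<sigma> a))" by simp
  then obtain p c s i where sp: "\<sigma> a = p @ [c] @ s" "j = length (WW N p) + i" "i < length (W N c)"
    by (rule concat_map_split)
  obtain x where x: "x \<in> S c" "\<beta> ^ N * zeta x = wv (take i (W N c))" using Suc.IH[OF sp(3)] by blast
  have "\<beta> ^ Suc N * zeta (case_nat (p, c, s) x) = \<beta> ^ N * wv p + \<beta> ^ N * zeta x"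
    using expansion_Cons(2)[OF sp(1) x(1)] by (rule beta_power_Suc)
  then show ?case
    using expansion_Cons(1)[OF sp(1) x(1)] W_split(2)[OF sp(1,3)] x(2) sp(2) eigen_WW[OF v_eigen, of N p] by auto
qed

lemma position_expansion_Suc:
  assumes sp: "\<sigma> a = p @ [c] @ s" "i < length (W N c)"
  shows "\<exists>x\<in>S a. x 0 = (p, c, s) \<and> \<beta> ^ Suc N * zeta x = wv (take (length (WW N p) + i) (W (Suc N) a))"
proof -
  obtain x where x: "x \<in> S c" "\<beta> ^ N * zeta x = wv (take i (W N c))" using position_expansion[OF sp(2)] by blast
  have "\<beta> ^ Suc N * zeta (case_nat (p, c, s) x) = \<beta> ^ N * wv p + \<beta> ^ N * zeta x"
    using expansion_Cons(2)[OF sp(1) x(1)] by (rule beta_power_Suc)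
  then have "\<beta> ^ Suc N * zeta (case_nat (p, c, s) x) = wv (take (length (WW N p) + i) (W (Suc N) a))"
    unfolding W_split(2)[OF sp] using x(2) eigen_WW[OF v_eigen, of N p] by simp
  then show ?thesis using expansion_Cons(1)[OF sp(1) x(1)] by (intro bexI[of _ "case_nat (p, c, s) x"]) auto
qed

text \<open>The position is read off the first \<open>N\<close> symbols. The remaining tail enters
  with factor 1 after multiplication by \<open>\<beta>^N\<close>, so the error is at most
  \<open>CF\<close> at every level.\<close>

lemma expansion_position:
  assumes "x \<in> S a"
  shows "\<exists>j<length (W N a). norm (wv (take j (W N a)) - \<beta> ^ N * zeta x) \<le> CF"
  using assms
proof (induction N arbitrary: a x)
  case 0
  then show ?case using zeta_bound by simp
next
  case (Suc N)
  obtain p c s where x0: "x 0 = (p, c, s)" "\<sigma> a = p @ [c] @ s" "shift x \<in> S c" using expansions_shift Suc.prems by blast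
  obtain i where i: "i < length (W N c)" "norm (wv (take i (W N c)) - \<beta> ^ N * zeta (shift x)) \<le> CF"
    using Suc.IH[OF x0(3)] by blast
  have "\<beta> ^ Suc N * zeta x = \<beta> ^ N * wv p + \<beta> ^ N * zeta (shift x)"
    using zeta_shift[OF Suc.prems x0(1)] by (rule beta_power_Suc)
  then have "wv (take (length (WW N p) + i) (W (Suc N) a)) - \<beta> ^ Suc N * zeta x = wv (take i (W N c)) - \<beta> ^ N * zeta (shift x)"
    unfolding W_split(2)[OF x0(2) i(1)] using eigen_WW[OF v_eigen, of N p] by simp
  then show ?case using W_split(1)[OF x0(2) i(1)] i(2) by (intro exI[of _ "length (WW N p) + i"]) simp
qed

text \<open>These are the positions at which the weight, the exponential of the negative real part,
  is largest.\<close>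

definition minimal_position :: "complex \<Rightarrow> nat \<Rightarrow> 'a \<Rightarrow> nat \<Rightarrow> bool" where
  "minimal_position c N a j \<longleftrightarrow> j < length (W N a) \<and>
     (\<forall>i<length (W N a). Re (c * wv (take j (W N a))) \<le> Re (c * wv (take i (W N a))))"

lemma minimal_position_ex: "\<exists>j. minimal_position c N a j"
proof -
  have "0 \<in> {..<length (W N a)}" by simp
  then have ne: "{..<length (W N a)} \<noteq> {}" by blast
  define f where "f j = Re (c * wv (take j (W N a)))" for j
  have "arg_min_on f {..<length (W N a)} \<in> {..<length (W N a)}"
    using arg_min_if_finite(1)[of "{..<length (W N a)}" f] ne by blast
  moreover have "f (arg_min_on f {..<length (W N a)}) \<le> f i" if "i < length (W N a)" for i
    using arg_min_least[of "{..<length (W N a)}" i f] ne that by simp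
  ultimately show ?thesis unfolding minimal_position_def f_def by blast
qed

lemma minimal_position_descend:
  assumes min: "minimal_position c (Suc N) a (length (WW N p) + j)" and sp: "\<sigma> a = p @ [b] @ s" "j < length (W N b)"
  shows "minimal_position c N b j"
  unfolding minimal_position_def
proof (intro conjI allI impI)
  fix i assume i: "i < length (W N b)"
  have "Re (c * wv (take (length (WW N p) + j) (W (Suc N) a))) \<le> Re (c * wv (take (length (WW N p) + i) (W (Suc N) a)))"
    using min W_split(1)[OF sp(1) i] unfolding minimal_position_def by blast
  then show "Re (c * wv (take j (W N b))) \<le> Re (c * wv (take i (W N b)))"
    unfolding W_split(2)[OF sp] W_split(2)[OF sp(1) i] by (simp add: algebra_simps)
qed (rule sp(2))

text \<open>Every point of the fractal is tested against a position with error \<open>CF\<close>. A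
  minimal position is thus extreme up to an error that does not grow with \<open>N\<close>, unlike
  the size of \<open>\<beta>^N\<close>.\<close>

lemma minimal_near_extreme:
  assumes min: "minimal_position c N a j" and x: "\<beta> ^ N * zeta x = wv (take j (W N a))" and z: "z \<in> S a"
  shows "Re (c * \<beta> ^ N * zeta x) \<le> Re (c * \<beta> ^ N * zeta z) + norm c * CF"
proof -
  obtain i where i: "i < length (W N a)" "norm (wv (take i (W N a)) - \<beta> ^ N * zeta z) \<le> CF"
    using expansion_position[OF z] by blast
  have "Re (c * (wv (take i (W N a)) - \<beta> ^ N * zeta z)) \<le> norm c * CF"
    using complex_Re_le_cmod[of "c * (wv (take i (W N a)) - \<beta> ^ N * zeta z)"] mult_left_mono[OF i(2), of "norm c"]
    by (simp add: norm_mult)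
  moreover have "Re (c * wv (take j (W N a))) \<le> Re (c * wv (take i (W N a)))" using min i(1) unfolding minimal_position_def by blast
  ultimately show ?thesis using x by (simp add: algebra_simps)
qed

end

subsection \<open>Generic directions\<close>

text \<open>Translates of the strip by multiples of \<open>3\<epsilon>/\<eta>\<close> in the direction \<open>w\<close> are disjoint.\<close>

lemma strip_measure:
  fixes U :: "complex \<Rightarrow> real"
  assumes cont: "continuous_on UNIV U" and w: "norm w = 1"
    and grow: "\<And>c t. t \<ge> 0 \<Longrightarrow> U c + t * \<eta> \<le> U (c + of_real t * w)"
    and \<eta>: "\<eta> > 0" and \<epsilon>: "0 < \<epsilon>" "\<epsilon> \<le> \<eta> / 6"
  shows "{c. \<bar>U c\<bar> \<le> \<epsilon>} \<inter> cball 0 R \<in> sets lborel"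
    "emeasure lborel ({c. \<bar>U c\<bar> \<le> \<epsilon>} \<inter> cball 0 R) < \<infinity>"
    "measure lborel ({c. \<bar>U c\<bar> \<le> \<epsilon>} \<inter> cball 0 R) \<le> 6 * measure lborel (cball (0::complex) (R + 1)) * \<epsilon> / \<eta>"
proof -
  define A where "A = {c. \<bar>U c\<bar> \<le> \<epsilon>} \<inter> cball 0 R"
  \<comment> \<open>Such a step along \<open>w\<close> raises \<open>U\<close> by at least
    \<open>3 * \<epsilon>\<close>, more than the spread \<open>2 * \<epsilon>\<close> of its values
    on the strip. By \<open>\<epsilon> \<le> \<eta> / 6\<close> it is at most 1/2, so rounding
    \<open>1 / s\<close> down costs at most a factor 2.\<close>
  define s where "s = 3 * \<epsilon> / \<eta>"
  define n where "n = nat \<lfloor>1 / s\<rfloor>"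
  define M where "M = measure lborel (cball (0::complex) (R + 1))"
  have s: "0 < s" "s \<le> 1 / 2" unfolding s_def using \<eta> \<epsilon> by (auto simp: field_simps)
  have n: "real n \<le> 1 / s" "1 / s < real n + 1" "1 / (2 * s) \<le> real n"
  proof -
    have "1 / s \<ge> 2" using s by (simp add: field_simps)
    then show 1: "real n \<le> 1 / s" "1 / s < real n + 1" unfolding n_def by linarith+
    have "1 / (2 * s) \<le> 1 / s - 1" using s by (simp add: field_simps)
    then show "1 / (2 * s) \<le> real n" using 1 by linarith
  qed
  have "closed {c. \<bar>U c\<bar> \<le> \<epsilon>}"
    using cont by (intro closed_Collect_le continuous_intros) auto
  then show sets: "A \<in> sets lborel" unfolding A_def by auto
  have "emeasure lborel A \<le> emeasure lborel (cball (0::complex) R)"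
    unfolding A_def by (intro emeasure_mono) auto
  also have "\<dots> < \<infinity>" by (rule emeasure_lborel_cball_finite)
  finally show fin: "emeasure lborel A < \<infinity>" .
  define F where "F k = (+) (- (of_real (real k * s) * w)) -` A" for k :: nat
  have setsF: "F k \<in> sets lborel" for k
    unfolding F_def using measurable_sets[of "(+) (- (of_real (real k * s) * w))" lborel lborel A] sets by simp
  have measF: "emeasure lborel (F k) = emeasure lborel A" for k
  proof -
    have "emeasure lborel A = emeasure (distr lborel borel ((+) (- (of_real (real k * s) * w)))) A"
      by (simp add: lborel_distr_plus)
    also have "\<dots> = emeasure lborel (F k)" unfolding F_def using sets by (subst emeasure_distr) auto
    finally show ?thesis by simp
  qed
  have disj: "disjoint_family_on F {..<n}"
    unfolding disjoint_family_on_def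
  proof (intro ballI impI, rule ccontr)
    fix j k assume "j \<noteq> k" "F j \<inter> F k \<noteq> {}"
    have "False" if "j < k" "F j \<inter> F k \<noteq> {}" for j k
    proof -
      from that(2) obtain c where c: "c \<in> F j" "c \<in> F k" by blast
      define c1 c2 where "c1 = c - of_real (real j * s) * w" and "c2 = c - of_real (real k * s) * w"
      have c12: "\<bar>U c1\<bar> \<le> \<epsilon>" "\<bar>U c2\<bar> \<le> \<epsilon>" using c unfolding F_def A_def c1_def c2_def by auto
      define t where "t = (real k - real j) * s"
      have "t \<ge> s" using that(1) s(1) unfolding t_def by (simp add: Suc_le_eq)
      have "c1 = c2 + of_real t * w" unfolding c1_def c2_def t_def by (simp add: algebra_simps)
      then have "U c2 + t * \<eta> \<le> U c1" using grow[of t c2] \<open>t \<ge> s\<close> s(1) by simp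
      moreover have "t * \<eta> \<ge> 3 * \<epsilon>" using mult_right_mono[OF \<open>t \<ge> s\<close>, of \<eta>] \<eta> unfolding s_def by simp
      ultimately show False using c12 \<epsilon>(1) by linarith
    qed
    then show False using \<open>j \<noteq> k\<close> \<open>F j \<inter> F k \<noteq> {}\<close> by (metis Int_commute nat_neq_iff)
  qed
  have sub: "(\<Union>k<n. F k) \<subseteq> cball 0 (R + 1)"
  proof
    fix c assume "c \<in> (\<Union>k<n. F k)"
    then obtain k where k: "k < n" "norm (c - of_real (real k * s) * w) \<le> R" unfolding F_def A_def by auto
    have "real k * s \<le> real n * s" using k(1) s(1) by simp
    also have "\<dots> \<le> 1" using mult_right_mono[OF n(1), of s] s(1) by simp
    finally have "norm (of_real (real k * s) * w) \<le> 1" using w s(1) by (simp add: norm_mult)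
    then show "c \<in> cball 0 (R + 1)"
      using norm_triangle_ineq[of "c - of_real (real k * s) * w" "of_real (real k * s) * w"] k(2) by simp
  qed
  have "of_nat n * emeasure lborel A = (\<Sum>k<n. emeasure lborel (F k))" using measF by simp
  also have "\<dots> = emeasure lborel (\<Union>k<n. F k)" using setsF disj by (intro sum_emeasure) auto
  also have "\<dots> \<le> emeasure lborel (cball (0::complex) (R + 1))" using sub by (intro emeasure_mono) auto
  also have "\<dots> = ennreal M" unfolding M_def using emeasure_lborel_cball_finite by (intro emeasure_eq_ennreal_measure) (auto simp: less_top)
  finally have "of_nat n * emeasure lborel A \<le> ennreal M" .
  moreover have "emeasure lborel A = ennreal (measure lborel A)" using fin by (intro emeasure_eq_ennreal_measure) (auto simp: less_top)
  moreover have "of_nat n = ennreal (real n)" by (simp add: ennreal_of_nat_eq_real_of_nat)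
  ultimately have "ennreal (real n * measure lborel A) \<le> ennreal M" by (simp add: ennreal_mult)
  then have nA: "real n * measure lborel A \<le> M" unfolding M_def by (simp add: ennreal_le_iff)
  have "1 / (2 * s) * measure lborel A \<le> real n * measure lborel A" using n(3) by (intro mult_right_mono) auto
  then have "1 / (2 * s) * measure lborel A \<le> M" using nA by linarith
  then have "measure lborel A \<le> M * (2 * s)" using s(1) by (simp add: field_simps)
  also have "M * (2 * s) = 6 * M * \<epsilon> / \<eta>" unfolding s_def by simp
  finally show "measure lborel A \<le> 6 * M * \<epsilon> / \<eta>" .
qed

context complex_eigen
begin

section \<open>Support functions of pieces of the fractals\<close>

definition cell :: "real \<Rightarrow> 'a \<Rightarrow> complex \<Rightarrow> 'a expansion set" where
  "cell \<delta> a z = {x \<in> S a. zeta x \<in> ball z \<delta>}"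

text \<open>The support function of the convex hull of the piece, with an infimum because minima are
  sought.\<close>

definition support :: "'a expansion set \<Rightarrow> complex \<Rightarrow> real" where
  "support Y c = Inf ((\<lambda>x. Re (c * zeta x)) ` Y)"

lemma support_bdd: "Y \<subseteq> S a \<Longrightarrow> bdd_below ((\<lambda>x. Re (c * zeta x)) ` Y)"
proof (rule bdd_belowI2)
  fix x assume "Y \<subseteq> S a" "x \<in> Y"
  then have "norm (zeta x) \<le> CF" using zeta_bound by blast
  then have "norm (c * zeta x) \<le> norm c * CF" by (simp add: norm_mult mult_left_mono)
  then show "- (norm c * CF) \<le> Re (c * zeta x)" using abs_Re_le_cmod[of "c * zeta x"] by linarith
qed

lemma support_le: "Y \<subseteq> S a \<Longrightarrow> x \<in> Y \<Longrightarrow> support Y c \<le> Re (c * zeta x)"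
  unfolding support_def using support_bdd by (intro cInf_lower) auto

lemma support_ge: "Y \<noteq> {} \<Longrightarrow> (\<And>x. x \<in> Y \<Longrightarrow> r \<le> Re (c * zeta x)) \<Longrightarrow> r \<le> support Y c"
  unfolding support_def by (intro cInf_greatest) auto

lemma support_lipschitz:
  assumes "Y \<subseteq> S a" "Y \<noteq> {}"
  shows "\<bar>support Y c - support Y c'\<bar> \<le> CF * norm (c - c')"
proof -
  have "support Y c - CF * norm (c - c') \<le> support Y c'" for c c'
  proof (rule support_ge[OF assms(2)])
    fix x assume x: "x \<in> Y"
    have "norm ((c - c') * zeta x) \<le> CF * norm (c - c')"
      using mult_left_mono[OF zeta_bound[OF subsetD[OF assms(1) x]], of "norm (c - c')"]
      by (simp add: norm_mult mult.commute)
    then have "Re (c * zeta x) - CF * norm (c - c') \<le> Re (c' * zeta x)"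
      using complex_Re_le_cmod[of "(c - c') * zeta x"] by (simp add: algebra_simps)
    then show "support Y c - CF * norm (c - c') \<le> Re (c' * zeta x)" using support_le[OF assms(1) x, of c] by linarith
  qed
  from this[of c c'] this[of c' c] show ?thesis by (simp add: norm_minus_commute abs_le_iff)
qed

lemma support_continuous:
  assumes "Y \<subseteq> S a" "Y \<noteq> {}"
  shows "continuous_on UNIV (\<lambda>c. support Y (c * k))"
proof -
  have "(CF * norm k + 1)-lipschitz_on UNIV (\<lambda>c. support Y (c * k))"
  proof (rule lipschitz_onI)
    fix c c' :: complex
    have "dist (support Y (c * k)) (support Y (c' * k)) \<le> CF * norm (c * k - c' * k)"
      using support_lipschitz[OF assms] by (simp add: dist_real_def)
    also have "\<dots> = (CF * norm k) * dist c c'" by (simp add: dist_norm norm_mult[symmetric] algebra_simps)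
    also have "\<dots> \<le> (CF * norm k + 1) * dist c c'" by (simp add: mult_right_mono)
    finally show "dist (support Y (c * k)) (support Y (c' * k)) \<le> (CF * norm k + 1) * dist c c'" .
  qed (use CF_nonneg in auto)
  then show ?thesis by (rule lipschitz_on_continuous_on)
qed

text \<open>Moving \<open>c\<close> by \<open>t * w\<close> adds \<open>t * Re (w * zeta x)\<close>
  to the functional. By the choice of \<open>w\<close> this separates the centres at rate
  \<open>norm (z - z')\<close>, and the radii of the two cells cost
  \<open>2 * \<delta>\<close>.\<close>

lemma support_difference_grows:
  assumes Y: "cell \<delta> a z \<noteq> {}" "cell \<delta> a z' \<noteq> {}" and t: "t \<ge> 0" and zz: "z \<noteq> z'"
  defines "w \<equiv> cnj (z - z') / norm (z - z')"
  shows "support (cell \<delta> a z) c - support (cell \<delta> a z') c + t * (norm (z - z') - 2 * \<delta>)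
    \<le> support (cell \<delta> a z) (c + of_real t * w) - support (cell \<delta> a z') (c + of_real t * w)"
proof -
  have sub: "cell \<delta> a z \<subseteq> S a" "cell \<delta> a z' \<subseteq> S a" unfolding cell_def by auto
  have nw: "norm w = 1" unfolding w_def using zz by (simp add: norm_divide del: complex_cnj_diff)
  have close: "\<bar>Re (w * zeta x) - Re (w * y)\<bar> \<le> \<delta>" if "x \<in> cell \<delta> a y" for x y
  proof -
    have "norm (w * (zeta x - y)) \<le> \<delta>" using that nw unfolding cell_def by (simp add: norm_mult dist_norm norm_minus_commute)
    then show ?thesis using abs_Re_le_cmod[of "w * (zeta x - y)"] by (simp add: algebra_simps)
  qed
  have dist: "Re (w * z) - Re (w * z') = norm (z - z')"
  proof -
    have "w * (z - z') = ((z - z') * cnj (z - z')) / norm (z - z')" unfolding w_def by (simp add: mult.commute)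
    also have "\<dots> = of_real (norm (z - z'))"
      using zz by (simp add: complex_norm_square[symmetric] power2_eq_square del: complex_cnj_diff)
    finally have "w * (z - z') = of_real (norm (z - z'))" .
    then have "Re (w * (z - z')) = norm (z - z')" by simp
    then show ?thesis by (simp add: algebra_simps)
  qed
  have up: "support (cell \<delta> a z) c + t * (Re (w * z) - \<delta>) \<le> support (cell \<delta> a z) (c + of_real t * w)"
  proof (rule support_ge[OF Y(1)])
    fix x assume x: "x \<in> cell \<delta> a z"
    have "t * (Re (w * z) - \<delta>) \<le> t * Re (w * zeta x)" using close[OF x] t by (intro mult_left_mono) auto
    moreover have "Re ((c + of_real t * w) * zeta x) = Re (c * zeta x) + t * Re (w * zeta x)" by (simp add: algebra_simps)
    ultimately show "support (cell \<delta> a z) c + t * (Re (w * z) - \<delta>) \<le> Re ((c + of_real t * w) * zeta x)"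
      using support_le[OF sub(1) x, of c] by linarith
  qed
  have down: "support (cell \<delta> a z') (c + of_real t * w) - t * (Re (w * z') + \<delta>) \<le> support (cell \<delta> a z') c"
  proof (rule support_ge[OF Y(2)])
    fix x assume x: "x \<in> cell \<delta> a z'"
    have "t * Re (w * zeta x) \<le> t * (Re (w * z') + \<delta>)" using close[OF x] t by (intro mult_left_mono) auto
    moreover have "Re ((c + of_real t * w) * zeta x) = Re (c * zeta x) + t * Re (w * zeta x)" by (simp add: algebra_simps)
    ultimately show "support (cell \<delta> a z') (c + of_real t * w) - t * (Re (w * z') + \<delta>) \<le> Re (c * zeta x)"
      using support_le[OF sub(2) x, of "c + of_real t * w"] by linarith
  qed
  have "t * (norm (z - z') - 2 * \<delta>) = t * (Re (w * z) - \<delta>) - t * (Re (w * z') + \<delta>)"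
    unfolding dist[symmetric] by (simp only: right_diff_distrib distrib_left)
  then show ?thesis using up down by linarith
qed

text \<open>A rate strictly between 1 and \<open>norm \<beta>\<close>: the margin \<open>r^N\<close>
  grows, while relative to \<open>norm \<beta>^N\<close> it is \<open>(1 / r)^N\<close>, which is
  summable as Borel-Cantelli requires.\<close>

definition r :: real where "r = sqrt (norm \<beta>)"

lemma r: "r > 1" "norm \<beta> = r ^ 2"
  unfolding r_def using beta by auto

text \<open>
  At level \<open>N\<close>, an expansion that is minimal for \<open>Re (c \<beta>\<^sup>N \<cdot>)\<close> up to a bounded error beats those with a different first
  symbol by a margin growing exponentially with \<open>N\<close>.
\<close>

definition generic_direction :: "complex \<Rightarrow> bool" where
  "generic_direction c \<longleftrightarrow> (\<exists>N1. \<forall>N\<ge>N1. \<forall>a. \<forall>x\<in>S a. \<forall>y\<in>S a. x 0 \<noteq> y 0 \<longrightarrow>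
     (\<forall>z\<in>S a. Re (c * \<beta> ^ N * zeta x) \<le> Re (c * \<beta> ^ N * zeta z) + norm c * CF) \<longrightarrow>
     Re (c * \<beta> ^ N * zeta x) + r ^ N / 2 \<le> Re (c * \<beta> ^ N * zeta y))"

text \<open>A competitor \<open>y\<close> within the margin is itself nearly extreme, so by
  \<open>near_extreme_separated\<close> it lies in a cell far from that of \<open>x\<close>, and the
  support functions of both cells almost agree at \<open>c\<close>. For each of the finitely many
  pairs of distant cells this confines \<open>c\<close> to a strip of width proportional to
  \<open>(1 / r)^N\<close>, and almost every \<open>c\<close> lies in only finitely many of these
  strips.\<close>

lemma ae_generic_direction: "AE c in lborel. generic_direction c"
proof -
  obtain \<kappa> where \<kappa>: "\<kappa> > 0" "\<And>a \<tau> x y. norm \<tau> = 1 \<Longrightarrow> x \<in> S a \<Longrightarrow> y \<in> S a \<Longrightarrow> x 0 \<noteq> y 0 \<Longrightarrow>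
     (\<And>z. z \<in> S a \<Longrightarrow> Re (\<tau> * zeta x) \<le> Re (\<tau> * zeta z) + \<kappa>) \<Longrightarrow> (\<And>z. z \<in> S a \<Longrightarrow> Re (\<tau> * zeta y) \<le> Re (\<tau> * zeta z) + \<kappa>) \<Longrightarrow>
     \<kappa> \<le> norm (zeta x - zeta y)" using near_extreme_separated by (metis (no_types, lifting))
  \<comment> \<open>With this radius, values at distance \<open>\<kappa>\<close> have centres at
    distance at least \<open>3 * \<kappa> / 4\<close>, and the support functions separate at rate at
    least \<open>3 * \<kappa> / 4 - 2 * \<delta> = \<kappa> / 2\<close>, the later
    \<open>\<eta>\<close>.\<close>
  define \<delta> where "\<delta> = \<kappa> / 8"
  have d0: "\<delta> > 0" unfolding \<delta>_def using \<kappa>(1) by simp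
  obtain Q where Q: "finite Q" "cball (0::complex) CF \<subseteq> (\<Union>z\<in>Q. ball z \<delta>)"
    using compact_eq_totally_bounded[of "cball (0::complex) CF"] d0 by auto
  define P where "P = {(a, z, z'). z \<in> Q \<and> z' \<in> Q \<and> cell \<delta> a z \<noteq> {} \<and> cell \<delta> a z' \<noteq> {} \<and> 3 * \<kappa> / 4 \<le> norm (z - z')}"
  have fP: "finite P" by (rule finite_subset[of _ "UNIV \<times> Q \<times> Q"]) (use Q(1) in \<open>auto simp: P_def\<close>)
  \<comment> \<open>The rotation in \<open>\<beta>^N\<close>. Its modulus is absorbed by the scale
    of the strips, since \<open>r^N = \<epsilon> N * norm \<beta>^N\<close>.\<close>
  define k where "k N = (\<beta> / norm \<beta>) ^ N" for N :: nat
  have k: "norm (k N) = 1" "\<beta> ^ N = of_real (norm \<beta> ^ N) * k N" for N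
    unfolding k_def using beta_nz by (simp_all add: norm_power norm_divide power_divide)
  define U where "U N = (\<lambda>(a, z, z') c. support (cell \<delta> a z) (c * k N) - support (cell \<delta> a z') (c * k N))" for N
  define \<epsilon> where "\<epsilon> N = (1 / r) ^ N" for N :: nat
  have eps_pos: "\<epsilon> N > 0" for N unfolding \<epsilon>_def using r(1) by simp
  have eps0: "\<epsilon> \<longlonglongrightarrow> 0" unfolding \<epsilon>_def using r(1) by (intro LIMSEQ_power_zero) simp
  define \<eta> where "\<eta> = \<kappa> / 2"
  have eta: "\<eta> > 0" unfolding \<eta>_def using \<kappa>(1) by simp
  define A where "A R p N = {c. \<bar>U N p c\<bar> \<le> \<epsilon> N} \<inter> cball 0 R" for R p N
  have strip: "A R p N \<in> sets lborel" "emeasure lborel (A R p N) < \<infinity>"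
     "measure lborel (A R p N) \<le> 6 * measure lborel (cball (0::complex) (R + 1)) * \<epsilon> N / \<eta>"
    if p: "p \<in> P" and small: "\<epsilon> N \<le> \<eta> / 6" for R p N
  proof -
    obtain a z z' where p': "p = (a, z, z')" by (cases p)
    have z: "cell \<delta> a z \<noteq> {}" "cell \<delta> a z' \<noteq> {}" "3 * \<kappa> / 4 \<le> norm (z - z')" using p unfolding P_def p' by auto
    then have zz: "z \<noteq> z'" using \<kappa>(1) by auto
    have sub: "cell \<delta> a z \<subseteq> S a" "cell \<delta> a z' \<subseteq> S a" unfolding cell_def by auto
    define w0 where "w0 = cnj (z - z') / norm (z - z')"
    define w where "w = w0 * cnj (k N)"
    have nw: "norm w = 1" unfolding w_def w0_def using zz k(1)[of N] by (simp add: norm_mult norm_divide del: complex_cnj_diff)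
    have cont: "continuous_on UNIV (U N p)"
      unfolding U_def p' split_def fst_conv snd_conv using sub z by (intro continuous_intros support_continuous)
    have grow: "U N p c + t * \<eta> \<le> U N p (c + of_real t * w)" if t: "t \<ge> 0" for c t
    proof -
      have "k N * cnj (k N) = 1" using k(1)[of N] by (simp add: complex_norm_square[symmetric])
      then have eq: "(c + of_real t * w) * k N = c * k N + of_real t * w0" unfolding w_def by (simp add: algebra_simps)
      have "\<eta> \<le> norm (z - z') - 2 * \<delta>" using z(3) unfolding \<eta>_def \<delta>_def by linarith
      then have "t * \<eta> \<le> t * (norm (z - z') - 2 * \<delta>)" using t by (rule mult_left_mono)
      then show ?thesis using support_difference_grows[OF z(1,2) t zz, of "c * k N"]
        unfolding U_def p' eq[unfolded w0_def] split_def fst_conv snd_conv eq w0_def by linarith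
    qed
    show "A R p N \<in> sets lborel" "emeasure lborel (A R p N) < \<infinity>"
     "measure lborel (A R p N) \<le> 6 * measure lborel (cball (0::complex) (R + 1)) * \<epsilon> N / \<eta>"
      unfolding A_def using strip_measure[OF cont nw grow eta eps_pos small] by auto
  qed
  obtain N0 where N0: "\<And>N. N \<ge> N0 \<Longrightarrow> \<epsilon> N \<le> \<eta> / 6"
    using order_tendstoD(2)[OF eps0, of "\<eta> / 6"] eta unfolding eventually_sequentially by (auto intro: less_imp_le)
  \<comment> \<open>The strips are cut to a ball to have finite measure; balls of integer radius
    then exhaust the plane.\<close>
  have ae: "AE c in lborel. c \<in> cball 0 R \<longrightarrow> eventually (\<lambda>N. \<forall>p\<in>P. \<epsilon> N < \<bar>U N p c\<bar>) sequentially" for R :: real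
  proof -
    have "AE c in lborel. eventually (\<lambda>N. c \<in> space lborel - A R p (N + N0)) sequentially" if p: "p \<in> P" for p
    proof (rule borel_cantelli_AE1)
      show "A R p (N + N0) \<in> sets lborel" "emeasure lborel (A R p (N + N0)) < \<infinity>" for N using strip(1,2)[OF p N0] by auto
      show "summable (\<lambda>N. measure lborel (A R p (N + N0)))"
      proof (rule summable_comparison_test'[of _ 0])
        have "summable (\<lambda>N. 6 * measure lborel (cball (0::complex) (R + 1)) / \<eta> * \<epsilon> N0 * (1 / r) ^ N)"
          using r(1) by (intro summable_mult summable_geometric) simp
        then show "summable (\<lambda>N. 6 * measure lborel (cball (0::complex) (R + 1)) * \<epsilon> (N + N0) / \<eta>)"
          unfolding \<epsilon>_def power_add by (simp add: mult_ac)
        show "norm (measure lborel (A R p (N + N0))) \<le> 6 * measure lborel (cball (0::complex) (R + 1)) * \<epsilon> (N + N0) / \<eta>" for N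
          using strip(3)[OF p N0] by simp
      qed
    qed
    then have "AE c in lborel. \<forall>p\<in>P. eventually (\<lambda>N. c \<in> space lborel - A R p (N + N0)) sequentially"
      using fP by (intro AE_finite_allI)
    then show ?thesis
    proof eventually_elim
      case (elim c)
      show ?case
      proof
        assume c: "c \<in> cball 0 R"
        have "eventually (\<lambda>N. \<forall>p\<in>P. c \<in> space lborel - A R p (N + N0)) sequentially"
          using elim fP by (simp add: eventually_ball_finite_distrib)
        then have "eventually (\<lambda>N. \<forall>p\<in>P. \<epsilon> (N + N0) < \<bar>U (N + N0) p c\<bar>) sequentially"
          by eventually_elim (use c in \<open>auto simp: A_def not_le\<close>)
        then show "eventually (\<lambda>N. \<forall>p\<in>P. \<epsilon> N < \<bar>U N p c\<bar>) sequentially"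
          by (rule eventually_sequentially_seg[THEN iffD1])
      qed
    qed
  qed
  have "AE c in lborel. \<forall>R::nat. c \<in> cball 0 (real R) \<longrightarrow> eventually (\<lambda>N. \<forall>p\<in>P. \<epsilon> N < \<bar>U N p c\<bar>) sequentially"
    using ae by (subst AE_all_countable) auto
  moreover have "AE c in lborel. c \<noteq> (0::complex)" by (rule AE_lborel_singleton)
  ultimately show ?thesis
  proof eventually_elim
    case (elim c)
    obtain R :: nat where "norm c \<le> real R" using real_arch_simple by blast
    then have ev1: "eventually (\<lambda>N. \<forall>p\<in>P. \<epsilon> N < \<bar>U N p c\<bar>) sequentially" using elim(1)[THEN spec, of R] by simp
    have tail: "(\<lambda>N. norm c * CF * q ^ N) \<longlonglongrightarrow> 0"
      using tendsto_mult[OF tendsto_const LIMSEQ_power_zero[of q], of "norm c * CF"] q by simp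
    have "(\<lambda>N. norm c * CF * q ^ N + \<epsilon> N / 2) \<longlonglongrightarrow> 0 + 0 / 2" by (intro tendsto_intros tail eps0) simp
    then have "eventually (\<lambda>N. norm c * CF * q ^ N + \<epsilon> N / 2 < norm c * \<kappa>) sequentially"
      using order_tendstoD(2)[of _ 0 _ "norm c * \<kappa>"] elim(2) \<kappa>(1) by simp
    moreover have "eventually (\<lambda>N. norm c * CF * q ^ N \<le> \<epsilon> N / 2) sequentially"
    proof -
      have "(\<lambda>N. norm c * CF * (1 / r) ^ N) \<longlonglongrightarrow> 0"
        using tendsto_mult[OF tendsto_const LIMSEQ_power_zero[of "1 / r"], of "norm c * CF"] r(1) by simp
      from order_tendstoD(2)[OF this, of "1 / 2"]
      have "eventually (\<lambda>N. norm c * CF * (1 / r) ^ N < 1 / 2) sequentially" by simp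
      then show ?thesis
      proof eventually_elim
        case (elim N)
        have "q = (1 / r) * (1 / r)" unfolding q_def using r by (simp add: power2_eq_square divide_inverse)
        then have "norm c * CF * q ^ N = (norm c * CF * (1 / r) ^ N) * \<epsilon> N" unfolding \<epsilon>_def by (simp only: power_mult_distrib mult.assoc)
        also have "\<dots> \<le> (1 / 2) * \<epsilon> N" using elim eps_pos[of N] by (intro mult_right_mono) auto
        finally show ?case by simp
      qed
    qed
    ultimately have "eventually (\<lambda>N. (\<forall>p\<in>P. \<epsilon> N < \<bar>U N p c\<bar>) \<and> norm c * CF * q ^ N + \<epsilon> N / 2 < norm c * \<kappa> \<and>
        norm c * CF * q ^ N \<le> \<epsilon> N / 2) sequentially" using ev1 by (intro eventually_conj)
    then obtain N1 where N1: "\<And>N. N \<ge> N1 \<Longrightarrow> (\<forall>p\<in>P. \<epsilon> N < \<bar>U N p c\<bar>)"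
       "\<And>N. N \<ge> N1 \<Longrightarrow> norm c * CF * q ^ N + \<epsilon> N / 2 < norm c * \<kappa>" "\<And>N. N \<ge> N1 \<Longrightarrow> norm c * CF * q ^ N \<le> \<epsilon> N / 2"
      unfolding eventually_sequentially by blast
    show "generic_direction c"
      unfolding generic_direction_def
    proof (intro exI[of _ N1] allI impI ballI, rule ccontr)
      fix N a x y assume N: "N \<ge> N1" and x: "x \<in> S a" and y: "y \<in> S a" and xy: "x 0 \<noteq> y 0"
        and min: "\<forall>z\<in>S a. Re (c * \<beta> ^ N * zeta x) \<le> Re (c * \<beta> ^ N * zeta z) + norm c * CF"
        and "\<not> Re (c * \<beta> ^ N * zeta x) + r ^ N / 2 \<le> Re (c * \<beta> ^ N * zeta y)"
      then have less: "Re (c * \<beta> ^ N * zeta y) < Re (c * \<beta> ^ N * zeta x) + r ^ N / 2" by simp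
      define c' where "c' = c * k N"
      have scale: "Re (c * \<beta> ^ N * z) = norm \<beta> ^ N * Re (c' * z)" for z
        unfolding k(2) c'_def by (simp add: algebra_simps)
      have bN: "norm \<beta> ^ N > 0" using beta_nz by simp
      have qN: "q ^ N * norm \<beta> ^ N = 1" unfolding q_def using beta_nz by (simp add: power_mult_distrib[symmetric])
      have rN: "r ^ N = \<epsilon> N * norm \<beta> ^ N" unfolding \<epsilon>_def r(2) using r(1) by (simp add: power_mult_distrib[symmetric] power2_eq_square)
      \<comment> \<open>The bounded error allowed for \<open>x\<close>, divided by
        \<open>norm \<beta>^N\<close>.\<close>
      define h where "h = norm c * CF * q ^ N"
      have h0: "h \<ge> 0" unfolding h_def using CF_nonneg q by simp
      have min': "Re (c' * zeta x) \<le> Re (c' * zeta z) + h" if "z \<in> S a" for z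
      proof -
        have "norm c * CF = norm \<beta> ^ N * h" unfolding h_def using qN by (simp add: mult_ac)
        then have "norm \<beta> ^ N * Re (c' * zeta x) \<le> norm \<beta> ^ N * (Re (c' * zeta z) + h)"
          using min that unfolding scale by (simp add: distrib_left)
        then show ?thesis using bN by simp
      qed
      have less': "Re (c' * zeta y) < Re (c' * zeta x) + \<epsilon> N / 2"
      proof -
        have "norm \<beta> ^ N * Re (c' * zeta y) < norm \<beta> ^ N * (Re (c' * zeta x) + \<epsilon> N / 2)"
          using less unfolding scale rN by (simp add: algebra_simps)
        then show ?thesis using bN by simp
      qed
      have nc: "norm c > 0" "norm c' = norm c" using elim(2) k(1)[of N] unfolding c'_def by (auto simp: norm_mult)
      have hk: "h + \<epsilon> N / 2 < norm c * \<kappa>" "h \<le> \<epsilon> N / 2" using N1(2,3)[OF N] unfolding h_def by auto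
      have "\<kappa> \<le> norm (zeta x - zeta y)"
      proof (rule \<kappa>(2)[OF _ x y xy])
        show "norm (c' / norm c) = 1" using nc by (simp add: norm_divide)
        have div: "Re (c' / norm c * z) = Re (c' * z) / norm c" for z
          using Re_divide_of_real[of "c' * z" "norm c"] by (simp add: mult.commute)
        have dv: "A / norm c \<le> B / norm c + \<kappa>" if "A \<le> B + norm c * \<kappa>" for A B
          using that nc(1) by (simp add: field_simps)
        fix z assume z: "z \<in> S a"
        have "Re (c' * zeta x) \<le> Re (c' * zeta z) + norm c * \<kappa>" "Re (c' * zeta y) \<le> Re (c' * zeta z) + norm c * \<kappa>"
          using min'[OF z] less' hk eps_pos[of N] by linarith+
        then show "Re (c' / norm c * zeta x) \<le> Re (c' / norm c * zeta z) + \<kappa>" "Re (c' / norm c * zeta y) \<le> Re (c' / norm c * zeta z) + \<kappa>"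
          unfolding div by (blast intro: dv)+
      qed
      obtain z z' where z: "z \<in> Q" "zeta x \<in> ball z \<delta>" "z' \<in> Q" "zeta y \<in> ball z' \<delta>"
      proof -
        have "zeta x \<in> (\<Union>z\<in>Q. ball z \<delta>)" "zeta y \<in> (\<Union>z\<in>Q. ball z \<delta>)"
          using subsetD[OF Q(2), of "zeta x"] subsetD[OF Q(2), of "zeta y"] zeta_bound[OF x] zeta_bound[OF y] by simp_all
        then show thesis using that by blast
      qed
      have cells: "x \<in> cell \<delta> a z" "y \<in> cell \<delta> a z'" unfolding cell_def using x y z by auto
      have "norm (zeta x - zeta y) \<le> norm (z - z') + dist z (zeta x) + dist z' (zeta y)"
        unfolding dist_norm using norm_triangle_ineq4[of "z - z'" "(z - zeta x) - (z' - zeta y)"]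
          norm_triangle_ineq4[of "z - zeta x" "z' - zeta y"] by (simp add: algebra_simps)
      then have "3 * \<kappa> / 4 \<le> norm (z - z')" using \<open>\<kappa> \<le> _\<close> z(2,4) unfolding \<delta>_def by simp
      then have p: "(a, z, z') \<in> P" unfolding P_def using z cells by auto
      have sub: "cell \<delta> a z \<subseteq> S a" "cell \<delta> a z' \<subseteq> S a" unfolding cell_def by auto
      \<comment> \<open>Both cell minima are at least the value of \<open>x\<close> minus
        \<open>h\<close>, and at most the values of \<open>x\<close> and \<open>y\<close>, which are
        close; so they differ by at most \<open>\<epsilon> N\<close>.\<close>
      have "support (cell \<delta> a z) c' \<le> Re (c' * zeta x)" "support (cell \<delta> a z') c' \<le> Re (c' * zeta y)"
        using support_le[OF sub(1) cells(1)] support_le[OF sub(2) cells(2)] by auto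
      moreover have "Re (c' * zeta x) - h \<le> support (cell \<delta> a z) c'" "Re (c' * zeta x) - h \<le> support (cell \<delta> a z') c'"
        using min' cells sub by (intro support_ge; force)+
      ultimately have "\<bar>support (cell \<delta> a z) c' - support (cell \<delta> a z') c'\<bar> \<le> \<epsilon> N"
        using less' hk(2) eps_pos[of N] unfolding abs_le_iff by linarith
      then have "\<bar>U N (a, z, z') c\<bar> \<le> \<epsilon> N" unfolding U_def c'_def by simp
      then show False using N1(1)[OF N] p by force
    qed
  qed
qed

end

subsection \<open>A point with minimal Birkhoff sums\<close>

text \<open>Koenig's lemma for an inverse system of nonempty finite sets: descend from a point of
  each level \<open>M\<close> and pass to a diagonal limit in \<open>M\<close>.\<close>

lemma inverse_limit:
  assumes fin: "\<And>N. finite (P N)" and ne: "\<And>N. P N \<noteq> {}"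
    and R: "\<And>N y. y \<in> P (Suc N) \<Longrightarrow> \<exists>x\<in>P N. R N x y"
  obtains s where "\<And>N::nat. s N \<in> P N" "\<And>N. R N (s N) (s (Suc N))"
proof -
  have "\<forall>N y. \<exists>x. y \<in> P (Suc N) \<longrightarrow> x \<in> P N \<and> R N x y" using R by blast
  then obtain f where f: "\<And>N y. y \<in> P (Suc N) \<Longrightarrow> f N y \<in> P N \<and> R N (f N y) y" by metis
  have "\<forall>N. \<exists>x. x \<in> P N" using ne by blast
  then obtain y where y: "\<And>N. y N \<in> P N" by metis
  define G where "G M = rec_nat (y M) (\<lambda>i z. f (M - Suc i) z)" for M
  have G: "G M 0 = y M" "G M (Suc i) = f (M - Suc i) (G M i)" for M i unfolding G_def by auto
  have GP: "G M i \<in> P (M - i)" if "i \<le> M" for M i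
    using that
  proof (induction i)
    case (Suc i)
    then have "G M i \<in> P (Suc (M - Suc i))" by (simp add: Suc_diff_Suc)
    then show ?case using f G(2) by simp
  qed (use y G in simp)
  \<comment> \<open>The levels above \<open>M\<close> receive the filler \<open>y n\<close>, which
    no longer occurs at a fixed level once \<open>M\<close> is large.\<close>
  define X where "X M n = (if n \<le> M then G M (M - n) else y n)" for M n
  have XP: "X M n \<in> P n" for M n
  proof (cases "n \<le> M")
    case True
    then show ?thesis using GP[of "M - n" M] unfolding X_def by simp
  next
    case False
    then show ?thesis using y unfolding X_def by simp
  qed
  have XR: "R n (X M n) (X M (Suc n))" if "n < M" for M n
  proof -
    have "M - n = Suc (M - Suc n)" using that by simp
    then have "X M n = f n (X M (Suc n))" unfolding X_def using G(2)[of M "M - Suc n"] that by simp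
    then show ?thesis using f XP by simp
  qed
  obtain r s where rs: "strict_mono r" "\<And>n. eventually (\<lambda>k. X (r k) n = s n) sequentially"
    using finite_valued_subsequence[of P X] fin XP by blast
  have "s n \<in> P n \<and> R n (s n) (s (Suc n))" for n
  proof -
    have "eventually (\<lambda>k. X (r k) n = s n \<and> X (r k) (Suc n) = s (Suc n) \<and> k > n) sequentially"
      using rs(2) eventually_gt_at_top by (intro eventually_conj)
    then obtain k where k: "X (r k) n = s n" "X (r k) (Suc n) = s (Suc n)" "k > n"
      unfolding eventually_sequentially by blast
    have "n < r k" using k(3) strict_mono_imp_increasing[OF rs(1), of k] by simp
    then show ?thesis using XP[of "r k" n] XR[of n "r k"] k by simp
  qed
  then show ?thesis using that by blast
qed

text \<open>Summing the rotating numbers \<open>\<omega>\<^sup>M g\<close> shows that their real parts tend to 0.\<close>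

lemma rotation_bounded_below:
  fixes \<omega> g :: complex
  assumes w: "norm \<omega> = 1" "Im \<omega> \<noteq> 0" and \<rho>: "0 < \<rho>" "\<rho> < 1" and C: "C \<ge> 0"
    and lower: "\<And>M. - (C * \<rho> ^ M) \<le> Re (\<omega> ^ M * g)"
  shows "g = 0"
proof -
  define f where "f M = Re (\<omega> ^ M * g) + C * \<rho> ^ M" for M
  have f0: "f M \<ge> 0" for M using lower[of M] unfolding f_def by simp
  have w1: "\<omega> \<noteq> 1" using w(2) by auto
  have bound: "(\<Sum>M<n. f M) \<le> 2 * norm g / norm (\<omega> - 1) + C / (1 - \<rho>)" for n
  proof -
    have "(\<Sum>M<n. \<omega> ^ M * g) = (\<omega> ^ n - 1) / (\<omega> - 1) * g"
      unfolding sum_distrib_right[symmetric] using geometric_sum[OF w1] by simp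
    then have "norm (\<Sum>M<n. \<omega> ^ M * g) = norm (\<omega> ^ n - 1) / norm (\<omega> - 1) * norm g" by (simp add: norm_mult norm_divide)
    also have "\<dots> \<le> 2 / norm (\<omega> - 1) * norm g"
      using norm_triangle_ineq4[of "\<omega> ^ n" 1] w(1) by (intro mult_right_mono divide_right_mono) (auto simp: norm_power)
    finally have "Re (\<Sum>M<n. \<omega> ^ M * g) \<le> 2 * norm g / norm (\<omega> - 1)" using complex_Re_le_cmod[of "\<Sum>M<n. \<omega> ^ M * g"] by simp
    moreover have "(\<Sum>M<n. C * \<rho> ^ M) \<le> C / (1 - \<rho>)"
      unfolding sum_distrib_left[symmetric] using \<rho> C by (simp add: sum_gp_strict divide_right_mono mult_left_le)
    ultimately show ?thesis unfolding f_def sum.distrib by simp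
  qed
  have "summable f" using bounded_imp_summable[of f "2 * norm g / norm (\<omega> - 1) + C / (1 - \<rho>)"] f0 
    bound[of "Suc _"] by (simp add: lessThan_Suc_atMost)
  then have "f \<longlonglongrightarrow> 0" by (rule summable_LIMSEQ_zero)
  moreover have pw: "(\<lambda>M. C * \<rho> ^ M) \<longlonglongrightarrow> 0" using tendsto_mult[OF tendsto_const LIMSEQ_power_zero[of \<rho>], of C] \<rho> by simp
  ultimately have "(\<lambda>M. f M - C * \<rho> ^ M) \<longlonglongrightarrow> 0 - 0" by (intro tendsto_diff)
  then have re: "(\<lambda>M. Re (\<omega> ^ M * g)) \<longlonglongrightarrow> 0" unfolding f_def by simp
  \<comment> \<open>Two consecutive real parts determine the imaginary part because
    \<open>Im \<omega>\<close> is nonzero.\<close>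
  have "(\<lambda>M. (Re \<omega> * Re (\<omega> ^ M * g) - Re (\<omega> ^ Suc M * g)) / Im \<omega>) \<longlonglongrightarrow> (Re \<omega> * 0 - 0) / Im \<omega>"
    using re LIMSEQ_Suc[OF re] w(2) by (intro tendsto_intros) auto
  moreover have "(Re \<omega> * Re (\<omega> ^ M * g) - Re (\<omega> ^ Suc M * g)) / Im \<omega> = Im (\<omega> ^ M * g)" for M
  proof -
    have "Re (\<omega> ^ Suc M * g) = Re \<omega> * Re (\<omega> ^ M * g) - Im \<omega> * Im (\<omega> ^ M * g)"
      by (simp add: mult.assoc)
    then show ?thesis using w(2) by simp
  qed
  ultimately have im: "(\<lambda>M. Im (\<omega> ^ M * g)) \<longlonglongrightarrow> 0" by simp
  have "(\<lambda>M. \<omega> ^ M * g) \<longlonglongrightarrow> 0" unfolding tendsto_complex_iff using re im by simp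
  then have "(\<lambda>M. norm (\<omega> ^ M * g)) \<longlonglongrightarrow> 0" by (rule tendsto_norm_zero)
  then have "(\<lambda>M::nat. norm g) \<longlonglongrightarrow> 0" using w(1) by (simp add: norm_mult norm_power)
  then show ?thesis by (simp add: LIMSEQ_const_iff)
qed

context complex_eigen
begin

text \<open>If \<open>e\<close> had a single expansion, \<open>\<sigma> e\<close> would be one
  letter, again with a single expansion. All words \<open>W N e\<close> would then have length 1,
  against \<open>long_words\<close>.\<close>

lemma two_expansions: "\<exists>x\<in>S a. \<exists>y\<in>S a. x \<noteq> y"
proof (rule ccontr)
  assume single: "\<not> ?thesis"
  have "length (W N e) = 1" if "\<forall>x\<in>S e. \<forall>y\<in>S e. x = y" for N e
    using that
  proof (induction N arbitrary: e)
    case (Suc N)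
    obtain c w where cw: "\<sigma> e = c # w" using sigma_nonempty[of e] by (cases "\<sigma> e") auto
    have "w = []"
    proof (rule ccontr)
      assume "w \<noteq> []"
      then obtain d w' where w: "w = d # w'" by (cases w) auto
      obtain x y where xy: "x \<in> S c" "y \<in> S d" using empty_prefix_expansion by metis
      have "case_nat ([], c, w) x \<in> S e" "case_nat ([c], d, w') y \<in> S e"
        using expansion_Cons(1)[of e "[]" c w x] expansion_Cons(1)[of e "[c]" d w' y] cw w xy by auto
      then have "case_nat ([], c, w) x = case_nat ([c], d, w') y" using Suc.prems by blast
      then have "case_nat ([], c, w) x 0 = case_nat ([c], d, w') y 0" by (rule fun_cong)
      then show False by simp
    qed
    then have c: "\<sigma> e = [] @ [c] @ []" using cw by simp
    have "x = y" if "x \<in> S c" "y \<in> S c" for x y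
    proof -
      have eq: "case_nat ([], c, []) x = case_nat ([], c, []) y" using expansion_Cons(1)[OF c] that Suc.prems by blast
      have "x n = y n" for n using fun_cong[OF eq, of "Suc n"] by simp
      then show ?thesis by blast
    qed
    then have "length (W N c) = 1" using Suc.IH by blast
    then show ?case using c by simp
  qed simp
  then have "length (W N a) = 1" for N using single by blast
  moreover obtain K where "\<forall>N\<ge>K. \<forall>a. length (W N a) \<ge> 2" using long_words by blast
  then have "length (W K a) \<ge> 2" by blast
  ultimately show False by simp
qed

text \<open>
  Along a periodic tail of addresses the prefix values are \<open>D + \<beta>\<^sup>N z\<close> with a fixed \<open>z\<close>. Their minimality and the
  rotation by powers of \<open>\<beta>\<close> force all of \<open>F\<^sub>e\<close> to coincide with \<open>z\<close>, contradicting the unique representation property.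
\<close>

lemma no_periodic_tail:
  assumes c: "c \<noteq> 0" and min: "\<And>N. minimal_position c N (b N) (j N)"
    and desc: "\<And>N. \<sigma> (b (Suc N)) = p N @ [b N] @ s N" "\<And>N. j (Suc N) = length (WW N (p N)) + j N"
    and per: "K > 0" "\<And>N. N \<ge> N0 \<Longrightarrow> b (N + K) = b N \<and> p (N + K) = p N"
  shows False
proof -
  define e where "e = b N0"
  define z where "z N = wv (take (j N) (W N (b N)))" for N
  have jl: "j N < length (W N (b N))" for N using min[of N] unfolding minimal_position_def by blast
  have z_Suc: "z (Suc N) = z N + \<beta> ^ N * wv (p N)" for N
    unfolding z_def desc(2) W_split(2)[OF desc(1) jl] using eigen_WW[OF v_eigen, of N "p N"] by simp
  have z_add: "z (N + n) = z N + \<beta> ^ N * (\<Sum>i<n. \<beta> ^ i * wv (p (N + i)))" for N n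
    by (induction n) (auto simp: z_Suc power_add algebra_simps)
  have perM: "b (N0 + K * M) = e \<and> (\<forall>i. p (N0 + K * M + i) = p (N0 + i))" for M
  proof (induction M)
    case 0
    then show ?case unfolding e_def by simp
  next
    case (Suc M)
    have "b (N0 + K * M + K) = b (N0 + K * M)" "p (N0 + K * M + i + K) = p (N0 + K * M + i)" for i using per(2) by auto
    moreover have "N0 + K * Suc M = N0 + K * M + K" "N0 + K * Suc M + i = N0 + K * M + i + K" for i by auto
    ultimately show ?case using Suc by metis
  qed
  define Q where "Q = (\<Sum>i<K. \<beta> ^ i * wv (p (N0 + i)))"
  have bK: "\<beta> ^ K - 1 \<noteq> 0" using nonreal[OF per(1)] by (metis diff_eq_diff_eq diff_zero one_complex.simps(2) right_minus_eq)
  \<comment> \<open>One period adds \<open>\<beta>^N * Q\<close> to the prefix value. For the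
    solution of \<open>zs + Q = \<beta>^K * zs\<close> the difference from
    \<open>\<beta>^N * zs\<close> therefore stays equal to \<open>D\<close>.\<close>
  define zs where "zs = Q / (\<beta> ^ K - 1)"
  have zsQ: "zs + Q = \<beta> ^ K * zs" using bK unfolding zs_def by (simp add: field_simps)
  define D where "D = z N0 - \<beta> ^ N0 * zs"
  have zM: "z (N0 + K * M) = D + \<beta> ^ (N0 + K * M) * zs" for M
  proof (induction M)
    case 0
    then show ?case unfolding D_def by simp
  next
    case (Suc M)
    have "z (N0 + K * Suc M) = z (N0 + K * M) + \<beta> ^ (N0 + K * M) * Q"
      using z_add[of "N0 + K * M" K] perM[of M] unfolding Q_def by (simp add: add.commute add.left_commute)
    also have "\<dots> = D + \<beta> ^ (N0 + K * M) * (zs + Q)" unfolding Suc by (simp add: algebra_simps)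
    also have "\<dots> = D + \<beta> ^ (N0 + K * Suc M) * zs" unfolding zsQ by (simp add: power_add mult_ac)
    finally show ?case .
  qed
  have all_eq: "zeta x = zs" if x: "x \<in> S e" for x
  proof -
    define C where "C = norm c * CF + norm (c * D)"
    have C0: "C \<ge> 0" unfolding C_def using CF_nonneg by simp
    define g where "g = c * \<beta> ^ N0 * (zeta x - zs)"
    define \<omega> where "\<omega> = (\<beta> / norm \<beta>) ^ K"
    have wK: "\<omega> * of_real (norm \<beta> ^ K) = \<beta> ^ K" unfolding \<omega>_def using beta_nz by (simp add: power_divide)
    have "g = 0"
    proof (rule rotation_bounded_below[of \<omega> "q ^ K" C])
      show "norm \<omega> = 1" unfolding \<omega>_def using beta_nz by (simp add: norm_power norm_divide)
      have "\<omega> = \<beta> ^ K * of_real (inverse (norm \<beta> ^ K))" using wK beta_nz by (simp add: field_simps)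
      then have "Im \<omega> = Im (\<beta> ^ K) * inverse (norm \<beta> ^ K)"
        by (simp only: times_complex.sel Re_complex_of_real Im_complex_of_real)
      then show "Im \<omega> \<noteq> 0" using nonreal[OF per(1)] beta_nz by simp
      show "0 < q ^ K" "q ^ K < 1" using q per(1) by (auto simp: power_less_one_iff)
      \<comment> \<open>Minimality bounds the comparison with \<open>x\<close> below by the constant
        \<open>- C\<close>. Division by \<open>norm \<beta>^(K * M)\<close> makes this bound decay
        while \<open>g\<close> is turned by \<open>\<omega>^M\<close>.\<close>
      show "- (C * (q ^ K) ^ M) \<le> Re (\<omega> ^ M * g)" for M
      proof -
        define N where "N = N0 + K * M"
        have mN: "minimal_position c N e (j N)" using min[of N] perM[of M] unfolding N_def by simp
        obtain y where y: "y \<in> S e" "\<beta> ^ N * zeta y = wv (take (j N) (W N e))"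
          using position_expansion[of "j N" N e] mN unfolding minimal_position_def by blast
        have zN: "wv (take (j N) (W N e)) = D + \<beta> ^ N * zs" using zM[of M] perM[of M] unfolding z_def N_def by simp
        have "Re (c * \<beta> ^ N * zeta y) \<le> Re (c * \<beta> ^ N * zeta x) + norm c * CF"
          using minimal_near_extreme[OF mN y(2) x] .
        moreover have "c * \<beta> ^ N * zeta y = c * D + c * \<beta> ^ N * zs" using y(2) zN by (simp add: algebra_simps)
        moreover have "c * \<beta> ^ N * zeta x - c * \<beta> ^ N * zs = of_real (norm \<beta> ^ (K * M)) * (\<omega> ^ M * g)"
        proof -
          have "\<beta> ^ (K * M) = of_real (norm \<beta> ^ (K * M)) * \<omega> ^ M"
            unfolding power_mult wK[symmetric] by (simp add: power_mult_distrib mult.commute)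
          then show ?thesis unfolding N_def g_def power_add by (simp add: algebra_simps)
        qed
        moreover have "- norm (c * D) \<le> Re (c * D)" using abs_Re_le_cmod[of "c * D"] by linarith
        moreover have "Re (of_real (norm \<beta> ^ (K * M)) * (\<omega> ^ M * g)) = norm \<beta> ^ (K * M) * Re (\<omega> ^ M * g)"
          unfolding scaleR_conv_of_real[symmetric] by simp
        moreover have "Re (c * \<beta> ^ N * zeta x - c * \<beta> ^ N * zs) = Re (c * \<beta> ^ N * zeta x) - Re (c * \<beta> ^ N * zs)" by simp
        moreover have "Re (c * D + c * \<beta> ^ N * zs) = Re (c * D) + Re (c * \<beta> ^ N * zs)" by simp
        ultimately have "- C \<le> norm \<beta> ^ (K * M) * Re (\<omega> ^ M * g)" unfolding C_def by (smt (verit))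
        then have "q ^ (K * M) * (- C) \<le> q ^ (K * M) * (norm \<beta> ^ (K * M) * Re (\<omega> ^ M * g))"
          using q(1) by (intro mult_left_mono) auto
        moreover have "q ^ (K * M) * norm \<beta> ^ (K * M) = 1" unfolding q_def using beta_nz by (simp add: power_mult_distrib[symmetric])
        ultimately show ?thesis by (simp add: power_mult mult.assoc[symmetric] mult.commute)
      qed
    qed (rule C0)
    then show ?thesis unfolding g_def using c beta_nz by simp
  qed
  obtain x y where xy: "x \<in> S e" "y \<in> S e" "x \<noteq> y" using two_expansions by blast
  \<comment> \<open>When all values agree, every expansion represents an extreme point in the
    direction 1.\<close>
  have "x = y" by (rule urp_unique[of 1 x e y]) (use xy all_eq in auto)
  then show False using xy(3) by simp
qed

text \<open>Minimal positions remain minimal in the subword of the level below, so compatible ones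
  exist by \<open>inverse_limit\<close>, and their floors nest down to a point \<open>t0\<close>.
  Infinitely many nonempty \<open>p N\<close> and \<open>s N\<close> are what lets the orbit of
  \<open>t0\<close> be controlled backwards and forwards. Each failure makes the addresses
  eventually periodic and contradicts \<open>no_periodic_tail\<close>.\<close>

lemma minimal_center:
  assumes c: "c \<noteq> 0"
  obtains t0 b j p s where "\<And>N. minimal_position c N (b N) (j N)"
    "\<And>N. \<sigma> (b (Suc N)) = p N @ [b N] @ s N" "\<And>N. j (Suc N) = length (WW N (p N)) + j N"
    "\<And>N. t0 \<in> flr N (b N) (j N)" "\<And>N0. \<exists>N\<ge>N0. p N \<noteq> []" "\<And>N0. \<exists>N\<ge>N0. s N \<noteq> []"
proof -
  define P where "P N = {(b, j). minimal_position c N b j}" for N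
  define R where "R N x y \<longleftrightarrow> (\<exists>p s. \<sigma> (fst y) = p @ [fst x] @ s \<and> snd y = length (WW N p) + snd x)" for N and x y :: "'a \<times> nat"
  obtain bj where bj: "\<And>N. bj N \<in> P N" "\<And>N. R N (bj N) (bj (Suc N))"
  proof (rule inverse_limit[of P R])
    show "finite (P N)" for N
      by (rule finite_subset[OF _ finite_positions[of N]]) (auto simp: P_def minimal_position_def)
    show "P N \<noteq> {}" for N unfolding P_def using minimal_position_ex by auto
    fix N y assume "y \<in> P (Suc N)"
    then obtain b' j' where y: "y = (b', j')" "minimal_position c (Suc N) b' j'" unfolding P_def by auto
    then have "j' < length (WW N (\<sigma> b'))" unfolding minimal_position_def by simp
    then obtain p b s i where sp: "\<sigma> b' = p @ [b] @ s" "j' = length (WW N p) + i" "i < length (W N b)"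
      by (rule concat_map_split)
    then have "minimal_position c N b i" using minimal_position_descend y(2) by blast
    then show "\<exists>x\<in>P N. R N x y" unfolding P_def R_def y(1) using sp by (intro bexI[of _ "(b, i)"]) auto
  qed blast
  define b j where "b N = fst (bj N)" and "j N = snd (bj N)" for N
  have min: "minimal_position c N (b N) (j N)" for N using bj(1)[of N] unfolding P_def b_def j_def by auto
  obtain p s where desc: "\<And>N. \<sigma> (b (Suc N)) = p N @ [b N] @ s N" "\<And>N. j (Suc N) = length (WW N (p N)) + j N"
    using bj(2) unfolding R_def b_def j_def by metis
  have jl: "j N < length (W N (b N))" for N using min[of N] unfolding minimal_position_def by blast
  have no_per: False if "K > 0" "\<And>N. N \<ge> N0 \<Longrightarrow> b (N + K) = b N \<and> p (N + K) = p N" for K N0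
    using no_periodic_tail[OF c min desc that] .
  define m where "m N = length (p N)" for N
  have m: "m N < length (\<sigma> (b (Suc N)))" "\<sigma> (b (Suc N)) ! m N = b N" "p N = take (m N) (\<sigma> (b (Suc N)))" for N
    unfolding m_def desc(1) by auto
  define x where "x N = (T ^^ j N) (\<alpha> ^ N * lft (b N))" for N
  define y where "y N = x N + \<alpha> ^ N * wid (b N)" for N
  have fl: "flr N (b N) (j N) = {x N..<y N}" for N unfolding flr_def x_def y_def by simp
  have step: "(T ^^ j (Suc N)) (\<alpha> ^ Suc N * u) = (T ^^ j N) (\<alpha> ^ N * (T ^^ m N) (\<alpha> * u)) \<and> (T ^^ m N) (\<alpha> * u) \<in> I (b N)"
    if u: "u \<in> I (b (Suc N))" for u N
  proof -
    have uU: "\<alpha> * u \<in> unit_ico" using u I_sub scale_U1 by blast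
    have it: "itin (m N) (\<alpha> * u) = p N"
      using itin_tower_take[OF u, of "m N" 1] m[of N] by simp
    have "(T ^^ length (WW N (p N))) (\<alpha> ^ N * (\<alpha> * u)) = \<alpha> ^ N * (T ^^ m N) (\<alpha> * u)"
      using level[OF uU, of N "m N"] it by simp
    then have "(T ^^ j (Suc N)) (\<alpha> ^ N * (\<alpha> * u)) = (T ^^ j N) (\<alpha> ^ N * (T ^^ m N) (\<alpha> * u))"
      unfolding desc(2) funpow_add_app by simp
    moreover have "ltr ((T ^^ m N) (\<alpha> * u)) = b N" using itin_tower[OF u, of "m N" 1] m[of N] by simp
    then have "(T ^^ m N) (\<alpha> * u) \<in> I (b N)" using ltr_I[OF Tn_U[OF uU]] by metis
    ultimately show ?thesis by (simp add: mult_ac)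
  qed
  have nested: "{x (Suc N)..<y (Suc N)} \<subseteq> {x N..<y N}" for N
  proof
    fix t assume "t \<in> {x (Suc N)..<y (Suc N)}"
    then obtain u where "u \<in> I (b (Suc N))" "t = (T ^^ j (Suc N)) (\<alpha> ^ Suc N * u)"
      using in_flr_iff[of "j (Suc N)" "Suc N" "b (Suc N)" t] jl[of "Suc N"] unfolding fl[symmetric] by auto
    then show "t \<in> {x N..<y N}"
      using step[of u N] in_flr_iff[of "j N" N "b N" t] jl[of N] unfolding fl[symmetric] by auto
  qed
  have xy: "x N < y N" for N unfolding y_def using wid_pos alpha by simp
  have inc: "x N \<le> x (Suc N)" "y (Suc N) \<le> y N" for N
    using nested[of N] xy[of "Suc N"] by (auto simp: atLeastLessThan_subset_iff)
  have x_mono: "x M \<le> x N" and y_mono: "y N \<le> y M" if "M \<le> N" for M N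
    using lift_Suc_mono_le[of x M N] lift_Suc_antimono_le[of y M N] inc that by auto
  have x_le_y: "x M \<le> y N" for M N
    using x_mono[of M "max M N"] y_mono[of N "max M N"] xy[of "max M N"] by simp
  define t0 where "t0 = Sup (range x)"
  have t0: "x N \<le> t0" "t0 \<le> y N" for N
    unfolding t0_def using x_le_y by (auto intro!: cSup_upper cSup_least bdd_aboveI2[of _ _ "y 0"])
  \<comment> \<open>Floors are half open, so the left ends could converge to a common right end.
    From then on each floor ends where its predecessor does. The floor ending at the right end of a
    letter interval is unique, so \<open>b N\<close> determines \<open>b (Suc N)\<close> and
    \<open>p N\<close>, and a repeated letter makes the tail periodic.\<close>
  have "t0 < y N" for N
  proof (rule ccontr)
    assume "\<not> t0 < y N"
    then have const: "y M = y N" if "M \<ge> N" for M using t0(2)[of M] y_mono[OF that] by simp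
    have align: "floor_right (b (Suc M), m M) = rgt (b M)" if "M \<ge> N" for M
    proof -
      define u where "u = lft (b (Suc M))"
      have u: "u \<in> I (b (Suc M))" unfolding u_def by (rule lft_in_I)
      define Pt where "Pt = (T ^^ m M) (\<alpha> * u)"
      have Pt: "Pt \<in> I (b M)" "x (Suc M) = (T ^^ j M) (\<alpha> ^ M * Pt)"
        using step[OF u] unfolding Pt_def x_def u_def by auto
      have "x (Suc M) = x M + \<alpha> ^ M * (Pt - lft (b M))"
        using floor_translation[OF Pt(1), of "j M" M] jl[of M] Pt(2) unfolding x_def[of M] by simp
      then have "x M + \<alpha> ^ M * (Pt - lft (b M)) + \<alpha> ^ Suc M * wid (b (Suc M)) = x M + \<alpha> ^ M * wid (b M)"
        using const[of "Suc M"] const[of M] that unfolding y_def by simp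
      then have "\<alpha> ^ M * (Pt - lft (b M) + \<alpha> * wid (b (Suc M))) = \<alpha> ^ M * wid (b M)" by (simp add: algebra_simps)
      then have "Pt - lft (b M) + \<alpha> * wid (b (Suc M)) = wid (b M)" using alpha by simp
      then show ?thesis unfolding floor_right_def Pt_def u_def by simp
    qed
    have det: "i = i'" if "i \<in> floors_in d" "i' \<in> floors_in d" "floor_right i = rgt d" "floor_right i' = rgt d" for i i' d
    proof (rule ccontr)
      assume "i \<noteq> i'"
      then have "{floor_left i..<floor_right i} \<inter> {floor_left i'..<floor_right i'} = {}"
        using letter_partition(2)[of d] that unfolding disjoint_family_on_def by blast
      moreover have "max (floor_left i) (floor_left i') \<in> {floor_left i..<floor_right i} \<inter> {floor_left i'..<floor_right i'}"
        using floor_less[of i] floor_less[of i'] that by auto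
      ultimately show False by blast
    qed
    have fin: "(b (Suc M), m M) \<in> floors_in (b M)" for M unfolding floors_in_def using m by simp
    have "\<not> inj_on b {N..}" using finite_imageD[of b "{N..}"] infinite_Ici by (metis finite finite_subset subset_UNIV)
    then obtain M M' where MM: "M \<ge> N" "M < M'" "b M = b M'"
      unfolding inj_on_def by (metis atLeast_iff linorder_neqE_nat)
    define K where "K = M' - M"
    have same: "(b (Suc (M + i + K)), m (M + i + K)) = (b (Suc (M + i)), m (M + i))" if "b (M + i + K) = b (M + i)" for i
      by (rule det[of _ "b (M + i)"])
         (use fin[of "M + i + K"] fin[of "M + i"] align[of "M + i + K"] align[of "M + i"] that MM(1) in simp_all)
    have bK: "b (M + i + K) = b (M + i)" for i
    proof (induction i)
      case 0
      then show ?case using MM unfolding K_def by simp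
    next
      case (Suc i)
      then show ?case using same[of i] by simp
    qed
    have pK: "p (M + i + K) = p (M + i)" for i
      using same[OF bK[of i]] m(3) by simp
    show False
    proof (rule no_per[of K M])
      show "K > 0" using MM unfolding K_def by simp
      show "b (N + K) = b N \<and> p (N + K) = p N" if "N \<ge> M" for N
        using bK[of "N - M"] pK[of "N - M"] that by simp
    qed
  qed
  then have t0fl: "t0 \<in> flr N (b N) (j N)" for N using t0 unfolding fl by simp
  obtain u where u: "\<And>N. u N \<in> I (b N)" "\<And>N. t0 = (T ^^ j N) (\<alpha> ^ N * u N)"
  proof -
    have "\<exists>u\<in>I (b N). t0 = (T ^^ j N) (\<alpha> ^ N * u)" for N
      using in_flr_iff[of "j N" N "b N" t0] jl[of N] t0fl[of N] by simp
    then show thesis using that by metis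
  qed
  have uU: "u N \<in> unit_ico" for N using u(1) I_sub by blast
  have squeeze: "d = 0" if "\<And>N. N \<ge> N0 \<Longrightarrow> d \<in> {0..<\<alpha> ^ N}" for d N0
  proof (rule ccontr)
    assume "d \<noteq> 0"
    then have "d > 0" using that[of N0] by auto
    then obtain N where "\<alpha> ^ N < d" using exists_small_pow by blast
    then have "\<alpha> ^ max N N0 < d" using alpha_pow_mono[of N "max N N0"] by simp
    then show False using that[of "max N N0"] by auto
  qed
  \<comment> \<open>Otherwise the climb to \<open>t0\<close> has constant length, so its base point
    is constant. It lies in every \<open>[0, \<alpha>^N)\<close>, hence is 0, and all further
    letters are that of 0.\<close>
  have p_inf: "\<exists>N\<ge>N0. p N \<noteq> []" for N0
  proof (rule ccontr)
    assume "\<not> ?thesis"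
    then have p0: "p N = []" if "N \<ge> N0" for N using that by blast
    have jc: "j (N0 + n) = j N0" for n by (induction n) (auto simp: desc(2) p0)
    have base: "\<alpha> ^ (N0 + n) * u (N0 + n) = \<alpha> ^ N0 * u N0" for n
      using u(2)[of "N0 + n"] u(2)[of N0] Tn_inj[OF scale_U'[OF uU] scale_U'[OF uU]] jc[of n] by metis
    have "\<alpha> ^ N0 * u N0 = 0"
      by (rule squeeze[of N0]) (metis base le_add_diff_inverse scale_U uU)
    then have "u (N0 + n) = 0" for n using base[of n] alpha by simp
    then have "b N = ltr 0" if "N \<ge> N0" for N using ltr_eq[OF u(1)[of N]] that by (metis le_add_diff_inverse)
    then show False using no_per[of 1 N0] p0 by simp
  qed
  \<comment> \<open>Otherwise the remaining height above \<open>t0\<close> is constant, and leaving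
    the tower leads to the same point at every level, hence to 0. Then \<open>u N\<close> is the
    preimage of 0, so the letters are constant and \<open>p N\<close> is \<open>\<sigma>\<close> of
    that letter without its last entry.\<close>
  have s_inf: "\<exists>N\<ge>N0. s N \<noteq> []" for N0
  proof (rule ccontr)
    assume "\<not> ?thesis"
    then have s0: "s N = []" if "N \<ge> N0" for N using that by blast
    define h where "h N = length (W N (b N)) - j N" for N
    have h: "length (W N (b N)) = j N + h N" for N using jl[of N] unfolding h_def by simp
    have hc: "h (N0 + n) = h N0" for n
    proof (induction n)
      case (Suc n)
      have "W (Suc (N0 + n)) (b (Suc (N0 + n))) = WW (N0 + n) (p (N0 + n)) @ W (N0 + n) (b (N0 + n))"
        using desc(1)[of "N0 + n"] s0[of "N0 + n"] by simp
      then have "h (Suc (N0 + n)) = h (N0 + n)" unfolding h_def desc(2) by simp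
      then show ?case using Suc by simp
    qed simp
    have top: "(T ^^ h N) t0 = \<alpha> ^ N * T (u N)" for N
      using level_letter(1)[OF u(1)[of N], of N] unfolding h funpow_add_app u(2)[of N, symmetric] .
    have "(T ^^ h N0) t0 = 0"
      by (rule squeeze[of N0]) (metis hc top le_add_diff_inverse scale_U T_U uU)
    then have T0: "T (u N) = 0" if "N \<ge> N0" for N using top[of N] hc[of "N - N0"] that alpha by auto
    have uc: "u N = u N0" if "N \<ge> N0" for N using T_inj[OF uU[of N] uU[of N0]] T0[OF that] T0[OF order_refl] by simp
    have bc: "b N = b N0" if "N \<ge> N0" for N using I_disjoint[OF u(1)[of N]] u(1)[of N0] uc[OF that] by metis
    have pc: "p N = butlast (\<sigma> (b N0))" if "N \<ge> N0" for N
      using desc(1)[of N] s0[OF that] bc[of "Suc N"] that by simp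
    show False
    proof (rule no_per[of 1 N0])
      show "b (N + 1) = b N \<and> p (N + 1) = p N" if "N \<ge> N0" for N
        using bc[of N] bc[of "N + 1"] pc[of N] pc[of "N + 1"] that by simp
    qed simp
  qed
  show ?thesis using that[OF min desc t0fl p_inf s_inf] .
qed

end

subsection \<open>Summable weights along an orbit\<close>

context interval_exchange
begin

lemma two_sided_orbit:
  assumes t: "t \<in> unit_ico"
  obtains X :: "int \<Rightarrow> real" where "X 0 = t" "\<And>n. X n \<in> unit_ico" "\<And>n. X (n + 1) = T (X n)"
proof -
  have "\<forall>k. \<exists>s. s \<in> unit_ico \<and> (T ^^ k) s = t" using Tn_surj[OF t] by blast
  then obtain B where B: "\<And>k. B k \<in> unit_ico" "\<And>k. (T ^^ k) (B k) = t" by metis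
  define X where "X n = (if n \<ge> 0 then (T ^^ nat n) t else B (nat (- n)))" for n :: int
  have "X (n + 1) = T (X n)" for n
  proof (cases "n \<ge> 0")
    case True
    then show ?thesis unfolding X_def by (simp add: nat_add_distrib)
  next
    case False
    define k where "k = nat (- n - 1)"
    have n: "n = - int (Suc k)" using False unfolding k_def by simp
    have "(T ^^ k) (T (B (Suc k))) = t" using B(2)[of "Suc k"] by (simp add: funpow_Suc_right del: funpow.simps)
    then have "T (B (Suc k)) = B k" using Tn_inj[OF T_U[OF B(1)[of "Suc k"]] B(1)[of k], of k] B(2)[of k] by simp
    moreover have "X (n + 1) = B k"
    proof (cases k)
      case 0
      then show ?thesis using n B(2)[of 0] unfolding X_def by simp
    next
      case (Suc i)
      then show ?thesis using n unfolding X_def by (simp add: nat_add_distrib)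
    qed
    moreover have "X n = B (Suc k)" using n unfolding X_def by (simp add: nat_add_distrib)
    ultimately show ?thesis by simp
  qed
  moreover have "X n \<in> unit_ico" for n using B(1) Tn_U[OF t] unfolding X_def by simp
  moreover have "X 0 = t" unfolding X_def by simp
  ultimately show ?thesis using that by blast
qed

lemma orbit_funpow:
  assumes "\<And>n::int. X (n + 1) = T (X n)"
  shows "(T ^^ k) (X n) = X (n + int k)"
proof (induction k)
  case (Suc k)
  then show ?case using assms[of "n + int k"] by (simp add: algebra_simps)
qed simp

end

text \<open>Since \<open>r^N / 2\<close> outgrows \<open>N * ln (2 * A)\<close>, the terms are
  eventually below \<open>(1 / 2)^N\<close>.\<close>

lemma summable_exp_growth:
  fixes A r :: real
  assumes "A > 0" "r > 1"
  shows "summable (\<lambda>N. A ^ N * exp (- (r ^ N / 2)))"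
proof (rule summable_comparison_test_ev[of _ "\<lambda>N. (1 / 2) ^ N"])
  define L where "L = ln (2 * A)"
  have "(\<lambda>N. real N * (1 / r) ^ N) \<longlonglongrightarrow> 0"
    using powser_times_n_limit_0[of "1 / r"] assms by simp
  then have "(\<lambda>N. (2 * \<bar>L\<bar> + 1) * (real N * (1 / r) ^ N)) \<longlonglongrightarrow> (2 * \<bar>L\<bar> + 1) * 0" by (intro tendsto_intros)
  from order_tendstoD(2)[OF this, of 1]
  have "eventually (\<lambda>N. (2 * \<bar>L\<bar> + 1) * (real N * (1 / r) ^ N) < 1) sequentially" by simp
  then show "eventually (\<lambda>N. norm (A ^ N * exp (- (r ^ N / 2))) \<le> (1 / 2) ^ N) sequentially"
  proof eventually_elim
    case (elim N)
    have "r ^ N * (1 / r) ^ N = 1" using assms by (simp add: power_mult_distrib[symmetric])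
    moreover have "r ^ N * ((2 * \<bar>L\<bar> + 1) * (real N * (1 / r) ^ N)) \<le> r ^ N * 1"
      using elim assms by (intro mult_left_mono) auto
    moreover have "r ^ N * ((2 * \<bar>L\<bar> + 1) * (real N * (1 / r) ^ N)) = ((2 * \<bar>L\<bar> + 1) * real N) * (r ^ N * (1 / r) ^ N)"
      by (simp only: mult_ac)
    ultimately have "(2 * \<bar>L\<bar> + 1) * real N \<le> r ^ N" by simp
    moreover have "real N * (2 * L) \<le> real N * (2 * \<bar>L\<bar> + 1)" by (intro mult_left_mono) auto
    ultimately have "real N * L \<le> r ^ N / 2" by (simp add: algebra_simps)
    then have "exp (real N * L) * exp (- (r ^ N / 2)) \<le> 1" unfolding exp_add[symmetric] by simp
    moreover have "exp (real N * L) = (2 * A) ^ N" unfolding L_def using assms exp_of_nat_mult[of N "ln (2 * A)"] by simp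
    ultimately have "2 ^ N * (A ^ N * exp (- (r ^ N / 2))) \<le> 1" by (simp add: power_mult_distrib mult.assoc)
    then show ?case using assms by (simp add: power_one_over field_simps)
  qed
  show "summable (\<lambda>N. (1 / 2 :: real) ^ N)" by (rule summable_geometric) simp
qed

context complex_eigen
begin

text \<open>Times are sorted by the first level whose tower around \<open>t0\<close> contains them.
  A time entering at level \<open>N\<close> has an address whose first symbol differs from that of
  \<open>t0\<close>, so its weight is at most \<open>exp (- r^N / 2)\<close> for large
  \<open>N\<close>, while the tower height bounds the number of such times by a multiple of
  \<open>\<alpha>^(-N)\<close>.\<close>

lemma summable_weights:
  assumes gen: "generic_direction c" and c: "c \<noteq> 0"
  obtains X :: "int \<Rightarrow> real" and \<omega> :: "int \<Rightarrow> real" where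
    "\<And>n. X n \<in> unit_ico" "\<And>n. X (n + 1) = T (X n)" "inj X"
    "\<And>u w. 0 \<le> u \<Longrightarrow> u < w \<Longrightarrow> w \<le> 1 \<Longrightarrow> \<exists>n. u < X n \<and> X n < w"
    "\<And>n. \<omega> n > 0" "\<And>n. \<omega> (n + 1) = exp (- Re (c * v $ ltr (X n))) * \<omega> n" "\<omega> summable_on UNIV"
proof -
  obtain t0 b j p s where ctr: "\<And>N. minimal_position c N (b N) (j N)"
    "\<And>N. \<sigma> (b (Suc N)) = p N @ [b N] @ s N" "\<And>N. j (Suc N) = length (WW N (p N)) + j N"
    "\<And>N. t0 \<in> flr N (b N) (j N)" "\<And>N0. \<exists>N\<ge>N0. p N \<noteq> []" "\<And>N0. \<exists>N\<ge>N0. s N \<noteq> []"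
    using minimal_center[OF c] by metis
  have jl: "j N < length (W N (b N))" for N using ctr(1)[of N] unfolding minimal_position_def by blast
  have "\<exists>u\<in>I (b N). t0 = (T ^^ j N) (\<alpha> ^ N * u)" for N
    using in_flr_iff[of "j N" N "b N" t0] jl[of N] ctr(4)[of N] by simp
  then obtain u where u: "\<And>N. u N \<in> I (b N)" "\<And>N. t0 = (T ^^ j N) (\<alpha> ^ N * u N)" by metis
  have uU: "u N \<in> unit_ico" for N using u(1) I_sub by blast
  have t0U: "t0 \<in> unit_ico" using u(2)[of 0] Tn_U[OF scale_U'[OF uU[of 0]]] by metis
  obtain X :: "int \<Rightarrow> real" where X: "X 0 = t0" "\<And>n. X n \<in> unit_ico" "\<And>n. X (n + 1) = T (X n)"
    using two_sided_orbit[OF t0U] by blast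
  note Xn = orbit_funpow[of X, OF X(3)]
  have base: "X (- int (j N)) = \<alpha> ^ N * u N" for N
  proof (rule Tn_inj[OF X(2) scale_U'[OF uU]])
    show "(T ^^ j N) (X (- int (j N))) = (T ^^ j N) (\<alpha> ^ N * u N)" using Xn[of "j N" "- int (j N)"] X(1) u(2)[of N] by simp
  qed
  define h where "h N = length (W N (b N)) - j N" for N
  have h: "length (W N (b N)) = j N + h N" for N using jl[of N] unfolding h_def by simp
  have h_Suc: "h (Suc N) = h N + length (WW N (s N))" for N
    using h[of "Suc N"] h[of N] unfolding ctr(3) by (simp add: ctr(2))
  have mono: "j M \<le> j N" "h M \<le> h N" if "M \<le> N" for M N
    using lift_Suc_mono_le[of j M N] lift_Suc_mono_le[of h M N] that by (simp_all add: ctr(3) h_Suc)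
  have j_unb: "\<exists>N. k \<le> j N" for k
  proof (induction k)
    case (Suc k)
    then obtain N where N: "k \<le> j N" by blast
    obtain M where M: "M \<ge> N" "p M \<noteq> []" using ctr(5) by blast
    have "length (WW M (p M)) \<ge> 1" using length_WW_ge[of "p M" M] M(2) by (cases "p M") auto
    then have "Suc k \<le> j (Suc M)" using ctr(3)[of M] mono(1)[OF M(1)] N by simp
    then show ?case by blast
  qed simp
  have h_unb: "\<exists>N. k \<le> h N" for k
  proof (induction k)
    case (Suc k)
    then obtain N where N: "k \<le> h N" by blast
    obtain M where M: "M \<ge> N" "s M \<noteq> []" using ctr(6) by blast
    have "length (WW M (s M)) \<ge> 1" using length_WW_ge[of "s M" M] M(2) by (cases "s M") auto
    then have "Suc k \<le> h (Suc M)" using h_Suc[of M] mono(2)[OF M(1)] N by simp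
    then show ?case by blast
  qed simp
  have injX: "X m \<noteq> X n" if "m < n" for m n
    using Xn[of "nat (n - m)" m] aperiodic[OF X(2), of "nat (n - m)" m] that by simp
  \<comment> \<open>The Birkhoff sum along the orbit relative to time 0, with the sign at negative
    times chosen so that \<open>G_Suc\<close> holds throughout.\<close>
  define G where "G n = (if n \<ge> 0 then wv (itin (nat n) t0) else - wv (itin (nat (- n)) (X n)))" for n
  have G_Suc: "G (n + 1) = G n + v $ ltr (X n)" for n
  proof (cases "n \<ge> 0")
    case True
    then have "X n = (T ^^ nat n) t0" using Xn[of "nat n" 0] X(1) by simp
    then show ?thesis using True unfolding G_def by (simp add: nat_add_distrib itin_Suc)
  next
    case False
    define k where "k = nat (- n - 1)"
    have n: "n = - int (Suc k)" using False unfolding k_def by simp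
    have "itin (Suc k) (X n) = ltr (X n) # itin k (X (n + 1))"
      using itin_add[of 1 k "X n"] X(3)[of n] by (simp add: itin_Suc)
    moreover have "G (n + 1) = - wv (itin k (X (n + 1)))" unfolding G_def n by auto
    moreover have "G n = - wv (itin (Suc k) (X n))" unfolding G_def n by (simp add: nat_add_distrib)
    ultimately show ?thesis by simp
  qed
  have G_add: "G (n + int k) = G n + wv (itin k (X n))" for n k
  proof (induction k)
    case (Suc k)
    have "G (n + int (Suc k)) = G (n + int k + 1)" by (simp add: algebra_simps)
    also have "\<dots> = G (n + int k) + v $ ltr (X (n + int k))" by (rule G_Suc)
    finally show ?case using Suc Xn[of k n] by (simp add: itin_Suc)
  qed simp
  have G_tower: "G n = wv (take i (W N (b N))) - wv (take (j N) (W N (b N)))"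
    if i: "int i = int (j N) + n" "i \<le> length (W N (b N))" for n i N
  proof -
    have it: "itin k (X (- int (j N))) = take k (W N (b N))" if "k \<le> length (W N (b N))" for k
      unfolding base using itin_tower_take[OF u(1) that] .
    have "n = - int (j N) + int i" using i(1) by simp
    then have "G n = G (- int (j N)) + wv (take i (W N (b N)))" using G_add[of "- int (j N)" i] it[OF i(2)] by simp
    moreover have "G 0 = G (- int (j N)) + wv (take (j N) (W N (b N)))"
      using G_add[of "- int (j N)" "j N"] it[of "j N"] jl[of N] by simp
    moreover have "G 0 = 0" unfolding G_def by simp
    ultimately show ?thesis by (simp add: algebra_simps)
  qed
  define \<omega> where "\<omega> n = exp (- Re (c * G n))" for n
  have w_pos: "\<omega> n > 0" for n unfolding \<omega>_def by simp
  have w_Suc: "\<omega> (n + 1) = exp (- Re (c * v $ ltr (X n))) * \<omega> n" for n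
    unfolding \<omega>_def G_Suc exp_add[symmetric] by (simp add: algebra_simps)
  \<comment> \<open>The times at which the orbit climbs the tower of level \<open>N\<close> through
    \<open>t0\<close>.\<close>
  define E where "E N = {n::int. - int (j N) \<le> n \<and> n < int (h N)}" for N
  have E: "finite (E N)" "card (E N) = length (W N (b N))" for N
  proof -
    have "E N = {- int (j N)..<int (h N)}" unfolding E_def by auto
    then show "finite (E N)" "card (E N) = length (W N (b N))" using h[of N] by auto
  qed
  have E_cover: "\<exists>N. n \<in> E N" for n
  proof -
    obtain M where M: "nat (- n) \<le> j M" using j_unb by blast
    obtain N where N: "nat (n + 1) \<le> h N" using h_unb by blast
    have "n \<in> E (max M N)" using M N mono(1)[of M "max M N"] mono(2)[of N "max M N"] unfolding E_def by auto
    then show ?thesis by blast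
  qed
  define lev where "lev n = (LEAST N. n \<in> E N)" for n
  have lev: "n \<in> E (lev n)" "N < lev n \<Longrightarrow> n \<notin> E N" for n N
    unfolding lev_def using LeastI_ex[OF E_cover] not_less_Least by auto
  obtain N1 where N1: "\<And>N a x y. N \<ge> N1 \<Longrightarrow> x \<in> S a \<Longrightarrow> y \<in> S a \<Longrightarrow> x 0 \<noteq> y 0 \<Longrightarrow>
     (\<And>z. z \<in> S a \<Longrightarrow> Re (c * \<beta> ^ N * zeta x) \<le> Re (c * \<beta> ^ N * zeta z) + norm c * CF) \<Longrightarrow>
     Re (c * \<beta> ^ N * zeta x) + r ^ N / 2 \<le> Re (c * \<beta> ^ N * zeta y)"
    using gen unfolding generic_direction_def by (metis (no_types, lifting))
  have growth: "r ^ Suc N / 2 \<le> Re (c * G n)" if n: "lev n = Suc N" "Suc N \<ge> N1" for n N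
  proof -
    have nE: "n \<in> E (Suc N)" "n \<notin> E N" using lev(1)[of n] lev(2)[of N n] n(1) by auto
    define i where "i = nat (int (j (Suc N)) + n)"
    have i: "int i = int (j (Suc N)) + n" using nE(1) unfolding i_def E_def by auto
    have il: "i < length (W (Suc N) (b (Suc N)))" using i nE(1) h[of "Suc N"] unfolding E_def by auto
    then have "i < length (WW N (\<sigma> (b (Suc N))))" by simp
    then obtain p' d s' i' where sp: "\<sigma> (b (Suc N)) = p' @ [d] @ s'" "i = length (WW N p') + i'" "i' < length (W N d)"
      by (rule concat_map_split)
    \<comment> \<open>A common first symbol would place time \<open>n\<close> in the same subword of
      level \<open>N\<close> as \<open>t0\<close>, that is, already in \<open>E N\<close>.\<close>
    have neq: "(p N, b N, s N) \<noteq> (p', d, s')"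
    proof
      assume "(p N, b N, s N) = (p', d, s')"
      then have eq: "p' = p N" "d = b N" by auto
      then have "int i' = int (j N) + n" using i sp(2) ctr(3)[of N] by simp
      then have "n \<in> E N" using sp(3) h[of N] unfolding eq E_def by auto
      then show False using nE(2) by simp
    qed
    obtain x where x: "x \<in> S (b (Suc N))" "x 0 = (p N, b N, s N)"
      "\<beta> ^ Suc N * zeta x = wv (take (j (Suc N)) (W (Suc N) (b (Suc N))))"
      using position_expansion_Suc[OF ctr(2) jl] unfolding ctr(3) by blast
    obtain y where y: "y \<in> S (b (Suc N))" "y 0 = (p', d, s')"
      "\<beta> ^ Suc N * zeta y = wv (take i (W (Suc N) (b (Suc N))))"
      using position_expansion_Suc[OF sp(1,3)] unfolding sp(2) by blast
    have "Re (c * \<beta> ^ Suc N * zeta x) + r ^ Suc N / 2 \<le> Re (c * \<beta> ^ Suc N * zeta y)"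
      using N1[OF n(2) x(1) y(1)] x(2) y(2) neq minimal_near_extreme[OF ctr(1) x(3)] by simp
    moreover have "G n = \<beta> ^ Suc N * zeta y - \<beta> ^ Suc N * zeta x"
      unfolding x(3) y(3) using G_tower[OF i less_imp_le[OF il]] .
    then have "c * G n = c * \<beta> ^ Suc N * zeta y - c * \<beta> ^ Suc N * zeta x"
      by (simp only: right_diff_distrib mult.assoc)
    ultimately show ?thesis by simp
  qed
  define B where "B N = (\<Sum>n\<in>{n \<in> E N. lev n = N}. \<omega> n)" for N
  have B0: "B N \<ge> 0" for N unfolding B_def using w_pos by (intro sum_nonneg) (simp add: less_imp_le)
  define D where "D = Max (range (\<lambda>a. 1 / wid a))"
  have D: "real (length (W N a)) \<le> D * (1 / \<alpha>) ^ N" for N a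
  proof -
    have "1 / wid a \<le> D" unfolding D_def by (rule Max_ge) auto
    moreover have "real (length (W N a)) \<le> 1 / wid a * (1 / \<alpha>) ^ N"
      using length_W_bound[of N a] wid_pos[of a] alpha by (simp add: field_simps power_one_over)
    ultimately show ?thesis using alpha by (meson mult_right_mono order_trans zero_le_divide_1_iff zero_le_power less_imp_le)
  qed
  have B_bound: "B N \<le> D * ((1 / \<alpha>) ^ N * exp (- (r ^ N / 2)))" if N: "N \<ge> Suc N1" for N
  proof -
    obtain M where M: "N = Suc M" using N by (cases N) auto
    have "B N \<le> (\<Sum>n\<in>{n \<in> E N. lev n = N}. exp (- (r ^ N / 2)))"
      unfolding B_def \<omega>_def
    proof (rule sum_mono)
      fix n assume "n \<in> {n \<in> E N. lev n = N}"
      then have "r ^ N / 2 \<le> Re (c * G n)" using growth[of n M] M N by simp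
      then show "exp (- Re (c * G n)) \<le> exp (- (r ^ N / 2))" by (simp only: exp_le_cancel_iff neg_le_iff_le)
    qed
    also have "\<dots> = real (card {n \<in> E N. lev n = N}) * exp (- (r ^ N / 2))" by simp
    also have "\<dots> \<le> real (length (W N (b N))) * exp (- (r ^ N / 2))"
      using card_mono[OF E(1), of "{n \<in> E N. lev n = N}" N] E(2)[of N] by (intro mult_right_mono) auto
    also have "\<dots> \<le> D * (1 / \<alpha>) ^ N * exp (- (r ^ N / 2))" using D by (intro mult_right_mono) auto
    finally show ?thesis by (simp add: mult.assoc)
  qed
  have sumB: "summable B"
  proof (rule summable_comparison_test'[of _ "Suc N1"])
    show "summable (\<lambda>N. D * ((1 / \<alpha>) ^ N * exp (- (r ^ N / 2))))"
      using alpha r(1) by (intro summable_mult summable_exp_growth) auto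
  qed (use B_bound B0 in auto)
  have "\<omega> summable_on UNIV"
  proof (rule nonneg_bdd_above_summable_on)
    show "bdd_above (sum \<omega> ` {F. F \<subseteq> UNIV \<and> finite F})"
    proof (rule bdd_aboveI2)
      fix F :: "int set" assume "F \<in> {F. F \<subseteq> UNIV \<and> finite F}"
      then have F: "finite F" by simp
      define M where "M = Suc (Max (insert 0 (lev ` F)))"
      have "sum \<omega> F = (\<Sum>N\<in>{..<M}. \<Sum>n\<in>{n \<in> F. lev n = N}. \<omega> n)"
      proof (rule sum.group[symmetric, OF F])
        show "lev ` F \<subseteq> {..<M}" unfolding M_def using F by (auto simp: less_Suc_eq_le)
      qed simp
      also have "\<dots> \<le> (\<Sum>N<M. B N)"
        unfolding B_def
      proof (intro sum_mono sum_mono2)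
        show "{n \<in> F. lev n = N} \<subseteq> {n \<in> E N. lev n = N}" for N using lev(1) by blast
      qed (use E(1) w_pos in \<open>auto simp: less_imp_le\<close>)
      also have "\<dots> \<le> suminf B" by (rule sum_le_suminf[OF sumB]) (use B0 in auto)
      finally show "sum \<omega> F \<le> suminf B" .
    qed
  qed (use w_pos in \<open>simp add: less_imp_le\<close>)
  \<comment> \<open>The orbit climbs a level \<open>N\<close> tower over every letter, because the
    words of level \<open>K\<close> contain all letters, and each floor has length at most
    \<open>\<alpha>^N\<close>.\<close>
  moreover have "\<exists>n. x < X n \<and> X n < y" if xy: "0 \<le> x" "x < y" "y \<le> 1" for x y
  proof -
    obtain K where K: "\<forall>N\<ge>K. \<forall>a b. b \<in> set (W N a)" using primitive by blast
    define z where "z = (x + y) / 2"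
    have z: "x < z" "z < y" "z \<in> unit_ico" using xy unfolding z_def by auto
    obtain N where N: "\<alpha> ^ N < min (z - x) (y - z)" using exists_small_pow[of "min (z - x) (y - z)"] z by auto
    obtain a i w where w: "w \<in> I a" "i < length (W N a)" "z = (T ^^ i) (\<alpha> ^ N * w)" using towerE[OF z(3)] by metis
    obtain m where m: "m < length (W K (b (N + K)))" "W K (b (N + K)) ! m = a" using K by (metis in_set_conv_nth order_refl)
    define t where "t = (T ^^ m) (\<alpha> ^ K * u (N + K))"
    have tU: "t \<in> unit_ico" unfolding t_def by (intro Tn_U scale_U' uU)
    have "ltr t = a" unfolding t_def using itin_tower[OF u(1) m(1)] m(2) by simp
    then have tI: "t \<in> I a" using ltr_I[OF tU] by blast
    define L where "L = length (WW N (itin m (\<alpha> ^ K * u (N + K))))"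
    have "(T ^^ L) (\<alpha> ^ N * (\<alpha> ^ K * u (N + K))) = \<alpha> ^ N * t"
      using level[OF scale_U'[OF uU], of N m] unfolding L_def t_def by blast
    then have "(T ^^ (L + i)) (X (- int (j (N + K)))) = (T ^^ i) (\<alpha> ^ N * t)"
      unfolding base funpow_add_app by (simp add: power_add mult.assoc)
    then have Xt: "X (- int (j (N + K)) + int (L + i)) = (T ^^ i) (\<alpha> ^ N * t)" using Xn by metis
    have "\<bar>(T ^^ i) (\<alpha> ^ N * t) - z\<bar> = \<alpha> ^ N * \<bar>t - w\<bar>"
    proof -
      have "(T ^^ i) (\<alpha> ^ N * t) - z = \<alpha> ^ N * (t - w)"
        using floor_translation[OF tI, of i N] floor_translation[OF w(1), of i N] w(2,3) by (simp add: algebra_simps)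
      then show ?thesis using alpha by (simp add: abs_mult)
    qed
    also have "\<dots> \<le> \<alpha> ^ N * 1" using tU w(1) I_sub[of a] alpha by (intro mult_left_mono) (auto simp: abs_le_iff subset_iff)
    finally have "\<bar>(T ^^ i) (\<alpha> ^ N * t) - z\<bar> < min (z - x) (y - z)" using N by simp
    then show ?thesis unfolding Xt[symmetric] by (intro exI[of _ "- int (j (N + K)) + int (L + i)"]) (simp add: abs_less_iff)
  qed
  moreover have "inj X" using injX by (auto intro: linorder_injI)
  ultimately show ?thesis using that[of X \<omega>] X(2,3) w_pos w_Suc by blast
qed

end

section \<open>The affine interval exchange map\<close>

text \<open>
  The orbit is blown up: \<open>gap_sum t\<close> is the total weight of the orbit points to the left of \<open>t\<close>, its generalized
  inverse is the semi-conjugacy, and the points \<open>X n\<close> become intervals of length \<open>\<omega> n\<close>.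
\<close>

context interval_exchange
begin

context
  fixes X :: "int \<Rightarrow> real" and \<omega> :: "int \<Rightarrow> real" and l :: "'a \<Rightarrow> real"
  assumes XU: "\<And>n. X n \<in> unit_ico" and X_Suc: "\<And>n. X (n + 1) = T (X n)" and injX: "inj X"
    and denseX: "\<And>u w. 0 \<le> u \<Longrightarrow> u < w \<Longrightarrow> w \<le> 1 \<Longrightarrow> \<exists>n. u < X n \<and> X n < w"
    and w_pos: "\<And>n. \<omega> n > 0" and w_Suc: "\<And>n. \<omega> (n + 1) = l (ltr (X n)) * \<omega> n"
    and summable_w: "\<omega> summable_on UNIV" and l_pos: "\<And>a. l a > 0"
begin

section \<open>The probability measure carried by the orbit\<close>

definition mass :: "real set \<Rightarrow> real" where
  "mass A = infsum \<omega> {n. X n \<in> A} / infsum \<omega> UNIV"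

lemma summable_sub: "\<omega> summable_on A"
  using summable_w summable_on_subset_banach by blast

lemma total_pos: "infsum \<omega> UNIV > 0"
proof -
  have "\<omega> 0 = infsum \<omega> {0}" by simp
  also have "\<dots> \<le> infsum \<omega> UNIV"
    by (rule infsum_mono_neutral) (use summable_sub w_pos in \<open>auto simp: less_imp_le\<close>)
  finally show ?thesis using w_pos[of 0] by simp
qed

lemma mass_mono: "A \<subseteq> B \<Longrightarrow> mass A \<le> mass B"
  unfolding mass_def using total_pos w_pos
  by (intro divide_right_mono infsum_mono_neutral summable_sub) (auto simp: less_imp_le)

lemma mass_Un: "A \<inter> B = {} \<Longrightarrow> mass (A \<union> B) = mass A + mass B"
proof -
  assume "A \<inter> B = {}"
  then have "infsum \<omega> ({n. X n \<in> A} \<union> {n. X n \<in> B}) = infsum \<omega> {n. X n \<in> A} + infsum \<omega> {n. X n \<in> B}"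
    by (intro infsum_Un_disjoint summable_sub) auto
  moreover have "{n. X n \<in> A \<union> B} = {n. X n \<in> A} \<union> {n. X n \<in> B}" by auto
  ultimately show ?thesis unfolding mass_def by (simp add: add_divide_distrib)
qed

lemma mass_unit: "mass unit_ico = 1"
proof -
  have "{n. X n \<in> unit_ico} = UNIV" using XU by auto
  then show ?thesis unfolding mass_def using total_pos by simp
qed

lemma mass_empty [simp]: "mass {} = 0" unfolding mass_def by simp

lemma mass_pos: "X n \<in> A \<Longrightarrow> mass A > 0"
proof -
  assume "X n \<in> A"
  then have "\<omega> n \<le> infsum \<omega> {n. X n \<in> A}"
    using infsum_mono_neutral[of \<omega> "{n}" \<omega> "{n. X n \<in> A}"] summable_sub w_pos by (force simp: less_imp_le)
  then show ?thesis unfolding mass_def using w_pos[of n] total_pos by simp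
qed

text \<open>\<open>T\<close> shifts the index of the orbit by one, and this multiplies the weights
  over \<open>I a\<close> by \<open>l a\<close>. The slopes originate here.\<close>

lemma mass_image:
  assumes A: "A \<subseteq> I a"
  shows "mass (T ` A) = l a * mass A"
proof -
  have eq: "{n. X n \<in> T ` A} = (\<lambda>n. n + 1) ` {n. X n \<in> A}"
  proof (intro equalityI subsetI)
    fix n assume "n \<in> {n. X n \<in> T ` A}"
    then obtain t where t: "t \<in> A" "X n = T t" by auto
    have "T (X (n - 1)) = T t" using X_Suc[of "n - 1"] t by simp
    then have "X (n - 1) = t" using T_inj[OF XU] A I_sub t(1) by blast
    then show "n \<in> (\<lambda>n. n + 1) ` {n. X n \<in> A}" using t(1) by (intro image_eqI[of _ _ "n - 1"]) auto
  qed (use X_Suc in auto)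
  have "infsum \<omega> {n. X n \<in> T ` A} = infsum (\<omega> \<circ> (\<lambda>n. n + 1)) {n. X n \<in> A}"
    unfolding eq by (rule infsum_reindex) auto
  also have "\<dots> = infsum (\<lambda>n. l a * \<omega> n) {n. X n \<in> A}"
    by (rule infsum_cong) (use w_Suc A ltr_eq in auto)
  also have "\<dots> = l a * infsum \<omega> {n. X n \<in> A}" by (rule infsum_cmult_right) (use summable_sub in auto)
  finally show ?thesis unfolding mass_def by simp
qed

definition gap_sum :: "real \<Rightarrow> real" where "gap_sum t = mass {0..<t}"

lemma gap_sum_0: "gap_sum 0 = 0" and gap_sum_1: "gap_sum 1 = 1"
  unfolding gap_sum_def using mass_unit by auto

lemma gap_sum_diff: "0 \<le> s \<Longrightarrow> s \<le> t \<Longrightarrow> gap_sum t - gap_sum s = mass {s..<t}"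
proof -
  assume "0 \<le> s" "s \<le> t"
  then have "{0..<t} = {0..<s} \<union> {s..<t}" by auto
  then show ?thesis unfolding gap_sum_def using mass_Un[of "{0..<s}" "{s..<t}"] by auto
qed

lemma gap_sum_strict: "0 \<le> s \<Longrightarrow> s < t \<Longrightarrow> t \<le> 1 \<Longrightarrow> gap_sum s < gap_sum t"
proof -
  assume st: "0 \<le> s" "s < t" "t \<le> 1"
  then obtain n where "s < X n" "X n < t" using denseX by blast
  then have "mass {s..<t} > 0" by (intro mass_pos[of n]) auto
  then show ?thesis using gap_sum_diff[of s t] st by simp
qed

lemma gap_sum_mono: "0 \<le> s \<Longrightarrow> s \<le> t \<Longrightarrow> gap_sum s \<le> gap_sum t"
  unfolding gap_sum_def by (intro mass_mono) auto

text \<open>No mass escapes to 1: finitely many orbit points carry almost all of it and lie below 1.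
  This keeps \<open>semi\<close> below 1.\<close>

lemma gap_sum_at_left_1:
  assumes "y < 1"
  shows "\<exists>t. 0 \<le> t \<and> t < 1 \<and> y < gap_sum t"
proof -
  define Z where "Z = infsum \<omega> UNIV"
  have "(sum \<omega> \<longlongrightarrow> Z) (finite_subsets_at_top UNIV)"
    using infsum_tendsto[OF summable_w] unfolding Z_def .
  moreover have "y * Z < Z" using assms total_pos unfolding Z_def by simp
  ultimately have "eventually (\<lambda>F. y * Z < sum \<omega> F) (finite_subsets_at_top UNIV)" by (rule order_tendstoD(1))
  then obtain F where F: "finite F" "y * Z < sum \<omega> F" unfolding eventually_finite_subsets_at_top by blast
  define m where "m = Max (insert 0 (X ` F))"
  have m: "m < 1" "0 \<le> m" unfolding m_def using F(1) XU by (auto simp: Max_less_iff)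
  define t where "t = (m + 1) / 2"
  have t: "m < t" "t < 1" using m unfolding t_def by auto
  have "F \<subseteq> {n. X n \<in> {0..<t}}"
  proof
    fix n assume "n \<in> F"
    then have "X n \<le> m" unfolding m_def using F(1) by simp
    then show "n \<in> {n. X n \<in> {0..<t}}" using XU[of n] t by auto
  qed
  then have "infsum \<omega> F \<le> infsum \<omega> {n. X n \<in> {0..<t}}"
    by (intro infsum_mono_neutral summable_sub) (use w_pos in \<open>auto simp: less_imp_le\<close>)
  then have "y * Z < infsum \<omega> {n. X n \<in> {0..<t}}" using F by simp
  then have "y < gap_sum t" unfolding gap_sum_def mass_def Z_def[symmetric] using total_pos unfolding Z_def[symmetric]
    by (simp add: pos_less_divide_eq)
  then show ?thesis using t m by (intro exI[of _ t]) auto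
qed

section \<open>The semi-conjugacy as a generalized inverse\<close>

definition semi :: "real \<Rightarrow> real" where "semi y = Sup {t. 0 \<le> t \<and> t < 1 \<and> gap_sum t \<le> y}"

text \<open>\<open>semi y = t\<close> holds if \<open>y\<close> lies between the left and right limits of \<open>gap_sum\<close> at \<open>t\<close>.\<close>

lemma semi_unique:
  assumes t: "0 \<le> t" "t < 1" "gap_sum t \<le> y" and right: "\<And>s. t < s \<Longrightarrow> s < 1 \<Longrightarrow> y \<le> gap_sum s"
  shows "semi y = t"
  unfolding semi_def
proof (rule cSup_eq_maximum)
  show "t \<in> {t. 0 \<le> t \<and> t < 1 \<and> gap_sum t \<le> y}" using t by simp
  fix s assume "s \<in> {t. 0 \<le> t \<and> t < 1 \<and> gap_sum t \<le> y}"
  then have s: "0 \<le> s" "s < 1" "gap_sum s \<le> y" by auto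
  show "s \<le> t"
  proof (rule ccontr)
    assume "\<not> s \<le> t"
    define m where "m = (s + t) / 2"
    have m: "t < m" "m < s" using \<open>\<not> s \<le> t\<close> unfolding m_def by auto
    then have "y \<le> gap_sum m" using right s(2) by simp
    also have "gap_sum m < gap_sum s" using gap_sum_strict[of m s] m t(1) s(2) by simp
    finally show False using s(3) by simp
  qed
qed

text \<open>Only points strictly below \<open>t\<close> are counted. Finitely many of them carry
  almost all of that mass and already lie below some \<open>s < t\<close>.\<close>

lemma gap_sum_left_continuous:
  assumes t: "0 \<le> t" "t \<le> 1" and below: "\<And>s. 0 \<le> s \<Longrightarrow> s < t \<Longrightarrow> gap_sum s \<le> y" and y0: "0 \<le> y"
  shows "gap_sum t \<le> y"
proof (rule ccontr)
  assume "\<not> ?thesis"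
  then have less: "y < gap_sum t" by simp
  define Z where "Z = infsum \<omega> UNIV"
  have Z: "Z > 0" unfolding Z_def by (rule total_pos)
  have "(sum \<omega> \<longlongrightarrow> infsum \<omega> {n. X n \<in> {0..<t}}) (finite_subsets_at_top {n. X n \<in> {0..<t}})"
    by (rule infsum_tendsto[OF summable_sub])
  moreover have "y * Z < infsum \<omega> {n. X n \<in> {0..<t}}"
    using less Z unfolding gap_sum_def mass_def Z_def[symmetric] by (simp add: pos_less_divide_eq)
  ultimately have "eventually (\<lambda>F. y * Z < sum \<omega> F) (finite_subsets_at_top {n. X n \<in> {0..<t}})" by (rule order_tendstoD(1))
  then obtain F where F: "finite F" "F \<subseteq> {n. X n \<in> {0..<t}}" "y * Z < sum \<omega> F" unfolding eventually_finite_subsets_at_top by blast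
  have "0 \<le> y * Z" using y0 Z by simp
  then have "F \<noteq> {}" using F(3) by auto
  define m where "m = Max (X ` F)"
  have "m \<in> X ` F" unfolding m_def using F(1) \<open>F \<noteq> {}\<close> by simp
  then have m: "0 \<le> m" "m < t" using F(2) by auto
  define s where "s = (m + t) / 2"
  have s: "m < s" "s < t" using m unfolding s_def by auto
  have "F \<subseteq> {n. X n \<in> {0..<s}}"
  proof
    fix n assume n: "n \<in> F"
    then have "X n \<le> m" unfolding m_def using F(1) by simp
    then show "n \<in> {n. X n \<in> {0..<s}}" using XU[of n] s by auto
  qed
  then have "infsum \<omega> F \<le> infsum \<omega> {n. X n \<in> {0..<s}}"
    by (intro infsum_mono_neutral summable_sub) (use w_pos in \<open>auto simp: less_imp_le\<close>)
  then have "y * Z < infsum \<omega> {n. X n \<in> {0..<s}}" using F by simp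
  then have "y < gap_sum s" unfolding gap_sum_def mass_def Z_def[symmetric] using Z by (simp add: pos_less_divide_eq)
  then show False using below[of s] s m by simp
qed

lemma semi_props:
  assumes y: "y \<in> unit_ico"
  shows "semi y \<in> unit_ico" "gap_sum (semi y) \<le> y" "\<And>s. semi y < s \<Longrightarrow> s < 1 \<Longrightarrow> y \<le> gap_sum s"
proof -
  define A where "A = {t. 0 \<le> t \<and> t < 1 \<and> gap_sum t \<le> y}"
  have A0: "0 \<in> A" unfolding A_def using y gap_sum_0 by simp
  have bdd: "bdd_above A" unfolding A_def by (rule bdd_aboveI[of _ 1]) auto
  have sem: "semi y = Sup A" unfolding semi_def A_def ..
  have s0: "0 \<le> semi y" unfolding sem using A0 bdd by (rule cSup_upper)
  obtain t1 where t1: "0 \<le> t1" "t1 < 1" "y < gap_sum t1" using gap_sum_at_left_1[of y] y by auto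
  have "semi y \<le> t1" unfolding sem
  proof (rule cSup_least)
    show "A \<noteq> {}" using A0 by blast
    fix t assume "t \<in> A"
    then show "t \<le> t1" using t1 gap_sum_mono[of t1 t] unfolding A_def by force
  qed
  then show U: "semi y \<in> unit_ico" using s0 t1 by simp
  have below: "gap_sum s \<le> y" if "0 \<le> s" "s < semi y" for s
  proof -
    from that(2) less_cSup_iff[of A s] A0 bdd obtain t where "t \<in> A" "s < t" unfolding sem by blast
    then show ?thesis using gap_sum_mono[of s t] that(1) unfolding A_def by force
  qed
  show "gap_sum (semi y) \<le> y" using gap_sum_left_continuous[OF _ _ below, of "semi y"] U y by auto
  fix s assume s: "semi y < s" "s < 1"
  show "y \<le> gap_sum s"
  proof (rule ccontr)
    assume "\<not> ?thesis"
    then have "s \<in> A" unfolding A_def using s s0 by auto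
    then show False using cSup_upper[OF _ bdd, of s] s(1) unfolding sem by simp
  qed
qed

lemma semi_gap_sum: "t \<in> unit_ico \<Longrightarrow> semi (gap_sum t) = t"
  by (rule semi_unique) (use gap_sum_mono in auto)

lemma gap_sum_U: "t \<in> unit_ico \<Longrightarrow> gap_sum t \<in> unit_ico"
  using gap_sum_strict[of t 1] gap_sum_mono[of 0 t] gap_sum_0 gap_sum_1 by auto

lemma semi_mono: "x \<in> unit_ico \<Longrightarrow> y \<in> unit_ico \<Longrightarrow> x \<le> y \<Longrightarrow> semi x \<le> semi y"
proof (rule ccontr)
  assume xy: "x \<in> unit_ico" "y \<in> unit_ico" "x \<le> y" "\<not> semi x \<le> semi y"
  define m where "m = (semi x + semi y) / 2"
  have m: "semi y < m" "m < semi x" using xy(4) unfolding m_def by auto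
  have "y \<le> gap_sum m" using semi_props(3)[OF xy(2) m(1)] semi_props(1)[OF xy(1)] m by auto
  also have "gap_sum m < gap_sum (semi x)"
    using gap_sum_strict[of m "semi x"] semi_props(1)[OF xy(1)] semi_props(1)[OF xy(2)] m by auto
  also have "\<dots> \<le> x" using semi_props(2)[OF xy(1)] .
  finally show False using xy(3) by simp
qed

text \<open>A generalized inverse could jump only across an interval on which \<open>gap_sum\<close>
  is constant; density of the orbit makes it strictly increasing.\<close>

lemma semi_continuous: "continuous_on unit_ico semi"
proof (rule continuous_on_eq_continuous_within[THEN iffD2, rule_format])
  fix y assume y: "y \<in> unit_ico"
  define t where "t = semi y"
  have tU: "t \<in> unit_ico" using semi_props(1)[OF y] t_def by simp
  show "continuous (at y within unit_ico) semi"
    unfolding continuous_within_eps_delta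
  proof (intro allI impI)
    fix e :: real assume e: "e > 0"
    have up: "\<exists>d>0. \<forall>x\<in>unit_ico. x < y + d \<longrightarrow> semi x < t + e"
    proof -
      define s where "s = min (t + e / 2) ((t + 1) / 2)"
      have "(t + 1) / 2 < 1" "t + e / 2 < t + e" using tU e by auto
      then have s: "t < s" "s < 1" "s < t + e" using tU e unfolding s_def
        by (auto intro: min.strict_coboundedI1 min.strict_coboundedI2)
      define m where "m = (t + s) / 2"
      have m: "t < m" "m < s" using s unfolding m_def by auto
      have "y \<le> gap_sum m" using semi_props(3)[OF y, of m] m s unfolding t_def by auto
      also have "gap_sum m < gap_sum s" using gap_sum_strict[of m s] m s tU by auto
      finally have ys: "y < gap_sum s" .
      have "semi x < t + e" if "x \<in> unit_ico" "x < y + (gap_sum s - y)" for x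
      proof -
        have "semi x \<le> semi (gap_sum s)" using semi_mono[OF that(1) gap_sum_U] that(2) s tU by auto
        then show ?thesis using semi_gap_sum[of s] s tU by auto
      qed
      then show ?thesis using ys by (intro exI[of _ "gap_sum s - y"]) auto
    qed
    have down: "\<exists>d>0. \<forall>x\<in>unit_ico. y - d < x \<longrightarrow> t - e < semi x"
    proof (cases "t = 0")
      case True
      have "t - e < semi x" if "x \<in> unit_ico" for x using semi_props(1)[OF that] True e by auto
      then show ?thesis by (intro exI[of _ 1]) auto
    next
      case False
      define s where "s = max (t - e / 2) (t / 2)"
      have s: "0 \<le> s" "s < t" "t - e < s" using tU e False unfolding s_def by auto
      have "gap_sum s < gap_sum t" using gap_sum_strict[of s t] s tU by auto
      also have "\<dots> \<le> y" using semi_props(2)[OF y] t_def by simp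
      finally have ys: "gap_sum s < y" .
      have "t - e < semi x" if "x \<in> unit_ico" "y - (y - gap_sum s) < x" for x
      proof -
        have "semi (gap_sum s) \<le> semi x" using semi_mono[OF gap_sum_U that(1)] that(2) s tU by auto
        then show ?thesis using semi_gap_sum[of s] s tU by auto
      qed
      then show ?thesis using ys by (intro exI[of _ "y - gap_sum s"]) auto
    qed
    obtain d1 d2 where d: "d1 > 0" "\<And>x. x \<in> unit_ico \<Longrightarrow> x < y + d1 \<Longrightarrow> semi x < t + e"
      "d2 > 0" "\<And>x. x \<in> unit_ico \<Longrightarrow> y - d2 < x \<Longrightarrow> t - e < semi x" using up down by blast
    have "dist (semi x) (semi y) < e" if "x \<in> unit_ico" "dist x y < min d1 d2" for x
      using d(2)[OF that(1)] d(4)[OF that(1)] that(2) unfolding t_def dist_real_def by (auto simp: abs_less_iff)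
    then show "\<exists>d>0. \<forall>x\<in>unit_ico. dist x y < d \<longrightarrow> dist (semi x) (semi y) < e"
      using d(1,3) by (intro exI[of _ "min d1 d2"]) auto
  qed
qed

section \<open>The affine map and its wandering interval\<close>

definition JJ :: "'a \<Rightarrow> real set" where "JJ a = {t \<in> unit_ico. semi t \<in> I a}"

lemma semi_ico:
  assumes "0 \<le> p" "p < s" "s \<le> 1"
  shows "{y \<in> unit_ico. semi y \<in> {p..<s}} = {gap_sum p..<gap_sum s}"
proof (intro equalityI subsetI)
  fix y assume "y \<in> {y \<in> unit_ico. semi y \<in> {p..<s}}"
  then have y: "y \<in> unit_ico" "p \<le> semi y" "semi y < s" by auto
  have "gap_sum p \<le> y" using gap_sum_mono[OF assms(1) y(2)] semi_props(2)[OF y(1)] by simp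
  moreover have "y < gap_sum s"
  proof -
    define m where "m = (semi y + s) / 2"
    have m: "semi y < m" "m < s" using y(3) unfolding m_def by auto
    have "y \<le> gap_sum m" using semi_props(3)[OF y(1) m(1)] m(2) assms(3) by simp
    also have "\<dots> < gap_sum s" using gap_sum_strict[of m s] m y(2) assms by simp
    finally show ?thesis .
  qed
  ultimately show "y \<in> {gap_sum p..<gap_sum s}" by simp
next
  fix y assume "y \<in> {gap_sum p..<gap_sum s}"
  then have y: "gap_sum p \<le> y" "y < gap_sum s" by auto
  have "0 \<le> gap_sum p" "gap_sum s \<le> 1"
    using gap_sum_mono[of 0 p] gap_sum_mono[of s 1] gap_sum_0 gap_sum_1 assms by auto
  then have yU: "y \<in> unit_ico" using y by auto
  have "p \<le> semi y" using semi_mono[OF gap_sum_U yU y(1)] semi_gap_sum[of p] assms by auto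
  moreover have "semi y < s"
  proof (rule ccontr)
    assume "\<not> semi y < s"
    then have "gap_sum s \<le> gap_sum (semi y)" using gap_sum_mono[of s "semi y"] assms by simp
    then show False using semi_props(2)[OF yU] y(2) by simp
  qed
  ultimately show "y \<in> {y \<in> unit_ico. semi y \<in> {p..<s}}" using yU by auto
qed

lemma JJ_eq: "JJ a = {gap_sum (lft a)..<gap_sum (rgt a)}"
  unfolding JJ_def lft_rgt(2)[of a] using semi_ico[of "lft a" "rgt a"] lft_U[of a] lft_rgt(1)[of a] rgt_le[of a] by auto

definition ff :: "real \<Rightarrow> real" where
  "ff y = gap_sum (T (lft (ltr (semi y)))) + l (ltr (semi y)) * (y - gap_sum (lft (ltr (semi y))))"

lemma gap_sum_T:
  assumes u: "lft a \<le> u" "u \<le> rgt a"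
  shows "gap_sum (T (lft a) + (u - lft a)) = gap_sum (T (lft a)) + l a * (gap_sum u - gap_sum (lft a))"
proof -
  have img: "T ` {lft a..<u} = {T (lft a)..<T (lft a) + (u - lft a)}"
  proof -
    have "T ` {lft a..<u} = (\<lambda>t. t + dl a) ` {lft a..<u}"
      by (intro image_cong) (use T_translation lft_rgt(2)[of a] u in auto)
    then show ?thesis using image_add_atLeastLessThan'[of "dl a" "lft a" u] unfolding dl_def by (simp add: algebra_simps)
  qed
  have "mass (T ` {lft a..<u}) = l a * mass {lft a..<u}" by (rule mass_image) (use u lft_rgt(2)[of a] in auto)
  then show ?thesis
    unfolding img using gap_sum_diff[of "lft a" u] lft_U[of a] u(1) T_U[OF lft_U, of a]
      gap_sum_diff[of "T (lft a)" "T (lft a) + (u - lft a)"] by auto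
qed

lemma semi_ff:
  assumes y: "y \<in> unit_ico"
  shows "semi (ff y) = T (semi y)"
proof -
  define t where "t = semi y"
  define a where "a = ltr t"
  have tU: "t \<in> unit_ico" using semi_props(1)[OF y] t_def by simp
  have ta: "lft a \<le> t" "t < rgt a" using ltr_bounds[OF tU] unfolding a_def by auto
  have Tt: "T t = T (lft a) + (t - lft a)" using T_ltr[OF tU] unfolding a_def[symmetric] dl_def by simp
  have ff: "ff y = gap_sum (T (lft a)) + l a * (y - gap_sum (lft a))" unfolding ff_def t_def a_def ..
  show ?thesis unfolding t_def[symmetric]
  proof (rule semi_unique)
    show "0 \<le> T t" "T t < 1" using T_U[OF tU] by auto
    have "l a * gap_sum t \<le> l a * y" using semi_props(2)[OF y] l_pos[of a] unfolding t_def by simp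
    then show "gap_sum (T t) \<le> ff y"
      unfolding ff Tt using gap_sum_T[of a t] ta by (simp add: algebra_simps)
    fix s assume s: "T t < s" "s < 1"
    \<comment> \<open>A point to the right of \<open>t\<close> that is still in \<open>I a\<close>
      and whose image does not exceed \<open>s\<close>.\<close>
    define u where "u = min (t + (s - T t)) ((t + rgt a) / 2)"
    have u: "t < u" "T (lft a) + (u - lft a) \<le> s" using s ta unfolding u_def Tt by auto
    have "(t + rgt a) / 2 < rgt a" using ta by simp
    then have u2: "u < rgt a" unfolding u_def by (rule min.strict_coboundedI2)
    have "y \<le> gap_sum u" using semi_props(3)[OF y, of u] u(1) u2 rgt_le[of a] unfolding t_def by auto
    then have "l a * y \<le> l a * gap_sum u" using l_pos[of a] by simp
    then have "ff y \<le> gap_sum (T (lft a) + (u - lft a))"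
      unfolding ff using gap_sum_T[of a u] u u2 ta by (simp add: algebra_simps)
    also have "\<dots> \<le> gap_sum s" using gap_sum_mono[OF _ u(2)] T_U[OF lft_U, of a] u(1) ta by auto
    finally show "ff y \<le> gap_sum s" .
  qed
qed

lemma ff_image: "ff ` JJ a = {gap_sum (T (lft a))..<gap_sum (T (lft a) + (rgt a - lft a))}"
proof -
  have ff: "ff y = gap_sum (T (lft a)) + l a * (y - gap_sum (lft a))" if "y \<in> JJ a" for y
    using that ltr_eq[of "semi y" a] unfolding ff_def JJ_def by simp
  have end_eq: "gap_sum (T (lft a) + (rgt a - lft a)) = gap_sum (T (lft a)) + l a * (gap_sum (rgt a) - gap_sum (lft a))"
    using gap_sum_T[of a "rgt a"] lft_rgt(1)[of a] by simp
  show ?thesis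
  proof (intro equalityI subsetI)
    fix z assume "z \<in> ff ` JJ a"
    then obtain y where y: "y \<in> JJ a" "z = ff y" by blast
    then show "z \<in> {gap_sum (T (lft a))..<gap_sum (T (lft a) + (rgt a - lft a))}"
      using ff[OF y(1)] l_pos[of a] unfolding JJ_eq end_eq by auto
  next
    fix z assume z: "z \<in> {gap_sum (T (lft a))..<gap_sum (T (lft a) + (rgt a - lft a))}"
    define y where "y = gap_sum (lft a) + (z - gap_sum (T (lft a))) / l a"
    have "y \<in> JJ a" using z l_pos[of a] unfolding JJ_eq end_eq y_def by (auto simp: field_simps)
    moreover have "ff y = z" using ff[OF calculation] l_pos[of a] unfolding y_def by simp
    ultimately show "z \<in> ff ` JJ a" by blast
  qed
qed

lemma ff_affine_iem: "affine_iem JJ l ff"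
proof -
  have part: "interval_partition JJ"
    unfolding interval_partition_def
  proof (intro conjI allI)
    show "\<exists>l r. l < r \<and> JJ a = {l..<r}" for a
      using JJ_eq gap_sum_strict[of "lft a" "rgt a"] lft_U[of a] lft_rgt(1)[of a] rgt_le[of a] by auto
    show "disjoint_family JJ" unfolding disjoint_family_on_def JJ_def using I_disjoint by blast
    show "(\<Union>a. JJ a) = unit_ico" unfolding JJ_def using semi_props(1) ltr_I by blast
  qed
  have img: "ff ` JJ a = {y \<in> unit_ico. semi y \<in> T ` I a}" for a
  proof -
    have "T ` I a \<subseteq> unit_ico" using T_U I_sub by blast
    then have "{T (lft a)..<T (lft a) + (rgt a - lft a)} \<subseteq> {0..<1}" unfolding forward_image_I .
    then have "0 \<le> T (lft a)" "T (lft a) + (rgt a - lft a) \<le> 1" using lft_rgt(1)[of a] by (auto simp: atLeastLessThan_subset_iff)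
    then show ?thesis
      unfolding forward_image_I using semi_ico[of "T (lft a)" "T (lft a) + (rgt a - lft a)"] lft_rgt(1)[of a] ff_image[of a]
      by auto
  qed
  have "bij_betw ff unit_ico unit_ico"
    unfolding bij_betw_def
  proof
    show "inj_on ff unit_ico"
    proof (rule inj_onI)
      fix x y assume xy: "x \<in> unit_ico" "y \<in> unit_ico" "ff x = ff y"
      then have "T (semi x) = T (semi y)" using semi_ff by metis
      then have s: "semi x = semi y" using T_inj semi_props(1) xy by blast
      then show "x = y" using xy(3) l_pos[of "ltr (semi y)"] unfolding ff_def by simp
    qed
    have "ff ` unit_ico = (\<Union>a. ff ` JJ a)" using part unfolding interval_partition_def by (metis image_UN)
    also have "\<dots> = {y \<in> unit_ico. semi y \<in> (\<Union>a. T ` I a)}" unfolding img by blast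
    also have "(\<Union>a. T ` I a) = unit_ico" using Un_I T_bij unfolding bij_betw_def by (metis image_UN)
    finally show "ff ` unit_ico = unit_ico" using semi_props(1) by auto
  qed
  moreover have "\<exists>d. \<forall>t\<in>JJ a. ff t = l a * t + d" for a
  proof (intro exI ballI)
    fix t assume "t \<in> JJ a"
    then have "ltr (semi t) = a" using ltr_eq unfolding JJ_def by auto
    then show "ff t = l a * t + (gap_sum (T (lft a)) - l a * gap_sum (lft a))" unfolding ff_def by (simp add: algebra_simps)
  qed
  ultimately show ?thesis unfolding affine_iem_def using part l_pos by blast
qed

text \<open>The fibre of \<open>semi\<close> over an orbit point is nondegenerate because this point
  has positive mass. Its iterates lie over the points \<open>X n\<close>, which are
  distinct.\<close>

lemma ff_wandering: "wandering_interval ff {y \<in> unit_ico. semi y = X 0}"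
proof -
  define V where "V = {y \<in> unit_ico. semi y = X 0}"
  have ffU: "ff y \<in> unit_ico" if "y \<in> unit_ico" for y
    using ff_affine_iem that unfolding affine_iem_def by (meson bij_betwE)
  have Un: "(ff ^^ k) y \<in> unit_ico" if "y \<in> unit_ico" for y k by (induction k) (use that ffU in auto)
  have sn: "semi ((ff ^^ k) y) = (T ^^ k) (semi y)" if "y \<in> unit_ico" for y k
    by (induction k) (use semi_ff[OF Un[OF that]] in auto)
  have it: "semi y = X n" if "y \<in> iterated_image ff n V" for y n
  proof (cases "n \<ge> 0")
    case True
    then obtain z where z: "z \<in> V" "y = (ff ^^ nat n) z" using \<open>y \<in> _\<close> unfolding iterated_image_def by auto
    then show ?thesis using sn[of z "nat n"] orbit_funpow[of X "nat n" 0, OF X_Suc] True unfolding V_def by simp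
  next
    case False
    then have y: "y \<in> unit_ico" "(ff ^^ nat (- n)) y \<in> V" using \<open>y \<in> _\<close> unfolding iterated_image_def by auto
    have "(T ^^ nat (- n)) (semi y) = X 0" using sn[OF y(1)] y(2) unfolding V_def by auto
    also have "\<dots> = (T ^^ nat (- n)) (X n)" using orbit_funpow[of X "nat (- n)" n, OF X_Suc] False by simp
    finally show ?thesis using Tn_inj[OF semi_props(1)[OF y(1)] XU] by blast
  qed
  have "disjoint_family (\<lambda>n. iterated_image ff n V)"
    unfolding disjoint_family_on_def
  proof (intro ballI impI, rule ccontr)
    fix m n :: int assume "m \<noteq> n" "iterated_image ff m V \<inter> iterated_image ff n V \<noteq> {}"
    then obtain y where "y \<in> iterated_image ff m V" "y \<in> iterated_image ff n V" by blast
    then show False using it injX \<open>m \<noteq> n\<close> unfolding inj_def by metis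
  qed
  moreover have "is_interval V"
    unfolding is_interval_1
  proof (intro ballI allI impI)
    fix a b x assume "a \<in> V" "b \<in> V" and x: "a \<le> x \<and> x \<le> b"
    then have ab: "a \<in> unit_ico" "b \<in> unit_ico" "semi a = X 0" "semi b = X 0" unfolding V_def by auto
    then have "x \<in> unit_ico" using x by auto
    then show "x \<in> V" using semi_mono[of a x] semi_mono[of x b] ab x unfolding V_def by auto
  qed
  moreover have "\<exists>x\<in>V. \<exists>y\<in>V. x < y"
  proof -
    define x where "x = gap_sum (X 0)"
    define w where "w = mass {X 0}"
    have w: "w > 0" unfolding w_def by (rule mass_pos[of 0]) simp
    have step: "x + w \<le> gap_sum s" if "X 0 < s" for s
    proof -
      have "mass {X 0} \<le> mass {X 0..<s}" using that by (intro mass_mono) auto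
      then show ?thesis using gap_sum_diff[of "X 0" s] XU[of 0] that unfolding x_def w_def by auto
    qed
    have "x \<in> V" using gap_sum_U[OF XU[of 0]] semi_gap_sum[OF XU[of 0]] unfolding V_def x_def by simp
    moreover have "x + w / 2 \<in> V"
    proof -
      have "semi (x + w / 2) = X 0"
        by (rule semi_unique) (use XU[of 0] w step in \<open>force simp: x_def\<close>)+
      moreover have "x + w \<le> 1" using step[of 1] XU[of 0] gap_sum_1 by simp
      moreover have "0 \<le> x" using gap_sum_U[OF XU[of 0]] unfolding x_def by simp
      ultimately show ?thesis using w unfolding V_def by auto
    qed
    ultimately show ?thesis using w by (intro bexI[of _ x] bexI[of _ "x + w / 2"]) auto
  qed
  ultimately show ?thesis unfolding wandering_interval_def V_def[symmetric] by (auto simp: V_def)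
qed

lemma wandering_slopes: "wandering_slope_vector I T l"
proof -
  have "semi_conjugacy semi ff T"
    unfolding semi_conjugacy_def
  proof (intro conjI ballI)
    show "semi ` unit_ico = unit_ico"
    proof
      show "semi ` unit_ico \<subseteq> unit_ico" using semi_props(1) by blast
      show "unit_ico \<subseteq> semi ` unit_ico" using semi_gap_sum gap_sum_U by (metis image_eqI subsetI)
    qed
    show "mono_on unit_ico semi" using semi_mono by (auto intro: mono_onI)
  qed (use semi_continuous semi_ff in auto)
  then show ?thesis
    unfolding wandering_slope_vector_def using ff_affine_iem ff_wandering JJ_def by blast
qed

end

end

section \<open>Almost every eigenvector\<close>

context complex_eigen
begin

lemma ae_wandering: "AE c in lborel. wandering_slope_vector I T (\<lambda>a. exp (- Re ((c *s v) $ a)))"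
proof -
  have "AE c in lborel. c \<noteq> (0::complex)" by (rule AE_lborel_singleton)
  then show ?thesis using ae_generic_direction
  proof eventually_elim
    case (elim c)
    obtain X :: "int \<Rightarrow> real" and \<omega> where Xw:
      "\<And>n. X n \<in> unit_ico" "\<And>n. X (n + 1) = T (X n)" "inj X"
      "\<And>u w. 0 \<le> u \<Longrightarrow> u < w \<Longrightarrow> w \<le> 1 \<Longrightarrow> \<exists>n. u < X n \<and> X n < w"
      "\<And>n. \<omega> n > 0" "\<And>n. \<omega> (n + 1) = exp (- Re (c * v $ ltr (X n))) * \<omega> n" "\<omega> summable_on UNIV"
      using summable_weights[OF elim(2,1)] by metis
    show ?case
      using wandering_slopes[OF Xw(1-5) _ Xw(7), of "\<lambda>a. exp (- Re ((c *s v) $ a))"] Xw(6) by simp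
  qed
qed

end

text \<open>All values are multiplied by \<open>s\<close>, so the direction \<open>\<tau>\<close>
  for the scaled vector corresponds to \<open>\<tau> * s / norm s\<close> for the original
  one.\<close>

lemma unique_representation_scale:
  fixes \<gamma> :: "complex^'a::finite"
  assumes urp: "unique_representation_for_vector \<sigma> \<beta> \<gamma>" and s: "s \<noteq> 0"
    and summ: "\<And>a x. x \<in> expansions \<sigma> a \<Longrightarrow> summable (\<lambda>n. inverse \<beta> ^ Suc n * word_value \<gamma> (prefix_part x n))"
  shows "unique_representation_for_vector \<sigma> \<beta> (s *s \<gamma>)"
proof -
  have val: "expansion_value \<beta> (s *s \<gamma>) x = s * expansion_value \<beta> \<gamma> x" if "x \<in> expansions \<sigma> a" for x a
  proof -
    have "expansion_value \<beta> (s *s \<gamma>) x = (\<Sum>n. s * (inverse \<beta> ^ Suc n * word_value \<gamma> (prefix_part x n)))"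
      unfolding expansion_value_def word_value_scale by (simp only: mult.left_commute)
    then show ?thesis unfolding expansion_value_def using suminf_mult[OF summ[OF that], of s] by simp
  qed
  show ?thesis
    unfolding unique_representation_for_vector_def
  proof (intro allI impI ballI)
    fix a \<tau> z assume \<tau>: "norm \<tau> = 1" and z: "z \<in> extreme_points (fractal \<sigma> \<beta> (s *s \<gamma>) a) \<tau>"
    obtain x where x: "x \<in> expansions \<sigma> a" "z = s * expansion_value \<beta> \<gamma> x"
      using z val unfolding extreme_points_def fractal_def by auto
    define \<tau>' where "\<tau>' = \<tau> * s / norm s"
    have \<tau>': "norm \<tau>' = 1" unfolding \<tau>'_def using \<tau> s by (simp add: norm_mult norm_divide)
    have "Re (\<tau>' * expansion_value \<beta> \<gamma> x) \<le> Re (\<tau>' * expansion_value \<beta> \<gamma> y)" if y: "y \<in> expansions \<sigma> a" for y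
    proof -
      have "Re (\<tau> * (s * expansion_value \<beta> \<gamma> x)) \<le> Re (\<tau> * (s * expansion_value \<beta> \<gamma> y))"
        using z y val[OF y] x(2) unfolding extreme_points_def fractal_def by auto
      moreover have "Re (\<tau>' * w) = Re (\<tau> * (s * w)) / norm s" for w
        unfolding \<tau>'_def using Re_divide_of_real[of "\<tau> * s * w" "norm s"] by (simp add: mult.assoc)
      ultimately show ?thesis by (simp add: divide_right_mono)
    qed
    then have "expansion_value \<beta> \<gamma> x \<in> extreme_points (fractal \<sigma> \<beta> \<gamma> a) \<tau>'"
      unfolding extreme_points_def fractal_def using x(1) by auto
    then have ex1: "\<exists>!y. y \<in> expansions \<sigma> a \<and> expansion_value \<beta> \<gamma> y = expansion_value \<beta> \<gamma> x"
      using urp \<tau>' unfolding unique_representation_for_vector_def by blast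
    show "\<exists>!y. y \<in> expansions \<sigma> a \<and> expansion_value \<beta> (s *s \<gamma>) y = z"
    proof (rule ex1I[of _ x])
      show "x \<in> expansions \<sigma> a \<and> expansion_value \<beta> (s *s \<gamma>) x = z" using x val by simp
      fix y assume y: "y \<in> expansions \<sigma> a \<and> expansion_value \<beta> (s *s \<gamma>) y = z"
      then have "expansion_value \<beta> \<gamma> y = expansion_value \<beta> \<gamma> x" using x(2) val[of y a] s by simp
      then show "y = x" using ex1 x(1) y by blast
    qed
  qed
qed

context self_similar_exchange
begin

text \<open>One-dimensionality in coordinates, in the form that \<open>galois_kernel\<close>
  transports. With \<open>k = 1\<close> it gives the line of eigenvectors, and with all
  \<open>k > 0\<close> it prevents real powers of \<open>\<beta>\<close>.\<close>

lemma eigen_one_dimensional: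
  assumes gal: "galois_conjugate \<beta> (complex_of_real (inverse \<alpha>)) \<or>
      galois_conjugate \<beta> (complex_of_real \<alpha>) \<and> rauzy_veech_periodic \<alpha> I T" and k: "k > 0"
  obtains b where "\<And>x. (\<And>a. word_value x (W k a) = \<beta> ^ k * x $ a) \<Longrightarrow> x $ b = 0 \<Longrightarrow> x = 0"
proof -
  interpret P: self_similar_exchange I T "\<alpha> ^ k" "W k" by (rule power_self_similar[OF k])
  from gal show ?thesis
  proof
    assume g: "galois_conjugate \<beta> (complex_of_real (inverse \<alpha>))"
    have "x = 0" if "\<And>a. word_value x (W k a) = complex_of_real (inverse \<alpha>) ^ k * x $ a" "x $ b = 0" for x b
      by (rule P.perron_right) (use that in \<open>auto simp: power_inverse\<close>)
    then have "x = 0" if "\<And>a. word_value x (W k a) = \<beta> ^ k * x $ a" "x $ b = 0" for x b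
      using galois_kernel[OF g, of "W k" k b x] that by blast
    then show ?thesis using that by blast
  next
    assume g: "galois_conjugate \<beta> (complex_of_real \<alpha>) \<and> rauzy_veech_periodic \<alpha> I T"
    obtain b where "\<And>x. (\<And>a. word_value x (W k a) = of_real (\<alpha> ^ k) * x $ a) \<Longrightarrow> x $ b = 0 \<Longrightarrow> x = 0"
      using P.eigenvector_alpha no_connection g by metis
    then have "x = 0" if "\<And>a. word_value x (W k a) = \<beta> ^ k * x $ a" "x $ b = 0" for x
      using galois_kernel[of \<beta> "complex_of_real \<alpha>" "W k" k b x] g that by simp
    then show ?thesis using that by blast
  qed
qed

text \<open>A real power \<open>\<beta>\<^sup>k\<close> would have the two independent eigenvectors \<open>\<gamma>\<close> and \<open>cnj \<gamma>\<close>.\<close>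

lemma eigenvalue_power_nonreal:
  assumes eig: "\<And>a. word_value x (\<sigma> a) = \<beta> * x $ a" and x: "x \<noteq> 0" and \<beta>: "\<beta> \<notin> \<real>"
    and b: "\<And>x. (\<And>a. word_value x (W k a) = \<beta> ^ k * x $ a) \<Longrightarrow> x $ b = 0 \<Longrightarrow> x = 0"
  shows "Im (\<beta> ^ k) \<noteq> 0"
proof
  assume "Im (\<beta> ^ k) = 0"
  then have real: "cnj (\<beta> ^ k) = \<beta> ^ k" by (metis Reals_cnj_iff complex_is_Real_iff)
  define y where "y = (\<chi> a. cnj (x $ a))"
  have y: "word_value y w = cnj (word_value x w)" for w
    by (induction w) (auto simp: y_def)
  have eigx: "word_value x (W k a) = \<beta> ^ k * x $ a" for a by (rule eigen_W[OF eig])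
  have eigy: "word_value y (W k a) = \<beta> ^ k * y $ a" for a
    unfolding y eigx complex_cnj_mult real by (simp add: y_def)
  have xb: "x $ b \<noteq> 0" using b[OF eigx] x by blast
  define z where "z = y $ b *s x - x $ b *s y"
  have zw: "word_value z w = y $ b * word_value x w - x $ b * word_value y w" for w
    by (induction w) (auto simp: z_def algebra_simps)
  have "word_value z (W k a) = \<beta> ^ k * z $ a" for a
    unfolding zw eigx eigy by (simp add: z_def algebra_simps)
  moreover have "z $ b = 0" unfolding z_def by simp
  ultimately have "z = 0" by (rule b)
  then have proportional: "x $ b * y $ a = y $ b * x $ a" for a unfolding z_def by (simp add: vec_eq_iff)
  have "x $ b * word_value y w = y $ b * word_value x w" for w
    by (induction w) (auto simp: distrib_left proportional)
  from this[of "\<sigma> b"] have "x $ b * (cnj \<beta> * y $ b) = y $ b * (\<beta> * x $ b)"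
    unfolding y eig complex_cnj_mult by (simp add: y_def)
  moreover have "y $ b \<noteq> 0" using xb unfolding y_def by simp
  ultimately have "cnj \<beta> = \<beta>" using xb by simp
  then show False using \<beta> by (metis Reals_cnj_iff)
qed

end

lemma self_similar_exchangeI:
  fixes I :: "'a::finite \<Rightarrow> real set"
  assumes ss: "self_similar \<alpha> I T" and sub: "associated_substitution \<alpha> I T \<sigma>"
    and nontrivial: "\<exists>t\<in>unit_ico. T t \<noteq> t"
  shows "self_similar_exchange I T \<alpha> \<sigma>"
proof -
  have iem: "iem I T" and alpha: "0 < \<alpha>" "\<alpha> < 1" using ss unfolding self_similar_def by auto
  interpret interval_exchange I T by unfold_locales (rule iem)
  have base: "\<alpha> * t \<in> {0..<\<alpha>}" if "t \<in> unit_ico" for t using that alpha by auto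
  have time: "first_return_time T {0..<\<alpha>} (\<alpha> * t) = length (\<sigma> a)" if "t \<in> I a" for t a
    using sub that unfolding associated_substitution_def by blast
  have ret: "\<exists>n>0. (T ^^ n) (\<alpha> * t) \<in> {0..<\<alpha>}" if "t \<in> unit_ico" for t
    using ss base[OF that] unfolding self_similar_def by blast
  have pos: "0 < length (\<sigma> a)" for a
  proof -
    have "first_return_time T {0..<\<alpha>} (\<alpha> * lft a) > 0"
      unfolding first_return_time_def using LeastI_ex[OF ret[OF lft_U]] by blast
    then show ?thesis using time[OF lft_in_I] by simp
  qed
  show ?thesis
  proof
    show "0 < \<alpha>" "\<alpha> < 1" by fact+
    show "\<sigma> a \<noteq> []" for a using pos[of a] by simp
    show "\<exists>t\<in>unit_ico. T t \<noteq> t" by fact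
    fix t a assume t: "t \<in> I a"
    then have tU: "t \<in> unit_ico" using I_sub by blast
    have "first_return_map T {0..<\<alpha>} (\<alpha> * t) = \<alpha> * T t" using ss tU unfolding self_similar_def by blast
    then show "(T ^^ length (\<sigma> a)) (\<alpha> * t) = \<alpha> * T t" unfolding first_return_map_def time[OF t] .
    show "itin (length (\<sigma> a)) (\<alpha> * t) = \<sigma> a"
    proof (rule nth_equalityI)
      fix i assume "i < length (itin (length (\<sigma> a)) (\<alpha> * t))"
      then have i: "i < length (\<sigma> a)" by simp
      then have "(T ^^ i) ` ((*) \<alpha> ` I a) \<subseteq> I (\<sigma> a ! i)" using sub unfolding associated_substitution_def by blast
      then have "(T ^^ i) (\<alpha> * t) \<in> I (\<sigma> a ! i)" using t by blast
      then show "itin (length (\<sigma> a)) (\<alpha> * t) ! i = \<sigma> a ! i" using itin_nth[OF i] ltr_eq by simp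
    qed simp
    fix m assume "0 < m" "m < length (\<sigma> a)"
    then show "(T ^^ m) (\<alpha> * t) \<notin> {0..<\<alpha>}"
      using time[OF t] not_less_Least[of m "\<lambda>n. n > 0 \<and> (T ^^ n) (\<alpha> * t) \<in> {0..<\<alpha>}"]
      unfolding first_return_time_def by auto
  qed
qed

text \<open>For the identity all words \<open>\<sigma> a\<close> have length 1, so \<open>M\<close> has no eigenvalue of modulus larger than 1.\<close>

lemma nontrivial_of_large_eigenvalue:
  fixes I :: "'a::finite \<Rightarrow> real set"
  assumes ss: "self_similar \<alpha> I T" and sub: "associated_substitution \<alpha> I T \<sigma>"
    and eig: "eigenvector (subst_matrix \<sigma>) \<beta> x" and \<beta>: "norm \<beta> > 1"
  shows "\<exists>t\<in>unit_ico. T t \<noteq> t"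
proof (rule ccontr)
  assume "\<not> ?thesis"
  then have id: "T t = t" if "t \<in> unit_ico" for t using that by blast
  have iem: "iem I T" and alpha: "0 < \<alpha>" "\<alpha> < 1" using ss unfolding self_similar_def by auto
  interpret interval_exchange I T by unfold_locales (rule iem)
  have len: "length (\<sigma> a) = 1" for a
  proof -
    have "\<alpha> * lft a \<in> {0..<\<alpha>}" "\<alpha> * lft a \<in> unit_ico" using lft_U[of a] alpha
      by (auto intro: le_less_trans[OF mult_right_le_one_le])
    then have "first_return_time T {0..<\<alpha>} (\<alpha> * lft a) = 1"
      unfolding first_return_time_def using id by (intro Least_equality) auto
    moreover have "first_return_time T {0..<\<alpha>} (\<alpha> * lft a) = length (\<sigma> a)"
      using sub lft_in_I[of a] unfolding associated_substitution_def by blast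
    ultimately show ?thesis by simp
  qed
  have x: "x \<noteq> 0" "word_value x (\<sigma> a) = \<beta> * x $ a" for a
    using eig unfolding eigenvector_def eigenspace_iff by auto
  define m where "m = Max (range (\<lambda>a. norm (x $ a)))"
  have le: "norm (x $ a) \<le> m" for a unfolding m_def by (intro Max_ge) auto
  have "m \<in> range (\<lambda>a. norm (x $ a))" unfolding m_def by (intro Max_in) auto
  then obtain a where a: "m = norm (x $ a)" by blast
  obtain c where "\<sigma> a = [c]" using len[of a] by (auto simp: length_Suc_conv)
  then have "norm \<beta> * m \<le> m" using x(2)[of a] a le[of c] by (simp add: norm_mult[symmetric])
  moreover have "m > 0"
  proof -
    obtain d where "x $ d \<noteq> 0" using x(1) by (auto simp: vec_eq_iff)
    then show ?thesis using le[of d] by (meson less_le_trans zero_less_norm_iff)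
  qed
  ultimately show False using \<beta> by simp
qed

theorem theoremB:
  fixes I :: "'a::finite \<Rightarrow> real set"
    and T :: "real \<Rightarrow> real"
    and \<alpha> :: real
    and \<sigma> :: "'a \<Rightarrow> 'a list"
    and \<beta> :: complex
  assumes "self_similar \<alpha> I T"
    and "associated_substitution \<alpha> I T \<sigma>"
    and "eigenvalue (subst_matrix \<sigma>) \<beta>"
    and "norm \<beta> > 1"
    and "\<beta> \<notin> \<real>"
    and "galois_conjugate \<beta> (complex_of_real (inverse \<alpha>)) \<or>
         galois_conjugate \<beta> (complex_of_real \<alpha>) \<and> rauzy_veech_periodic \<alpha> I T"
    and "unique_representation_property \<sigma> \<beta>"
  shows "almost_everywhere_on_subspace (eigenspace (subst_matrix \<sigma>) \<beta>)
           (\<lambda>\<gamma>. wandering_slope_vector I T (\<lambda>a. exp (- Re (\<gamma> $ a))))"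
proof -
  obtain \<gamma> where \<gamma>: "eigenvector (subst_matrix \<sigma>) \<beta> \<gamma>" "unique_representation_for_vector \<sigma> \<beta> \<gamma>"
    using assms(7) unfolding unique_representation_property_def by blast
  have g: "\<gamma> \<noteq> 0" "\<And>a. word_value \<gamma> (\<sigma> a) = \<beta> * \<gamma> $ a"
    using \<gamma>(1) unfolding eigenvector_def eigenspace_iff by auto
  interpret self_similar_exchange I T \<alpha> \<sigma>
    using self_similar_exchangeI[OF assms(1,2) nontrivial_of_large_eigenvalue[OF assms(1,2) \<gamma>(1) assms(4)]] .
  have nonreal: "Im (\<beta> ^ k) \<noteq> 0" if k: "k > 0" for k
    using eigen_one_dimensional[OF assms(6) k] eigenvalue_power_nonreal[OF g(2,1) assms(5)] by metis
  interpret G: complex_eigen I T \<alpha> \<sigma> \<beta> \<gamma>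
    by unfold_locales (use assms(4) g \<gamma>(2) nonreal in auto)
  obtain b where b: "\<And>x. (\<And>a. word_value x (\<sigma> a) = \<beta> * x $ a) \<Longrightarrow> x $ b = 0 \<Longrightarrow> x = 0"
    using eigen_one_dimensional[OF assms(6), of 1] by auto
  \<comment> \<open>Cancelling the \<open>b\<close>-th entry by a multiple of
    \<open>\<gamma>\<close> leaves an eigenvector that must vanish.\<close>
  have line: "\<exists>s. x = s *s \<gamma>" if x: "\<And>a. word_value x (\<sigma> a) = \<beta> * x $ a" for x
  proof -
    have gb: "\<gamma> $ b \<noteq> 0" using b g by blast
    define k where "k = x $ b / \<gamma> $ b"
    define z where "z = x - k *s \<gamma>"
    have zw: "word_value z w = word_value x w - k * word_value \<gamma> w" for w
      by (induction w) (auto simp: z_def algebra_simps)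
    have "word_value z (\<sigma> a) = \<beta> * z $ a" for a
      unfolding zw x g(2) by (simp add: z_def algebra_simps)
    moreover have "z $ b = 0" unfolding z_def k_def using gb by simp
    ultimately have "z = 0" by (rule b)
    then show ?thesis unfolding z_def by (metis eq_iff_diff_eq_0)
  qed
  show ?thesis
    unfolding almost_everywhere_on_subspace_def
  proof (intro allI impI)
    fix B assume B: "vec.independent B \<and> vec.span B = eigenspace (subst_matrix \<sigma>) \<beta>"
    have multiple: "\<exists>s. x = s *s \<gamma>" if "x \<in> B" for x
    proof -
      have "x \<in> eigenspace (subst_matrix \<sigma>) \<beta>" using B that vec.span_base by blast
      then show ?thesis using line unfolding eigenspace_iff by blast
    qed
    have "B \<noteq> {}"
    proof
      assume "B = {}"
      then have "\<gamma> = 0" using B \<gamma>(1) unfolding eigenvector_def by (metis singletonD vec.span_empty)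
      then show False using g(1) by simp
    qed
    then obtain v where v: "v \<in> B" by blast
    obtain s where s: "v = s *s \<gamma>" using multiple[OF v] by blast
    have v0: "v \<noteq> 0" using B v vec.dependent_zero by blast
    then have s0: "s \<noteq> 0" using s by auto
    \<comment> \<open>All members of \<open>B\<close> are multiples of \<open>\<gamma>\<close>, and
      independence leaves room for one. It need not be \<open>\<gamma>\<close> itself, so unique
      representation has to be transferred to \<open>v\<close>.\<close>
    have "B = {v}"
    proof (rule ccontr)
      assume "B \<noteq> {v}"
      then obtain w where w: "w \<in> B" "w \<noteq> v" using v by blast
      obtain r where r: "w = r *s \<gamma>" using multiple[OF w(1)] by blast
      have "w = (r / s) *s v" unfolding r s using s0 by simp
      then have "w \<in> vec.span {v}" by (metis vec.span_scale vec.span_base singletonI)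
      moreover have "{v} \<subseteq> B - {w}" using v w by blast
      ultimately have "w \<in> vec.span (B - {w})" using vec.span_mono by blast
      then show False using B w(1) unfolding vec.dependent_def by blast
    qed
    interpret V: complex_eigen I T \<alpha> \<sigma> \<beta> v
    proof unfold_locales
      show "1 < norm \<beta>" by fact
      show "word_value v (\<sigma> a) = \<beta> * v $ a" for a unfolding s word_value_scale g(2) by simp
      show "unique_representation_for_vector \<sigma> \<beta> v"
        unfolding s using unique_representation_scale[OF \<gamma>(2) s0 G.zeta_summable] .
    qed (rule nonreal)
    interpret PS: product_sigma_finite "\<lambda>_ :: complex^'a. lborel :: complex measure" ..
    \<comment> \<open>Over a one-element index set the product measure projects to Lebesgue measure
      on the single coordinate.\<close>
    have "AE c in distr (Pi\<^sub>M {v} (\<lambda>_. lborel :: complex measure)) lborel (\<lambda>x. x v).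
        wandering_slope_vector I T (\<lambda>a. exp (- Re ((c *s v) $ a)))"
      unfolding PS.distr_singleton using V.ae_wandering .
    then have "AE c in Pi\<^sub>M {v} (\<lambda>_. lborel). wandering_slope_vector I T (\<lambda>a. exp (- Re ((c v *s v) $ a)))"
      by (rule AE_distrD[rotated]) (rule measurable_component_singleton, simp)
    then show "AE c in Pi\<^sub>M B (\<lambda>_. lborel :: complex measure). wandering_slope_vector I T (\<lambda>a. exp (- Re ((\<Sum>v\<in>B. c v *s v) $ a)))"
      unfolding \<open>B = {v}\<close> by simp
  qed
qed

end
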